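(* Let $c>1$ and let $\theta\in\mathbb{RP}^1$ be a direction. There is a saddle connection in direction $\theta$ of $S_c$ if and only if the direction $\varphi_c(\theta)$ contains saddle connections of $S_1$. Equivalently, $\theta$ contains saddle connections of $S_c$ if and only if $\theta$ is an image of the horizontal or slope one direction under an element of $\mathcal{G}^\pm_c=\langle -I,A_c,B_c,C_c\rangle$. Furthermore, the collections of homotopy classes of saddle connections are identical in $S_c$ and $S_1$: for every saddle connection $\sigma\subset S_c$ there is a saddle connection $\sigma'\in h_c([\sigma])$ in $S_1$, and for every saddle connection $\sigma'\subset S_1$ there is a saddle connection $\sigma\in h_c^{-1}([\sigma'])$ in $S_c$.
   Context: The surfaces $S_c$: for real $c\ge 1$ let $T_c(x,y)=(cx+(c-1)y+1,\ (c+1)x+cy+1)$ and $P_c^k=T_c^k(0,0)$ for $k\in\mathbb{Z}$ (for $c=1$, $P_1^k=(k,k^2)$). Let $Q_c^+$ be the convex hull of $\{P_c^k\}_{k\in\mathbb{Z}}$ (an infinite polygon with edges $\overline{P_c^kP_c^{k+1}}$), and let $Q_c^-$ be the image of $Q_c^+$ under the rotation by $\pi$. $S_c$ is the translation surface obtained by gluing each edge of $Q_c^+$ by a translation to its image edge in $Q_c^-$. Its set of singularities $\Sigma$ (images of vertices) consists of two points of infinite cone angle. A saddle connection is a geodesic segment joining singularities with no singularity in its interior. Canonical homeomorphism $h_c:S_c\to S_1$ (well defined up to isotopy fixing the singularities): it is induced by a homeomorphism $Q_c^+\to Q_1^+$ fixing $(0,0)$ and sending each edge $\overline{P_c^kP_c^{k+1}}$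 to $\overline{P_1^kP_1^{k+1}}$ preserving ratios of distances on each edge, and on $Q_c^-$ by the conjugate of this map by the rotation by $\pi$. Two paths are homotopic if they have the same endpoints and are homotopic fixing endpoints, by a homotopy not passing through singular points; $[\gamma]$ denotes the homotopy class of $\gamma$. Groups: $\mathcal{G}^\pm=(\mathbb{Z}_2*\mathbb{Z}_2*\mathbb{Z}_2)\oplus\mathbb{Z}_2$ with generators $A,B,C$ of the free factors and $-I$ of the last factor. For $G\in\mathcal{G}^\pm$, $G_c\in\mathrm{GL}(2,\mathbb{R})$ is its image under the representation sending $-I\mapsto -I$ and $$A\mapsto A_c=\begin{pmatrix}-1&0\\0&1\end{pmatrix},\quad B\mapsto B_c=\begin{pmatrix}-1&2\\0&1\end{pmatrix},\quad C\mapsto C_c=\begin{pmatrix}-c&c-1\\-c-1&c\end{pmatrix}.$$ Directions modulo rotation by $\pi$ are identified with $\mathbb{RP}^1=\partial\mathbb{H}^2$, on which each $G_c$ acts. For $c>1$, $\varphi_c:\mathbb{RP}^1\to\mathbb{RP}^1$ is the natural semiconjugacy: a continuous surjective degree one map, weakly preserving orientation (positively oriented triples are not sent to negatively oriented triples), with $\varphi_c\circ G_c=G_1\circ\varphi_c$ for all $G\in\mathcal{G}^\pm$. Geometrically: $\mathcal{G}_c^\pm$ acts on $\mathbb{H}^2$ with fundamental domain a triangle $\Delta_c$ bounded by the reflection geodesics of $A_c,B_c,C_c$ (two ideal vertices and one ultra-ideal vertex for $c>1$; three ideal vertices for $c=1$); a map $\overline{\Delta}_c\to\overline{\Delta}_1$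 of closures in $\overline{\mathbb{H}}^2$, sending edges to corresponding edges and collapsing the ultra-ideal vertex to an ideal vertex, is extended equivariantly to $\overline{\mathbb{H}}^2$, and $\varphi_c$ is the restriction of the extension to $\partial\mathbb{H}^2$. It collapses each component of the domain of discontinuity of $\mathcal{G}_c^\pm$ in $\mathbb{RP}^1$ to a point. *)

theory Defs
  imports "HOL-Analysis.Analysis" "HOL-Algebra.Elementary_Groups"
begin

section \<open>Quotient spaces\<close>

definition quotient_topology :: "'a topology \<Rightarrow> 'a rel \<Rightarrow> 'a set topology" where
  "quotient_topology X r =
     topology (\<lambda>U. U \<subseteq> topspace X // r \<and> openin X {x \<in> topspace X. r `` {x} \<in> U})"

lemma istopology_quotient:
  "istopology (\<lambda>U. U \<subseteq> topspace X // r \<and> openin X {x \<in> topspace X. r `` {x} \<in> U})"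
  unfolding istopology_def
proof (intro conjI allI impI)
  fix S T
  assume S: "S \<subseteq> topspace X // r \<and> openin X {x \<in> topspace X. r `` {x} \<in> S}"
    and T: "T \<subseteq> topspace X // r \<and> openin X {x \<in> topspace X. r `` {x} \<in> T}"
  have "{x \<in> topspace X. r `` {x} \<in> S \<inter> T} =
        {x \<in> topspace X. r `` {x} \<in> S} \<inter> {x \<in> topspace X. r `` {x} \<in> T}"
    by auto
  then show "openin X {x \<in> topspace X. r `` {x} \<in> S \<inter> T}" using S T by auto
  show "S \<inter> T \<subseteq> topspace X // r" using S by auto
next
  fix K
  assume K: "\<forall>S\<in>K. S \<subseteq> topspace X // r \<and> openin X {x \<in> topspace X. r `` {x} \<in> S}"
  have "{x \<in> topspace X. r `` {x} \<in> \<Union>K} = (\<Union>S\<in>K. {x \<in> topspace X. r `` {x} \<in> S})"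
    by auto
  then show "openin X {x \<in> topspace X. r `` {x} \<in> \<Union>K}" using K by auto
  show "\<Union>K \<subseteq> topspace X // r" using K by auto
qed

lemma openin_quotient_topology:
  "openin (quotient_topology X r) U \<longleftrightarrow>
     U \<subseteq> topspace X // r \<and> openin X {x \<in> topspace X. r `` {x} \<in> U}"
  by (simp add: quotient_topology_def topology_inverse'[OF istopology_quotient])

lemma topspace_quotient_topology [simp]: "topspace (quotient_topology X r) = topspace X // r"
proof
  show "topspace (quotient_topology X r) \<subseteq> topspace X // r"
    using openin_topspace[of "quotient_topology X r"] by (simp only: openin_quotient_topology)
  have "{x \<in> topspace X. r `` {x} \<in> topspace X // r} = topspace X"
    by (auto simp: quotient_def)
  then have "openin (quotient_topology X r) (topspace X // r)"
    by (simp add: openin_quotient_topology)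
  then show "topspace X // r \<subseteq> topspace (quotient_topology X r)"
    by (rule openin_subset)
qed


section \<open>The surfaces \<open>S\<^sub>c\<close>\<close>

definition T :: "real \<Rightarrow> real^2 \<Rightarrow> real^2" where
  "T c v = vector [c * v$1 + (c - 1) * v$2 + 1, (c + 1) * v$1 + c * v$2 + 1]"

definition P :: "real \<Rightarrow> int \<Rightarrow> real^2" where
  "P c k = (if 0 \<le> k then (T c ^^ nat k) 0 else (inv_into UNIV (T c) ^^ nat (- k)) 0)"

definition Qplus :: "real \<Rightarrow> (real^2) set" where
  "Qplus c = convex hull (range (P c))"

definition edge :: "real \<Rightarrow> int \<Rightarrow> (real^2) set" where
  "edge c k = closed_segment (P c k) (P c (k + 1))"

text \<open>
  A point of the disjoint union of \<open>Q\<^sub>c\<^sup>+\<close> and \<open>Q\<^sub>c\<^sup>-\<close> is a pair \<open>(s, x)\<close>, where the sign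
  \<open>s \<in> {1, -1}\<close> names the polygon \<open>s *\<^sub>R Qplus c\<close> containing \<open>x\<close>. The translation gluing edge \<open>k\<close>
  to its rotated copy takes \<open>P c k\<close> to \<open>- P c (k + 1)\<close> and \<open>P c (k + 1)\<close> to \<open>- P c k\<close>.
\<close>

definition polygons :: "real \<Rightarrow> (real \<times> (real^2)) topology" where
  "polygons c = sum_topology (\<lambda>s. top_of_set ((*\<^sub>R) s ` Qplus c)) {1, -1}"

definition glue :: "real \<Rightarrow> (real \<times> (real^2)) rel" where
  "glue c = {((1, x), (-1, x - P c k - P c (k + 1))) | k x. x \<in> edge c k}"

definition glue_equiv :: "real \<Rightarrow> (real \<times> (real^2)) rel" where
  "glue_equiv c = (glue c \<union> (glue c)\<inverse>)\<^sup>*"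

type_synonym surface_point = "(real \<times> (real^2)) set"

definition surface :: "real \<Rightarrow> surface_point topology" where
  "surface c = quotient_topology (polygons c) (glue_equiv c)"

definition to_surface :: "real \<Rightarrow> real \<times> (real^2) \<Rightarrow> surface_point" where
  "to_surface c z = glue_equiv c `` {z}"

definition singularities :: "real \<Rightarrow> surface_point set" where
  "singularities c = {to_surface c (s, s *\<^sub>R P c k) | s k. s \<in> {1, -1}}"


section \<open>Saddle connections\<close>

text \<open>
  The translation structure away from the singularities is given by one parametrization for every
  edge \<open>k\<close>: translate \<open>Q\<^sub>c\<^sup>-\<close> so that it meets \<open>Q\<^sub>c\<^sup>+\<close> along edge \<open>k\<close>, and map the interior of the
  union of the two polygons to the surface.
\<close>

definition chart_domain :: "real \<Rightarrow> int \<Rightarrow> (real^2) set" where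
  "chart_domain c k =
     interior (Qplus c) \<union> open_segment (P c k) (P c (k + 1)) \<union>
     (\<lambda>y. y + P c k + P c (k + 1)) ` interior (uminus ` Qplus c)"

definition chart_param :: "real \<Rightarrow> int \<Rightarrow> real^2 \<Rightarrow> surface_point" where
  "chart_param c k x =
     to_surface c (if x \<in> Qplus c then (1, x) else (-1, x - P c k - P c (k + 1)))"

definition saddle_connection_along :: "real \<Rightarrow> real^2 \<Rightarrow> (real \<Rightarrow> surface_point) \<Rightarrow> bool" where
  "saddle_connection_along c v \<gamma> \<longleftrightarrow>
     pathin (surface c) \<gamma> \<and> v \<noteq> 0 \<and>
     \<gamma> 0 \<in> singularities c \<and> \<gamma> 1 \<in> singularities c \<and>
     (\<forall>t\<in>{0<..<1}. \<gamma> t \<notin> singularities c) \<and>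
     (\<forall>t\<in>{0<..<1}. \<exists>k x. \<exists>e>0. \<forall>u. \<bar>u - t\<bar> < e \<longrightarrow>
        x + (u - t) *\<^sub>R v \<in> chart_domain c k \<and> \<gamma> u = chart_param c k (x + (u - t) *\<^sub>R v))"

definition saddle_connection :: "real \<Rightarrow> (real \<Rightarrow> surface_point) \<Rightarrow> bool" where
  "saddle_connection c \<gamma> \<longleftrightarrow> (\<exists>v. saddle_connection_along c v \<gamma>)"


section \<open>Homotopy classes and the canonical homeomorphism\<close>

definition homotopy_class ::
    "real \<Rightarrow> (real \<Rightarrow> surface_point) \<Rightarrow> (real \<Rightarrow> surface_point) set" where
  "homotopy_class c \<gamma> = {\<delta>.
     homotopic_with
       (\<lambda>\<eta>. \<eta> 0 = \<gamma> 0 \<and> \<eta> 1 = \<gamma> 1 \<and> (\<forall>t\<in>{0<..<1}. \<eta> t \<notin> singularities c))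
       (top_of_set {0..1}) (surface c) \<gamma> \<delta>}"

definition canonical_homeomorphism :: "real \<Rightarrow> (surface_point \<Rightarrow> surface_point) \<Rightarrow> bool" where
  "canonical_homeomorphism c h \<longleftrightarrow>
     (\<exists>f g. homeomorphism (Qplus c) (Qplus 1) f g \<and> f 0 = 0 \<and>
        (\<forall>k. f ` edge c k = edge 1 k \<and>
          (\<exists>r. \<forall>x\<in>edge c k. \<forall>y\<in>edge c k. dist (f x) (f y) = r * dist x y)) \<and>
        (\<forall>x\<in>Qplus c.
          h (to_surface c (1, x)) = to_surface 1 (1, f x) \<and>
          h (to_surface c (-1, - x)) = to_surface 1 (-1, - f x)))"


section \<open>Directions\<close>

definition collinear_rel :: "(real^2) rel" where
  "collinear_rel = {(v, t *\<^sub>R v) | v t. t \<noteq> 0}"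

definition RP1 :: "(real^2) set topology" where
  "RP1 = quotient_topology (top_of_set (- {0})) collinear_rel"

definition direction :: "real^2 \<Rightarrow> (real^2) set" where
  "direction v = collinear_rel `` {v}"

abbreviation horizontal :: "(real^2) set" where
  "horizontal \<equiv> direction (vector [1, 0])"

abbreviation slope_one :: "(real^2) set" where
  "slope_one \<equiv> direction (vector [1, 1])"

definition act :: "real^2^2 \<Rightarrow> (real^2) set \<Rightarrow> (real^2) set" where
  "act M \<theta> = (\<lambda>v. M *v v) ` \<theta>"

definition has_saddle_connection :: "real \<Rightarrow> (real^2) set \<Rightarrow> bool" where
  "has_saddle_connection c \<theta> \<longleftrightarrow> (\<exists>v\<in>\<theta>. \<exists>\<sigma>. saddle_connection_along c v \<sigma>)"


section \<open>The group \<open>(\<int>\<^sub>2 * \<int>\<^sub>2 * \<int>\<^sub>2) \<oplus> \<int>\<^sub>2\<close> and its representations\<close>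

datatype reflection = ReflA | ReflB | ReflC

text \<open>
  The free product of one copy of \<open>\<int>\<^sub>2\<close> for every element of \<open>'a\<close>, realized on reduced words:
  since every nontrivial syllable is a generator of order two, a word is reduced iff no two adjacent
  letters agree.
\<close>

fun cons_cancel :: "'a \<Rightarrow> 'a list \<Rightarrow> 'a list" where
  "cons_cancel a [] = [a]"
| "cons_cancel a (b # w) = (if a = b then w else a # b # w)"

definition free_product_Z2 :: "'a list monoid" where
  "free_product_Z2 =
     \<lparr>carrier = {w. distinct_adj w}, monoid.mult = foldr cons_cancel, one = []\<rparr>"

definition Gpm :: "(reflection list \<times> int) monoid" where
  "Gpm = free_product_Z2 \<times>\<times> integer_mod_group 2"

fun reflection_matrix :: "real \<Rightarrow> reflection \<Rightarrow> real^2^2" where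
  "reflection_matrix c ReflA = vector [vector [-1, 0], vector [0, 1]]"
| "reflection_matrix c ReflB = vector [vector [-1, 2], vector [0, 1]]"
| "reflection_matrix c ReflC = vector [vector [-c, c - 1], vector [-c - 1, c]]"

definition rep :: "real \<Rightarrow> reflection list \<times> int \<Rightarrow> real^2^2" where
  "rep c = (\<lambda>(w, e). (-1) ^ nat e *\<^sub>R foldr (\<lambda>g M. reflection_matrix c g ** M) w (mat 1))"

definition GL2 :: "(real^2^2) monoid" where
  "GL2 = \<lparr>carrier = {M. invertible M}, monoid.mult = (**), one = mat 1\<rparr>"

definition Gpm_image :: "real \<Rightarrow> (real^2^2) set" where
  "Gpm_image c = generate GL2 (insert (- mat 1) (range (reflection_matrix c)))"

lemma distinct_adj_cons_cancel: "distinct_adj w \<Longrightarrow> distinct_adj (cons_cancel a w)"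
  by (cases w) (auto simp: distinct_adj_Cons)

lemma cons_cancel_involution: "distinct_adj w \<Longrightarrow> cons_cancel a (cons_cancel a w) = w"
proof (cases w)
  case (Cons b v)
  then show "distinct_adj w \<Longrightarrow> ?thesis" by (cases v) auto
qed simp

lemma distinct_adj_foldr_cons_cancel: "distinct_adj v \<Longrightarrow> distinct_adj (foldr cons_cancel u v)"
  by (induction u) (auto intro: distinct_adj_cons_cancel)

lemma foldr_cons_cancel_Cons:
  "distinct_adj w \<Longrightarrow>
     foldr cons_cancel (cons_cancel a u) w = cons_cancel a (foldr cons_cancel u w)"
  by (cases u) (auto simp: cons_cancel_involution distinct_adj_foldr_cons_cancel)

lemma foldr_cons_cancel_assoc:
  "distinct_adj w \<Longrightarrow>
     foldr cons_cancel (foldr cons_cancel u v) w = foldr cons_cancel u (foldr cons_cancel v w)"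
  by (induction u) (auto simp: foldr_cons_cancel_Cons)

lemma foldr_cons_cancel_rev:
  "distinct_adj v \<Longrightarrow> foldr cons_cancel (rev u) (foldr cons_cancel u v) = v"
proof (induction u arbitrary: v)
  case (Cons a u)
  then show ?case
    by (simp add: cons_cancel_involution distinct_adj_foldr_cons_cancel)
qed simp

lemma foldr_cons_cancel_Nil: "distinct_adj w \<Longrightarrow> foldr cons_cancel w [] = w"
proof (induction w)
  case (Cons a w)
  then show ?case by (cases w) auto
qed simp

lemma group_free_product_Z2: "group free_product_Z2"
proof (rule groupI)
  fix x :: "'a list" assume x: "x \<in> carrier free_product_Z2"
  then have "foldr cons_cancel (rev x) x = []"
    using foldr_cons_cancel_rev[of "[]" x] by (simp add: free_product_Z2_def foldr_cons_cancel_Nil)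
  then show "\<exists>y\<in>carrier free_product_Z2. y \<otimes>\<^bsub>free_product_Z2\<^esub> x = \<one>\<^bsub>free_product_Z2\<^esub>"
    using x by (intro bexI[of _ "rev x"]) (auto simp: free_product_Z2_def)
qed (auto simp: free_product_Z2_def distinct_adj_foldr_cons_cancel foldr_cons_cancel_assoc)

lemma group_Gpm: "group Gpm"
  unfolding Gpm_def by (intro DirProd_group group_free_product_Z2 group_integer_mod_group)

lemma invertible_mat_1: "invertible (mat 1 :: real^2^2)"
  unfolding invertible_def by (rule exI[of _ "mat 1"]) simp

lemma group_GL2: "group GL2"
proof (rule groupI)
  fix M :: "real^2^2" assume "M \<in> carrier GL2"
  then obtain N where "M ** N = mat 1" "N ** M = mat 1"
    by (auto simp: GL2_def invertible_def)
  then show "\<exists>N\<in>carrier GL2. N \<otimes>\<^bsub>GL2\<^esub> M = \<one>\<^bsub>GL2\<^esub>"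
    by (intro bexI[of _ N]) (auto simp: GL2_def invertible_def)
qed (auto simp: GL2_def invertible_mult matrix_mul_assoc invertible_mat_1)

lemma reflection_matrix_square: "reflection_matrix c g ** reflection_matrix c g = mat 1"
  by (cases g)
    (auto simp: vec_eq_iff matrix_matrix_mult_def mat_def UNIV_2 forall_2 algebra_simps)

lemma rep_hom: "rep c \<in> hom Gpm GL2"
proof -
  define m where "m w = foldr (\<lambda>g M. reflection_matrix c g ** M) w (mat 1)" for w
  have inv_m: "invertible (m w)" for w
  proof (induction w)
    case (Cons g w)
    have "invertible (reflection_matrix c g)"
      using reflection_matrix_square by (auto simp: invertible_def)
    with Cons show ?case by (auto simp: m_def intro: invertible_mult)
  qed (simp add: m_def invertible_mat_1)
  have m_cc: "m (cons_cancel g w) = reflection_matrix c g ** m w" for g w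
    by (cases w) (auto simp: m_def matrix_mul_assoc reflection_matrix_square)
  have m_mult: "m (foldr cons_cancel u v) = m u ** m v" for u v
  proof (induction u)
    case (Cons g u)
    then show ?case by (simp add: m_cc) (simp add: m_def matrix_mul_assoc)
  qed (simp add: m_def)
  have smult: "(a *\<^sub>R M) ** (b *\<^sub>R N) = (a * b) *\<^sub>R (M ** N)" for a b and M N :: "real^2^2"
    by (simp add: scalar_matrix_assoc matrix_scalar_ac mult.commute)
  have scal: "invertible ((-1::real) ^ n *\<^sub>R M)" if M: "invertible M" for n and M :: "real^2^2"
  proof -
    from M obtain N where "M ** N = mat 1" "N ** M = mat 1"
      by (auto simp: invertible_def)
    then have "((-1::real) ^ n *\<^sub>R M) ** ((-1) ^ n *\<^sub>R N) = mat 1"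
      "((-1::real) ^ n *\<^sub>R N) ** ((-1) ^ n *\<^sub>R M) = mat 1"
      by (simp_all add: smult flip: power_mult_distrib)
    then show ?thesis by (auto simp: invertible_def)
  qed
  have pow: "(-1::real) ^ nat ((e + f) mod 2) = (-1) ^ nat e * (-1) ^ nat f"
    if "e \<in> {0..<2}" "f \<in> {0..<2}" for e f :: int
  proof -
    from that have "e = 0 \<or> e = 1" "f = 0 \<or> f = 1" by auto
    then show ?thesis by auto
  qed
  show ?thesis
    unfolding hom_def Gpm_def
    by (auto simp: rep_def GL2_def free_product_Z2_def carrier_integer_mod_group
        m_def[symmetric] m_mult inv_m scal smult pow)
qed

lemma Gpm_image_eq: "Gpm_image c = rep c ` carrier Gpm"
proof -
  interpret group_hom Gpm GL2 "rep c"
    by (simp add: group_hom_def group_hom_axioms_def group_Gpm group_GL2 rep_hom)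
  define K :: "(reflection list \<times> int) set" where "K = insert ([], 1) (range (\<lambda>g. ([g], 0)))"
  have K: "K \<subseteq> carrier Gpm"
    by (auto simp: K_def Gpm_def free_product_Z2_def carrier_integer_mod_group)
  have img: "rep c ` K = insert (- mat 1) (range (reflection_matrix c))"
    by (auto simp: K_def rep_def image_iff)
  have word: "(w, 0) \<in> generate Gpm K" if "distinct_adj w" for w
    using that
  proof (induction w)
    case Nil
    then show ?case
      using generate.one[of Gpm K] by (simp add: Gpm_def free_product_Z2_def)
  next
    case (Cons g w)
    have "(w, 0) \<in> generate Gpm K"
      using Cons by (auto simp: distinct_adj_Cons)
    moreover have "([g], 0) \<in> generate Gpm K"
      by (rule generate.incl) (simp add: K_def)
    ultimately have "([g], 0) \<otimes>\<^bsub>Gpm\<^esub> (w, 0) \<in> generate Gpm K"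
      by (intro generate.eng)
    moreover have "([g], 0) \<otimes>\<^bsub>Gpm\<^esub> (w, 0) = (g # w, 0)"
      using Cons.prems by (cases w) (auto simp: Gpm_def free_product_Z2_def)
    ultimately show ?case by simp
  qed
  have "carrier Gpm \<subseteq> generate Gpm K"
  proof
    fix x assume "x \<in> carrier Gpm"
    then obtain w e where x: "x = (w, e)" "distinct_adj w" "e = 0 \<or> e = 1"
      by (force simp: Gpm_def free_product_Z2_def carrier_integer_mod_group)
    have "([], 1) \<in> generate Gpm K"
      by (rule generate.incl) (simp add: K_def)
    with word[OF x(2)] have "(w, 0) \<otimes>\<^bsub>Gpm\<^esub> ([], 1) \<in> generate Gpm K"
      by (rule generate.eng)
    then have "(w, 1) \<in> generate Gpm K"
      using x by (simp add: Gpm_def free_product_Z2_def foldr_cons_cancel_Nil)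
    then show "x \<in> generate Gpm K" using x word by auto
  qed
  then have "generate Gpm K = carrier Gpm"
    using G.generate_incl[OF K] by auto
  then show ?thesis
    unfolding Gpm_image_def img[symmetric] using generate_img[OF K] by simp
qed

section \<open>The semiconjugacy\<close>

definition angle_direction :: "real \<Rightarrow> (real^2) set" where
  "angle_direction a = direction (vector [cos a, sin a])"

definition positively_oriented ::
    "(real^2) set \<Rightarrow> (real^2) set \<Rightarrow> (real^2) set \<Rightarrow> bool" where
  "positively_oriented \<theta>\<^sub>1 \<theta>\<^sub>2 \<theta>\<^sub>3 \<longleftrightarrow>
     (\<exists>a\<^sub>1 a\<^sub>2 a\<^sub>3. a\<^sub>1 < a\<^sub>2 \<and> a\<^sub>2 < a\<^sub>3 \<and> a\<^sub>3 < a\<^sub>1 + pi \<and>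
        \<theta>\<^sub>1 = angle_direction a\<^sub>1 \<and> \<theta>\<^sub>2 = angle_direction a\<^sub>2 \<and> \<theta>\<^sub>3 = angle_direction a\<^sub>3)"

text \<open>
  The degree is read off a lift to the universal cover \<open>angle_direction\<close>, whose deck group is
  generated by the translation by \<open>pi\<close>.
\<close>

definition degree_one :: "((real^2) set \<Rightarrow> (real^2) set) \<Rightarrow> bool" where
  "degree_one \<phi> \<longleftrightarrow>
     (\<exists>F::real \<Rightarrow> real. continuous_on UNIV F \<and>
        (\<forall>a. \<phi> (angle_direction a) = angle_direction (F a)) \<and>
        (\<forall>a. F (a + pi) = F a + pi))"

definition natural_semiconjugacy :: "real \<Rightarrow> ((real^2) set \<Rightarrow> (real^2) set) \<Rightarrow> bool" where
  "natural_semiconjugacy c \<phi> \<longleftrightarrow>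
     continuous_map RP1 RP1 \<phi> \<and>
     \<phi> ` topspace RP1 = topspace RP1 \<and>
     degree_one \<phi> \<and>
     (\<forall>\<theta>\<^sub>1\<in>topspace RP1. \<forall>\<theta>\<^sub>2\<in>topspace RP1. \<forall>\<theta>\<^sub>3\<in>topspace RP1.
        positively_oriented \<theta>\<^sub>1 \<theta>\<^sub>2 \<theta>\<^sub>3 \<longrightarrow> \<not> positively_oriented (\<phi> \<theta>\<^sub>1) (\<phi> \<theta>\<^sub>3) (\<phi> \<theta>\<^sub>2)) \<and>
     (\<forall>G\<in>carrier Gpm. \<forall>\<theta>\<in>topspace RP1. \<phi> (act (rep c G) \<theta>) = act (rep 1 G) (\<phi> \<theta>))"

end

theory Submission
  imports Defs
begin

text \<open>
  In the coordinates \<open>X = y - x\<close> (skew) and \<open>Y = y\<close> (height) the vertices of the polygon form a staircase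
  on the corners of a product grid, and after a piecewise linear change of both coordinates the polygon
  becomes the strip \<open>0 \<le> gx \<le> gy \<le> gx + 1\<close> over the integer lattice, for every \<open>c \<ge> 1\<close> (\<open>Qplus_iff\<close>). The
  grid cuts the surface into rectangular cells, each consisting of a triangle from either polygon, and the
  rows and columns of cells are the cylinders in the horizontal and the slope one direction.

  The generators \<open>A\<close>, \<open>B\<close>, \<open>C\<close> are derivatives of affine homeomorphisms of the surface: \<open>A\<close> and \<open>C\<close> come from
  affine symmetries of the polygon, and \<open>B\<close> from the map \<open>cell_flip\<close>, which reflects every cell. They act on
  saddle connections, and every saddle connection can be reduced by them to a diagonal of a polygon
  (\<open>saddle_connection_induct\<close>). The reduction is a descent on the holonomy \<open>(X, Y)\<close>: \<open>B\<close> arranges that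
  \<open>X Y > 0\<close>, \<open>A\<close> decreases \<open>\<bar>X\<bar>\<close> when \<open>\<bar>Y\<bar> < \<bar>X\<bar>\<close>, and \<open>C\<close> decreases \<open>\<bar>Y\<bar>\<close> when \<open>(c + 1) \<bar>X\<bar> < 2 \<bar>Y\<bar>\<close>. The
  directions in between point into the polygon from every edge, so a straight path in such a direction that has
  entered a polygon never leaves it again, and no saddle connection exists (\<open>no_steep_saddle\<close>). The descent
  stops because a saddle connection crosses every cylinder that it meets completely: \<open>\<bar>X\<bar>\<close> and \<open>\<bar>Y\<bar>\<close> are sums of
  cylinder widths (\<open>level_structure.holonomy_level_sum\<close>), and these sums form a discrete set. At the end
  \<open>X = 0\<close> or \<open>Y = 0\<close>, and the saddle connection runs along a level of the grid, that is, along a diagonal.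

  Everything follows from this induction. First, the directions of saddle connections are the images of
  the horizontal and the slope one direction under the group (\<open>has_saddle_connection_iff_cusp\<close>). Secondly,
  let \<open>F\<close> be the grid map from the polygon of \<open>c\<close> to that of \<open>d\<close>, the identity in lattice coordinates. It
  commutes with \<open>cell_flip\<close>, commutes with the symmetries \<open>A\<close> and \<open>C\<close> up to homotopy, and takes a diagonal to a
  path homotopic to a diagonal; hence it takes every saddle connection to a path homotopic to a saddle
  connection (\<open>corresponding_saddle_connection\<close>). The canonical homeomorphism agrees with \<open>F\<close> on the edges and
  is therefore homotopic to it, since the polygon is convex (\<open>surface_map_homotopic\<close>).

  For the semiconjugacy \<open>\<phi>\<close> it remains to see that \<open>\<phi> \<theta>\<close> is in the orbit of one of the two base directions
  only if \<open>\<theta>\<close> is. Each base direction \<open>p\<close> is the fixed point of a parabolic element, which forces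
  \<open>\<phi> p = p\<close>. The fibre over \<open>p\<close> is invariant under the parabolic element and, as \<open>\<phi>\<close> has a monotone lift, an
  interval; if it contained a second direction it would contain all of them (\<open>cusp_preimage\<close>).
\<close>

section \<open>Skew coordinates and the staircase of vertices\<close>

text \<open>
  The coordinates \<open>skew = y - x\<close> and \<open>height = y\<close> turn the two
  base directions, slope one and horizontal, into the coordinate axes. Each of the generators
  \<open>A\<close>, \<open>B\<close>, \<open>C\<close> then changes only one of the two
  coordinates.
\<close>

definition skew :: "real^2 \<Rightarrow> real" where "skew v = v$2 - v$1"
definition height :: "real^2 \<Rightarrow> real" where "height v = v$2"
definition pt :: "real \<Rightarrow> real \<Rightarrow> real^2" where "pt a b = vector [b - a, b]"

lemma skew_pt [simp]: "skew (pt a b) = a" and height_pt [simp]: "height (pt a b) = b"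
  by (simp_all add: skew_def height_def pt_def)

lemma vec2_eq_iff: "u = v \<longleftrightarrow> skew u = skew v \<and> height u = height v"
  by (auto simp: skew_def height_def vec_eq_iff forall_2)

lemma pt_skew_height [simp]: "pt (skew v) (height v) = v"
  by (simp add: vec2_eq_iff)

lemma pt_eq_iff [simp]: "pt a b = pt a' b' \<longleftrightarrow> a = a' \<and> b = b'"
  by (auto simp: vec2_eq_iff)

lemma linear_skew: "linear skew" and linear_height: "linear height"
  by (auto intro!: linearI simp: skew_def height_def algebra_simps)

lemma skew_simps [simp]:
  "skew (u + v) = skew u + skew v" "skew (u - v) = skew u - skew v"
  "skew (a *\<^sub>R v) = a * skew v" "skew (- v) = - skew v" "skew 0 = 0"
  by (simp_all add: skew_def algebra_simps)

lemma height_simps [simp]: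
  "height (u + v) = height u + height v" "height (u - v) = height u - height v"
  "height (a *\<^sub>R v) = a * height v" "height (- v) = - height v" "height 0 = 0"
  by (simp_all add: height_def algebra_simps)

lemma continuous_on_skew [continuous_intros]:
  "continuous_on S f \<Longrightarrow> continuous_on S (\<lambda>x. skew (f x))"
  unfolding skew_def by (intro continuous_intros)

lemma continuous_on_height [continuous_intros]:
  "continuous_on S f \<Longrightarrow> continuous_on S (\<lambda>x. height (f x))"
  unfolding height_def by (intro continuous_intros)

lemma continuous_on_pt [continuous_intros]:
  assumes "continuous_on S f" "continuous_on S g"
  shows "continuous_on S (\<lambda>x. pt (f x) (g x))"
proof -
  have "pt a b = a *\<^sub>R pt 1 0 + b *\<^sub>R pt 0 1" for a b
    by (simp add: vec2_eq_iff)
  then have "(\<lambda>x. pt (f x) (g x)) = (\<lambda>x. f x *\<^sub>R pt 1 0 + g x *\<^sub>R pt 0 1)"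
    by (rule ext)
  then show ?thesis by (simp only:) (intro continuous_intros assms)
qed

text \<open>
  So \<open>T\<close> is the composite of two involutions: the first replaces only the skew
  \<open>X\<close> by \<open>2 Y - X\<close>, the second only the height \<open>Y\<close> by
  \<open>(c + 1) X + 1 - Y\<close>.
\<close>

lemma skew_T: "skew (T c v) = 2 * height v - skew v"
  and height_T: "height (T c v) = (c + 1) * skew (T c v) + 1 - height v"
  by (simp_all add: T_def skew_def height_def algebra_simps)

lemma bij_T: "bij (T c)"
proof (rule bijI)
  show "inj (T c)"
  proof (rule injI)
    fix v w assume eq: "T c v = T c w"
    then have h: "height v = height w" using height_T[of c v] height_T[of c w] by simp
    then show "v = w" using eq skew_T[of c v] skew_T[of c w] by (simp add: vec2_eq_iff)
  qed
  show "surj (T c)"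
  proof (rule surjI)
    fix v
    define b where "b = (c + 1) * skew v + 1 - height v"
    show "T c (pt (2 * b - skew v) b) = v"
      by (simp add: vec2_eq_iff skew_T height_T b_def)
  qed
qed

lemma P_0 [simp]: "P c 0 = 0" by (simp add: P_def)

lemma P_step: "P c (k + 1) = T c (P c k)"
proof (cases "0 \<le> k")
  case True
  then show ?thesis by (simp add: P_def nat_add_distrib)
next
  case False
  have "nat (- k) = Suc (nat (- (k + 1)))" using False by simp
  then have "T c (P c k) = (inv_into UNIV (T c) ^^ nat (- (k + 1))) 0"
    using False bij_T by (simp add: P_def surj_f_inv_f bij_is_surj)
  also have "\<dots> = P c (k + 1)"
    using False by (cases "k = -1") (auto simp: P_def)
  finally show ?thesis by simp
qed

lemma skew_P_step: "skew (P c (k + 1)) = 2 * height (P c k) - skew (P c k)"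
  and height_P_step: "height (P c (k + 1)) = (c + 1) * skew (P c (k + 1)) + 1 - height (P c k)"
  by (simp_all add: P_step skew_T height_T)

text \<open>
  Running the orbit of the origin backwards applies the same two involutions in the opposite
  order, so both halves of the orbit meet the same sequence of skews and heights.
\<close>

lemma P_symmetric:
  "height (P c (- int n)) = height (P c (int n)) \<and> skew (P c (- int n)) = skew (P c (int n + 1))"
proof (induction n)
  case 0
  then show ?case by (simp add: skew_P_step[of c 0, simplified])
next
  case (Suc n)
  let ?k = "- int (Suc n)"
  have k: "?k + 1 = - int n" by simp
  have *: "skew (P c (- int n)) = 2 * height (P c ?k) - skew (P c ?k)"
    "height (P c (- int n)) = (c + 1) * skew (P c (- int n)) + 1 - height (P c ?k)"
    using skew_P_step[of c ?k] height_P_step[of c ?k] by (simp_all only: k)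
  have **: "height (P c (int n + 1)) = (c + 1) * skew (P c (int n + 1)) + 1 - height (P c (int n))"
    "skew (P c (int n + 1 + 1)) = 2 * height (P c (int n + 1)) - skew (P c (int n + 1))"
    by (rule height_P_step, rule skew_P_step)
  have "height (P c ?k) = height (P c (int n + 1))" using * ** Suc by simp
  moreover from this have "skew (P c ?k) = skew (P c (int n + 1 + 1))" using * ** Suc by simp
  ultimately show ?case by (simp add: add.commute)
qed

text \<open>
  The vertices sit at corners of the product grid of these two sequences: every level of constant
  skew and every level of constant height, except height 0, carries exactly two of them.
\<close>

definition row_at :: "real \<Rightarrow> nat \<Rightarrow> real" where "row_at c n = height (P c (int n))"
definition col_at :: "real \<Rightarrow> nat \<Rightarrow> real" where "col_at c n = skew (P c (int n + 1))"

lemma P_neg: "P c (- int n) = pt (col_at c n) (row_at c n)"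
  and P_pos: "P c (int n + 1) = pt (col_at c n) (row_at c (Suc n))"
  using P_symmetric[of c n] by (simp_all add: vec2_eq_iff row_at_def col_at_def add.commute)

lemma col_add: "col_at c n + col_at c (Suc n) = 2 * row_at c (Suc n)"
  using skew_P_step[of c "int n + 1"] by (simp add: row_at_def col_at_def add.commute)

lemma row_add: "row_at c n + row_at c (Suc n) = (c + 1) * col_at c n + 1"
  using height_P_step[of c "int n"] by (simp add: row_at_def col_at_def add.commute)

lemma row_0 [simp]: "row_at c 0 = 0" by (simp add: row_at_def)
lemma col_0 [simp]: "col_at c 0 = 0" using skew_P_step[of c 0] by (simp add: col_at_def)
lemma row_1 [simp]: "row_at c (Suc 0) = 1" using row_add[of c 0] by simp

lemma int_cases_vertex: obtains (pos) n where "k = int n + 1" | (neg) n where "k = - int n"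
proof (cases "k > 0")
  case True
  then have "k = int (nat (k - 1)) + 1" by simp
  then show ?thesis by (rule pos)
next
  case False
  then have "k = - int (nat (- k))" by simp
  then show ?thesis by (rule neg)
qed

text \<open>
  Half the width of column \<open>n\<close> is
  \<open>row_at c (Suc n) - col_at c n\<close>, and the height of every row but the first
  is the sum of two consecutive half widths. This one recursion therefore controls all gaps of the
  grid.
\<close>

lemma gap_step:
  "row_at c (Suc (Suc n)) - col_at c (Suc n) =
     c * (row_at c (Suc n) - col_at c n) + (c - 1) * row_at c (Suc n) + 1"
proof -
  have e: "col_at c n = 2 * row_at c (Suc n) - col_at c (Suc n)"
    using col_add[of c n] by simp
  show ?thesis unfolding e using row_add[of c "Suc n"] by (simp add: algebra_simps)
qed

lemma col_step: "col_at c (Suc n) - col_at c n = 2 * (row_at c (Suc n) - col_at c n)"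
  using col_add[of c n] by simp

lemma row_step: "row_at c (Suc (Suc n)) - row_at c (Suc n) = (row_at c (Suc n) - col_at c n) + (row_at c (Suc (Suc n)) - col_at c (Suc n))"
  using col_add[of c n] by simp

lemma gaps:
  assumes "c \<ge> 1"
  shows "row_at c (Suc n) \<ge> 0 \<and> row_at c (Suc n) - col_at c n \<ge> 1"
proof (induction n)
  case (Suc n)
  have 1: "c * (row_at c (Suc n) - col_at c n) \<ge> 1 * 1"
    using Suc assms by (intro mult_mono) auto
  have 2: "(c - 1) * row_at c (Suc n) \<ge> 0" using Suc assms by simp
  show ?case using 1 2 gap_step[of c n] row_step[of c n] Suc by auto
qed simp

lemma col_gap: "c \<ge> 1 \<Longrightarrow> col_at c (Suc n) \<ge> col_at c n + 2"
  using gaps[of c n] col_step[of c n] by simp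

lemma row_gap: "c \<ge> 1 \<Longrightarrow> row_at c (Suc n) \<ge> row_at c n + 1"
proof (cases n)
  case (Suc m)
  then show "c \<ge> 1 \<Longrightarrow> ?thesis" using gaps[of c m] gaps[of c n] row_step[of c m] by simp
qed simp

text \<open>
  In skew coordinates the upper edges have slope greater than \<open>(c + 1) / 2\<close> and
  the lower edges slope less than 1. A line whose slope lies in between moves away from both
  boundary lines as it rises.
\<close>

lemma edge_slope:
  assumes "c \<ge> 1"
  shows "2 * (row_at c (Suc (Suc n)) - row_at c (Suc n)) > (c + 1) * (col_at c (Suc n) - col_at c n)"
    and "row_at c (Suc n) - row_at c n < col_at c (Suc n) - col_at c n"
proof -
  have 1: "(c - 1) * row_at c (Suc n) \<ge> 0" using gaps[OF assms, of n] assms by simp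
  then have 2: "row_at c (Suc (Suc n)) - col_at c (Suc n) > c * (row_at c (Suc n) - col_at c n)"
    using gap_step[of c n] by simp
  show "2 * (row_at c (Suc (Suc n)) - row_at c (Suc n)) > (c + 1) * (col_at c (Suc n) - col_at c n)"
    unfolding row_step col_step using 2 by (simp add: algebra_simps)
  show "row_at c (Suc n) - row_at c n < col_at c (Suc n) - col_at c n"
  proof (cases n)
    case 0
    then show ?thesis using col_gap[OF assms, of 0] by simp
  next
    case (Suc m)
    have "row_at c (Suc (Suc m)) - col_at c (Suc m) > row_at c (Suc m) - col_at c m"
      using gap_step[of c m] gaps[OF assms, of m] assms mult_right_mono[of 1 c "row_at c (Suc m) - col_at c m"]
      by (smt (verit) mult_nonneg_nonneg)
    then show ?thesis using row_step[of c m] col_step[of c "Suc m"] Suc by simp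
  qed
qed

section \<open>Piecewise linear maps between grids\<close>

text \<open>
  The lower bound on the gaps makes the cells \<open>[a n, a (n + 1)]\<close> exhaust the
  half line.
\<close>

definition grid :: "(nat \<Rightarrow> real) \<Rightarrow> bool" where
  "grid a \<longleftrightarrow> a 0 = 0 \<and> (\<forall>n. a (Suc n) \<ge> a n + 1)"

lemma grid_col: "c \<ge> 1 \<Longrightarrow> grid (col_at c)" and grid_row: "c \<ge> 1 \<Longrightarrow> grid (row_at c)"
  and grid_real: "grid real"
  using col_gap row_gap by (auto simp: grid_def) (smt (verit))

lemma gridD: "grid a \<Longrightarrow> a n + 1 \<le> a (Suc n)" and grid_0: "grid a \<Longrightarrow> a 0 = 0"
  by (auto simp: grid_def)

lemma grid_strict_mono: "grid a \<Longrightarrow> strict_mono a"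
  by (rule strict_monoI_Suc) (smt (verit) gridD)

lemma grid_less: "grid a \<Longrightarrow> a m < a n \<longleftrightarrow> m < n"
  and grid_le: "grid a \<Longrightarrow> a m \<le> a n \<longleftrightarrow> m \<le> n"
  using strict_mono_less strict_mono_less_eq grid_strict_mono by blast+

lemma grid_ge: "grid a \<Longrightarrow> a n \<ge> real n"
  by (induction n) (auto simp: grid_0 dest: gridD, smt (verit) gridD)

lemma grid_cell:
  assumes "grid a" "x \<ge> 0" obtains n where "a n \<le> x" "x < a (Suc n)"
proof -
  obtain m where m: "x < real m" using reals_Archimedean2 by blast
  then have "x < a m" using grid_ge[OF assms(1), of m] by linarith
  define n where "n = (LEAST m. x < a m)"
  have n: "x < a n" "\<And>i. i < n \<Longrightarrow> a i \<le> x"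
    using \<open>x < a m\<close> not_less_Least unfolding n_def by (auto intro: LeastI simp: not_less[symmetric])
  have "n \<noteq> 0"
  proof
    assume "n = 0"
    then show False using n(1) assms(2) grid_0[OF assms(1)] by simp
  qed
  then show ?thesis using that[of "n - 1"] n by (cases n) auto
qed

text \<open>
  Piecewise linear with \<open>a n \<mapsto> b n\<close>. The value \<open>x\<close> on the
  negative half line makes it a homeomorphism of the whole line.
\<close>

definition interpolate :: "(nat \<Rightarrow> real) \<Rightarrow> (nat \<Rightarrow> real) \<Rightarrow> real \<Rightarrow> real" where
  "interpolate a b x = (if x < 0 then x else
     (let n = LEAST n. x < a (Suc n) in b n + (x - a n) * (b (Suc n) - b n) / (a (Suc n) - a n)))"

lemma interpolate_neg: "x < 0 \<Longrightarrow> interpolate a b x = x" by (simp add: interpolate_def)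

lemma interpolate_cell:
  assumes a: "grid a" and x: "a n \<le> x" "x \<le> a (Suc n)"
  shows "interpolate a b x = b n + (x - a n) * (b (Suc n) - b n) / (a (Suc n) - a n)"
proof -
  have x0: "\<not> x < 0" using grid_ge[OF a, of n] x by linarith
  have less: "(LEAST n. x < a (Suc n)) = m" if "a m \<le> x" "x < a (Suc m)" for m
  proof (rule Least_equality)
    fix y assume "x < a (Suc y)"
    then have "a m < a (Suc y)" using that by linarith
    then show "m \<le> y" using grid_less[OF a] by simp
  qed (use that in simp)
  show ?thesis
  proof (cases "x < a (Suc n)")
    case True
    then show ?thesis using x0 less[of n] x by (simp add: interpolate_def)
  next
    case False
    then have "x = a (Suc n)" using x by simp
    moreover have "a (Suc n) < a (Suc (Suc n))" "a n < a (Suc n)" using grid_less[OF a] by auto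
    ultimately show ?thesis using x0 less[of "Suc n"] by (simp add: interpolate_def)
  qed
qed

lemma interpolate_at [simp]: "grid a \<Longrightarrow> interpolate a b (a n) = b n"
  using interpolate_cell[of a n "a n" b] grid_less[of a n "Suc n"] by (simp add: less_imp_le)

lemma interpolate_in_cell:
  assumes a: "grid a" and b: "grid b" and x: "a n \<le> x" "x \<le> a (Suc n)"
  shows "b n \<le> interpolate a b x" "interpolate a b x \<le> b (Suc n)"
proof -
  have l: "a n < a (Suc n)" "b n < b (Suc n)" using grid_less a b by auto
  have "0 \<le> (x - a n) * (b (Suc n) - b n) / (a (Suc n) - a n)" using l x by simp
  then show "b n \<le> interpolate a b x" by (simp add: interpolate_cell[OF a x])
  have "(x - a n) * (b (Suc n) - b n) / (a (Suc n) - a n) \<le> b (Suc n) - b n"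
    using l x by (simp add: divide_le_eq mult.commute)
  then show "interpolate a b x \<le> b (Suc n)" by (simp add: interpolate_cell[OF a x])
qed

lemma interpolate_interpolate:
  assumes a: "grid a" and b: "grid b"
  shows "interpolate b d (interpolate a b x) = interpolate a d x"
proof (cases "x < 0")
  case False
  then obtain n where x: "a n \<le> x" "x \<le> a (Suc n)" using grid_cell[OF a] by (metis less_imp_le not_le)
  have l: "a n < a (Suc n)" "b n < b (Suc n)" using grid_less a b by auto
  have "interpolate b d (interpolate a b x) = d n + (interpolate a b x - b n) * (d (Suc n) - d n) / (b (Suc n) - b n)"
    by (rule interpolate_cell[OF b interpolate_in_cell[OF a b x]])
  also have "\<dots> = interpolate a d x" using l by (simp add: interpolate_cell[OF a x])
  finally show ?thesis .
qed (simp add: interpolate_neg)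

lemma interpolate_self: "grid a \<Longrightarrow> interpolate a a x = x"
proof (cases "x < 0")
  case False
  assume a: "grid a"
  then obtain n where x: "a n \<le> x" "x \<le> a (Suc n)" using grid_cell[OF a] False by (metis less_imp_le not_le)
  moreover have "a n < a (Suc n)" using grid_less a by auto
  ultimately show ?thesis by (simp add: interpolate_cell[OF a])
qed (simp add: interpolate_neg)

lemma interpolate_inverse: "grid a \<Longrightarrow> grid b \<Longrightarrow> interpolate b a (interpolate a b x) = x"
  by (simp add: interpolate_interpolate interpolate_self)

lemma interpolate_nonneg: "grid a \<Longrightarrow> grid b \<Longrightarrow> interpolate a b x \<ge> 0 \<longleftrightarrow> x \<ge> 0"
proof (cases "x < 0")
  case False
  assume a: "grid a" and b: "grid b"
  then obtain n where x: "a n \<le> x" "x \<le> a (Suc n)" using grid_cell[OF a] False by (metis less_imp_le not_le)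
  then show ?thesis using interpolate_in_cell(1)[OF a b x] grid_ge[OF b, of n] False by simp
qed (simp add: interpolate_neg)

lemma interpolate_strict_mono:
  assumes a: "grid a" and b: "grid b" and xy: "x < y"
  shows "interpolate a b x < interpolate a b y"
proof (cases "x < 0")
  case True
  then show ?thesis
    using xy interpolate_nonneg[OF a b, of y] by (cases "y < 0") (simp_all add: interpolate_neg not_less)
next
  case False
  obtain n where x: "a n \<le> x" "x < a (Suc n)" using grid_cell[OF a] False by (metis not_le)
  obtain m where y: "a m \<le> y" "y < a (Suc m)" using grid_cell[OF a] False xy by (metis not_le less_trans)
  have l: "a n < a (Suc n)" "b n < b (Suc n)" using grid_less a b by auto
  have "a n < a (Suc m)" using x y xy by linarith
  then have "n \<le> m" using grid_less[OF a] by simp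
  show ?thesis
  proof (cases "n = m")
    case True
    have "(x - a n) * (b (Suc n) - b n) / (a (Suc n) - a n) < (y - a n) * (b (Suc n) - b n) / (a (Suc n) - a n)"
      using l xy by (intro divide_strict_right_mono mult_strict_right_mono) auto
    then show ?thesis using x y True by (simp add: interpolate_cell[OF a, where n=n] less_imp_le)
  next
    case False
    then have nm: "Suc n \<le> m" using \<open>n \<le> m\<close> by simp
    have "(x - a n) * (b (Suc n) - b n) / (a (Suc n) - a n) < b (Suc n) - b n"
      using l x by (simp add: divide_less_eq mult.commute)
    then have "interpolate a b x < b (Suc n)" using x by (simp add: interpolate_cell[OF a, where n=n] less_imp_le)
    also have "\<dots> \<le> b m" using grid_le[OF b] nm by simp
    also have "\<dots> \<le> interpolate a b y" using interpolate_in_cell[OF a b, of m y] y by simp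
    finally show ?thesis .
  qed
qed

lemma interpolate_less_iff: "grid a \<Longrightarrow> grid b \<Longrightarrow> interpolate a b x < interpolate a b y \<longleftrightarrow> x < y"
  by (metis interpolate_strict_mono not_less_iff_gr_or_eq)

lemma interpolate_le_iff: "grid a \<Longrightarrow> grid b \<Longrightarrow> interpolate a b x \<le> interpolate a b y \<longleftrightarrow> x \<le> y"
  by (meson interpolate_less_iff not_less)

lemma continuous_interpolate:
  assumes a: "grid a" and b: "grid b" shows "continuous_on UNIV (interpolate a b)"
proof (rule continuous_onI_mono)
  have "interpolate a b ` UNIV = UNIV" using interpolate_inverse[OF b a] by (metis surjI)
  then show "open (interpolate a b ` UNIV)" by simp
qed (simp add: interpolate_le_iff a b)

lemma continuous_on_interpolate [continuous_intros]:
  assumes "grid a" "grid b" "continuous_on S f"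
  shows "continuous_on S (\<lambda>x. interpolate a b (f x))"
  using continuous_on_compose2[OF continuous_interpolate] assms by blast

text \<open>
  An affine map between two intervals commutes with their reflections in the midpoints. This is
  the reason why the map between two polygons built from \<open>interpolate\<close> commutes with
  the reflection of cells.
\<close>

lemma interpolate_reflect:
  assumes a: "grid a" and x: "a n \<le> x" "x \<le> a (Suc n)"
  shows "interpolate a b (a n + a (Suc n) - x) = b n + b (Suc n) - interpolate a b x"
proof -
  have l: "a n < a (Suc n)" using grid_less a by auto
  have "interpolate a b (a n + a (Suc n) - x) = b n + (a (Suc n) - x) * (b (Suc n) - b n) / (a (Suc n) - a n)"
    using x by (subst interpolate_cell[OF a, where n=n]) auto
  also have "\<dots> = b n + b (Suc n) - interpolate a b x"
    using l by (simp add: interpolate_cell[OF a x] field_simps)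
  finally show ?thesis .
qed

section \<open>The polygon as a strip\<close>

text \<open>
  The signed area of the parallelogram spanned by edge \<open>k\<close> and the vector from its
  initial point to \<open>z\<close>; it is positive on the side of the edge on which the polygon
  lies.
\<close>

definition side :: "real \<Rightarrow> int \<Rightarrow> real^2 \<Rightarrow> real" where
  "side c k z =
     (height (P c (k + 1)) - height (P c k)) * (skew z - skew (P c k)) -
     (skew (P c (k + 1)) - skew (P c k)) * (height z - height (P c k))"

lemma side_affine: "side c k ((1 - t) *\<^sub>R x + t *\<^sub>R y) = (1 - t) * side c k x + t * side c k y"
  by (simp add: side_def algebra_simps)

lemma side_0 [simp]: "side c 0 z = skew z"
proof -
  have "P c 1 = pt 0 1" using P_pos[of c 0] by simp
  then show ?thesis by (simp add: side_def)
qed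

lemma side_T: "side c (k + 1) (T c z) = side c k z"
proof -
  have "side c (k + 1) (T c z) =
      (height (T c (P c (k + 1))) - height (T c (P c k))) * (skew (T c z) - skew (T c (P c k))) -
      (skew (T c (P c (k + 1))) - skew (T c (P c k))) * (height (T c z) - height (T c (P c k)))"
    by (simp only: side_def P_step)
  also have "\<dots> = side c k z"
    unfolding height_T skew_T side_def by (simp add: algebra_simps)
  finally show ?thesis .
qed

lemma T_inverse: obtains w where "T c w = z"
  using bij_T by (metis bij_is_surj surj_def)

text \<open>
  \<open>T\<close> preserves area and moves edge \<open>k\<close> to edge \<open>k + 1\<close>,
  which reduces every edge to edge 0; that one spans the line of skew 0.
\<close>

lemma side_P: "side c k (P c j) = skew (P c (j - k))"
proof (induction k arbitrary: j rule: int_induct[where k=0])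
  case (step1 i)
  have "side c (i + 1) (P c ((j - 1) + 1)) = side c i (P c (j - 1))" by (simp only: P_step side_T)
  then show ?case using step1(2)[of "j - 1"] by (simp add: algebra_simps)
next
  case (step2 i)
  have "side c ((i - 1) + 1) (P c (j + 1)) = side c (i - 1) (P c j)" by (simp only: P_step side_T)
  then show ?case using step2(2)[of "j + 1"] by (simp add: algebra_simps)
qed simp

lemma skew_P_nonneg: "c \<ge> 1 \<Longrightarrow> skew (P c j) \<ge> 0"
  and skew_P_zero: "c \<ge> 1 \<Longrightarrow> skew (P c j) = 0 \<longleftrightarrow> j = 0 \<or> j = 1"
proof -
  assume c: "c \<ge> 1"
  show "skew (P c j) \<ge> 0"
  proof -
    have "0 \<le> col_at c n" for n
      using grid_ge[OF grid_col[OF c], of n] by (meson of_nat_0_le_iff order_trans)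
    then show ?thesis by (cases j rule: int_cases_vertex) (auto simp: P_neg P_pos)
  qed
  have "col_at c n = 0 \<longleftrightarrow> n = 0" for n
    using grid_ge[OF grid_col[OF c], of n] by (cases n) auto
  then show "skew (P c j) = 0 \<longleftrightarrow> j = 0 \<or> j = 1"
    by (cases j rule: int_cases_vertex) (auto simp: P_neg P_pos)
qed

lemma side_P_nonneg: "c \<ge> 1 \<Longrightarrow> side c k (P c j) \<ge> 0"
  and side_P_zero: "c \<ge> 1 \<Longrightarrow> side c k (P c j) = 0 \<longleftrightarrow> j = k \<or> j = k + 1"
  by (auto simp: side_P skew_P_nonneg skew_P_zero)

lemma inj_P: assumes c: "c \<ge> 1" shows "P c i = P c j \<longleftrightarrow> i = j"
proof
  assume eq: "P c i = P c j"
  have "side c i (P c j) = 0" "side c (i - 1) (P c j) = 0"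
    unfolding eq[symmetric] using side_P_zero[OF c] by auto
  then show "i = j" using side_P_zero[OF c] by force
qed simp

lemma P_in_Qplus [simp]: "P c k \<in> Qplus c"
  by (simp add: Qplus_def hull_inc)

lemma convex_Qplus: "convex (Qplus c)" by (simp add: Qplus_def)

lemma Qplus_side: assumes "c \<ge> 1" "z \<in> Qplus c" shows "side c k z \<ge> 0"
proof -
  have "convex {z. side c k z \<ge> 0}"
  proof (rule convexI)
    fix x y and u v :: real
    assume *: "x \<in> {z. side c k z \<ge> 0}" "y \<in> {z. side c k z \<ge> 0}" "0 \<le> u" "0 \<le> v" "u + v = 1"
    then have u: "u = 1 - v" by simp
    have "side c k (u *\<^sub>R x + v *\<^sub>R y) = u * side c k x + v * side c k y"
      unfolding u by (rule side_affine)
    then show "u *\<^sub>R x + v *\<^sub>R y \<in> {z. side c k z \<ge> 0}" using * by simp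
  qed
  moreover have "range (P c) \<subseteq> {z. side c k z \<ge> 0}" using side_P_nonneg[OF assms(1)] by auto
  ultimately have "Qplus c \<subseteq> {z. side c k z \<ge> 0}" unfolding Qplus_def by (rule hull_minimal[rotated])
  then show ?thesis using assms by auto
qed

text \<open>
  Lattice coordinates: they place the grid on the integer lattice for every \<open>c\<close>.
\<close>

definition gx :: "real \<Rightarrow> real^2 \<Rightarrow> real" where "gx c z = interpolate (col_at c) real (skew z)"
definition gy :: "real \<Rightarrow> real^2 \<Rightarrow> real" where "gy c z = interpolate (row_at c) real (height z)"

lemma continuous_on_gx [continuous_intros]:
    "c \<ge> 1 \<Longrightarrow> continuous_on S f \<Longrightarrow> continuous_on S (\<lambda>x. gx c (f x))"
  and continuous_on_gy [continuous_intros]: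
    "c \<ge> 1 \<Longrightarrow> continuous_on S f \<Longrightarrow> continuous_on S (\<lambda>x. gy c (f x))"
  unfolding gx_def gy_def by (intro continuous_intros grid_col grid_row grid_real; assumption)+

lemma gx_cell: "c \<ge> 1 \<Longrightarrow> real n \<le> gx c z \<longleftrightarrow> col_at c n \<le> skew z" "c \<ge> 1 \<Longrightarrow> gx c z \<le> real n \<longleftrightarrow> skew z \<le> col_at c n"
   "c \<ge> 1 \<Longrightarrow> real n < gx c z \<longleftrightarrow> col_at c n < skew z" "c \<ge> 1 \<Longrightarrow> gx c z < real n \<longleftrightarrow> skew z < col_at c n"
  unfolding gx_def using interpolate_le_iff[OF grid_col grid_real, of c] interpolate_less_iff[OF grid_col grid_real, of c]
    interpolate_at[OF grid_col, of c real n] by metis+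

lemma gy_cell: "c \<ge> 1 \<Longrightarrow> real n \<le> gy c z \<longleftrightarrow> row_at c n \<le> height z" "c \<ge> 1 \<Longrightarrow> gy c z \<le> real n \<longleftrightarrow> height z \<le> row_at c n"
   "c \<ge> 1 \<Longrightarrow> real n < gy c z \<longleftrightarrow> row_at c n < height z" "c \<ge> 1 \<Longrightarrow> gy c z < real n \<longleftrightarrow> height z < row_at c n"
  unfolding gy_def using interpolate_le_iff[OF grid_row grid_real, of c] interpolate_less_iff[OF grid_row grid_real, of c]
    interpolate_at[OF grid_row, of c real n] by metis+

lemma gx_nonneg: "c \<ge> 1 \<Longrightarrow> 0 \<le> gx c z \<longleftrightarrow> 0 \<le> skew z" and gx_pos: "c \<ge> 1 \<Longrightarrow> 0 < gx c z \<longleftrightarrow> 0 < skew z"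
  using gx_cell(1)[of c 0 z] gx_cell(3)[of c 0 z] by simp_all

lemma gy_nonneg: "c \<ge> 1 \<Longrightarrow> 0 \<le> gy c z \<longleftrightarrow> 0 \<le> height z" and gy_pos: "c \<ge> 1 \<Longrightarrow> 0 < gy c z \<longleftrightarrow> 0 < height z"
  using gy_cell(1)[of c 0 z] gy_cell(3)[of c 0 z] by simp_all

lemma col_cell:
  assumes "c \<ge> 1" "skew z \<ge> 0"
  obtains n where "col_at c n \<le> skew z" "skew z < col_at c (Suc n)"
  using grid_cell[OF grid_col] assms by blast

lemma P_lower: "P c (- int n - 1) = pt (col_at c (Suc n)) (row_at c (Suc n))" "P c (- int n - 1 + 1) = pt (col_at c n) (row_at c n)"
proof -
  have "- int n - 1 = - int (Suc n)" "- int n - 1 + 1 = - int n" by simp_all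
  then show "P c (- int n - 1) = pt (col_at c (Suc n)) (row_at c (Suc n))"
    "P c (- int n - 1 + 1) = pt (col_at c n) (row_at c n)" by (simp_all only: P_neg)
qed

lemma P_upper: "P c (int n + 1) = pt (col_at c n) (row_at c (Suc n))" "P c (int n + 1 + 1) = pt (col_at c (Suc n)) (row_at c (Suc (Suc n)))"
proof -
  have "int n + 1 + 1 = int (Suc n) + 1" by simp
  then show "P c (int n + 1) = pt (col_at c n) (row_at c (Suc n))"
    "P c (int n + 1 + 1) = pt (col_at c (Suc n)) (row_at c (Suc (Suc n)))" by (simp_all only: P_pos)
qed

context
  fixes c z n
  assumes c: "(c::real) \<ge> 1" and z: "col_at c n \<le> skew z" "skew z \<le> col_at c (Suc n)"
begin

lemma side_lower_eq: "side c (- int n - 1) z = (col_at c (Suc n) - col_at c n) * (height z - interpolate (col_at c) (row_at c) (skew z))"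
proof -
  have l: "col_at c n < col_at c (Suc n)" using grid_less[OF grid_col[OF c]] by simp
  have "(col_at c (Suc n) - col_at c n) * interpolate (col_at c) (row_at c) (skew z) =
     (col_at c (Suc n) - col_at c n) * row_at c n + (skew z - col_at c n) * (row_at c (Suc n) - row_at c n)"
    using l by (simp add: interpolate_cell[OF grid_col[OF c] z] field_simps)
  then show ?thesis unfolding side_def P_lower by (simp add: algebra_simps)
qed

lemma side_upper_eq: "side c (int n + 1) z = (col_at c (Suc n) - col_at c n) * (interpolate (col_at c) (\<lambda>n. row_at c (Suc n)) (skew z) - height z)"
proof -
  have l: "col_at c n < col_at c (Suc n)" using grid_less[OF grid_col[OF c]] by simp
  have "(col_at c (Suc n) - col_at c n) * interpolate (col_at c) (\<lambda>n. row_at c (Suc n)) (skew z) =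
     (col_at c (Suc n) - col_at c n) * row_at c (Suc n) + (skew z - col_at c n) * (row_at c (Suc (Suc n)) - row_at c (Suc n))"
    using l by (simp add: interpolate_cell[OF grid_col[OF c] z] field_simps)
  then show ?thesis unfolding side_def P_upper by (simp add: algebra_simps)
qed

lemma gx_lower: "interpolate (row_at c) real (interpolate (col_at c) (row_at c) (skew z)) = gx c z"
  by (simp add: gx_def interpolate_interpolate grid_col grid_row c)

lemma gx_upper: "interpolate (row_at c) real (interpolate (col_at c) (\<lambda>n. row_at c (Suc n)) (skew z)) = gx c z + 1"
proof -
  let ?s = "\<lambda>n. row_at c (Suc n)"
  let ?d = "\<lambda>n. ?s n - 1"
  have l: "col_at c n < col_at c (Suc n)" "?s n < ?s (Suc n)" using grid_less grid_row grid_col c by auto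
  define q where "q = (skew z - col_at c n) / (col_at c (Suc n) - col_at c n)"
  have q: "0 \<le> q" "q \<le> 1" using l z by (auto simp: q_def)
  have e: "interpolate (col_at c) ?s (skew z) = ?s n + q * (?s (Suc n) - ?s n)"
    by (simp add: interpolate_cell[OF grid_col[OF c] z] q_def)
  have d: "0 \<le> q * (?s (Suc n) - ?s n)" "q * (?s (Suc n) - ?s n) \<le> ?s (Suc n) - ?s n"
    using q l by (auto intro: mult_left_le_one_le)
  have "?s n \<le> interpolate (col_at c) ?s (skew z)" "interpolate (col_at c) ?s (skew z) \<le> ?s (Suc n)"
    unfolding e using d by linarith+
  then have "interpolate (row_at c) real (interpolate (col_at c) ?s (skew z)) =
      real (Suc n) + (interpolate (col_at c) ?s (skew z) - ?s n) * (real (Suc (Suc n)) - real (Suc n)) / (?s (Suc n) - ?s n)"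
    by (rule interpolate_cell[OF grid_row[OF c]])
  also have "\<dots> = real (Suc n) + q" unfolding e using l by simp
  finally have "interpolate (row_at c) real (interpolate (col_at c) ?s (skew z)) = real (Suc n) + q" .
  moreover have "gx c z = real n + q" by (simp add: gx_def interpolate_cell[OF grid_col[OF c] z] q_def)
  ultimately show ?thesis by simp
qed

lemma side_lower_iff: "0 \<le> side c (- int n - 1) z \<longleftrightarrow> gx c z \<le> gy c z" "0 < side c (- int n - 1) z \<longleftrightarrow> gx c z < gy c z"
proof -
  have l: "col_at c n < col_at c (Suc n)" using grid_less[OF grid_col[OF c]] by simp
  show "0 \<le> side c (- int n - 1) z \<longleftrightarrow> gx c z \<le> gy c z"
    using l unfolding side_lower_eq gx_lower[symmetric] gy_def
    by (simp add: interpolate_le_iff grid_row grid_real c zero_le_mult_iff)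
  show "0 < side c (- int n - 1) z \<longleftrightarrow> gx c z < gy c z"
    using l unfolding side_lower_eq gx_lower[symmetric] gy_def
    by (simp add: interpolate_less_iff grid_row grid_real c zero_less_mult_iff)
qed

lemma side_upper_iff: "0 \<le> side c (int n + 1) z \<longleftrightarrow> gy c z \<le> gx c z + 1" "0 < side c (int n + 1) z \<longleftrightarrow> gy c z < gx c z + 1"
proof -
  have l: "col_at c n < col_at c (Suc n)" using grid_less[OF grid_col[OF c]] by simp
  show "0 \<le> side c (int n + 1) z \<longleftrightarrow> gy c z \<le> gx c z + 1"
    using l unfolding side_upper_eq gx_upper[symmetric] gy_def
    by (simp add: interpolate_le_iff grid_row grid_real c zero_le_mult_iff)
  show "0 < side c (int n + 1) z \<longleftrightarrow> gy c z < gx c z + 1"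
    using l unfolding side_upper_eq gx_upper[symmetric] gy_def
    by (simp add: interpolate_less_iff grid_row grid_real c zero_less_mult_iff)
qed

text \<open>
  The point lies between the points of the same skew on a lower and on an upper edge.
\<close>

lemma between_edges_in_Qplus:
  assumes "gx c z \<le> gy c z" "gy c z \<le> gx c z + 1"
  shows "z \<in> Qplus c"
proof -
  let ?lo = "interpolate (col_at c) (row_at c) (skew z)" and ?up = "interpolate (col_at c) (\<lambda>n. row_at c (Suc n)) (skew z)"
  have l: "col_at c n < col_at c (Suc n)" using grid_less[OF grid_col[OF c]] by simp
  define q where "q = (skew z - col_at c n) / (col_at c (Suc n) - col_at c n)"
  have q: "0 \<le> q" "q \<le> 1" using l z by (auto simp: q_def)
  have qz: "skew z = col_at c n + q * (col_at c (Suc n) - col_at c n)" using l by (simp add: q_def)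
  have lo: "?lo = row_at c n + q * (row_at c (Suc n) - row_at c n)"
    and up: "?up = row_at c (Suc n) + q * (row_at c (Suc (Suc n)) - row_at c (Suc n))"
    by (simp_all add: interpolate_cell[OF grid_col[OF c] z] q_def)
  have "pt (skew z) ?lo = (1 - q) *\<^sub>R P c (- int n) + q *\<^sub>R P c (- int n - 1)"
    unfolding lo P_lower P_neg vec2_eq_iff by (simp add: qz algebra_simps)
  then have 1: "pt (skew z) ?lo \<in> Qplus c"
    using q convexD_alt[OF convex_Qplus P_in_Qplus P_in_Qplus] by simp
  have "pt (skew z) ?up = (1 - q) *\<^sub>R P c (int n + 1) + q *\<^sub>R P c (int n + 1 + 1)"
    unfolding up P_upper vec2_eq_iff by (simp add: qz algebra_simps)
  then have 2: "pt (skew z) ?up \<in> Qplus c"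
    using q convexD_alt[OF convex_Qplus P_in_Qplus P_in_Qplus] by simp
  have h: "?lo \<le> height z" "height z \<le> ?up"
    using assms unfolding gx_upper[symmetric] unfolding gx_lower[symmetric] gy_def
    by (simp_all add: interpolate_le_iff grid_row grid_real c)
  obtain t where t: "0 \<le> t" "t \<le> 1" "height z = (1 - t) * ?lo + t * ?up"
  proof -
    have "height z \<in> closed_segment ?lo ?up" using h by (simp add: closed_segment_eq_real_ivl)
    then show ?thesis using that by (auto simp: closed_segment_def)
  qed
  have "z = (1 - t) *\<^sub>R pt (skew z) ?lo + t *\<^sub>R pt (skew z) ?up"
    using t(3) by (simp add: vec2_eq_iff algebra_simps)
  then show ?thesis using convexD_alt[OF convex_Qplus 1 2, of t] t by simp
qed

end

text \<open>
  In lattice coordinates the polygon is a strip that does not depend on \<open>c\<close>. This is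
  what makes the surfaces for different \<open>c\<close> comparable cell by cell.
\<close>

lemma Qplus_iff_side: assumes "c \<ge> 1" shows "z \<in> Qplus c \<longleftrightarrow> (\<forall>k. side c k z \<ge> 0)"
  and Qplus_iff: "z \<in> Qplus c \<longleftrightarrow> 0 \<le> skew z \<and> gx c z \<le> gy c z \<and> gy c z \<le> gx c z + 1"
proof -
  have 1: "\<forall>k. side c k z \<ge> 0" if "z \<in> Qplus c" using Qplus_side[OF assms that] by simp
  have 2: "0 \<le> skew z \<and> gx c z \<le> gy c z \<and> gy c z \<le> gx c z + 1" if *: "\<forall>k. side c k z \<ge> 0"
  proof -
    have s: "0 \<le> skew z" using *[rule_format, of 0] by simp
    obtain n where n: "col_at c n \<le> skew z" "skew z \<le> col_at c (Suc n)"
      using col_cell[OF assms s] by (metis less_imp_le)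
    show ?thesis using s * side_lower_iff(1)[OF assms n] side_upper_iff(1)[OF assms n] by blast
  qed
  have 3: "z \<in> Qplus c" if *: "0 \<le> skew z \<and> gx c z \<le> gy c z \<and> gy c z \<le> gx c z + 1"
  proof -
    obtain n where n: "col_at c n \<le> skew z" "skew z \<le> col_at c (Suc n)"
      using col_cell[OF assms] * by (metis less_imp_le)
    show ?thesis using between_edges_in_Qplus[OF assms n] * by blast
  qed
  show "z \<in> Qplus c \<longleftrightarrow> (\<forall>k. side c k z \<ge> 0)"
    "z \<in> Qplus c \<longleftrightarrow> 0 \<le> skew z \<and> gx c z \<le> gy c z \<and> gy c z \<le> gx c z + 1"
    using 1 2 3 by blast+
qed

lemma interior_sides_pos:
  assumes c: "c \<ge> 1" and z: "z \<in> interior (Qplus c)" shows "side c k z > 0"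
proof -
  obtain e where e: "e > 0" "ball z e \<subseteq> Qplus c" using z by (auto simp: mem_interior)
  define h where "h = height (P c (k + 1)) - height (P c k)"
  define s where "s = skew (P c (k + 1)) - skew (P c k)"
  define w where "w = pt (- h) s"
  have "P c k \<noteq> P c (k + 1)" using inj_P[OF c, of k "k + 1"] by simp
  then have hs: "h^2 + s^2 > 0" by (auto simp: h_def s_def vec2_eq_iff sum_power2_gt_zero_iff)
  then have "w \<noteq> 0" by (auto simp: w_def vec2_eq_iff)
  define d where "d = e / (2 * norm w)"
  have d: "d > 0" using e \<open>w \<noteq> 0\<close> by (simp add: d_def)
  have "z + d *\<^sub>R w \<in> ball z e" using e \<open>w \<noteq> 0\<close> by (simp add: dist_norm d_def)
  then have "0 \<le> side c k (z + d *\<^sub>R w)" using Qplus_side[OF c] e by blast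
  also have "\<dots> = side c k z - d * (h^2 + s^2)"
    by (simp add: side_def w_def h_def s_def power2_eq_square algebra_simps)
  finally show ?thesis using mult_pos_pos[OF d hs] by linarith
qed

lemma all_sides_pos_imp:
  assumes c: "c \<ge> 1" and *: "\<forall>k. side c k z > 0"
  shows "0 < skew z \<and> gx c z < gy c z \<and> gy c z < gx c z + 1"
proof -
  have s: "0 < skew z" using *[rule_format, of 0] by simp
  obtain n where n: "col_at c n \<le> skew z" "skew z \<le> col_at c (Suc n)"
    using col_cell[OF c, of z] s by (metis less_imp_le)
  show ?thesis using s * side_lower_iff(2)[OF c n] side_upper_iff(2)[OF c n] by blast
qed

lemma open_strip:
  assumes c: "c \<ge> 1" shows "open {z. 0 < skew z \<and> gx c z < gy c z \<and> gy c z < gx c z + 1}"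
  by (intro open_Collect_conj open_Collect_less continuous_intros c)

lemma strip_in_interior:
  assumes c: "c \<ge> 1" and z: "0 < skew z" "gx c z < gy c z" "gy c z < gx c z + 1"
  shows "z \<in> interior (Qplus c)"
  by (rule interiorI[OF open_strip[OF c]]) (use z in \<open>auto simp: Qplus_iff[OF c]\<close>)

lemma interior_Qplus_iff:
  assumes c: "c \<ge> 1"
  shows "z \<in> interior (Qplus c) \<longleftrightarrow> 0 < skew z \<and> gx c z < gy c z \<and> gy c z < gx c z + 1"
  using interior_sides_pos[OF c] all_sides_pos_imp[OF c] strip_in_interior[OF c] by blast

lemma interior_Qplus_iff_side:
  assumes c: "c \<ge> 1"
  shows "z \<in> interior (Qplus c) \<longleftrightarrow> (\<forall>k. side c k z > 0)"
  using interior_sides_pos[OF c] all_sides_pos_imp[OF c] strip_in_interior[OF c] by blast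

section \<open>Edges\<close>

lemma mem_edge: "z \<in> edge c k \<longleftrightarrow> (\<exists>t. 0 \<le> t \<and> t \<le> 1 \<and> z = (1 - t) *\<^sub>R P c k + t *\<^sub>R P c (k + 1))"
  by (auto simp: edge_def closed_segment_def)

lemma edge_subset_Qplus: "edge c k \<subseteq> Qplus c"
  unfolding edge_def by (rule closed_segment_subset[OF P_in_Qplus P_in_Qplus convex_Qplus])

lemma side_edge: "c \<ge> 1 \<Longrightarrow> z \<in> edge c k \<Longrightarrow> side c k z = 0"
  using side_P_zero[of c k k] side_P_zero[of c k "k + 1"] by (auto simp: mem_edge side_affine)

lemma T_affine: "T c ((1 - t) *\<^sub>R x + t *\<^sub>R y) = (1 - t) *\<^sub>R T c x + t *\<^sub>R T c y"
  by (simp add: vec2_eq_iff skew_T height_T algebra_simps)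

lemma T_in_Qplus: "c \<ge> 1 \<Longrightarrow> T c z \<in> Qplus c \<longleftrightarrow> z \<in> Qplus c"
  using side_T by (simp add: Qplus_iff_side) (metis diff_add_cancel)

lemma T_eq_iff: "T c x = T c y \<longleftrightarrow> x = y"
  using bij_T by (metis bij_def inj_eq)

lemma T_in_edge: "T c z \<in> edge c (k + 1) \<longleftrightarrow> z \<in> edge c k"
  unfolding mem_edge P_step[of c k] P_step[of c "k + 1"]
  by (simp only: T_affine[symmetric] T_eq_iff)

lemma edge_0_iff: "z \<in> edge c 0 \<longleftrightarrow> skew z = 0 \<and> 0 \<le> height z \<and> height z \<le> 1"
proof -
  have "P c 1 = pt 0 1" using P_pos[of c 0] by simp
  then show ?thesis unfolding mem_edge vec2_eq_iff by auto
qed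

lemma edge_iff_side: assumes c: "c \<ge> 1"
  shows "z \<in> edge c k \<longleftrightarrow> z \<in> Qplus c \<and> side c k z = 0"
proof -
  have "\<forall>z. z \<in> Qplus c \<and> side c k z = 0 \<longrightarrow> z \<in> edge c k"
  proof (induction k rule: int_induct[where k=0])
    case base
    have "z \<in> edge c 0" if z: "z \<in> Qplus c" "skew z = 0" for z
    proof -
      have "gx c z = 0" using z(2) gx_nonneg[OF c, of z] gx_pos[OF c, of z] by simp
      then have "0 \<le> gy c z" "gy c z \<le> 1" using z by (auto simp: Qplus_iff[OF c])
      then show ?thesis using z gy_cell(1)[OF c, of 0 z] gy_cell(2)[OF c, of z 1] by (simp add: edge_0_iff)
    qed
    then show ?case by simp
  next
    case (step1 i)
    show ?case
    proof (intro allI impI)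
      fix z assume z: "z \<in> Qplus c \<and> side c (i + 1) z = 0"
      obtain w where w: "T c w = z" by (rule T_inverse)
      then show "z \<in> edge c (i + 1)" using z step1 by (auto simp: T_in_Qplus[OF c] side_T T_in_edge)
    qed
  next
    case (step2 i)
    show ?case
    proof (intro allI impI)
      fix z assume z: "z \<in> Qplus c \<and> side c (i - 1) z = 0"
      then have "T c z \<in> edge c (i - 1 + 1)" using step2 side_T[of c "i - 1" z] by (auto simp: T_in_Qplus[OF c])
      then show "z \<in> edge c (i - 1)" by (simp only: T_in_edge)
    qed
  qed
  then show ?thesis using side_edge[OF c] edge_subset_Qplus by blast
qed

lemma Qplus_cases:
  assumes c: "c \<ge> 1" and z: "z \<in> Qplus c"
  obtains (interior) "z \<in> interior (Qplus c)" | (edge) k where "z \<in> edge c k"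
  using z edge_iff_side[OF c, of z] interior_Qplus_iff_side[OF c, of z] Qplus_side[OF c z]
  by (metis less_eq_real_def)

lemma interior_not_edge: "c \<ge> 1 \<Longrightarrow> z \<in> interior (Qplus c) \<Longrightarrow> z \<notin> edge c k"
  using interior_sides_pos[of c z k] side_edge[of c z k] by auto

definition open_edge :: "real \<Rightarrow> int \<Rightarrow> (real^2) set" where
  "open_edge c k = open_segment (P c k) (P c (k + 1))"

lemma mem_open_edge: "c \<ge> 1 \<Longrightarrow> z \<in> open_edge c k \<longleftrightarrow> (\<exists>t. 0 < t \<and> t < 1 \<and> z = (1 - t) *\<^sub>R P c k + t *\<^sub>R P c (k + 1))"
  using inj_P[of c k "k + 1"] by (auto simp: open_edge_def in_segment)

lemma mem_open_edge_iff: "z \<in> open_edge c k \<longleftrightarrow> z \<in> edge c k \<and> z \<noteq> P c k \<and> z \<noteq> P c (k + 1)"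
  by (auto simp: open_edge_def edge_def open_segment_def)

lemma open_edge_side_pos:
  assumes c: "c \<ge> 1" and z: "z \<in> open_edge c k" and "i \<noteq> k" shows "side c i z > 0"
proof -
  obtain t where t: "0 < t" "t < 1" "z = (1 - t) *\<^sub>R P c k + t *\<^sub>R P c (k + 1)"
    using z mem_open_edge[OF c] by blast
  have "side c i z = (1 - t) * side c i (P c k) + t * side c i (P c (k + 1))" by (simp add: t side_affine)
  moreover have "(1 - t) * side c i (P c k) \<ge> 0" "t * side c i (P c (k + 1)) \<ge> 0"
    using t side_P_nonneg[OF c] by auto
  moreover have "side c i (P c k) \<noteq> 0 \<or> side c i (P c (k + 1)) \<noteq> 0"
    using \<open>i \<noteq> k\<close> side_P_zero[OF c] by auto
  then have "(1 - t) * side c i (P c k) \<noteq> 0 \<or> t * side c i (P c (k + 1)) \<noteq> 0" using t by simp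
  ultimately show ?thesis by linarith
qed

lemma edge_unique: "c \<ge> 1 \<Longrightarrow> z \<in> open_edge c k \<Longrightarrow> z \<in> edge c i \<Longrightarrow> i = k"
  using open_edge_side_pos[of c z k i] side_edge[of c z i] by force

lemma edge_cases: "z \<in> edge c k \<Longrightarrow> z \<in> open_edge c k \<or> z = P c k \<or> z = P c (k + 1)"
  by (auto simp: mem_open_edge_iff)

lemma open_edge_not_vertex: "c \<ge> 1 \<Longrightarrow> z \<in> open_edge c k \<Longrightarrow> z \<noteq> P c j"
  using edge_unique[of c z k j] by (metis edge_def ends_in_segment(1) mem_open_edge_iff)

lemma P_in_edge: "P c k \<in> edge c k" "P c (k + 1) \<in> edge c k" "P c k \<in> edge c (k - 1)"
  by (auto simp: edge_def)

lemma open_edge_in_Qplus: "z \<in> open_edge c k \<Longrightarrow> z \<in> Qplus c"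
  using edge_subset_Qplus mem_open_edge_iff by blast

lemma nonvertex_cases:
  assumes c: "c \<ge> 1" and z: "z \<in> Qplus c" "z \<notin> range (P c)"
  obtains (interior) "z \<in> interior (Qplus c)" | (edge) k where "z \<in> open_edge c k"
  using Qplus_cases[OF c z(1)] z(2) edge_cases by (metis rangeI)

section \<open>Folding along an edge\<close>

text \<open>
  The point reflection in the midpoint of edge \<open>k\<close>. The gluing translation along edge
  \<open>k\<close> is this reflection followed by the rotation by \<open>\<pi>\<close>, so folding
  is what gluing becomes once both polygons are parametrized by \<open>Qplus c\<close>.
\<close>

definition fold_edge :: "real \<Rightarrow> int \<Rightarrow> real^2 \<Rightarrow> real^2" where
  "fold_edge c k z = P c k + P c (k + 1) - z"

lemma fold_fold [simp]: "fold_edge c k (fold_edge c k z) = z" by (simp add: fold_edge_def)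

lemma fold_in_edge: assumes "z \<in> edge c k" shows "fold_edge c k z \<in> edge c k"
proof -
  obtain t where t: "0 \<le> t" "t \<le> 1" "z = (1 - t) *\<^sub>R P c k + t *\<^sub>R P c (k + 1)"
    using assms by (auto simp: mem_edge)
  then have "fold_edge c k z = (1 - (1 - t)) *\<^sub>R P c k + (1 - t) *\<^sub>R P c (k + 1)"
    by (simp add: fold_edge_def algebra_simps)
  then show ?thesis unfolding mem_edge using t by (intro exI[of _ "1 - t"]) auto
qed

lemma fold_in_open_edge: "z \<in> open_edge c k \<Longrightarrow> fold_edge c k z \<in> open_edge c k"
  using fold_in_edge by (auto simp: mem_open_edge_iff) (auto simp: fold_edge_def)

lemma side_fold: "side c k (fold_edge c k z) = - side c k z"
  by (simp add: side_def fold_edge_def algebra_simps)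

lemma fold_interior_not_Qplus: "c \<ge> 1 \<Longrightarrow> fold_edge c k z \<in> interior (Qplus c) \<Longrightarrow> z \<notin> Qplus c"
  using interior_sides_pos[of c "fold_edge c k z" k] Qplus_side[of c z k] by (auto simp: side_fold)

lemma mem_chart_domain:
  "z \<in> chart_domain c k \<longleftrightarrow>
     z \<in> interior (Qplus c) \<or> z \<in> open_edge c k \<or> fold_edge c k z \<in> interior (Qplus c)"
proof -
  have "z \<in> (\<lambda>y. y + P c k + P c (k + 1)) ` interior (uminus ` Qplus c) \<longleftrightarrow> fold_edge c k z \<in> interior (Qplus c)"
    unfolding interior_negations fold_edge_def image_image
    by (auto simp: algebra_simps intro!: image_eqI[of _ _ "P c k + P c (k + 1) - z"])
  then show ?thesis by (auto simp: chart_domain_def open_edge_def)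
qed

lemma chart_domain_in_Qplus:
  "c \<ge> 1 \<Longrightarrow> z \<in> chart_domain c k \<Longrightarrow> z \<in> Qplus c \<longleftrightarrow> z \<in> interior (Qplus c) \<or> z \<in> open_edge c k"
  using fold_interior_not_Qplus open_edge_in_Qplus interior_subset by (fastforce simp: mem_chart_domain)

lemma open_side_pos: "open {z. side c i z > 0}"
  unfolding side_def by (intro open_Collect_less continuous_intros)

text \<open>
  Only the edges in the columns up to that of \<open>z\<close> can separate \<open>z\<close> from
  the polygon. Membership is thus locally given by finitely many half planes, although the polygon
  has infinitely many edges.
\<close>

lemma finitely_many_sides:
  assumes c: "c \<ge> 1" and z: "skew z < col_at c n" and s: "\<And>i. \<bar>i\<bar> \<le> int n + 1 \<Longrightarrow> side c i z \<ge> 0"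
  shows "z \<in> Qplus c"
proof -
  have s0: "0 \<le> skew z" using s[of 0] by simp
  obtain m where m: "col_at c m \<le> skew z" "skew z < col_at c (Suc m)" using col_cell[OF c s0] by blast
  then have m': "skew z \<le> col_at c (Suc m)" by simp
  have "col_at c m < col_at c n" using m z by linarith
  then have "m < n" using grid_less[OF grid_col[OF c]] by simp
  then show ?thesis
    using s[of "- int m - 1"] s[of "int m + 1"] s0 side_lower_iff(1)[OF c m(1) m'] side_upper_iff(1)[OF c m(1) m']
    by (simp add: Qplus_iff[OF c])
qed

lemma finitely_many_sides_pos:
  assumes c: "c \<ge> 1" and z: "skew z < col_at c n" and s: "\<And>i. \<bar>i\<bar> \<le> int n + 1 \<Longrightarrow> side c i z > 0"
  shows "z \<in> interior (Qplus c)"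
proof -
  have s0: "0 < skew z" using s[of 0] by simp
  obtain m where m: "col_at c m \<le> skew z" "skew z < col_at c (Suc m)" using col_cell[OF c] s0 by (metis less_imp_le)
  then have m': "skew z \<le> col_at c (Suc m)" by simp
  have "col_at c m < col_at c n" using m z by linarith
  then have "m < n" using grid_less[OF grid_col[OF c]] by simp
  then show ?thesis
    using s[of "- int m - 1"] s[of "int m + 1"] s0 side_lower_iff(2)[OF c m(1) m'] side_upper_iff(2)[OF c m(1) m']
    by (simp add: interior_Qplus_iff[OF c])
qed

lemma open_chart_domain: assumes c: "c \<ge> 1" shows "open (chart_domain c k)"
proof (subst open_subopen, intro ballI)
  fix x assume x: "x \<in> chart_domain c k"
  have I: "open (interior (Qplus c))" by simp
  have F: "open (fold_edge c k -` interior (Qplus c))"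
    unfolding fold_edge_def by (intro open_vimage I continuous_intros)
  consider "x \<in> interior (Qplus c)" | "fold_edge c k x \<in> interior (Qplus c)" | "x \<in> open_edge c k"
    using x mem_chart_domain by blast
  then show "\<exists>U. open U \<and> x \<in> U \<and> U \<subseteq> chart_domain c k"
  proof cases
    case 1
    then show ?thesis using I by (intro exI[of _ "interior (Qplus c)"]) (auto simp: mem_chart_domain)
  next
    case 2
    then show ?thesis using F by (intro exI[of _ "fold_edge c k -` interior (Qplus c)"]) (auto simp: mem_chart_domain)
  next
    case 3
    have fx: "fold_edge c k x \<in> open_edge c k" by (rule fold_in_open_edge[OF 3])
    define n where "n = nat (max (max \<lceil>skew x\<rceil> \<lceil>skew (fold_edge c k x)\<rceil>) \<bar>k\<bar>) + 1"
    have n: "skew x < real n" "skew (fold_edge c k x) < real n" "\<bar>k\<bar> \<le> int n" unfolding n_def by linarith+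
    have nc: "real n \<le> col_at c n" by (rule grid_ge[OF grid_col[OF c]])
    define J where "J = {i. \<bar>i\<bar> \<le> int n + 1} - {k}"
    have "{i. \<bar>i\<bar> \<le> int n + 1} \<subseteq> {- int n - 1..int n + 1}" by auto
    then have J: "finite J" unfolding J_def by (metis finite_Diff finite_atLeastAtMost_int finite_subset)
    define W where "W = (\<Inter>i\<in>J. {y. side c i y > 0})"
    define U where "U = {y. skew y < col_at c n} \<inter> {y. skew (fold_edge c k y) < col_at c n} \<inter>
      W \<inter> fold_edge c k -` W"
    have "open W" using J open_side_pos unfolding W_def by (intro open_INT) auto
    then have "open U" unfolding U_def fold_edge_def
      by (intro open_Int open_vimage open_Collect_less continuous_intros)
    moreover have "x \<in> U" using 3 fx n nc open_edge_side_pos[OF c] by (auto simp: U_def W_def J_def)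
    moreover have "U \<subseteq> chart_domain c k"
    proof
      fix y assume y: "y \<in> U"
      have s: "side c i y > 0" "side c i (fold_edge c k y) > 0" if "i \<noteq> k" "\<bar>i\<bar> \<le> int n + 1" for i
        using y that by (auto simp: U_def W_def J_def)
      have b: "skew y < col_at c n" "skew (fold_edge c k y) < col_at c n" using y by (auto simp: U_def)
      consider "side c k y > 0" | "side c k y < 0" | "side c k y = 0" by linarith
      then show "y \<in> chart_domain c k"
      proof cases
        case 1
        then have "y \<in> interior (Qplus c)" by (metis finitely_many_sides_pos[OF c b(1)] s(1))
        then show ?thesis by (simp add: mem_chart_domain)
      next
        case 2
        then have "fold_edge c k y \<in> interior (Qplus c)"
          by (metis finitely_many_sides_pos[OF c b(2)] s(2) side_fold neg_0_less_iff_less)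
        then show ?thesis by (simp add: mem_chart_domain)
      next
        case 3
        then have "y \<in> Qplus c" by (metis finitely_many_sides[OF c b(1)] s(1) less_imp_le order_refl)
        then have e: "y \<in> edge c k" using 3 by (simp add: edge_iff_side[OF c])
        have "side c (k - 1) (P c k) = 0" "side c (k + 1) (P c (k + 1)) = 0" using side_P_zero[OF c] by auto
        moreover have "side c (k - 1) y > 0" "side c (k + 1) y > 0" using s[of "k - 1"] s[of "k + 1"] n(3) by auto
        ultimately have "y \<noteq> P c k" "y \<noteq> P c (k + 1)" by auto
        then show ?thesis using e by (simp add: mem_chart_domain mem_open_edge_iff)
      qed
    qed
    ultimately show ?thesis by blast
  qed
qed

section \<open>Points of the surface and maps out of it\<close>

text \<open>
  The surface point with folded coordinate \<open>z\<close> on sheet \<open>s\<close>: both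
  polygons are parametrized by \<open>Qplus c\<close>, the second one through the rotation by
  \<open>\<pi>\<close>.
\<close>

definition sp :: "real \<Rightarrow> real \<Rightarrow> real^2 \<Rightarrow> surface_point" where
  "sp c s z = to_surface c (s, s *\<^sub>R z)"

abbreviation sheet :: "real \<Rightarrow> bool" where "sheet s \<equiv> s = 1 \<or> s = -1"

lemma sheet_mult [simp]: "sheet s \<Longrightarrow> s *\<^sub>R s *\<^sub>R (z::real^2) = z" "sheet s \<Longrightarrow> s * (s * r) = r" "sheet s \<Longrightarrow> s * s = 1"
  by auto

lemma topspace_polygons: "topspace (polygons c) = {(s, x). sheet s \<and> s *\<^sub>R x \<in> Qplus c}"
proof -
  have "x \<in> (*\<^sub>R) s ` Qplus c \<longleftrightarrow> s *\<^sub>R x \<in> Qplus c" if "sheet s" for s and x :: "real^2"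
    using that by (auto intro: image_eqI[of _ _ "s *\<^sub>R x"])
  then show ?thesis unfolding polygons_def topspace_sum_topology by force
qed

lemma topspace_surface: "topspace (surface c) = {sp c s z | s z. sheet s \<and> z \<in> Qplus c}"
proof
  show "topspace (surface c) \<subseteq> {sp c s z | s z. sheet s \<and> z \<in> Qplus c}"
  proof
    fix C assume "C \<in> topspace (surface c)"
    then obtain s x where *: "sheet s" "s *\<^sub>R x \<in> Qplus c" "C = to_surface c (s, x)"
      by (auto simp: surface_def quotient_def topspace_polygons to_surface_def)
    then have "C = sp c s (s *\<^sub>R x)" by (simp add: sp_def)
    then show "C \<in> {sp c s z | s z. sheet s \<and> z \<in> Qplus c}" using * by blast
  qed
  show "{sp c s z | s z. sheet s \<and> z \<in> Qplus c} \<subseteq> topspace (surface c)"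
  proof clarify
    fix s z assume "sheet s" "z \<in> Qplus c"
    then have "(s, s *\<^sub>R z) \<in> topspace (polygons c)" by (simp add: topspace_polygons)
    then show "sp c s z \<in> topspace (surface c)"
      unfolding sp_def to_surface_def surface_def topspace_quotient_topology by (rule quotientI)
  qed
qed

lemma sp_in_surface [simp]: "sheet s \<Longrightarrow> z \<in> Qplus c \<Longrightarrow> sp c s z \<in> topspace (surface c)"
  by (auto simp: topspace_surface)

lemma surface_cases:
  assumes "C \<in> topspace (surface c)" obtains s z where "sheet s" "z \<in> Qplus c" "C = sp c s z"
  using assms by (auto simp: topspace_surface)

lemma equiv_glue: "equiv UNIV (glue_equiv c)"
proof (rule equivI)
  show "sym (glue_equiv c)" unfolding glue_equiv_def by (intro sym_rtrancl sym_Un_converse)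
qed (auto simp: glue_equiv_def refl_rtrancl trans_rtrancl)

lemma to_surface_eq_iff: "to_surface c p = to_surface c q \<longleftrightarrow> (p, q) \<in> glue_equiv c"
  unfolding to_surface_def using eq_equiv_class_iff[OF equiv_glue] by auto

lemma glue_pair: "x \<in> edge c k \<Longrightarrow> ((1, x), (-1, - fold_edge c k x)) \<in> glue c"
  by (auto simp: glue_def fold_edge_def algebra_simps)

lemma sp_fold: assumes "z \<in> edge c k" "sheet s"
  shows "sp c (- s) (fold_edge c k z) = sp c s z"
proof -
  have 1: "sp c (-1) (fold_edge c k x) = sp c 1 x" if "x \<in> edge c k" for x
    unfolding sp_def to_surface_eq_iff glue_equiv_def
    using glue_pair[OF that] by (intro r_into_rtrancl) auto
  show ?thesis using 1[OF assms(1)] 1[OF fold_in_edge[OF assms(1)]] assms(2) by auto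
qed

definition glue_invariant :: "real \<Rightarrow> (real \<Rightarrow> real^2 \<Rightarrow> 'b) \<Rightarrow> bool" where
  "glue_invariant c \<phi> \<longleftrightarrow> (\<forall>k. \<forall>z\<in>edge c k. \<phi> 1 z = \<phi> (-1) (fold_edge c k z))"

text \<open>
  An arbitrary representative is chosen; for glue invariant \<open>\<phi>\<close> the choice does
  not matter.
\<close>

definition lift :: "(real \<Rightarrow> real^2 \<Rightarrow> 'b) \<Rightarrow> surface_point \<Rightarrow> 'b" where
  "lift \<phi> C = (case SOME p. p \<in> C of (s, x) \<Rightarrow> \<phi> s (s *\<^sub>R x))"

lemma lift_sp [simp]:
  assumes "glue_invariant c \<phi>" "sheet s"
  shows "lift \<phi> (sp c s z) = \<phi> s z"
proof -
  let ?f = "\<lambda>(s, x). \<phi> s (s *\<^sub>R x)"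
  have *: "?f p = ?f q" if "(p, q) \<in> glue_equiv c" for p q
    using that unfolding glue_equiv_def
  proof (induction rule: rtrancl_induct)
    case (step q r)
    have g: "?f a = ?f b" if "(a, b) \<in> glue c" for a b
    proof -
      obtain k x where "a = (1, x)" "b = (-1, x - P c k - P c (k + 1))" "x \<in> edge c k"
        using \<open>(a, b) \<in> glue c\<close> by (auto simp: glue_def)
      moreover have "- (x - P c k - P c (k + 1)) = fold_edge c k x" by (simp add: fold_edge_def)
      ultimately show ?thesis using assms(1) by (simp add: glue_invariant_def)
    qed
    have "(q, r) \<in> glue c \<or> (r, q) \<in> glue c" using step.hyps(2) by blast
    then have "?f q = ?f r" using g[of q r] g[of r q] by argo
    then show ?case using step.IH by argo
  qed (rule refl)
  have "(s, s *\<^sub>R z) \<in> sp c s z" by (simp add: sp_def to_surface_def glue_equiv_def)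
  then have "(SOME p. p \<in> sp c s z) \<in> sp c s z" by (rule someI)
  then have "((s, s *\<^sub>R z), SOME p. p \<in> sp c s z) \<in> glue_equiv c" by (simp add: sp_def to_surface_def)
  from *[OF this] show ?thesis using assms(2) by (simp add: lift_def)
qed

lemma quotient_map_to_surface: "quotient_map (polygons c) (surface c) (to_surface c)"
proof -
  have im: "to_surface c ` topspace (polygons c) = topspace (surface c)"
    by (auto simp: surface_def quotient_def to_surface_def)
  have "openin (polygons c) {x \<in> topspace (polygons c). to_surface c x \<in> U} \<longleftrightarrow> openin (surface c) U"
    if "U \<subseteq> topspace (surface c)" for U
    using that by (simp add: surface_def openin_quotient_topology to_surface_def)
  then show ?thesis unfolding quotient_map_def using im by blast
qed

lemma continuous_map_sum_topology:
  assumes "\<And>i. i \<in> I \<Longrightarrow> continuous_map (X i) Y (\<lambda>x. f (i, x))"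
  shows "continuous_map (sum_topology X I) Y f"
  unfolding continuous_map_def
proof (intro conjI allI impI)
  show "f \<in> topspace (sum_topology X I) \<rightarrow> topspace Y"
    using assms by (auto simp: continuous_map_def Pi_iff)
  fix U assume U: "openin Y U"
  show "openin (sum_topology X I) {x \<in> topspace (sum_topology X I). f x \<in> U}"
    unfolding openin_sum_topology
  proof (intro conjI ballI)
    fix i assume i: "i \<in> I"
    then have "openin (X i) {x \<in> topspace (X i). f (i, x) \<in> U}"
      using assms U by (auto simp: continuous_map_def)
    then show "openin (X i) {x. (i, x) \<in> {x \<in> topspace (sum_topology X I). f x \<in> U}}"
      using i by (simp add: conj_commute)
  qed auto
qed

lemma continuous_map_scale_sheet:
  "sheet s \<Longrightarrow> continuous_map (top_of_set ((*\<^sub>R) s ` Qplus c)) (top_of_set (Qplus c)) (\<lambda>x. s *\<^sub>R x)"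
  by (auto simp: continuous_map_in_subtopology intro!: continuous_intros)

lemma continuous_map_lift:
  assumes \<phi>: "glue_invariant c \<phi>"
    and cont: "\<And>s. sheet s \<Longrightarrow> continuous_map (top_of_set (Qplus c)) Y (\<phi> s)"
  shows "continuous_map (surface c) Y (lift \<phi>)"
proof (rule continuous_compose_quotient_map[OF quotient_map_to_surface])
  have "continuous_map (top_of_set ((*\<^sub>R) s ` Qplus c)) Y (\<lambda>x. (lift \<phi> \<circ> to_surface c) (s, x))"
    if s: "s \<in> {1, -1}" for s
  proof (rule continuous_map_eq)
    show "continuous_map (top_of_set ((*\<^sub>R) s ` Qplus c)) Y (\<phi> s \<circ> (\<lambda>x. s *\<^sub>R x))"
      using s by (intro continuous_map_compose[OF continuous_map_scale_sheet cont]) auto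
    fix x assume "x \<in> topspace (top_of_set ((*\<^sub>R) s ` Qplus c))"
    have "sp c s (s *\<^sub>R x) = to_surface c (s, x)" using s by (auto simp: sp_def)
    then show "(\<phi> s \<circ> (\<lambda>x. s *\<^sub>R x)) x = (lift \<phi> \<circ> to_surface c) (s, x)"
      using lift_sp[OF \<phi>, of s "s *\<^sub>R x"] s by auto
  qed
  then show "continuous_map (polygons c) Y (lift \<phi> \<circ> to_surface c)"
    unfolding polygons_def by (rule continuous_map_sum_topology)
qed

lemma continuous_map_sp:
  assumes "sheet s" shows "continuous_map (top_of_set (Qplus c)) (surface c) (sp c s)"
proof -
  have "continuous_map (top_of_set (Qplus c)) (polygons c) (Pair s \<circ> (\<lambda>z. s *\<^sub>R z))"
    unfolding polygons_def
  proof (rule continuous_map_compose)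
    show "continuous_map (top_of_set (Qplus c)) (top_of_set ((*\<^sub>R) s ` Qplus c)) (\<lambda>z. s *\<^sub>R z)"
      by (auto simp: continuous_map_in_subtopology intro!: continuous_intros)
    show "continuous_map (top_of_set ((*\<^sub>R) s ` Qplus c)) (sum_topology (\<lambda>s. top_of_set ((*\<^sub>R) s ` Qplus c)) {1, -1}) (Pair s)"
      using assms by (intro continuous_map_component_injection) auto
  qed
  then have "continuous_map (top_of_set (Qplus c)) (surface c) (to_surface c \<circ> (Pair s \<circ> (\<lambda>z. s *\<^sub>R z)))"
    by (rule continuous_map_compose[OF _ quotient_imp_continuous_map[OF quotient_map_to_surface]])
  moreover have "to_surface c \<circ> (Pair s \<circ> (\<lambda>z. s *\<^sub>R z)) = sp c s" by (simp add: sp_def fun_eq_iff)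
  ultimately show ?thesis by simp
qed

lemma fold_P: "fold_edge c k (P c k) = P c (k + 1)" "fold_edge c k (P c (k + 1)) = P c k"
  by (simp_all add: fold_edge_def)

lemma fold_vertex: "c \<ge> 1 \<Longrightarrow> z \<in> edge c k \<Longrightarrow> fold_edge c k z \<in> range (P c) \<longleftrightarrow> z \<in> range (P c)"
  by (metis edge_cases fold_P(1) fold_P(2) fold_in_open_edge open_edge_not_vertex rangeE rangeI)

section \<open>Fibres of the gluing\<close>

text \<open>
  Assigning to \<open>(s, z)\<close> the set of all pairs glued to it, and the empty set at the
  vertices, is glue invariant. It therefore descends to the surface, where it separates the
  fibres.
\<close>

lemma sp_eq_imp:
  assumes c: "c \<ge> 1" and z: "z \<notin> range (P c)" and s: "sheet s" "sheet s'" and eq: "sp c s z = sp c s' z'"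
  shows "(s' = s \<and> z' = z) \<or> (s' = - s \<and> (\<exists>k. z \<in> open_edge c k \<and> z' = fold_edge c k z))"
proof -
  define \<phi> where "\<phi> s z = (if z \<in> range (P c) then {} else {(s', z'). (s' = s \<and> z' = z) \<or> (s' = - s \<and> (\<exists>k. z \<in> open_edge c k \<and> z' = fold_edge c k z))})"
    for s :: real and z
  have "glue_invariant c \<phi>"
    unfolding glue_invariant_def
  proof (intro allI ballI)
    fix k z assume z: "z \<in> edge c k"
    show "\<phi> 1 z = \<phi> (-1) (fold_edge c k z)"
    proof (cases "z \<in> range (P c)")
      case True
      then show ?thesis using fold_vertex[OF c z] by (simp add: \<phi>_def)
    next
      case False
      then have o: "z \<in> open_edge c k" using z edge_cases by blast
      have "z \<in> open_edge c j \<longleftrightarrow> j = k" "fold_edge c k z \<in> open_edge c j \<longleftrightarrow> j = k" for j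
        using o fold_in_open_edge[OF o] edge_unique[OF c o, of j] edge_unique[OF c fold_in_open_edge[OF o], of j] mem_open_edge_iff by blast+
      then show ?thesis using False fold_vertex[OF c z] o fold_in_open_edge[OF o] unfolding \<phi>_def by auto
    qed
  qed
  then have "\<phi> s z = \<phi> s' z'" using lift_sp[of c \<phi>] s eq by metis
  moreover have "(s, z) \<in> \<phi> s z" using z by (simp add: \<phi>_def)
  ultimately have *: "(s, z) \<in> \<phi> s' z'" by simp
  then have "(s = s' \<and> z = z') \<or> (s = - s' \<and> (\<exists>k. z' \<in> open_edge c k \<and> z = fold_edge c k z'))"
    by (auto simp: \<phi>_def split: if_splits)
  then show ?thesis using fold_in_open_edge by fastforce
qed

lemma sp_interior_eq:
  assumes c: "c \<ge> 1" and z: "z \<in> interior (Qplus c)" and s: "sheet s" "sheet s'" and eq: "sp c s z = sp c s' z'"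
  shows "s' = s \<and> z' = z"
proof -
  have "z \<notin> open_edge c k" for k using interior_not_edge[OF c z] mem_open_edge_iff by blast
  moreover have "z \<notin> range (P c)" using interior_not_edge[OF c z] P_in_edge(1) by blast
  ultimately show ?thesis using sp_eq_imp[OF c _ s eq] by blast
qed

lemma interior_not_vertex: "c \<ge> 1 \<Longrightarrow> z \<in> interior (Qplus c) \<Longrightarrow> z \<notin> range (P c)"
  using interior_not_edge P_in_edge(1) by blast

lemma singularities_sp: "singularities c = {sp c s (P c k) | s k. sheet s}"
  by (auto simp: singularities_def sp_def)

lemma sp_singular_iff:
  assumes c: "c \<ge> 1" and "sheet s"
  shows "sp c s z \<in> singularities c \<longleftrightarrow> z \<in> range (P c)"
proof -
  have "glue_invariant c (\<lambda>s z. z \<in> range (P c))" using fold_vertex[OF c] by (auto simp: glue_invariant_def)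
  from lift_sp[OF this] show ?thesis using assms(2) unfolding singularities_sp by (auto; metis rangeI)
qed

section \<open>Functions that detect the singularities\<close>

lemma edge_row:
  assumes c: "c \<ge> 1" and z: "z \<in> edge c k"
  obtains m where "row_at c m \<le> height z" "height z \<le> row_at c (Suc m)"
    "height (P c k) + height (P c (k + 1)) = row_at c m + row_at c (Suc m)"
proof -
  obtain t where t: "0 \<le> t" "t \<le> 1" "height z = (1 - t) * height (P c k) + t * height (P c (k + 1))"
    using z by (auto simp: mem_edge)
  then have "height z \<in> closed_segment (height (P c k)) (height (P c (k + 1)))"
    by (auto simp: closed_segment_def)
  then have b: "min (height (P c k)) (height (P c (k + 1))) \<le> height z" "height z \<le> max (height (P c k)) (height (P c (k + 1)))"
    by (auto simp: closed_segment_eq_real_ivl split: if_splits)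
  have l: "row_at c n \<le> row_at c (Suc n)" for n using grid_le[OF grid_row[OF c]] by simp
  show ?thesis
  proof (cases "k \<ge> 0")
    case True
    define m where "m = nat k"
    have "k = int m" using True by (simp add: m_def)
    then have "height (P c k) = row_at c m" "height (P c (k + 1)) = row_at c (Suc m)"
      by (simp_all add: row_at_def add.commute)
    then show ?thesis using that[of m] b l[of m] by auto
  next
    case False
    define m where "m = nat (- k - 1)"
    have k: "k = - int m - 1" using False by (simp add: m_def)
    have "height (P c k) = row_at c (Suc m)" "height (P c (k + 1)) = row_at c m"
      unfolding k P_lower by simp_all
    then show ?thesis using that[of m] b l[of m] by auto
  qed
qed

lemma edge_col:
  assumes c: "c \<ge> 1" and z: "z \<in> edge c k" and "k \<noteq> 0"
  obtains n where "col_at c n \<le> skew z" "skew z \<le> col_at c (Suc n)"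
    "skew (P c k) + skew (P c (k + 1)) = col_at c n + col_at c (Suc n)"
proof -
  obtain t where t: "0 \<le> t" "t \<le> 1" "skew z = (1 - t) * skew (P c k) + t * skew (P c (k + 1))"
    using z by (auto simp: mem_edge)
  then have "skew z \<in> closed_segment (skew (P c k)) (skew (P c (k + 1)))"
    by (auto simp: closed_segment_def)
  then have b: "min (skew (P c k)) (skew (P c (k + 1))) \<le> skew z" "skew z \<le> max (skew (P c k)) (skew (P c (k + 1)))"
    by (auto simp: closed_segment_eq_real_ivl split: if_splits)
  have l: "col_at c n \<le> col_at c (Suc n)" for n using grid_le[OF grid_col[OF c]] by simp
  show ?thesis
  proof (cases "k > 0")
    case True
    define m where "m = nat (k - 1)"
    have k: "k = int m + 1" using True by (simp add: m_def)
    have "skew (P c k) = col_at c m" "skew (P c (k + 1)) = col_at c (Suc m)"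
      unfolding k P_upper by simp_all
    then show ?thesis using that[of m] b l[of m] by auto
  next
    case False
    define m where "m = nat (- k - 1)"
    have k: "k = - int m - 1" using False \<open>k \<noteq> 0\<close> by (simp add: m_def)
    have "skew (P c k) = col_at c (Suc m)" "skew (P c (k + 1)) = col_at c m"
      unfolding k P_lower by simp_all
    then show ?thesis using that[of m] b l[of m] by auto
  qed
qed

lemma gy_fold:
  assumes c: "c \<ge> 1" and z: "z \<in> edge c k"
  obtains m where "real m \<le> gy c z" "gy c z \<le> real (Suc m)" "gy c (fold_edge c k z) = 2 * real m + 1 - gy c z"
    "height (P c k) + height (P c (k + 1)) = row_at c m + row_at c (Suc m)"
proof -
  obtain m where m: "row_at c m \<le> height z" "height z \<le> row_at c (Suc m)"
    "height (P c k) + height (P c (k + 1)) = row_at c m + row_at c (Suc m)"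
    using edge_row[OF c z] .
  have "height (fold_edge c k z) = row_at c m + row_at c (Suc m) - height z"
    using m(3) by (simp add: fold_edge_def)
  then have "gy c (fold_edge c k z) = 2 * real m + 1 - gy c z"
    using interpolate_reflect[OF grid_row[OF c] m(1,2), of real] by (simp add: gy_def)
  then show ?thesis using that m gy_cell[OF c] by blast
qed

text \<open>
  Every edge other than edge 0 is a diagonal of a cell of the grid, and folding along it is the
  half turn of that cell.
\<close>

lemma gx_fold:
  assumes c: "c \<ge> 1" and z: "z \<in> edge c k" and k: "k \<noteq> 0"
  obtains m where "real m \<le> gx c z" "gx c z \<le> real (Suc m)" "gx c (fold_edge c k z) = 2 * real m + 1 - gx c z"
    "skew (P c k) + skew (P c (k + 1)) = col_at c m + col_at c (Suc m)"
proof -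
  obtain m where m: "col_at c m \<le> skew z" "skew z \<le> col_at c (Suc m)"
    "skew (P c k) + skew (P c (k + 1)) = col_at c m + col_at c (Suc m)"
    using edge_col[OF c z k] .
  have "skew (fold_edge c k z) = col_at c m + col_at c (Suc m) - skew z"
    using m(3) by (simp add: fold_edge_def)
  then have "gx c (fold_edge c k z) = 2 * real m + 1 - gx c z"
    using interpolate_reflect[OF grid_col[OF c] m(1,2), of real] by (simp add: gx_def)
  then show ?thesis using that m gx_cell[OF c] by blast
qed

lemma gx_fold_0:
  assumes c: "c \<ge> 1" and z: "z \<in> edge c 0"
  shows "gx c z = 0" "gx c (fold_edge c 0 z) = 0"
proof -
  have "gx c w = 0" if "w \<in> edge c 0" for w
    using that gx_nonneg[OF c, of w] gx_pos[OF c, of w] by (simp add: edge_0_iff)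
  then show "gx c z = 0" "gx c (fold_edge c 0 z) = 0" using z fold_in_edge[OF z] by auto
qed

lemma sin_odd_minus: "sin (pi * (2 * real m + 1 - x)) = sin (pi * x)"
  and cos_odd_minus: "cos (pi * (2 * real m + 1 - x)) = - cos (pi * x)"
proof -
  have e: "pi * (2 * real m + 1 - x) = (pi - pi * x) + 2 * real m * pi" by (simp add: algebra_simps)
  show "sin (pi * (2 * real m + 1 - x)) = sin (pi * x)" "cos (pi * (2 * real m + 1 - x)) = - cos (pi * x)"
    unfolding e by (simp_all add: sin_add cos_add)
qed

text \<open>
  The functions \<open>sin (\<pi> t)\<close> and \<open>cos (\<pi> t)\<close> are even and odd
  under the folding \<open>t \<mapsto> 2 m + 1 - t\<close>, and the sheet sign compensates
  the oddness, so all three descend to continuous functions on the surface. The first two detect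
  the slope one and the horizontal levels and vanish together only at the singularities; the third
  tells the two singularities apart.
\<close>

definition sinx where "sinx c = lift (\<lambda>s z. sin (pi * gx c z))"
definition siny where "siny c = lift (\<lambda>s z. sin (pi * gy c z))"
definition cosy where "cosy c = lift (\<lambda>s z. s * cos (pi * gy c z))"

lemma glue_invariant_sinx: "c \<ge> 1 \<Longrightarrow> glue_invariant c (\<lambda>s z. sin (pi * gx c z))"
  unfolding glue_invariant_def
proof (intro allI ballI)
  fix k z assume c: "c \<ge> 1" and z: "z \<in> edge c k"
  show "sin (pi * gx c z) = sin (pi * gx c (fold_edge c k z))"
  proof (cases "k = 0")
    case True
    then show ?thesis using gx_fold_0[OF c] z by simp
  next
    case False
    then show ?thesis by (metis gx_fold[OF c z] sin_odd_minus)
  qed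
qed

lemma glue_invariant_siny: "c \<ge> 1 \<Longrightarrow> glue_invariant c (\<lambda>s z. sin (pi * gy c z))"
  unfolding glue_invariant_def by (metis gy_fold sin_odd_minus)

lemma glue_invariant_cosy: "c \<ge> 1 \<Longrightarrow> glue_invariant c (\<lambda>s z. s * cos (pi * gy c z))"
  unfolding glue_invariant_def by (metis gy_fold cos_odd_minus mult_1 mult_minus1 minus_minus)

lemma sinx_sp: "c \<ge> 1 \<Longrightarrow> sheet s \<Longrightarrow> sinx c (sp c s z) = sin (pi * gx c z)"
  and siny_sp: "c \<ge> 1 \<Longrightarrow> sheet s \<Longrightarrow> siny c (sp c s z) = sin (pi * gy c z)"
  and cosy_sp: "c \<ge> 1 \<Longrightarrow> sheet s \<Longrightarrow> cosy c (sp c s z) = s * cos (pi * gy c z)"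
  unfolding sinx_def siny_def cosy_def
  using lift_sp[OF glue_invariant_sinx] lift_sp[OF glue_invariant_siny] lift_sp[OF glue_invariant_cosy] by blast+

lemma continuous_sinx: "c \<ge> 1 \<Longrightarrow> continuous_map (surface c) euclideanreal (sinx c)"
  and continuous_siny: "c \<ge> 1 \<Longrightarrow> continuous_map (surface c) euclideanreal (siny c)"
  and continuous_cosy: "c \<ge> 1 \<Longrightarrow> continuous_map (surface c) euclideanreal (cosy c)"
  unfolding sinx_def siny_def cosy_def
  by (auto intro!: continuous_map_lift glue_invariant_sinx glue_invariant_siny glue_invariant_cosy continuous_intros)

lemma sin_pi_eq_0: "sin (pi * x) = 0 \<longleftrightarrow> x \<in> \<int>"
  by (auto simp: sin_zero_iff_int2 Ints_def mult.commute)

lemma vertex_iff_lattice: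
  assumes c: "c \<ge> 1" and z: "z \<in> Qplus c"
  shows "z \<in> range (P c) \<longleftrightarrow> sin (pi * gx c z) = 0 \<and> sin (pi * gy c z) = 0"
proof
  assume "z \<in> range (P c)"
  then obtain k where k: "z = P c k" by blast
  have "gx c z \<in> \<int> \<and> gy c z \<in> \<int>"
    unfolding k by (cases k rule: int_cases_vertex)
      (simp_all add: P_neg P_pos gx_def gy_def interpolate_at grid_col grid_row c)
  then show "sin (pi * gx c z) = 0 \<and> sin (pi * gy c z) = 0" by (simp add: sin_pi_eq_0)
next
  assume "sin (pi * gx c z) = 0 \<and> sin (pi * gy c z) = 0"
  then obtain i j where ij: "gx c z = of_int i" "gy c z = of_int j" by (auto simp: sin_pi_eq_0 Ints_def)
  have *: "0 \<le> skew z" "gx c z \<le> gy c z" "gy c z \<le> gx c z + 1" using z by (auto simp: Qplus_iff[OF c])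
  define n where "n = nat i"
  have "0 \<le> gx c z" using gx_nonneg[OF c] * by simp
  then have n: "i = int n" using ij by (simp add: n_def)
  have "j = int n \<or> j = int n + 1" using * ij n by linarith
  then show "z \<in> range (P c)"
  proof
    assume j: "j = int n"
    then have "skew z = col_at c n" "height z = row_at c n"
      using ij n gx_cell(1)[OF c, of n z] gx_cell(2)[OF c, of z n] gy_cell(1)[OF c, of n z] gy_cell(2)[OF c, of z n] by simp_all
    then have "z = P c (- int n)" by (simp add: P_neg vec2_eq_iff)
    then show ?thesis by blast
  next
    assume j: "j = int n + 1"
    then have "skew z = col_at c n" "height z = row_at c (Suc n)"
      using ij n gx_cell(1)[OF c, of n z] gx_cell(2)[OF c, of z n] gy_cell(1)[OF c, of "Suc n" z] gy_cell(2)[OF c, of z "Suc n"] by simp_all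
    then have "z = P c (int n + 1)" by (simp add: P_pos vec2_eq_iff)
    then show ?thesis by blast
  qed
qed

lemma singular_iff_sin:
  assumes c: "c \<ge> 1" and C: "C \<in> topspace (surface c)"
  shows "C \<in> singularities c \<longleftrightarrow> sinx c C = 0 \<and> siny c C = 0"
  using C by (elim surface_cases) (simp add: sp_singular_iff[OF c] sinx_sp[OF c] siny_sp[OF c] vertex_iff_lattice[OF c])

lemma sp_P_step: "sheet s \<Longrightarrow> sp c (- s) (P c (k + 1)) = sp c s (P c k)"
  using sp_fold[OF P_in_edge(1), of s c k] by (simp add: fold_P)

text \<open>
  The gluing along edge \<open>k\<close> identifies vertex \<open>k\<close> on one sheet with
  vertex \<open>k + 1\<close> on the other, so there are only two singularities.
\<close>

lemma sp_P_parity: assumes "sheet s" shows "sp c s (P c k) = sp c (if even k then s else - s) 0"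
  using assms
proof (induction k arbitrary: s rule: int_induct[where k=0])
  case (step1 i)
  then show ?case using sp_P_step[of "-s" c i] step1(2)[of "- s"] by auto
next
  case (step2 i)
  then show ?case using sp_P_step[of "s" c "i - 1"] step2(2)[of "- s"] by auto
qed simp

lemma cosy_P: assumes c: "c \<ge> 1" and s: "sheet s" shows "cosy c (sp c s (P c k)) = (if even k then s else - s)"
proof -
  have "gy c 0 = 0" using interpolate_at[OF grid_row[OF c], of real 0] by (simp add: gy_def)
  then show ?thesis using s by (subst sp_P_parity[OF s]) (auto simp: cosy_sp[OF c])
qed

lemma singularity_eqI:
  assumes c: "c \<ge> 1" and "C \<in> singularities c" "D \<in> singularities c" "cosy c C = cosy c D"
  shows "C = D"
proof -
  obtain s k where s: "sheet s" "C = sp c s (P c k)" using assms by (auto simp: singularities_sp)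
  obtain s' k' where s': "sheet s'" "D = sp c s' (P c k')" using assms by (auto simp: singularities_sp)
  have "(if even k then s else - s) = (if even k' then s' else - s')"
    using assms(4) cosy_P[OF c] s s' by simp
  then show ?thesis using sp_P_parity[OF s(1)] sp_P_parity[OF s'(1)] s s' by simp
qed

section \<open>Charts and the rotation by \<open>\<pi>\<close>\<close>

lemma chart_param_sp: "chart_param c k z = (if z \<in> Qplus c then sp c 1 z else sp c (-1) (fold_edge c k z))"
proof -
  have "z - P c k - P c (k + 1) = - fold_edge c k z" by (simp add: fold_edge_def)
  then show ?thesis by (simp add: chart_param_def sp_def)
qed

text \<open>
  The rotation by \<open>\<pi>\<close> exchanges the two polygons and realizes the group element
  \<open>-I\<close>.
\<close>

definition rotation :: "real \<Rightarrow> surface_point \<Rightarrow> surface_point" where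
  "rotation c = lift (\<lambda>s z. sp c (- s) z)"

lemma glue_invariant_rotation: "glue_invariant c (\<lambda>s z. sp c (- s) z)"
  unfolding glue_invariant_def using sp_fold[of _ c _ "-1"] by simp

lemma rotation_sp [simp]: "sheet s \<Longrightarrow> rotation c (sp c s z) = sp c (- s) z"
  unfolding rotation_def using lift_sp[OF glue_invariant_rotation] by simp

lemma continuous_rotation: "continuous_map (surface c) (surface c) (rotation c)"
  unfolding rotation_def by (rule continuous_map_lift[OF glue_invariant_rotation]) (rule continuous_map_sp, auto)

lemma rotation_chart_param:
  assumes c: "c \<ge> 1" and z: "z \<in> chart_domain c k"
  shows "rotation c (chart_param c k z) = chart_param c k (fold_edge c k z)"
proof -
  consider "z \<in> interior (Qplus c)" | "z \<in> open_edge c k" | "fold_edge c k z \<in> interior (Qplus c)"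
    using z mem_chart_domain by blast
  then show ?thesis
  proof cases
    case 1
    then have "z \<in> Qplus c" "fold_edge c k z \<notin> Qplus c"
      using interior_subset fold_interior_not_Qplus[OF c, of k "fold_edge c k z"] by auto
    then show ?thesis by (simp add: chart_param_sp)
  next
    case 2
    then have "z \<in> Qplus c" "fold_edge c k z \<in> Qplus c" "z \<in> edge c k"
      using open_edge_in_Qplus fold_in_open_edge mem_open_edge_iff by blast+
    then show ?thesis using sp_fold[of z c k "-1"] by (simp add: chart_param_sp)
  next
    case 3
    then have "fold_edge c k z \<in> Qplus c" "z \<notin> Qplus c"
      using interior_subset fold_interior_not_Qplus[OF c] by auto
    then show ?thesis by (simp add: chart_param_sp)
  qed
qed

lemma fold_chart_domain: "z \<in> chart_domain c k \<Longrightarrow> fold_edge c k z \<in> chart_domain c k"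
  using fold_in_open_edge by (auto simp: mem_chart_domain)

section \<open>The surface as a quotient of two copies of the polygon\<close>

lemma continuous_map_sheets:
  assumes "\<And>s. sheet s \<Longrightarrow> continuous_map (top_of_set Q) Y (g s)"
  shows "continuous_map (top_of_set ({1, -1::real} \<times> Q)) Y (\<lambda>(s, z). g s z)"
  unfolding continuous_map_def
proof (intro conjI allI impI)
  show "(\<lambda>(s, z). g s z) \<in> topspace (top_of_set ({1, -1} \<times> Q)) \<rightarrow> topspace Y"
    using assms by (auto simp: continuous_map_def)
  fix U assume U: "openin Y U"
  have o: "openin (top_of_set {1, -1::real}) {s}" if "sheet s" for s
  proof -
    have "{s} = {1, -1} \<inter> ball s 1" using that by (auto simp: dist_real_def)
    then show ?thesis by (metis open_ball openin_open_Int)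
  qed
  have o2: "openin (top_of_set ({1, -1} \<times> Q)) ({s} \<times> {z \<in> Q. g s z \<in> U})" if "sheet s" for s
    using assms[OF that] U by (intro openin_Times o[OF that]) (auto simp: continuous_map_def)
  have "openin (top_of_set ({1, -1::real} \<times> Q)) (({1} \<times> {z \<in> Q. g 1 z \<in> U}) \<union> ({-1} \<times> {z \<in> Q. g (-1) z \<in> U}))"
    by (intro openin_Un o2) simp_all
  also have "({1::real} \<times> {z \<in> Q. g 1 z \<in> U}) \<union> ({-1} \<times> {z \<in> Q. g (-1) z \<in> U}) =
      {x \<in> topspace (top_of_set ({1, -1} \<times> Q)). (case x of (s, z) \<Rightarrow> g s z) \<in> U}" by auto
  finally show "openin (top_of_set ({1, -1} \<times> Q)) {x \<in> topspace (top_of_set ({1, -1} \<times> Q)). (case x of (s, z) \<Rightarrow> g s z) \<in> U}" .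
qed

lemma continuous_map_sp_pair:
  "continuous_map (top_of_set ({1, -1} \<times> Qplus c)) (surface c) (\<lambda>(s, z). sp c s z)"
  by (rule continuous_map_sheets) (rule continuous_map_sp)

text \<open>
  Homotopies are built on the two copies of the polygon and descend along this map, also after
  taking the product with a compact interval.
\<close>

lemma quotient_map_sp:
  "quotient_map (top_of_set ({1, -1} \<times> Qplus c)) (surface c) (\<lambda>(s, z). sp c s z)"
proof (rule quotient_map_from_composition[OF _ continuous_map_sp_pair])
  show "continuous_map (polygons c) (top_of_set ({1, -1} \<times> Qplus c)) (\<lambda>(s, x). (s, s *\<^sub>R x))"
    unfolding polygons_def
  proof (rule continuous_map_sum_topology)
    fix s :: real assume s: "s \<in> {1, -1}"
    have "s *\<^sub>R x \<in> Qplus c" if "x \<in> (*\<^sub>R) s ` Qplus c" for x using that s by auto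
    then show "continuous_map (top_of_set ((*\<^sub>R) s ` Qplus c)) (top_of_set ({1, -1} \<times> Qplus c))
        (\<lambda>x. case (s, x) of (s, x) \<Rightarrow> (s, s *\<^sub>R x))"
      using s by (auto simp: continuous_map_in_subtopology intro!: continuous_intros)
  qed
  show "quotient_map (polygons c) (surface c) ((\<lambda>(s, z). sp c s z) \<circ> (\<lambda>(s, x). (s, s *\<^sub>R x)))"
    by (rule quotient_map_eq[OF quotient_map_to_surface]) (auto simp: topspace_polygons sp_def)
qed

section \<open>Homotopy classes of paths between singularities\<close>

lemma homotopy_classI:
  assumes cont: "continuous_map (prod_topology (top_of_set {0..1::real}) (top_of_set {0..1::real})) (surface c) H"
    and 0: "\<And>t. t \<in> {0..1} \<Longrightarrow> H (0, t) = \<gamma> t" and 1: "\<And>t. t \<in> {0..1} \<Longrightarrow> H (1, t) = \<delta> t"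
    and ends: "\<And>r. r \<in> {0..1} \<Longrightarrow> H (r, 0) = \<gamma> 0" "\<And>r. r \<in> {0..1} \<Longrightarrow> H (r, 1) = \<gamma> 1"
    and ns: "\<And>r t. r \<in> {0..1} \<Longrightarrow> t \<in> {0<..<1} \<Longrightarrow> H (r, t) \<notin> singularities c"
  shows "\<delta> \<in> homotopy_class c \<gamma>"
  unfolding homotopy_class_def mem_Collect_eq
proof (subst homotopic_with)
  fix h k :: "real \<Rightarrow> surface_point"
  assume "\<And>x. x \<in> topspace (top_of_set {0..1}) \<Longrightarrow> h x = k x"
  then have "h 0 = k 0" "h 1 = k 1" "\<forall>t\<in>{0<..<1}. h t = k t" by auto
  then show "(h 0 = \<gamma> 0 \<and> h 1 = \<gamma> 1 \<and> (\<forall>t\<in>{0<..<1}. h t \<notin> singularities c)) \<longleftrightarrow>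
      (k 0 = \<gamma> 0 \<and> k 1 = \<gamma> 1 \<and> (\<forall>t\<in>{0<..<1}. k t \<notin> singularities c))" by simp
next
  show "\<exists>h. continuous_map (prod_topology (top_of_set {0..1::real}) (top_of_set {0..1::real})) (surface c) h \<and>
        (\<forall>x\<in>topspace (top_of_set {0..1}). h (0, x) = \<gamma> x) \<and>
        (\<forall>x\<in>topspace (top_of_set {0..1}). h (1, x) = \<delta> x) \<and>
        (\<forall>t\<in>{0..1}. h (t, 0) = \<gamma> 0 \<and> h (t, 1) = \<gamma> 1 \<and> (\<forall>ta\<in>{0<..<1}. h (t, ta) \<notin> singularities c))"
    by (intro exI[of _ H] conjI ballI cont) (simp_all add: 0 1 ends ns)
qed

lemma homotopy_class_endpoints:
  assumes "\<delta> \<in> homotopy_class c \<gamma>"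
  shows "\<delta> 0 = \<gamma> 0" "\<delta> 1 = \<gamma> 1" "\<And>t. t \<in> {0<..<1} \<Longrightarrow> \<delta> t \<notin> singularities c"
    "\<And>t. t \<in> {0<..<1} \<Longrightarrow> \<gamma> t \<notin> singularities c"
  using homotopic_with_imp_property[OF assms[unfolded homotopy_class_def mem_Collect_eq]] by simp_all

lemma homotopy_class_trans:
  assumes "\<delta> \<in> homotopy_class c \<gamma>" "\<eta> \<in> homotopy_class c \<delta>" shows "\<eta> \<in> homotopy_class c \<gamma>"
  using assms homotopy_class_endpoints[OF assms(1)] unfolding homotopy_class_def mem_Collect_eq
  by (auto intro: homotopic_with_trans)

text \<open>
  Saddle connections without the condition of being straight.
\<close>

definition singular_arc :: "real \<Rightarrow> (real \<Rightarrow> surface_point) \<Rightarrow> bool" where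
  "singular_arc c \<gamma> \<longleftrightarrow> pathin (surface c) \<gamma> \<and> \<gamma> 0 \<in> singularities c \<and> \<gamma> 1 \<in> singularities c \<and>
     (\<forall>t\<in>{0<..<1}. \<gamma> t \<notin> singularities c)"

lemma homotopy_class_eq_on:
  assumes "singular_arc c \<gamma>" "\<And>t. t \<in> {0..1} \<Longrightarrow> \<delta> t = \<gamma> t"
  shows "\<delta> \<in> homotopy_class c \<gamma>"
  using assms unfolding homotopy_class_def mem_Collect_eq singular_arc_def pathin_def
  by (intro homotopic_with_equal) auto

lemma homotopy_class_map:
  assumes "\<delta> \<in> homotopy_class c \<gamma>" and cont: "continuous_map (surface c) (surface d) \<Phi>"
    and ns: "\<And>C. C \<in> topspace (surface c) \<Longrightarrow> \<Phi> C \<in> singularities d \<Longrightarrow> C \<in> singularities c"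
  shows "\<Phi> \<circ> \<delta> \<in> homotopy_class d (\<Phi> \<circ> \<gamma>)"
proof -
  obtain H where H: "continuous_map (prod_topology (top_of_set {0..1::real}) (top_of_set {0..1::real})) (surface c) H"
    "\<forall>x. H (0, x) = \<gamma> x" "\<forall>x. H (1, x) = \<delta> x"
    "\<forall>t\<in>{0..1}. H (t, 0) = \<gamma> 0 \<and> H (t, 1) = \<gamma> 1 \<and> (\<forall>x\<in>{0<..<1}. H (t, x) \<notin> singularities c)"
    using assms(1) unfolding homotopy_class_def homotopic_with_def by auto
  show ?thesis
  proof (rule homotopy_classI)
    show "continuous_map (prod_topology (top_of_set {0..1}) (top_of_set {0..1})) (surface d) (\<Phi> \<circ> H)"
      by (rule continuous_map_compose[OF H(1) cont])
    show "(\<Phi> \<circ> H) (r, t) \<notin> singularities d" if "r \<in> {0..1}" "t \<in> {0<..<1}" for r t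
    proof -
      have "H (r, t) \<in> topspace (surface c)"
        using continuous_map_funspace[OF H(1)] that by (auto simp: Pi_iff)
      then show ?thesis using ns[of "H (r, t)"] H(4) that by auto
    qed
  qed (use H in auto)
qed

lemma singular_arc_map:
  assumes "singular_arc c \<gamma>" and cont: "continuous_map (surface c) (surface d) \<Phi>"
    and ns: "\<And>C. C \<in> topspace (surface c) \<Longrightarrow> \<Phi> C \<in> singularities d \<longleftrightarrow> C \<in> singularities c"
  shows "singular_arc d (\<Phi> \<circ> \<gamma>)"
proof -
  have "\<gamma> t \<in> topspace (surface c)" if "t \<in> {0..1}" for t
    using assms(1) that unfolding singular_arc_def pathin_def by (auto simp: continuous_map_def)
  then show ?thesis
    using assms(1) ns continuous_map_compose[OF _ cont] unfolding singular_arc_def pathin_def by auto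
qed

section \<open>Maps of polygons and the induced maps of surfaces\<close>

text \<open>
  The maps of polygons that respect the gluings: edges go affinely to edges, the vertex indices
  transform by \<open>k \<mapsto> e k + m\<close>, and only vertices go to vertices. For
  \<open>e = -1\<close> the order of the edges is reversed.
\<close>

definition polygon_map :: "real \<Rightarrow> real \<Rightarrow> int \<Rightarrow> int \<Rightarrow> (real^2 \<Rightarrow> real^2) \<Rightarrow> bool" where
  "polygon_map c d e m f \<longleftrightarrow> (e = 1 \<or> e = -1) \<and> continuous_on (Qplus c) f \<and> f ` Qplus c \<subseteq> Qplus d \<and>
     (\<forall>k. \<forall>t\<in>{0..1}. f ((1 - t) *\<^sub>R P c k + t *\<^sub>R P c (k + 1)) =
        (1 - t) *\<^sub>R P d (e * k + m) + t *\<^sub>R P d (e * (k + 1) + m)) \<and>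
     (\<forall>z\<in>Qplus c. f z \<in> range (P d) \<longrightarrow> z \<in> range (P c))"

lemma polygon_map_P: "polygon_map c d e m f \<Longrightarrow> f (P c k) = P d (e * k + m)"
  unfolding polygon_map_def by (drule conjunct2, drule conjunct2, drule conjunct2, drule conjunct1,
      drule spec[of _ k], drule bspec[of _ _ 0]) auto

lemma polygon_map_vertex: "polygon_map c d e m f \<Longrightarrow> z \<in> Qplus c \<Longrightarrow> f z \<in> range (P d) \<longleftrightarrow> z \<in> range (P c)"
  using polygon_map_P unfolding polygon_map_def by blast

lemma polygon_map_Q: "polygon_map c d e m f \<Longrightarrow> z \<in> Qplus c \<Longrightarrow> f z \<in> Qplus d"
  by (auto simp: polygon_map_def)

text \<open>
  Edges are named after their lower vertex index, which for \<open>e = -1\<close> is the image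
  of \<open>k + 1\<close>.
\<close>

definition edge_index :: "int \<Rightarrow> int \<Rightarrow> int \<Rightarrow> int" where
  "edge_index e m k = (if e = 1 then k + m else m - k - 1)"

lemma edge_image:
  assumes "e = 1 \<or> e = -1"
  and f: "\<And>t. 0 \<le> t \<Longrightarrow> t \<le> 1 \<Longrightarrow> f ((1 - t) *\<^sub>R P c k + t *\<^sub>R P c (k + 1)) = (1 - t) *\<^sub>R P d (e * k + m) + t *\<^sub>R P d (e * (k + 1) + m)"
  and z: "z \<in> edge c k"
  shows "f z \<in> edge d (edge_index e m k)" "f (fold_edge c k z) = fold_edge d (edge_index e m k) (f z)"
proof -
  obtain t where t: "0 \<le> t" "t \<le> 1" "z = (1 - t) *\<^sub>R P c k + t *\<^sub>R P c (k + 1)" using z by (auto simp: mem_edge)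
  have fz: "f z = (1 - t) *\<^sub>R P d (e * k + m) + t *\<^sub>R P d (e * (k + 1) + m)" using f t by simp
  have "fold_edge c k z = (1 - (1 - t)) *\<^sub>R P c k + (1 - t) *\<^sub>R P c (k + 1)"
    by (simp add: fold_edge_def t algebra_simps)
  then have ff: "f (fold_edge c k z) = t *\<^sub>R P d (e * k + m) + (1 - t) *\<^sub>R P d (e * (k + 1) + m)"
    using f[of "1 - t"] t by simp
  have "f z \<in> edge d (edge_index e m k) \<and> f (fold_edge c k z) = fold_edge d (edge_index e m k) (f z)"
  proof (cases "e = 1")
    case True
    have "f z \<in> edge d (k + m)" unfolding mem_edge fz using t True by (intro exI[of _ t]) (simp add: algebra_simps)
    then show ?thesis using True unfolding ff fz by (simp add: edge_index_def fold_edge_def algebra_simps)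
  next
    case False
    then have e: "e = -1" using assms by simp
    have "f z \<in> edge d (m - k - 1)" unfolding mem_edge fz using t e by (intro exI[of _ "1 - t"]) (simp add: algebra_simps)
    then show ?thesis using e unfolding ff fz by (simp add: edge_index_def fold_edge_def algebra_simps)
  qed
  then show "f z \<in> edge d (edge_index e m k)" "f (fold_edge c k z) = fold_edge d (edge_index e m k) (f z)" by blast+
qed

lemma polygon_map_edge:
  assumes "polygon_map c d e m f" "z \<in> edge c k"
  shows "f z \<in> edge d (edge_index e m k)" "f (fold_edge c k z) = fold_edge d (edge_index e m k) (f z)"
  using edge_image[of e f c k d m z] assms unfolding polygon_map_def by auto

definition surface_map :: "real \<Rightarrow> real \<Rightarrow> (real^2 \<Rightarrow> real^2) \<Rightarrow> surface_point \<Rightarrow> surface_point" where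
  "surface_map c d f = lift (\<lambda>s z. sp d s (f z))"

lemma glue_invariant_surface_map: "polygon_map c d e m f \<Longrightarrow> glue_invariant c (\<lambda>s z. sp d s (f z))"
  unfolding glue_invariant_def using polygon_map_edge sp_fold[of _ d _ 1] by metis

lemma surface_map_sp: "polygon_map c d e m f \<Longrightarrow> sheet s \<Longrightarrow> surface_map c d f (sp c s z) = sp d s (f z)"
  unfolding surface_map_def by (rule lift_sp[OF glue_invariant_surface_map])

lemma continuous_surface_map: assumes "polygon_map c d e m f" shows "continuous_map (surface c) (surface d) (surface_map c d f)"
  unfolding surface_map_def
proof (rule continuous_map_lift[OF glue_invariant_surface_map[OF assms]])
  fix s :: real assume s: "sheet s"
  have "continuous_map (top_of_set (Qplus c)) (top_of_set (Qplus d)) f"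
    using assms by (auto simp: polygon_map_def continuous_map_in_subtopology)
  from continuous_map_compose[OF this continuous_map_sp[OF s]]
  show "continuous_map (top_of_set (Qplus c)) (surface d) (\<lambda>z. sp d s (f z))" by (simp add: o_def)
qed

lemma surface_map_singular:
  assumes c: "c \<ge> 1" "d \<ge> 1" and f: "polygon_map c d e m f" and C: "C \<in> topspace (surface c)"
  shows "surface_map c d f C \<in> singularities d \<longleftrightarrow> C \<in> singularities c"
  using C by (elim surface_cases) (simp add: surface_map_sp[OF f] sp_singular_iff c polygon_map_vertex[OF f])

lemma polygon_map_compose:
  assumes f: "polygon_map c d e m f" and g: "polygon_map d b e' m' g"
  shows "polygon_map c b (e' * e) (e' * m + m') (g \<circ> f)"
  unfolding polygon_map_def
proof (intro conjI allI ballI impI)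
  show "continuous_on (Qplus c) (g \<circ> f)"
  proof (rule continuous_on_compose)
    show "continuous_on (Qplus c) f" using f by (simp add: polygon_map_def)
    show "continuous_on (f ` Qplus c) g" using f g by (auto simp: polygon_map_def elim: continuous_on_subset)
  qed
  fix k :: int and t :: real assume t: "t \<in> {0..1}"
  have fk: "f ((1 - t) *\<^sub>R P c k + t *\<^sub>R P c (k + 1)) = (1 - t) *\<^sub>R P d (e * k + m) + t *\<^sub>R P d (e * (k + 1) + m)"
    using f t by (auto simp: polygon_map_def)
  have gk: "g ((1 - t) *\<^sub>R P d i + t *\<^sub>R P d (i + 1)) = (1 - t) *\<^sub>R P b (e' * i + m') + t *\<^sub>R P b (e' * (i + 1) + m')"
    if "t \<in> {0..1}" for i t using g that by (auto simp: polygon_map_def)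
  show "(g \<circ> f) ((1 - t) *\<^sub>R P c k + t *\<^sub>R P c (k + 1)) =
    (1 - t) *\<^sub>R P b (e' * e * k + (e' * m + m')) + t *\<^sub>R P b (e' * e * (k + 1) + (e' * m + m'))"
  proof (cases "e = 1")
    case True
    then have idx: "e * k + m = k + m" "e * (k + 1) + m = (k + m) + 1"
      "e' * e * k + (e' * m + m') = e' * (k + m) + m'"
      "e' * e * (k + 1) + (e' * m + m') = e' * (k + m + 1) + m'" by (simp_all add: algebra_simps)
    show ?thesis unfolding o_apply fk unfolding idx by (rule gk[OF t])
  next
    case False
    then have e: "e = -1" using f by (auto simp: polygon_map_def)
    have t': "1 - t \<in> {0..1}" using t by auto
    have idx: "e * k + m = (m - k - 1) + 1" "e * (k + 1) + m = m - k - 1"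
      "e' * e * k + (e' * m + m') = e' * (m - k - 1 + 1) + m'"
      "e' * e * (k + 1) + (e' * m + m') = e' * (m - k - 1) + m'" using e by (simp_all add: algebra_simps)
    show ?thesis unfolding o_apply fk unfolding idx using gk[OF t', of "m - k - 1"] by (simp add: add.commute)
  qed
next
  fix z assume "z \<in> Qplus c" "(g \<circ> f) z \<in> range (P b)"
  then show "z \<in> range (P c)" using f g unfolding polygon_map_def by (auto simp: image_subset_iff)
qed (use f g in \<open>auto simp: polygon_map_def\<close>)

lemma polygon_map_id: "polygon_map c c 1 0 (\<lambda>z. z)" by (auto simp: polygon_map_def)

lemma surface_map_compose:
  assumes f: "polygon_map c d e m f" and g: "polygon_map d b e' m' g" and C: "C \<in> topspace (surface c)"
  shows "surface_map d b g (surface_map c d f C) = surface_map c b (g \<circ> f) C"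
  using C by (elim surface_cases) (simp add: surface_map_sp[OF f] surface_map_sp[OF g] surface_map_sp[OF polygon_map_compose[OF f g]])

text \<open>
  Vertices are extreme points of the polygon.
\<close>

lemma convex_combination_vertex:
  assumes c: "c \<ge> 1" and x: "x \<in> Qplus c" and y: "y \<in> Qplus c" and t: "0 < t" "t < 1"
    and v: "(1 - t) *\<^sub>R x + t *\<^sub>R y = P c k"
  shows "x = P c k"
proof -
  have s: "side c i x = 0" if "i = k \<or> i = k - 1" for i
  proof -
    have "side c i (P c k) = 0" using that side_P_zero[OF c] by auto
    then have "(1 - t) * side c i x + t * side c i y = 0" unfolding v[symmetric] side_affine .
    moreover have "(1 - t) * side c i x \<ge> 0" "t * side c i y \<ge> 0"
      using t Qplus_side[OF c x] Qplus_side[OF c y] by auto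
    ultimately have "(1 - t) * side c i x = 0" by linarith
    then show ?thesis using t by simp
  qed
  then have x: "x \<in> edge c k" "x \<in> edge c (k - 1)" using x by (simp_all add: edge_iff_side[OF c])
  have "x \<notin> open_edge c k" using edge_unique[OF c _ x(2), of k] by auto
  moreover have "x \<noteq> P c (k + 1)" using s[of "k - 1"] side_P_zero[OF c, of "k - 1" "k + 1"] by auto
  ultimately show ?thesis using edge_cases[OF x(1)] by blast
qed

lemma polygon_map_line:
  assumes d: "d \<ge> 1" and f: "polygon_map c d e m f" and g: "polygon_map c d e m g" and r: "r \<in> {0..1}"
  shows "polygon_map c d e m (\<lambda>z. (1 - r) *\<^sub>R f z + r *\<^sub>R g z)"
  unfolding polygon_map_def
proof (intro conjI allI ballI impI)
  show "continuous_on (Qplus c) (\<lambda>z. (1 - r) *\<^sub>R f z + r *\<^sub>R g z)"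
    using f g unfolding polygon_map_def by (intro continuous_intros) auto
  show "(\<lambda>z. (1 - r) *\<^sub>R f z + r *\<^sub>R g z) ` Qplus c \<subseteq> Qplus d"
    using polygon_map_Q[OF f] polygon_map_Q[OF g] r convexD_alt[OF convex_Qplus] by auto
  fix z assume z: "z \<in> Qplus c" and *: "(1 - r) *\<^sub>R f z + r *\<^sub>R g z \<in> range (P d)"
  then obtain k where k: "(1 - r) *\<^sub>R f z + r *\<^sub>R g z = P d k" by auto
  show "z \<in> range (P c)"
  proof (cases "r = 0 \<or> r = 1")
    case True
    then show ?thesis using * polygon_map_vertex[OF f z] polygon_map_vertex[OF g z] by auto
  next
    case False
    then have "f z = P d k"
      using r k by (intro convex_combination_vertex[OF d polygon_map_Q[OF f z] polygon_map_Q[OF g z], of r]) auto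
    then show ?thesis using polygon_map_vertex[OF f z] by auto
  qed
next
  fix k t assume t: "t \<in> {0..1::real}"
  let ?z = "(1 - t) *\<^sub>R P c k + t *\<^sub>R P c (k + 1)"
  let ?w = "(1 - t) *\<^sub>R P d (e * k + m) + t *\<^sub>R P d (e * (k + 1) + m)"
  have fg: "f ?z = ?w" "g ?z = ?w" using f g t by (auto simp: polygon_map_def)
  show "(1 - r) *\<^sub>R f ?z + r *\<^sub>R g ?z = ?w" unfolding fg by (simp flip: scaleR_add_left)
qed (use f in \<open>auto simp: polygon_map_def\<close>)

text \<open>
  Two polygon maps with the same action on vertices agree on all edges. The straight line homotopy
  between them stays in the convex polygon, respects the gluings, and meets no vertex except where
  both maps do, because vertices are extreme points.
\<close>

lemma surface_map_homotopic:
  assumes c: "c \<ge> 1" and d: "d \<ge> 1" and f: "polygon_map c d e m f" and g: "polygon_map c d e m g" and \<gamma>: "singular_arc c \<gamma>"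
  shows "surface_map c d g \<circ> \<gamma> \<in> homotopy_class d (surface_map c d f \<circ> \<gamma>)"
proof -
  let ?h = "\<lambda>r z. (1 - r) *\<^sub>R f z + r *\<^sub>R g z"
  let ?I = "top_of_set {0..1::real}"
  have h: "polygon_map c d e m (?h r)" if "r \<in> {0..1}" for r using polygon_map_line[OF d f g that] .
  have cont: "continuous_map (prod_topology ?I (surface c)) (surface d) (\<lambda>(r, C). surface_map c d (?h r) C)"
  proof (rule continuous_compose_quotient_map)
    have "locally_compact_space ?I"
      by (simp add: compact_imp_locally_compact_space compact_space_subtopology)
    then show "quotient_map (prod_topology ?I (top_of_set ({1, -1} \<times> Qplus c))) (prod_topology ?I (surface c)) (\<lambda>(r, p). (r, (\<lambda>(s, z). sp c s z) p))"
      by (rule quotient_map_prod_right[OF _ _ quotient_map_sp]) (simp add: Hausdorff_space_subtopology)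
    have fg: "continuous_on (Qplus c) f" "continuous_on (Qplus c) g" using f g by (auto simp: polygon_map_def)
    let ?S = "{0..1::real} \<times> ({1, -1::real} \<times> Qplus c)"
    have z: "continuous_on ?S (\<lambda>x. snd (snd x))" by (intro continuous_intros)
    have "continuous_on ?S (\<lambda>x. f (snd (snd x)))" "continuous_on ?S (\<lambda>x. g (snd (snd x)))"
      by (rule continuous_on_compose2[OF fg(1) z], force, rule continuous_on_compose2[OF fg(2) z], force)
    then have "continuous_on ?S (\<lambda>x. (fst (snd x), (1 - fst x) *\<^sub>R f (snd (snd x)) + fst x *\<^sub>R g (snd (snd x))))"
      by (intro continuous_on_Pair continuous_on_add continuous_on_scaleR continuous_on_diff continuous_on_const
          continuous_on_fst continuous_on_snd continuous_on_id)
    then have "continuous_on ?S (\<lambda>(r, (s, z)). (s, ?h r z))" by (simp add: case_prod_unfold)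
    then have "continuous_map (top_of_set ({0..1} \<times> ({1, -1::real} \<times> Qplus c))) (top_of_set ({1, -1} \<times> Qplus d)) (\<lambda>(r, (s, z)). (s, ?h r z))"
      using polygon_map_Q[OF h] by (auto simp: continuous_map_in_subtopology)
    from continuous_map_compose[OF this continuous_map_sp_pair]
    show "continuous_map (prod_topology ?I (top_of_set ({1, -1} \<times> Qplus c))) (surface d)
        ((\<lambda>(r, C). surface_map c d (?h r) C) \<circ> (\<lambda>(r, p). (r, (\<lambda>(s, z). sp c s z) p)))"
      unfolding Product_Topology.prod_topology_subtopology_eu
      by (rule continuous_map_eq) (auto simp: surface_map_sp[OF h])
  qed
  have \<gamma>c: "continuous_map ?I (surface c) \<gamma>" and \<gamma>s: "\<And>t. t \<in> {0..1} \<Longrightarrow> \<gamma> t \<in> topspace (surface c)"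
    using \<gamma> unfolding singular_arc_def pathin_def by (auto simp: continuous_map_def)
  have at_sing: "surface_map c d (?h r) C = surface_map c d f C" if "r \<in> {0..1}" "C \<in> singularities c" for r C
  proof -
    obtain s k where sk: "sheet s" "C = sp c s (P c k)" using \<open>C \<in> singularities c\<close> by (auto simp: singularities_sp)
    have "?h r (P c k) = f (P c k)" using polygon_map_P[OF h[OF that(1)], of k] polygon_map_P[OF f, of k] by simp
    then show ?thesis unfolding sk(2) surface_map_sp[OF h[OF that(1)] sk(1)] surface_map_sp[OF f sk(1)] by simp
  qed
  show ?thesis
  proof (rule homotopy_classI)
    have "continuous_map (prod_topology ?I ?I) (prod_topology ?I (surface c)) (\<lambda>(r, t). (r, \<gamma> t))"
      using \<gamma>c continuous_map_prod_top[of ?I ?I ?I "surface c" "\<lambda>r. r" \<gamma>] by simp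
    from continuous_map_compose[OF this cont]
    show "continuous_map (prod_topology ?I ?I) (surface d) (\<lambda>(r, t). surface_map c d (?h r) (\<gamma> t))"
      by (simp add: o_def case_prod_unfold)
    show "(case (r, t) of (r, t) \<Rightarrow> surface_map c d (?h r) (\<gamma> t)) \<notin> singularities d" if "r \<in> {0..1}" "t \<in> {0<..<1}" for r t
      using \<gamma> surface_map_singular[OF c d h[OF that(1)] \<gamma>s, of t] that unfolding singular_arc_def by auto
    show "(case (r, 0) of (r, t) \<Rightarrow> surface_map c d (?h r) (\<gamma> t)) = (surface_map c d f \<circ> \<gamma>) 0"
      "(case (r, 1) of (r, t) \<Rightarrow> surface_map c d (?h r) (\<gamma> t)) = (surface_map c d f \<circ> \<gamma>) 1" if "r \<in> {0..1}" for r
      using at_sing[OF that] \<gamma> unfolding singular_arc_def by auto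
  qed simp_all
qed

section \<open>The grid map between two polygons\<close>

text \<open>
  The identity in lattice coordinates: it takes each cell of the grid of \<open>c\<close> affinely
  to the corresponding cell of the grid of \<open>d\<close>.
\<close>

definition grid_map :: "real \<Rightarrow> real \<Rightarrow> real^2 \<Rightarrow> real^2" where
  "grid_map c d z = pt (interpolate (col_at c) (col_at d) (skew z)) (interpolate (row_at c) (row_at d) (height z))"

lemma interpolate_affine:
  assumes a: "grid a" and t: "0 \<le> t" "t \<le> 1"
  shows "interpolate a b ((1 - t) * a n + t * a (Suc n)) = (1 - t) * b n + t * b (Suc n)"
    "interpolate a b ((1 - t) * a (Suc n) + t * a n) = (1 - t) * b (Suc n) + t * b n"
proof -
  have l: "a n < a (Suc n)" using grid_less[OF a] by simp
  have *: "interpolate a b ((1 - t) * a n + t * a (Suc n)) = (1 - t) * b n + t * b (Suc n)" if t: "0 \<le> t" "t \<le> 1" for t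
  proof -
    have e: "(1 - t) * a n + t * a (Suc n) = a n + t * (a (Suc n) - a n)" by (simp add: algebra_simps)
    have "0 \<le> t * (a (Suc n) - a n)" "t * (a (Suc n) - a n) \<le> a (Suc n) - a n"
      using t l by (auto intro: mult_left_le_one_le)
    then have "interpolate a b (a n + t * (a (Suc n) - a n)) = b n + (a n + t * (a (Suc n) - a n) - a n) * (b (Suc n) - b n) / (a (Suc n) - a n)"
      by (intro interpolate_cell[OF a]) auto
    also have "\<dots> = b n + t * (b (Suc n) - b n)" using l by simp
    finally show ?thesis unfolding e by (simp add: algebra_simps)
  qed
  show "interpolate a b ((1 - t) * a n + t * a (Suc n)) = (1 - t) * b n + t * b (Suc n)" using *[OF t] .
  show "interpolate a b ((1 - t) * a (Suc n) + t * a n) = (1 - t) * b (Suc n) + t * b n"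
    using *[of "1 - t"] t by (simp add: add.commute)
qed

context fixes c d :: real assumes c: "c \<ge> 1" and d: "d \<ge> 1" begin

lemma gx_grid_map [simp]: "gx d (grid_map c d z) = gx c z" and gy_grid_map [simp]: "gy d (grid_map c d z) = gy c z"
  by (simp_all add: gx_def gy_def grid_map_def interpolate_interpolate grid_col grid_row c d)

lemma grid_map_Q: "grid_map c d z \<in> Qplus d \<longleftrightarrow> z \<in> Qplus c"
  by (simp add: Qplus_iff c d) (metis c d gx_grid_map gx_nonneg)

lemma polygon_map_grid_map: "polygon_map c d 1 0 (grid_map c d)"
  unfolding polygon_map_def
proof (intro conjI allI ballI impI)
  show "continuous_on (Qplus c) (grid_map c d)"
    unfolding grid_map_def by (intro continuous_intros grid_col grid_row c d)
  show "grid_map c d ` Qplus c \<subseteq> Qplus d" using grid_map_Q by auto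
  fix k and t :: real assume "t \<in> {0..1}"
  then have t: "0 \<le> t" "t \<le> 1" by auto
  show "grid_map c d ((1 - t) *\<^sub>R P c k + t *\<^sub>R P c (k + 1)) =
      (1 - t) *\<^sub>R P d (1 * k + 0) + t *\<^sub>R P d (1 * (k + 1) + 0)"
  proof -
    consider "k = 0" | n where "k = int n + 1" | n where "k = - int n - 1"
    proof -
      show ?thesis
        using that(1) that(2)[of "nat (k - 1)"] that(3)[of "nat (- k - 1)"] by linarith
    qed
    then show ?thesis
    proof cases
      case 1
      have P1: "P b 1 = pt 0 1" for b using P_pos[of b 0] by simp
      have z: "interpolate (col_at c) (col_at d) 0 = 0" using interpolate_at[OF grid_col[OF c], of "col_at d" 0] by simp
      have "interpolate (row_at c) (row_at d) t = t"
        using interpolate_affine(1)[OF grid_row[OF c] t, of "row_at d" 0] by simp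
      then show ?thesis using 1 z by (simp add: grid_map_def P1 vec2_eq_iff)
    next
      case (2 n)
      show ?thesis unfolding 2 mult_1 add_0_right P_upper grid_map_def
        by (simp add: vec2_eq_iff interpolate_affine[OF grid_col[OF c] t] interpolate_affine[OF grid_row[OF c] t])
    next
      case (3 n)
      show ?thesis unfolding 3 mult_1 add_0_right P_lower grid_map_def
        by (simp add: vec2_eq_iff interpolate_affine[OF grid_col[OF c] t] interpolate_affine[OF grid_row[OF c] t])
    qed
  qed
next
  fix z assume z: "z \<in> Qplus c" "grid_map c d z \<in> range (P d)"
  then show "z \<in> range (P c)"
    using vertex_iff_lattice[OF d, of "grid_map c d z"] vertex_iff_lattice[OF c z(1)] by (simp add: grid_map_Q)
qed simp

end

section \<open>Affine symmetries of the polygon\<close>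

text \<open>
  Two reflections that preserve the polygon: \<open>move_A\<close> exchanges the vertices
  \<open>k\<close> and \<open>- k\<close>, and \<open>affine_C\<close>, whose linear part is the
  generator \<open>C\<close>, exchanges \<open>k\<close> and \<open>1 - k\<close>.
\<close>

definition move_A :: "real^2 \<Rightarrow> real^2" where "move_A z = pt (2 * height z - skew z) (height z)"
definition affine_C :: "real \<Rightarrow> real^2 \<Rightarrow> real^2" where "affine_C c z = T c (move_A z)"

definition symmetry :: "real \<Rightarrow> int \<Rightarrow> int \<Rightarrow> (real^2 \<Rightarrow> real^2) \<Rightarrow> bool" where
  "symmetry c e m f \<longleftrightarrow> (e = 1 \<or> e = -1) \<and> continuous_on UNIV f \<and>
     (\<forall>x y t. f ((1 - t) *\<^sub>R x + t *\<^sub>R y) = (1 - t) *\<^sub>R f x + t *\<^sub>R f y) \<and>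
     (\<forall>k. f (P c k) = P c (e * k + m)) \<and> (\<forall>z. f (f z) = z)"

lemma move_A_P: "move_A (P c k) = P c (- k)"
proof (cases k rule: int_cases_vertex)
  case (pos n)
  have "- k = - int (Suc n)" using pos by simp
  then show ?thesis unfolding pos move_A_def P_pos using P_neg[of c "Suc n"] col_add[of c n] by (simp add: add.commute)
next
  case (neg n)
  show ?thesis
  proof (cases n)
    case 0
    then show ?thesis using neg by (simp add: move_A_def vec2_eq_iff)
  next
    case (Suc m)
    have "- k = int m + 1" using neg Suc by simp
    then show ?thesis using P_pos[of c m] P_neg[of c "Suc m"] col_add[of c m] neg Suc
      by (simp add: move_A_def)
  qed
qed

lemma symmetry_move_A: "symmetry c (-1) 0 move_A"
  unfolding symmetry_def
proof (intro conjI allI)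
  show "continuous_on UNIV move_A" unfolding move_A_def by (intro continuous_intros)
  show "move_A ((1 - t) *\<^sub>R x + t *\<^sub>R y) = (1 - t) *\<^sub>R move_A x + t *\<^sub>R move_A y" for x y t
    by (simp add: move_A_def vec2_eq_iff algebra_simps)
  show "move_A (move_A z) = z" for z by (simp add: move_A_def vec2_eq_iff)
qed (simp_all add: move_A_P)

lemma symmetry_affine_C: "symmetry c (-1) 1 (affine_C c)"
  unfolding symmetry_def
proof (intro conjI allI)
  have "affine_C c z = pt (skew z) ((c + 1) * skew z + 1 - height z)" for z
    by (simp add: affine_C_def move_A_def vec2_eq_iff skew_T height_T)
  then have e: "affine_C c = (\<lambda>z. pt (skew z) ((c + 1) * skew z + 1 - height z))" by blast
  show "continuous_on UNIV (affine_C c)" unfolding e by (intro continuous_intros)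
  show "affine_C c (P c k) = P c (- 1 * k + 1)" for k
    by (simp only: affine_C_def move_A_P P_step[symmetric]) simp
  show "affine_C c (affine_C c z) = z" for z unfolding e by (simp add: vec2_eq_iff)
  show "affine_C c ((1 - t) *\<^sub>R x + t *\<^sub>R y) = (1 - t) *\<^sub>R affine_C c x + t *\<^sub>R affine_C c y" for x y t
    unfolding e by (simp add: vec2_eq_iff algebra_simps)
qed simp

context
  fixes c e m f
  assumes c: "(c::real) \<ge> 1" and f: "symmetry c e m f"
begin

lemma symmetry_Q_imp: "z \<in> Qplus c \<Longrightarrow> f z \<in> Qplus c"
proof -
  have "convex {z. f z \<in> Qplus c}"
  proof (rule convexI)
    fix x y and u v :: real
    assume *: "x \<in> {z. f z \<in> Qplus c}" "y \<in> {z. f z \<in> Qplus c}" "0 \<le> u" "0 \<le> v" "u + v = 1"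
    then have u: "u = 1 - v" by simp
    show "u *\<^sub>R x + v *\<^sub>R y \<in> {z. f z \<in> Qplus c}"
      using f * convexD_alt[OF convex_Qplus, of "f x" c "f y" v] unfolding u by (auto simp: symmetry_def)
  qed
  moreover have "range (P c) \<subseteq> {z. f z \<in> Qplus c}" using f by (auto simp: symmetry_def)
  ultimately have "Qplus c \<subseteq> {z. f z \<in> Qplus c}" unfolding Qplus_def by (rule hull_minimal[rotated])
  then show "z \<in> Qplus c \<Longrightarrow> f z \<in> Qplus c" by blast
qed

lemma symmetry_Q: "f z \<in> Qplus c \<longleftrightarrow> z \<in> Qplus c"
  using symmetry_Q_imp[of z] symmetry_Q_imp[of "f z"] f by (auto simp: symmetry_def)

lemma symmetry_polygon_map: "polygon_map c c e m f"
  unfolding polygon_map_def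
proof (intro conjI allI ballI impI)
  show "continuous_on (Qplus c) f" using f continuous_on_subset by (auto simp: symmetry_def)
  fix z assume "f z \<in> range (P c)"
  then obtain k where "f z = P c k" by blast
  then have "f (f z) = P c (e * k + m)" using f by (simp add: symmetry_def)
  then show "z \<in> range (P c)" using f by (auto simp: symmetry_def)
qed (use f symmetry_Q in \<open>auto simp: symmetry_def\<close>)

lemma symmetry_fold: "f (fold_edge c k z) = fold_edge c (edge_index e m k) (f z)"
proof -
  have aff: "f ((1 - t) *\<^sub>R x + t *\<^sub>R y) = (1 - t) *\<^sub>R f x + t *\<^sub>R f y" for x y t using f by (auto simp: symmetry_def)
  define M where "M = (1 - 1/2) *\<^sub>R P c k + (1/2) *\<^sub>R P c (k + 1)"
  have "fold_edge c k z = (1 - 2) *\<^sub>R z + 2 *\<^sub>R M" by (simp add: fold_edge_def M_def algebra_simps)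
  then have "f (fold_edge c k z) = (1 - 2) *\<^sub>R f z + 2 *\<^sub>R f M" by (simp only: aff)
  also have "2 *\<^sub>R f M = P c (e * k + m) + P c (e * (k + 1) + m)"
    unfolding M_def aff using f by (simp add: symmetry_def algebra_simps)
  also have "P c (e * k + m) + P c (e * (k + 1) + m) = P c (edge_index e m k) + P c (edge_index e m k + 1)"
    using f by (auto simp: symmetry_def edge_index_def algebra_simps)
  finally show ?thesis by (simp add: fold_edge_def)
qed

lemma symmetry_edge: "z \<in> edge c k \<Longrightarrow> f z \<in> edge c (edge_index e m k)"
  using polygon_map_edge(1)[OF symmetry_polygon_map] .

lemma symmetry_open_edge: "z \<in> open_edge c k \<Longrightarrow> f z \<in> open_edge c (edge_index e m k)"
proof -
  assume z: "z \<in> open_edge c k"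
  then have "z \<in> edge c k" "z \<in> Qplus c" using mem_open_edge_iff open_edge_in_Qplus by blast+
  moreover have "z \<notin> range (P c)" using open_edge_not_vertex[OF c z] by auto
  ultimately have "f z \<in> edge c (edge_index e m k)" "f z \<notin> range (P c)"
    using symmetry_edge polygon_map_vertex[OF symmetry_polygon_map] by blast+
  then show ?thesis unfolding mem_open_edge_iff by (metis rangeI)
qed

lemma symmetry_interior: "z \<in> interior (Qplus c) \<Longrightarrow> f z \<in> interior (Qplus c)"
proof -
  assume z: "z \<in> interior (Qplus c)"
  then have "z \<in> Qplus c" using interior_subset by blast
  moreover have "f z \<notin> edge c k" for k
  proof
    assume "f z \<in> edge c k"
    then have "f (f z) \<in> edge c (edge_index e m k)" by (rule symmetry_edge)
    then show False using f z interior_not_edge[OF c z] by (simp add: symmetry_def)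
  qed
  ultimately show ?thesis using Qplus_cases[OF c] symmetry_Q by metis
qed

lemma symmetry_chart:
  assumes z: "z \<in> chart_domain c k"
  shows "f z \<in> chart_domain c (edge_index e m k)"
    "surface_map c c f (chart_param c k z) = chart_param c (edge_index e m k) (f z)"
proof -
  show "f z \<in> chart_domain c (edge_index e m k)"
    using z symmetry_interior symmetry_open_edge unfolding mem_chart_domain symmetry_fold[symmetric] by blast
  show "surface_map c c f (chart_param c k z) = chart_param c (edge_index e m k) (f z)"
    by (simp add: chart_param_sp surface_map_sp[OF symmetry_polygon_map] symmetry_Q symmetry_fold)
qed

end

section \<open>The reflection of the cells\<close>

text \<open>
  The cells of the grid that have an edge of the polygon as diagonal, numbered in the order in
  which the strip passes through them: alternately one step up and one step to the right. Every
  edge except edge 0 is the diagonal of exactly one cell.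
\<close>

definition cell_col :: "nat \<Rightarrow> nat" where "cell_col j = j div 2"
definition cell_row :: "nat \<Rightarrow> nat" where "cell_row j = (j + 1) div 2"
definition cell_edge :: "nat \<Rightarrow> int" where
  "cell_edge j = (if even j then - int (cell_col j) - 1 else int (cell_col j) + 1)"

lemma cell_row_eq: "even j \<Longrightarrow> cell_row j = cell_col j" "odd j \<Longrightarrow> cell_row j = Suc (cell_col j)"
  by (auto simp: cell_row_def cell_col_def elim!: evenE oddE)

lemma cell_edge_surj: assumes "k \<noteq> 0" obtains j where "k = cell_edge j"
proof (cases "k > 0")
  case True
  then have "k = cell_edge (2 * nat (k - 1) + 1)" by (simp add: cell_edge_def cell_col_def)
  then show ?thesis by (rule that)
next
  case False
  then have "k = cell_edge (2 * nat (- k - 1))" using assms by (simp add: cell_edge_def cell_col_def)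
  then show ?thesis by (rule that)
qed

definition cell :: "real \<Rightarrow> nat \<Rightarrow> (real^2) set" where
  "cell c j = {z. col_at c (cell_col j) \<le> skew z \<and> skew z \<le> col_at c (Suc (cell_col j)) \<and>
                  row_at c (cell_row j) \<le> height z \<and> height z \<le> row_at c (Suc (cell_row j))}"

text \<open>
  The reflections of a cell in its two axes. Their composite, the half turn of the cell, is the
  folding along its diagonal.
\<close>

definition flip_skew :: "real \<Rightarrow> nat \<Rightarrow> real^2 \<Rightarrow> real^2" where
  "flip_skew c j z = pt (col_at c (cell_col j) + col_at c (Suc (cell_col j)) - skew z) (height z)"
definition flip_height :: "real \<Rightarrow> nat \<Rightarrow> real^2 \<Rightarrow> real^2" where
  "flip_height c j z = pt (skew z) (row_at c (cell_row j) + row_at c (Suc (cell_row j)) - height z)"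

lemma edge_ends_cell_edge:
  "P c (cell_edge j) + P c (cell_edge j + 1) = pt (col_at c (cell_col j) + col_at c (Suc (cell_col j))) (row_at c (cell_row j) + row_at c (Suc (cell_row j)))"
proof (cases "even j")
  case True
  then show ?thesis unfolding cell_edge_def cell_row_eq(1)[OF True] by (simp only: if_True P_lower) (simp add: vec2_eq_iff)
next
  case False
  then show ?thesis unfolding cell_edge_def cell_row_eq(2)[OF False] by (simp only: if_False P_upper) (simp add: vec2_eq_iff)
qed

lemma fold_cell_edge: "fold_edge c (cell_edge j) z = pt (col_at c (cell_col j) + col_at c (Suc (cell_col j)) - skew z) (row_at c (cell_row j) + row_at c (Suc (cell_row j)) - height z)"
  unfolding fold_edge_def edge_ends_cell_edge by (simp add: vec2_eq_iff)

lemma flip_skew_simps [simp]: "flip_skew c j (flip_skew c j z) = z" "flip_height c j (flip_height c j z) = z"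
  "fold_edge c (cell_edge j) (flip_skew c j z) = flip_height c j z" "fold_edge c (cell_edge j) (flip_height c j z) = flip_skew c j z"
  "flip_height c j (flip_skew c j z) = fold_edge c (cell_edge j) z" "flip_skew c j (flip_height c j z) = fold_edge c (cell_edge j) z"
  "flip_skew c j (fold_edge c (cell_edge j) z) = flip_height c j z" "flip_height c j (fold_edge c (cell_edge j) z) = flip_skew c j z"
  by (simp_all add: fold_cell_edge flip_skew_def flip_height_def vec2_eq_iff)

lemma flip_skew_in_cell [simp]: "flip_skew c j z \<in> cell c j \<longleftrightarrow> z \<in> cell c j" "flip_height c j z \<in> cell c j \<longleftrightarrow> z \<in> cell c j"
  "fold_edge c (cell_edge j) z \<in> cell c j \<longleftrightarrow> z \<in> cell c j"
  by (auto simp: cell_def flip_skew_def flip_height_def fold_cell_edge)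

lemma continuous_on_flip_skew: "continuous_on S (flip_skew c j)" "continuous_on S (flip_height c j)"
  unfolding flip_skew_def flip_height_def by (intro continuous_intros)+

lemma closed_Qplus: "c \<ge> 1 \<Longrightarrow> closed (Qplus c)"
proof -
  assume c: "c \<ge> 1"
  have e: "Qplus c = {z. 0 \<le> skew z \<and> gx c z \<le> gy c z \<and> gy c z \<le> gx c z + 1}" using Qplus_iff[OF c] by blast
  show ?thesis unfolding e by (intro closed_Collect_conj closed_Collect_le continuous_intros c)
qed

lemma closed_cell: "closed (cell c j)"
  unfolding cell_def by (intro closed_Collect_conj closed_Collect_le continuous_intros)

text \<open>
  One half of a cell lies in the polygon; unfolded along the diagonal, the other half belongs to
  the other sheet. The reflection of the skew therefore either stays on its sheet or, followed by
  the folding, becomes the reflection of the height on the other sheet.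
\<close>

definition flip_in_cell :: "real \<Rightarrow> nat \<Rightarrow> real \<Rightarrow> real^2 \<Rightarrow> surface_point" where
  "flip_in_cell c j s z = (if flip_skew c j z \<in> Qplus c then sp c s (flip_skew c j z) else sp c (- s) (flip_height c j z))"

definition flip_on_sheet :: "real \<Rightarrow> real \<Rightarrow> real^2 \<Rightarrow> surface_point" where
  "flip_on_sheet c s z = flip_in_cell c (SOME j. z \<in> cell c j) s z"

text \<open>
  The affine homeomorphism that realizes the generator \<open>B\<close>. Unlike \<open>A\<close>
  and \<open>C\<close> it does not preserve the polygons: it reflects every cell, each made of two
  triangles from different polygons.
\<close>

definition cell_flip :: "real \<Rightarrow> surface_point \<Rightarrow> surface_point" where "cell_flip c = lift (flip_on_sheet c)"

definition move_B :: "real^2 \<Rightarrow> real^2" where "move_B v = pt (- skew v) (height v)"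

definition local_affine :: "real \<Rightarrow> (real^2 \<Rightarrow> real^2) \<Rightarrow> (surface_point \<Rightarrow> surface_point) \<Rightarrow> bool" where
  "local_affine c M \<Phi> \<longleftrightarrow> (\<forall>k. \<forall>x \<in> chart_domain c k. \<exists>k' \<tau> W. open W \<and> x \<in> W \<and>
     (\<forall>y\<in>W. M y + \<tau> \<in> chart_domain c k' \<and> \<Phi> (chart_param c k y) = chart_param c k' (M y + \<tau>)))"

context fixes c :: real assumes c: "c \<ge> 1" begin

lemma cell_iff: "z \<in> cell c j \<longleftrightarrow> real (cell_col j) \<le> gx c z \<and> gx c z \<le> real (Suc (cell_col j)) \<and> real (cell_row j) \<le> gy c z \<and> gy c z \<le> real (Suc (cell_row j))"
  unfolding cell_def by (simp only: gx_cell[OF c] gy_cell[OF c] mem_Collect_eq)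

lemma gx_flip_skew: "z \<in> cell c j \<Longrightarrow> gx c (flip_skew c j z) = 2 * real (cell_col j) + 1 - gx c z"
  using interpolate_reflect[OF grid_col[OF c], of "cell_col j" "skew z" real] by (auto simp: gx_def flip_skew_def cell_def)

lemma gy_flip_skew [simp]: "gy c (flip_skew c j z) = gy c z" by (simp add: gy_def flip_skew_def)

lemma gy_flip_height: "z \<in> cell c j \<Longrightarrow> gy c (flip_height c j z) = 2 * real (cell_row j) + 1 - gy c z"
  using interpolate_reflect[OF grid_row[OF c], of "cell_row j" "height z" real] by (auto simp: gy_def flip_height_def cell_def)

lemma gx_flip_height [simp]: "gx c (flip_height c j z) = gx c z" by (simp add: gx_def flip_height_def)

lemma cell_Q: assumes "z \<in> cell c j"
  shows "z \<in> Qplus c \<longleftrightarrow> (if even j then gx c z \<le> gy c z else gy c z \<le> gx c z + 1)"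
proof -
  have "0 \<le> gx c z" using assms unfolding cell_iff by (meson of_nat_0_le_iff order_trans)
  then have "0 \<le> skew z" using gx_nonneg[OF c] by simp
  then show ?thesis using assms cell_row_eq[of j] unfolding cell_iff Qplus_iff[OF c] by auto
qed

lemma flip_skew_or_flip_height: "z \<in> cell c j \<Longrightarrow> flip_skew c j z \<in> Qplus c \<or> flip_height c j z \<in> Qplus c"
  using cell_Q[of "flip_skew c j z" j] cell_Q[of "flip_height c j z" j] gx_flip_skew[of z j] gy_flip_height[of z j] cell_row_eq[of j]
  by (cases "even j") auto

lemma in_Q_and_fold: "z \<in> Qplus c \<Longrightarrow> fold_edge c k z \<in> Qplus c \<Longrightarrow> z \<in> edge c k"
  using Qplus_side[OF c, of z k] Qplus_side[OF c, of "fold_edge c k z" k] by (simp add: side_fold edge_iff_side[OF c])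

lemma Q_in_some_cell: assumes z: "z \<in> Qplus c" shows "\<exists>j. z \<in> cell c j"
proof -
  have "0 \<le> skew z" using z Qplus_iff[OF c] by simp
  then obtain n where n: "col_at c n \<le> skew z" "skew z \<le> col_at c (Suc n)" using col_cell[OF c] by (metis less_imp_le)
  then have n': "real n \<le> gx c z" "gx c z \<le> real (Suc n)" using gx_cell[OF c] by blast+
  have q: "gx c z \<le> gy c z" "gy c z \<le> gx c z + 1" using z Qplus_iff[OF c] by auto
  show ?thesis
  proof (cases "gy c z \<le> real (Suc n)")
    case True
    then have "z \<in> cell c (2 * n)" unfolding cell_iff using n' q by (simp add: cell_col_def cell_row_def)
    then show ?thesis by blast
  next
    case False
    then have "z \<in> cell c (2 * n + 1)" unfolding cell_iff using n' q by (simp add: cell_col_def cell_row_def)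
    then show ?thesis by blast
  qed
qed

lemma flip_in_cell_flip_height: assumes "z \<in> cell c j" "flip_height c j z \<in> Qplus c" "sheet s"
  shows "flip_in_cell c j s z = sp c (- s) (flip_height c j z)"
proof (cases "flip_skew c j z \<in> Qplus c")
  case True
  then have "flip_skew c j z \<in> edge c (cell_edge j)" using in_Q_and_fold[of "flip_skew c j z" "cell_edge j"] assms by simp
  then show ?thesis using sp_fold[of "flip_skew c j z" c "cell_edge j" s] assms True by (simp add: flip_in_cell_def)
qed (simp add: flip_in_cell_def)

text \<open>
  Two consecutive cells share a side. If the side is horizontal, the cells lie in one column and
  their reflections of the skew coincide; otherwise they lie in one row and the reflections of the
  height coincide.
\<close>

lemma flip_in_cell_step: assumes z: "z \<in> Qplus c" "z \<in> cell c i" "z \<in> cell c (Suc i)" and s: "sheet s"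
  shows "flip_in_cell c i s z = flip_in_cell c (Suc i) s z"
proof (cases "even i")
  case True
  then have n: "cell_col (Suc i) = cell_col i" "cell_row i = cell_col i" "cell_row (Suc i) = Suc (cell_col i)" by (auto simp: cell_col_def cell_row_def elim!: evenE)
  then have r: "flip_skew c (Suc i) z = flip_skew c i z" by (simp add: flip_skew_def)
  have "gy c z = real (Suc (cell_col i))" using z n unfolding cell_iff by simp
  then have "flip_skew c i z \<in> Qplus c"
    using z True n cell_Q[of "flip_skew c i z" i] gx_flip_skew[OF z(2)] unfolding cell_iff by simp
  then show ?thesis using r by (simp add: flip_in_cell_def)
next
  case False
  then have n: "cell_col (Suc i) = Suc (cell_col i)" "cell_row i = Suc (cell_col i)" "cell_row (Suc i) = Suc (cell_col i)" by (auto simp: cell_col_def cell_row_def elim!: oddE)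
  then have r: "flip_height c (Suc i) z = flip_height c i z" by (simp add: flip_height_def)
  have "gx c z = real (Suc (cell_col i))" using z n unfolding cell_iff by simp
  then have "flip_height c i z \<in> Qplus c"
    using z False n cell_Q[of "flip_height c i z" i] gy_flip_height[OF z(2)] unfolding cell_iff by simp
  then show ?thesis using flip_in_cell_flip_height[OF z(2) _ s] flip_in_cell_flip_height[OF z(3) _ s] r by simp
qed

lemma cell_between: assumes "z \<in> cell c i" "z \<in> cell c j" "i \<le> l" "l \<le> j" shows "z \<in> cell c l"
proof -
  have "cell_col i \<le> cell_col l" "cell_col l \<le> cell_col j" "cell_row i \<le> cell_row l" "cell_row l \<le> cell_row j"
    using assms by (auto simp: cell_col_def cell_row_def intro!: div_le_mono)
  then show ?thesis using assms unfolding cell_iff by (smt (verit, best) of_nat_le_iff Suc_le_mono)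
qed

lemma flip_in_cell_agree_le: assumes z: "z \<in> Qplus c" "z \<in> cell c i" "z \<in> cell c j" and s: "sheet s" and "i \<le> j"
  shows "flip_in_cell c i s z = flip_in_cell c j s z"
  using \<open>i \<le> j\<close> z(3)
proof (induction j rule: dec_induct)
  case (step l)
  have l: "z \<in> cell c l" using cell_between[OF z(2) step.prems] step.hyps by simp
  then show ?case using step.IH flip_in_cell_step[OF z(1) l step.prems s] by simp
qed simp

lemma flip_in_cell_agree: assumes "z \<in> Qplus c" "z \<in> cell c i" "z \<in> cell c j" "sheet s"
  shows "flip_in_cell c i s z = flip_in_cell c j s z"
  using flip_in_cell_agree_le[of z i j s] flip_in_cell_agree_le[of z j i s] assms by (metis linear)

lemma flip_on_sheet_eq: assumes "z \<in> Qplus c" "z \<in> cell c j" "sheet s" shows "flip_on_sheet c s z = flip_in_cell c j s z"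
  unfolding flip_on_sheet_def using assms by (intro flip_in_cell_agree) (auto intro: someI)

lemma edge_in_cell: "z \<in> edge c (cell_edge j) \<Longrightarrow> z \<in> cell c j"
proof -
  assume z: "z \<in> edge c (cell_edge j)"
  have "P c (cell_edge j) \<in> cell c j \<and> P c (cell_edge j + 1) \<in> cell c j"
  proof (cases "even j")
    case True
    then show ?thesis unfolding cell_edge_def cell_def cell_row_eq(1)[OF True]
      by (simp only: if_True P_lower) (simp add: grid_le[OF grid_col[OF c]] grid_le[OF grid_row[OF c]])
  next
    case False
    then show ?thesis unfolding cell_edge_def cell_def cell_row_eq(2)[OF False]
      by (simp only: if_False P_upper) (simp add: grid_le[OF grid_col[OF c]] grid_le[OF grid_row[OF c]])
  qed
  moreover have "convex (cell c j)"
  proof -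
    have "cell c j = skew -` {col_at c (cell_col j)..col_at c (Suc (cell_col j))} \<inter> height -` {row_at c (cell_row j)..row_at c (Suc (cell_row j))}"
      by (auto simp: cell_def)
    then show ?thesis by (simp add: convex_Int convex_linear_vimage linear_skew linear_height)
  qed
  ultimately show ?thesis using z closed_segment_subset[of "P c (cell_edge j)" "cell c j" "P c (cell_edge j + 1)"] by (auto simp: edge_def)
qed

lemma glue_invariant_flip_on_sheet: "glue_invariant c (flip_on_sheet c)"
  unfolding glue_invariant_def
proof (intro allI ballI)
  fix k z assume z: "z \<in> edge c k"
  then have zQ: "z \<in> Qplus c" "fold_edge c k z \<in> Qplus c" using edge_subset_Qplus fold_in_edge by blast+
  show "flip_on_sheet c 1 z = flip_on_sheet c (-1) (fold_edge c k z)"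
  proof (cases "k = 0")
    case False
    then obtain j where j: "k = cell_edge j" by (rule cell_edge_surj)
    have zc: "z \<in> cell c j" using edge_in_cell z j by simp
    then have fc: "fold_edge c k z \<in> cell c j" using j by simp
    have "flip_in_cell c j 1 z = flip_in_cell c j (-1) (fold_edge c k z)"
    proof (cases "flip_skew c j z \<in> Qplus c")
      case True
      then show ?thesis using flip_in_cell_flip_height[OF fc, of "-1"] j by (simp add: flip_in_cell_def)
    next
      case False
      then have "flip_height c j z \<in> Qplus c" using flip_skew_or_flip_height[OF zc] by simp
      then show ?thesis using flip_in_cell_flip_height[OF zc, of 1] j by (simp add: flip_in_cell_def)
    qed
    then show ?thesis using flip_on_sheet_eq[OF zQ(1) zc] flip_on_sheet_eq[OF zQ(2) fc] by simp
  next
    case True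
    \<comment> \<open>Edge 0 is no diagonal: it is the side of cell 0 of skew 0 and is fixed pointwise.\<close>
    have col1: "0 \<le> col_at c (Suc 0)" using grid_le[OF grid_col[OF c], of 0 "Suc 0"] by simp
    have w: "flip_height c 0 w = fold_edge c 0 w" "w \<in> cell c 0" if "w \<in> edge c 0" for w
    proof -
      have "P c 1 = pt 0 1" using P_pos[of c 0] by simp
      then show "flip_height c 0 w = fold_edge c 0 w"
        using that by (simp add: flip_height_def fold_edge_def cell_row_def vec2_eq_iff edge_0_iff)
      show "w \<in> cell c 0" using that col1 by (simp add: cell_def cell_col_def cell_row_def edge_0_iff)
    qed
    have *: "flip_on_sheet c s w = sp c (- s) (fold_edge c 0 w)" if "w \<in> edge c 0" "sheet s" for s w
    proof -
      have "w \<in> Qplus c" "fold_edge c 0 w \<in> Qplus c" using that edge_subset_Qplus fold_in_edge by blast+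
      then show ?thesis using flip_on_sheet_eq[of w 0 s] flip_in_cell_flip_height[of w 0 s] w[OF that(1)] that by simp
    qed
    have "flip_on_sheet c 1 z = sp c (-1) (fold_edge c 0 z)" using * z True by simp
    also have "\<dots> = sp c 1 z" using sp_fold[of z c 0 1] z True by simp
    also have "\<dots> = flip_on_sheet c (-1) (fold_edge c 0 z)" using *[of "fold_edge c 0 z" "-1"] fold_in_edge z True by simp
    finally show ?thesis using True by simp
  qed
qed

lemma cell_flip_sp: assumes "z \<in> Qplus c" "z \<in> cell c j" "sheet s" shows "cell_flip c (sp c s z) = flip_in_cell c j s z"
  unfolding cell_flip_def using lift_sp[OF glue_invariant_flip_on_sheet assms(3), of z] flip_on_sheet_eq[OF assms] by simp

lemma continuous_cell_flip: "continuous_map (surface c) (surface c) (cell_flip c)"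
  unfolding cell_flip_def
proof (rule continuous_map_lift[OF glue_invariant_flip_on_sheet])
  fix s :: real assume s: "sheet s"
  let ?X = "top_of_set (Qplus c)"
  define TT where "TT = (\<lambda>(j, b). {z \<in> Qplus c \<inter> cell c j. (if b then flip_skew c j z else flip_height c j z) \<in> Qplus c})"
  define ff where "ff = (\<lambda>(j, b) z. if b then sp c s (flip_skew c j z) else sp c (- s) (flip_height c j z))"
  have val: "flip_on_sheet c s z = ff i z" if "z \<in> TT i" for i z
  proof -
    obtain j b where i: "i = (j, b)" by (cases i)
    have z: "z \<in> Qplus c" "z \<in> cell c j" "(if b then flip_skew c j z else flip_height c j z) \<in> Qplus c" using that i by (auto simp: TT_def)
    show ?thesis using flip_on_sheet_eq[OF z(1,2) s] flip_in_cell_flip_height[OF z(2) _ s] z(3) i by (cases b) (auto simp: ff_def flip_in_cell_def)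
  qed
  show "continuous_map ?X (surface c) (flip_on_sheet c s)"
  proof (rule pasting_lemma_locally_finite[where I = UNIV and T = TT and f = ff])
    fix x assume "x \<in> topspace ?X"
    then have x: "x \<in> Qplus c" by simp
    obtain N where N: "gx c x < real N" using reals_Archimedean2 by blast
    let ?V = "Qplus c \<inter> {z. gx c z < real N}"
    have "openin ?X ?V" by (intro openin_open_Int open_Collect_less continuous_intros c)
    moreover have "{i \<in> UNIV. TT i \<inter> ?V \<noteq> {}} \<subseteq> {..2 * N + 1} \<times> UNIV"
    proof
      fix i assume "i \<in> {i \<in> UNIV. TT i \<inter> ?V \<noteq> {}}"
      moreover obtain j b where i: "i = (j, b)" by (cases i)
      ultimately obtain z where z: "z \<in> TT (j, b)" "z \<in> Qplus c" "gx c z < real N" by auto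
      then have "real (cell_col j) \<le> gx c z" by (auto simp: TT_def cell_iff)
      then have "cell_col j < N" using z by simp
      then show "i \<in> {..2 * N + 1} \<times> UNIV" unfolding i by (auto simp: cell_col_def)
    qed
    then have "finite {i \<in> UNIV. TT i \<inter> ?V \<noteq> {}}" by (rule finite_subset) simp
    ultimately show "\<exists>V. openin ?X V \<and> x \<in> V \<and> finite {i \<in> UNIV. TT i \<inter> V \<noteq> {}}" using x N by blast
  next
    fix i :: "nat \<times> bool"
    obtain j b where i: "i = (j, b)" by (cases i)
    define g where "g = (if b then flip_skew c j else flip_height c j)"
    have g: "continuous_on S g" for S using continuous_on_flip_skew by (simp add: g_def)
    have TTi: "TT i = Qplus c \<inter> (cell c j \<inter> g -` Qplus c)" by (auto simp: TT_def i g_def)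
    show "closedin ?X (TT i)" unfolding TTi
      by (intro closedin_closed_Int closed_Int closed_cell closed_vimage closed_Qplus c g)
    have "continuous_map (subtopology ?X (TT i)) (top_of_set (Qplus c)) g"
      using g by (auto simp: subtopology_subtopology continuous_map_in_subtopology TTi)
    moreover have "continuous_map (top_of_set (Qplus c)) (surface c) (sp c (if b then s else - s))"
      using s by (intro continuous_map_sp) auto
    ultimately have "continuous_map (subtopology ?X (TT i)) (surface c) (sp c (if b then s else - s) \<circ> g)"
      by (rule continuous_map_compose)
    moreover have "sp c (if b then s else - s) \<circ> g = ff i" by (auto simp: ff_def i g_def)
    ultimately show "continuous_map (subtopology ?X (TT i)) (surface c) (ff i)" by simp
  next
    fix i j x assume "x \<in> topspace ?X \<inter> TT i \<inter> TT j"
    then show "ff i x = ff j x" using val by (metis IntE)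
  next
    fix x assume "x \<in> topspace ?X"
    then have x: "x \<in> Qplus c" by simp
    then obtain j where j: "x \<in> cell c j" using Q_in_some_cell by blast
    then have "x \<in> TT (j, True) \<or> x \<in> TT (j, False)" using flip_skew_or_flip_height[OF j] x by (auto simp: TT_def)
    then show "\<exists>j. j \<in> UNIV \<and> x \<in> TT j \<and> flip_on_sheet c s x = ff j x" using val by blast
  qed
qed

lemma cell_flip_cases:
  assumes C: "C \<in> topspace (surface c)"
  obtains s z j where "sheet s" "z \<in> Qplus c" "z \<in> cell c j" "C = sp c s z" "flip_skew c j z \<in> Qplus c" "cell_flip c C = sp c s (flip_skew c j z)"
  | s z j where "sheet s" "z \<in> Qplus c" "z \<in> cell c j" "C = sp c s z" "flip_height c j z \<in> Qplus c" "cell_flip c C = sp c (- s) (flip_height c j z)"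
proof -
  obtain s z where s: "sheet s" "z \<in> Qplus c" "C = sp c s z" using C by (rule surface_cases)
  obtain j where j: "z \<in> cell c j" using Q_in_some_cell s by blast
  show ?thesis
    using that(1)[OF s(1,2) j s(3)] that(2)[OF s(1,2) j s(3)] cell_flip_sp[OF s(2) j s(1)] flip_in_cell_flip_height[OF j _ s(1)] flip_skew_or_flip_height[OF j] s(3)
    by (auto simp: flip_in_cell_def)
qed

lemma cell_flip_cell_flip: "C \<in> topspace (surface c) \<Longrightarrow> cell_flip c (cell_flip c C) = C"
proof (erule cell_flip_cases)
  fix s z j assume *: "sheet s" "z \<in> Qplus c" "z \<in> cell c j" "C = sp c s z" "flip_skew c j z \<in> Qplus c" "cell_flip c C = sp c s (flip_skew c j z)"
  then show "cell_flip c (cell_flip c C) = C" using cell_flip_sp[of "flip_skew c j z" j s] by (simp add: flip_in_cell_def)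
next
  fix s z j assume *: "sheet s" "z \<in> Qplus c" "z \<in> cell c j" "C = sp c s z" "flip_height c j z \<in> Qplus c" "cell_flip c C = sp c (- s) (flip_height c j z)"
  then show "cell_flip c (cell_flip c C) = C" using cell_flip_sp[of "flip_height c j z" j "- s"] flip_in_cell_flip_height[of "flip_height c j z" j "- s"] by auto
qed

lemma cell_flip_in_surface: "C \<in> topspace (surface c) \<Longrightarrow> cell_flip c C \<in> topspace (surface c)"
  by (erule cell_flip_cases) auto

lemma cell_flip_singular: assumes C: "C \<in> topspace (surface c)"
  shows "cell_flip c C \<in> singularities c \<longleftrightarrow> C \<in> singularities c"
proof -
  have "sinx c (cell_flip c C) = sinx c C \<and> siny c (cell_flip c C) = siny c C"
    using C by (rule cell_flip_cases) (auto simp: sinx_sp[OF c] siny_sp[OF c] gx_flip_skew gy_flip_height sin_odd_minus)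
  then show ?thesis using singular_iff_sin[OF c C] singular_iff_sin[OF c cell_flip_in_surface[OF C]] by simp
qed

lemma cell_flip_rotation: assumes C: "C \<in> topspace (surface c)" shows "cell_flip c (rotation c C) = rotation c (cell_flip c C)"
proof -
  obtain s z where s: "sheet s" "z \<in> Qplus c" "C = sp c s z" using C by (rule surface_cases)
  obtain j where j: "z \<in> cell c j" using Q_in_some_cell s by blast
  have "sheet (- s)" using s(1) by auto
  then show ?thesis using s(1) cell_flip_sp[OF s(2) j] unfolding s(3) by (simp add: flip_in_cell_def)
qed

lemma cell_flip_chart_cell:
  assumes y: "y \<in> cell c j"
  shows "cell_flip c (chart_param c (cell_edge j) y) = chart_param c (cell_edge j) (flip_skew c j y)"
proof (cases "y \<in> Qplus c")
  case True
  then show ?thesis using cell_flip_sp[OF True y, of 1] by (simp add: chart_param_sp flip_in_cell_def)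
next
  case False
  have fy: "fold_edge c (cell_edge j) y \<in> cell c j" using y by simp
  have fQ: "fold_edge c (cell_edge j) y \<in> Qplus c"
    using flip_skew_or_flip_height[of "flip_skew c j y" j] y False by simp
  have "cell_flip c (chart_param c (cell_edge j) y) = flip_in_cell c j (-1) (fold_edge c (cell_edge j) y)"
    using cell_flip_sp[OF fQ fy, of "-1"] False by (simp add: chart_param_sp)
  also have "\<dots> = chart_param c (cell_edge j) (flip_skew c j y)"
  proof (cases "flip_skew c j y \<in> Qplus c")
    case True
    then show ?thesis using flip_in_cell_flip_height[OF fy, of "-1"] by (simp add: chart_param_sp)
  next
    case False
    then have "flip_height c j y \<in> Qplus c" using flip_skew_or_flip_height[OF y] by simp
    then have "flip_in_cell c j (-1) (fold_edge c (cell_edge j) y) = sp c (-1) (flip_height c j y)" unfolding flip_in_cell_def by simp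
    then show ?thesis using False by (simp add: chart_param_sp)
  qed
  finally show ?thesis .
qed

section \<open>Affine homeomorphisms act on saddle connections\<close>

lemma interior_in_Q: "z \<in> interior (Qplus c) \<Longrightarrow> z \<in> Qplus c"
  using interior_subset by blast

lemma chart_interior: assumes "y \<in> interior (Qplus c)"
  shows "chart_param c k y = sp c 1 y" "y \<in> chart_domain c k"
  using assms interior_in_Q by (auto simp: chart_param_sp mem_chart_domain)

lemma chart_fold_interior: assumes "y \<in> interior (Qplus c)"
  shows "chart_param c k (fold_edge c k y) = sp c (-1) y" "fold_edge c k y \<in> chart_domain c k"
  using assms fold_interior_not_Qplus[OF c, of k "fold_edge c k y"] by (auto simp: chart_param_sp mem_chart_domain)

lemma open_cell_interior:
  "open {z. a < gx c z \<and> gx c z < b \<and> p < gy c z \<and> gy c z < q}"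
  by (intro open_Collect_conj open_Collect_less continuous_intros c)

lemma open_cell_in_chart:
  assumes "real (cell_col j) < gx c z" "gx c z < real (Suc (cell_col j))" "real (cell_row j) < gy c z" "gy c z < real (Suc (cell_row j))"
  shows "z \<in> chart_domain c (cell_edge j)"
proof -
  have z: "z \<in> cell c j" using assms unfolding cell_iff by simp
  have i: "w \<in> interior (Qplus c) \<or> w \<in> open_edge c (cell_edge j)"
    if w: "w \<in> Qplus c" "real (cell_col j) < gx c w" "gx c w < real (Suc (cell_col j))" "real (cell_row j) < gy c w" "gy c w < real (Suc (cell_row j))" for w
  proof (cases rule: nonvertex_cases[OF c w(1)])
    case 1
    show ?case
    proof
      assume "w \<in> range (P c)"
      then have "gx c w \<in> \<int>" using vertex_iff_lattice[OF c w(1)] by (simp add: sin_pi_eq_0)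
      then obtain i where i: "gx c w = of_int i" by (auto simp: Ints_def)
      have "real_of_int (int (cell_col j)) < real_of_int i" "real_of_int i < real_of_int (int (cell_col j) + 1)" using w(2,3) i by simp_all
      then have "int (cell_col j) < i" "i < int (cell_col j) + 1" by (simp_all only: of_int_less_iff)
      then show False by simp
    qed
  next
    case (3 k)
    have "k \<noteq> 0"
    proof
      assume "k = 0"
      then show False using gx_fold_0(1)[OF c, of w] 3 w(2) mem_open_edge_iff by (metis of_nat_0_le_iff not_less)
    qed
    then obtain i where k: "k = cell_edge i" by (rule cell_edge_surj)
    then have "w \<in> cell c i" using 3 edge_in_cell mem_open_edge_iff by blast
    then have "real (cell_col i) \<le> gx c w" "gx c w \<le> real (Suc (cell_col i))" "real (cell_row i) \<le> gy c w" "gy c w \<le> real (Suc (cell_row i))"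
      unfolding cell_iff by blast+
    then have "real (cell_col i) < real (Suc (cell_col j))" "real (cell_col j) < real (Suc (cell_col i))"
      "real (cell_row i) < real (Suc (cell_row j))" "real (cell_row j) < real (Suc (cell_row i))" using w(2-5) by (meson le_less_trans less_le_trans)+
    then have "cell_col i = cell_col j" "cell_row i = cell_row j" by (simp_all only: of_nat_less_iff)
    moreover have "cell_col l + cell_row l = l" for l by (cases "even l") (auto simp: cell_col_def cell_row_def elim!: evenE oddE)
    ultimately have "i = j" by metis
    then show ?thesis using 3 k by simp
  qed simp
  show ?thesis
  proof (cases "z \<in> Qplus c")
    case True
    then show ?thesis using i[OF True] assms by (auto simp: mem_chart_domain)
  next
    case False
    let ?w = "fold_edge c (cell_edge j) z"
    have w: "gx c ?w = 2 * real (cell_col j) + 1 - gx c z" "gy c ?w = 2 * real (cell_row j) + 1 - gy c z"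
      using gx_flip_skew[of "flip_height c j z" j] gy_flip_height[of "flip_skew c j z" j] z by (simp_all add: gx_flip_skew gy_flip_height)
    have "?w \<in> Qplus c" using flip_skew_or_flip_height[of "flip_skew c j z" j] z False by simp
    then have "?w \<in> interior (Qplus c) \<or> ?w \<in> open_edge c (cell_edge j)" using i[of ?w] assms w by simp
    then show ?thesis using fold_in_open_edge[of ?w c "cell_edge j"] by (auto simp: mem_chart_domain)
  qed
qed

lemma flip_skew_affine: "flip_skew c j y = move_B y + pt (col_at c (cell_col j) + col_at c (Suc (cell_col j))) 0"
  and fold_flip_height_affine: "fold_edge c k (flip_height c j y) = move_B y + (P c k + P c (k + 1) - pt 0 (row_at c (cell_row j) + row_at c (Suc (cell_row j))))"
  by (simp_all add: move_B_def flip_skew_def flip_height_def fold_edge_def vec2_eq_iff)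

lemma local_affine_witness:
  assumes "open W" "x \<in> W" "\<And>y. g y = move_B y + \<tau>"
    and "\<And>y. y \<in> W \<Longrightarrow> R y \<and> g y \<in> chart_domain c k' \<and> h y = chart_param c k' (g y)"
  shows "\<exists>k' \<tau> W. open W \<and> x \<in> W \<and> (\<forall>y\<in>W. R y \<and> move_B y + \<tau> \<in> chart_domain c k' \<and> h y = chart_param c k' (move_B y + \<tau>))"
  using assms(1,2) assms(4)[unfolded assms(3)] by (intro exI[of _ k'] exI[of _ \<tau>] exI[of _ W]) simp

text \<open>
  An interior point of the polygon lies inside a cell or on a side shared by two consecutive
  cells. In the second case one formula, \<open>flip_skew\<close> on the same sheet or
  \<open>flip_height\<close> on the other one, is valid in both cells.
\<close>

lemma cell_flip_local_interior:
  assumes x: "x \<in> interior (Qplus c)"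
  shows "\<exists>k' \<tau> W. open W \<and> x \<in> W \<and> (\<forall>y\<in>W. y \<in> interior (Qplus c) \<and> move_B y + \<tau> \<in> chart_domain c k' \<and> cell_flip c (sp c 1 y) = chart_param c k' (move_B y + \<tau>))"
proof -
  have xQ: "x \<in> Qplus c" using x interior_in_Q by blast
  have xs: "0 < gx c x" "gx c x < gy c x" "gy c x < gx c x + 1" using x by (auto simp: interior_Qplus_iff[OF c] gx_pos[OF c])
  obtain j where j: "x \<in> cell c j" using Q_in_some_cell[OF xQ] by blast
  have oQ: "open (interior (Qplus c))" by simp
  consider (both) "real (cell_col j) < gx c x" "gx c x < real (Suc (cell_col j))" "real (cell_row j) < gy c x" "gy c x < real (Suc (cell_row j))"
    | (hor) n where "gy c x = real (Suc n)" | (ver) n where "gx c x = real (Suc n)"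
  proof -
    have "gx c x = real (cell_col j) \<or> gx c x = real (Suc (cell_col j)) \<Longrightarrow> \<exists>n. gx c x = real (Suc n)"
      using xs(1) by (metis not0_implies_Suc of_nat_0 less_irrefl)
    moreover have "gy c x = real (cell_row j) \<or> gy c x = real (Suc (cell_row j)) \<Longrightarrow> \<exists>n. gy c x = real (Suc n)"
      using xs(1,2) by (metis not0_implies_Suc of_nat_0 less_irrefl less_trans)
    ultimately show ?thesis
      using that j unfolding cell_iff by (metis less_eq_real_def)
  qed
  then show ?thesis
  proof cases
    case both
    let ?W = "interior (Qplus c) \<inter> {z. real (cell_col j) < gx c z \<and> gx c z < real (Suc (cell_col j)) \<and> real (cell_row j) < gy c z \<and> gy c z < real (Suc (cell_row j))}"
    have "open ?W" by (intro open_Int oQ open_cell_interior)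
    moreover have "flip_skew c j y \<in> chart_domain c (cell_edge j) \<and> cell_flip c (sp c 1 y) = chart_param c (cell_edge j) (flip_skew c j y)" if y: "y \<in> ?W" for y
    proof -
      have yc: "y \<in> cell c j" using y unfolding cell_iff by simp
      have "flip_skew c j y \<in> chart_domain c (cell_edge j)" using y by (intro open_cell_in_chart) (simp_all add: gx_flip_skew[OF yc])
      then show ?thesis using cell_flip_chart_cell[OF yc] chart_interior(1)[of y "cell_edge j"] y by simp
    qed
    ultimately show ?thesis using x both
      by (intro local_affine_witness[where W = ?W and g = "flip_skew c j", OF _ _ flip_skew_affine]) auto
  next
    case (hor n)
    have cs: "cell_col (2 * n) = n" "cell_row (2 * n) = n" "cell_col (Suc (2 * n)) = n" "cell_row (Suc (2 * n)) = Suc n" by (auto simp: cell_col_def cell_row_def)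
    have g: "real n < gx c x" "gx c x < real (Suc n)" using hor xs by auto
    let ?W = "interior (Qplus c) \<inter> {z. real n < gx c z \<and> gx c z < real (Suc n) \<and> real n < gy c z \<and> gy c z < real (Suc (Suc n))} \<inter>
       flip_skew c (2 * n) -` interior (Qplus c)"
    have "open ?W" by (intro open_Int oQ open_cell_interior open_vimage continuous_on_flip_skew)
    moreover have "x \<in> ?W"
    proof -
      have "x \<in> cell c (2 * n)" using hor g unfolding cell_iff cs by simp
      then have "gx c (flip_skew c (2 * n) x) = 2 * real n + 1 - gx c x" using gx_flip_skew cs by simp
      then have "flip_skew c (2 * n) x \<in> interior (Qplus c)" unfolding interior_Qplus_iff[OF c] gx_pos[OF c, symmetric] using g hor by simp
      then show ?thesis using x g hor by simp
    qed
    moreover have "flip_skew c (2 * n) y \<in> chart_domain c 0 \<and> cell_flip c (sp c 1 y) = chart_param c 0 (flip_skew c (2 * n) y)" if y: "y \<in> ?W" for y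
    proof -
      have r: "flip_skew c (Suc (2 * n)) y = flip_skew c (2 * n) y" by (simp add: flip_skew_def cs)
      have ri: "flip_skew c (2 * n) y \<in> interior (Qplus c)" using y by simp
      have yQ: "y \<in> Qplus c" using y interior_in_Q by blast
      have "y \<in> cell c (2 * n) \<or> y \<in> cell c (Suc (2 * n))" using y unfolding cell_iff cs by auto
      then have "cell_flip c (sp c 1 y) = sp c 1 (flip_skew c (2 * n) y)"
        using cell_flip_sp[OF yQ, of _ 1] interior_in_Q[OF ri] r by (auto simp: flip_in_cell_def)
      then show ?thesis using chart_interior[OF ri] by simp
    qed
    ultimately show ?thesis
      by (intro local_affine_witness[where W = ?W and g = "flip_skew c (2 * n)", OF _ _ flip_skew_affine]) blast+
  next
    case (ver n)
    have cs: "cell_col (Suc (2 * n)) = n" "cell_row (Suc (2 * n)) = Suc n" "cell_col (Suc (Suc (2 * n))) = Suc n" "cell_row (Suc (Suc (2 * n))) = Suc n" by (auto simp: cell_col_def cell_row_def)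
    let ?j = "Suc (2 * n)"
    have g: "real (Suc n) < gy c x" "gy c x < real (Suc (Suc n))" using ver xs by auto
    let ?W = "interior (Qplus c) \<inter> {z. real n < gx c z \<and> gx c z < real (Suc (Suc n)) \<and> real (Suc n) < gy c z \<and> gy c z < real (Suc (Suc n))} \<inter>
       flip_height c ?j -` interior (Qplus c)"
    have "open ?W" by (intro open_Int oQ open_cell_interior open_vimage continuous_on_flip_skew)
    moreover have "x \<in> ?W"
    proof -
      have "x \<in> cell c ?j" using ver g unfolding cell_iff cs by simp
      then have "gy c (flip_height c ?j x) = 2 * real (Suc n) + 1 - gy c x" using gy_flip_height cs by simp
      then have "flip_height c ?j x \<in> interior (Qplus c)" unfolding interior_Qplus_iff[OF c] gx_pos[OF c, symmetric] using g ver by simp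
      then show ?thesis using x g ver by simp
    qed
    moreover have "fold_edge c 0 (flip_height c ?j y) \<in> chart_domain c 0 \<and> cell_flip c (sp c 1 y) = chart_param c 0 (fold_edge c 0 (flip_height c ?j y))" if y: "y \<in> ?W" for y
    proof -
      have r: "flip_height c (Suc ?j) y = flip_height c ?j y" by (simp add: flip_height_def cs)
      have ri: "flip_height c ?j y \<in> interior (Qplus c)" using y by simp
      have yQ: "y \<in> Qplus c" using y interior_in_Q by blast
      have "y \<in> cell c ?j \<or> y \<in> cell c (Suc ?j)" using y unfolding cell_iff cs by auto
      then have "cell_flip c (sp c 1 y) = sp c (-1) (flip_height c ?j y)"
        using cell_flip_sp[OF yQ, of _ 1] flip_in_cell_flip_height[of y _ 1] interior_in_Q[OF ri] r by auto
      then show ?thesis using chart_fold_interior[OF ri] by simp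
    qed
    ultimately show ?thesis
      by (intro local_affine_witness[where W = ?W and g = "\<lambda>y. fold_edge c 0 (flip_height c ?j y)", OF _ _ fold_flip_height_affine]) blast+
  qed
qed

lemma cell_flip_local_edge_0:
  assumes x: "x \<in> open_edge c 0"
  shows "\<exists>W. open W \<and> x \<in> W \<and> (\<forall>y\<in>W. move_B y \<in> chart_domain c 0 \<and> cell_flip c (chart_param c 0 y) = chart_param c 0 (move_B y))"
proof -
  have P1: "P c 1 = pt 0 1" using P_pos[of c 0] by simp
  have f0: "fold_edge c 0 y = pt (- skew y) (1 - height y)" for y by (simp add: fold_edge_def P1 vec2_eq_iff)
  have Be: "move_B y = y" if "y \<in> open_edge c 0" for y
    using that mem_open_edge_iff[of y c 0] by (simp add: move_B_def edge_0_iff vec2_eq_iff)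
  have rv: "flip_height c 0 y = fold_edge c 0 (move_B y)" for y by (simp add: flip_height_def f0 move_B_def cell_row_def)
  have col1: "2 \<le> col_at c (Suc 0)" using col_gap[OF c, of 0] by simp
  let ?D = "chart_domain c 0"
  let ?W = "?D \<inter> move_B -` ?D \<inter> {y. 0 < height y \<and> height y < 1 \<and> - 1 < skew y \<and> skew y < 1}"
  have "continuous_on UNIV move_B" unfolding move_B_def by (intro continuous_intros)
  then have "open ?W" by (intro open_Int open_vimage open_chart_domain c open_Collect_conj open_Collect_less continuous_intros)
  moreover have "x \<in> ?W"
  proof -
    have e: "x \<in> edge c 0" "x \<noteq> 0" "x \<noteq> P c 1" using x by (simp_all add: mem_open_edge_iff)
    then have "skew x = 0" "0 < height x" "height x < 1" by (auto simp: edge_0_iff P1 vec2_eq_iff less_le)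
    then show ?thesis using x Be[OF x] by (simp add: mem_chart_domain)
  qed
  moreover have "cell_flip c (chart_param c 0 y) = chart_param c 0 (move_B y)" if y: "y \<in> ?W" for y
  proof -
    have cell0: "w \<in> cell c 0" if "0 \<le> skew w" "skew w < 1" "0 < height w" "height w < 1" for w
      using that col1 by (simp add: cell_def cell_col_def cell_row_def)
    have pos: "0 < skew w" if "w \<in> interior (Qplus c)" for w using that interior_Qplus_iff[OF c] by blast
    have zero: "skew w = 0" if "w \<in> open_edge c 0" for w using that by (simp add: mem_open_edge_iff edge_0_iff)
    have sk: "skew (move_B y) = - skew y" "height (move_B y) = height y" by (simp_all add: move_B_def)
    consider (pos) "y \<in> interior (Qplus c)" | (edge) "y \<in> open_edge c 0" | (neg) "fold_edge c 0 y \<in> interior (Qplus c)"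
      using y by (auto simp: mem_chart_domain)
    then show ?thesis
    proof cases
      case pos
      have sy: "0 < skew y" using pos \<open>\<And>w. w \<in> interior (Qplus c) \<Longrightarrow> 0 < skew w\<close> by blast
      have "move_B y \<notin> interior (Qplus c)" "move_B y \<notin> open_edge c 0"
        using \<open>\<And>w. w \<in> interior (Qplus c) \<Longrightarrow> 0 < skew w\<close>[of "move_B y"] zero[of "move_B y"] sk sy by auto
      then have f: "fold_edge c 0 (move_B y) \<in> interior (Qplus c)" using y by (auto simp: mem_chart_domain)
      have "cell_flip c (sp c 1 y) = sp c (-1) (flip_height c 0 y)"
        using cell_flip_sp[OF interior_in_Q[OF pos] cell0, of 1] flip_in_cell_flip_height[of y 0 1] cell0[of y] interior_in_Q[OF f] rv[of y] sy y by simp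
      then show ?thesis using chart_interior(1)[OF pos] chart_fold_interior(1)[OF f, of 0] rv[of y] by simp
    next
      case edge
      have e: "fold_edge c 0 y \<in> Qplus c" using fold_in_open_edge[OF edge] open_edge_in_Qplus by blast
      have "cell_flip c (sp c 1 y) = sp c (-1) (flip_height c 0 y)"
        using cell_flip_sp[OF open_edge_in_Qplus[OF edge] cell0, of 1] flip_in_cell_flip_height[of y 0 1] cell0[of y] e rv[of y] Be[OF edge] y zero[OF edge] by simp
      also have "\<dots> = sp c 1 y" using rv[of y] Be[OF edge] sp_fold[of y c 0 1] edge mem_open_edge_iff by simp
      finally show ?thesis using Be[OF edge] open_edge_in_Qplus[OF edge] by (simp add: chart_param_sp)
    next
      case neg
      let ?w = "fold_edge c 0 y"
      have sy: "0 < skew ?w" using neg \<open>\<And>w. w \<in> interior (Qplus c) \<Longrightarrow> 0 < skew w\<close> by blast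
      then have sy': "skew y < 0" by (simp add: f0)
      have "move_B y \<notin> open_edge c 0" "fold_edge c 0 (move_B y) \<notin> interior (Qplus c)"
        using \<open>\<And>w. w \<in> interior (Qplus c) \<Longrightarrow> 0 < skew w\<close>[of "fold_edge c 0 (move_B y)"] zero[of "move_B y"] sk sy' by (auto simp: f0)
      then have b: "move_B y \<in> interior (Qplus c)" using y by (auto simp: mem_chart_domain)
      have r: "flip_height c 0 ?w = move_B y" unfolding rv by (simp add: f0 move_B_def)
      have "?w \<in> cell c 0" using cell0[of ?w] sy y by (simp add: f0)
      then have "cell_flip c (sp c (-1) ?w) = sp c 1 (move_B y)"
        using cell_flip_sp[OF interior_in_Q[OF neg], of 0 "-1"] flip_in_cell_flip_height[of ?w 0 "-1"] r interior_in_Q[OF b] by simp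
      then show ?thesis using chart_fold_interior(1)[OF neg, of 0] chart_interior(1)[OF b] by simp
    qed
  qed
  ultimately show ?thesis by (intro exI[of _ ?W]) auto
qed

lemma move_B_fold: "move_B (fold_edge c k y) = move_B (P c k + P c (k + 1)) - move_B y"
  by (simp add: move_B_def fold_edge_def vec2_eq_iff)

lemma local_affine_cell_flip: "local_affine c move_B (cell_flip c)"
  unfolding local_affine_def
proof (intro allI ballI)
  fix k x assume x: "x \<in> chart_domain c k"
  let ?goal = "\<exists>k' \<tau> W. open W \<and> x \<in> W \<and> (\<forall>y\<in>W. move_B y + \<tau> \<in> chart_domain c k' \<and> cell_flip c (chart_param c k y) = chart_param c k' (move_B y + \<tau>))"
  consider (int) "x \<in> interior (Qplus c)" | (edge) "x \<in> open_edge c k" | (fold) "fold_edge c k x \<in> interior (Qplus c)"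
    using x by (auto simp: mem_chart_domain)
  then show ?goal
  proof cases
    case int
    then obtain k' \<tau> W where W: "open W" "x \<in> W" "\<And>y. y \<in> W \<Longrightarrow> y \<in> interior (Qplus c)"
      "\<And>y. y \<in> W \<Longrightarrow> move_B y + \<tau> \<in> chart_domain c k' \<and> cell_flip c (sp c 1 y) = chart_param c k' (move_B y + \<tau>)"
      using cell_flip_local_interior[OF int] by blast
    then show ?thesis using chart_interior(1)[OF W(3)] by (intro exI[of _ k'] exI[of _ \<tau>] exI[of _ W]) auto
  next
    case fold
    then obtain k' \<tau> W where W: "open W" "fold_edge c k x \<in> W" "\<And>y. y \<in> W \<Longrightarrow> y \<in> interior (Qplus c)"
      "\<And>y. y \<in> W \<Longrightarrow> move_B y + \<tau> \<in> chart_domain c k' \<and> cell_flip c (sp c 1 y) = chart_param c k' (move_B y + \<tau>)"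
      using cell_flip_local_interior[OF fold] by blast
    let ?t = "P c k' + P c (k' + 1) - move_B (P c k + P c (k + 1)) - \<tau>"
    have op: "open (fold_edge c k -` W)" unfolding fold_edge_def by (intro open_vimage W(1) continuous_intros)
    have img: "move_B y + ?t \<in> chart_domain c k' \<and> cell_flip c (chart_param c k y) = chart_param c k' (move_B y + ?t)"
      if y: "fold_edge c k y \<in> W" for y
    proof -
      let ?w = "fold_edge c k y"
      have e: "fold_edge c k' (move_B ?w + \<tau>) = move_B y + ?t" by (simp add: move_B_fold) (simp add: fold_edge_def)
      have w: "?w \<in> interior (Qplus c)" "move_B ?w + \<tau> \<in> chart_domain c k'" "cell_flip c (sp c 1 ?w) = chart_param c k' (move_B ?w + \<tau>)"
        using W y by blast+
      have "cell_flip c (chart_param c k y) = cell_flip c (rotation c (sp c 1 ?w))"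
        using chart_fold_interior(1)[OF w(1), of k] by simp
      also have "\<dots> = rotation c (chart_param c k' (move_B ?w + \<tau>))"
        using cell_flip_rotation[of "sp c 1 ?w"] interior_in_Q[OF w(1)] w(3) by simp
      also have "\<dots> = chart_param c k' (move_B y + ?t)" using rotation_chart_param[OF c w(2)] e by simp
      finally show ?thesis using fold_chart_domain[OF w(2)] e by simp
    qed
    show ?thesis
    proof (intro exI[of _ k'] exI[of _ ?t] exI[of _ "fold_edge c k -` W"] conjI ballI op)
      show "x \<in> fold_edge c k -` W" using W(2) by simp
      fix y assume "y \<in> fold_edge c k -` W"
      then have y: "fold_edge c k y \<in> W" by simp
      show "move_B y + ?t \<in> chart_domain c k'" by (rule img[OF y, THEN conjunct1])
      show "cell_flip c (chart_param c k y) = chart_param c k' (move_B y + ?t)" by (rule img[OF y, THEN conjunct2])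
    qed
  next
    case edge
    show ?thesis
    proof (cases "k = 0")
      case True
      then have "x \<in> open_edge c 0" using edge by simp
      from cell_flip_local_edge_0[OF this] obtain W where W: "open W" "x \<in> W"
        "\<forall>y\<in>W. move_B y \<in> chart_domain c 0 \<and> cell_flip c (chart_param c 0 y) = chart_param c 0 (move_B y)"
        by (elim exE conjE)
      show ?thesis
        by (intro exI[of _ 0] exI[of _ "0::real^2"] exI[of _ W] conjI W(1,2)) (use W(3) True in simp)
    next
      case False
      then obtain j where j: "k = cell_edge j" by (rule cell_edge_surj)
      let ?W = "{z. real (cell_col j) < gx c z \<and> gx c z < real (Suc (cell_col j)) \<and> real (cell_row j) < gy c z \<and> gy c z < real (Suc (cell_row j))}"
      have W: "x \<in> ?W"
      proof -
        have xe: "x \<in> edge c (cell_edge j)" "x \<noteq> P c (cell_edge j)" "x \<noteq> P c (cell_edge j + 1)" using edge j by (simp_all add: mem_open_edge_iff)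
        obtain t where t: "0 < t" "t < 1" "x = (1 - t) *\<^sub>R P c (cell_edge j) + t *\<^sub>R P c (cell_edge j + 1)"
          using edge mem_open_edge[OF c] j by blast
        have cl: "col_at c (cell_col j) < col_at c (Suc (cell_col j))" "row_at c (cell_row j) < row_at c (Suc (cell_row j))"
          using grid_less[OF grid_col[OF c]] grid_less[OF grid_row[OF c]] by auto
        have mid: "a < (1 - t) * a + t * b \<and> (1 - t) * a + t * b < b \<and> a < (1 - t) * b + t * a \<and> (1 - t) * b + t * a < b" if "a < b" for a b
        proof -
          have "t * (b - a) > 0" "(1 - t) * (b - a) > 0" using t that by auto
          then show ?thesis by (simp add: algebra_simps)
        qed
        have "col_at c (cell_col j) < skew x \<and> skew x < col_at c (Suc (cell_col j)) \<and> row_at c (cell_row j) < height x \<and> height x < row_at c (Suc (cell_row j))"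
        proof (cases "even j")
          case True
          then show ?thesis unfolding t(3) cell_edge_def using mid[OF cl(1)] mid[OF cl(2)] cell_row_eq(1)[OF True]
            by (simp only: if_True P_lower) simp
        next
          case False
          then show ?thesis unfolding t(3) cell_edge_def using mid[OF cl(1)] mid[OF cl(2)] cell_row_eq(2)[OF False]
            by (simp only: if_False P_upper) simp
        qed
        then show ?thesis by (simp only: mem_Collect_eq gx_cell[OF c] gy_cell[OF c])
      qed
      have "flip_skew c j y \<in> chart_domain c (cell_edge j) \<and> cell_flip c (chart_param c k y) = chart_param c (cell_edge j) (flip_skew c j y)" if y: "y \<in> ?W" for y
      proof -
        have yc: "y \<in> cell c j" using y unfolding cell_iff by simp
        have "flip_skew c j y \<in> chart_domain c (cell_edge j)" using y by (intro open_cell_in_chart) (simp_all add: gx_flip_skew[OF yc])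
        then show ?thesis using cell_flip_chart_cell[OF yc] j by simp
      qed
      then show ?thesis using open_cell_interior W unfolding flip_skew_affine
        by (intro exI[of _ "cell_edge j"] exI[of _ "pt (col_at c (cell_col j) + col_at c (Suc (cell_col j))) 0"] exI[of _ ?W]) auto
    qed
  qed
qed

lemma local_affine_rotation: "local_affine c uminus (rotation c)"
  unfolding local_affine_def
proof (intro allI ballI)
  fix k x assume x: "x \<in> chart_domain c k"
  have "- y + (P c k + P c (k + 1)) = fold_edge c k y" for y by (simp add: fold_edge_def)
  then show "\<exists>k' \<tau> W. open W \<and> x \<in> W \<and> (\<forall>y\<in>W. - y + \<tau> \<in> chart_domain c k' \<and> rotation c (chart_param c k y) = chart_param c k' (- y + \<tau>))"
    using x rotation_chart_param[OF c] fold_chart_domain open_chart_domain[OF c]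
    by (intro exI[of _ k] exI[of _ "P c k + P c (k + 1)"] exI[of _ "chart_domain c k"]) auto
qed

lemma local_affine_symmetry:
  assumes f: "symmetry c e m f" shows "local_affine c (\<lambda>y. f y - f 0) (surface_map c c f)"
  unfolding local_affine_def
proof (intro allI ballI)
  fix k x assume x: "x \<in> chart_domain c k"
  show "\<exists>k' \<tau> W. open W \<and> x \<in> W \<and> (\<forall>y\<in>W. f y - f 0 + \<tau> \<in> chart_domain c k' \<and> surface_map c c f (chart_param c k y) = chart_param c k' (f y - f 0 + \<tau>))"
    using x symmetry_chart[OF c f] open_chart_domain[OF c]
    by (intro exI[of _ "edge_index e m k"] exI[of _ "f 0"] exI[of _ "chart_domain c k"]) auto
qed

lemma saddle_transfer:
  assumes \<gamma>: "saddle_connection_along c v \<gamma>" and M: "linear M" "M v \<noteq> 0" and la: "local_affine c M \<Phi>"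
    and cont: "continuous_map (surface c) (surface c) \<Phi>"
    and sing: "\<And>C. C \<in> topspace (surface c) \<Longrightarrow> \<Phi> C \<in> singularities c \<longleftrightarrow> C \<in> singularities c"
  shows "saddle_connection_along c (M v) (\<Phi> \<circ> \<gamma>)"
proof -
  have path: "continuous_map (top_of_set {0..1}) (surface c) \<gamma>" using \<gamma> by (simp add: saddle_connection_along_def pathin_def)
  then have top: "\<gamma> t \<in> topspace (surface c)" if "t \<in> {0..1}" for t using that by (auto simp: continuous_map_def)
  have "\<exists>k x e. e > 0 \<and> (\<forall>u. \<bar>u - t\<bar> < e \<longrightarrow> x + (u - t) *\<^sub>R M v \<in> chart_domain c k \<and>
      (\<Phi> \<circ> \<gamma>) u = chart_param c k (x + (u - t) *\<^sub>R M v))" if t: "t \<in> {0<..<1}" for t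
  proof -
    obtain k x e where e: "e > 0" "\<And>u. \<bar>u - t\<bar> < e \<Longrightarrow> x + (u - t) *\<^sub>R v \<in> chart_domain c k \<and> \<gamma> u = chart_param c k (x + (u - t) *\<^sub>R v)"
      using \<gamma> t unfolding saddle_connection_along_def by blast
    have "x \<in> chart_domain c k" using e(2)[of t] e(1) by simp
    from la[unfolded local_affine_def, rule_format, OF this]
    obtain k' \<tau> W where W: "open W" "x \<in> W"
      "\<forall>y\<in>W. M y + \<tau> \<in> chart_domain c k' \<and> \<Phi> (chart_param c k y) = chart_param c k' (M y + \<tau>)"
      by (elim exE conjE)
    have "open ((\<lambda>u. x + (u - t) *\<^sub>R v) -` W)" by (intro open_vimage W(1) continuous_intros)
    moreover have "t \<in> (\<lambda>u. x + (u - t) *\<^sub>R v) -` W" using W(2) by simp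
    ultimately obtain d where d: "d > 0" "ball t d \<subseteq> (\<lambda>u. x + (u - t) *\<^sub>R v) -` W" by (meson openE)
    have Mu: "M (x + (u - t) *\<^sub>R v) + \<tau> = (M x + \<tau>) + (u - t) *\<^sub>R M v" for u
      using M(1) by (simp add: linear_add linear_scale)
    have "(M x + \<tau>) + (u - t) *\<^sub>R M v \<in> chart_domain c k' \<and> (\<Phi> \<circ> \<gamma>) u = chart_param c k' ((M x + \<tau>) + (u - t) *\<^sub>R M v)"
      if u: "\<bar>u - t\<bar> < min e d" for u
    proof -
      have "u \<in> ball t d" using u by (simp add: dist_real_def abs_minus_commute)
      then have "x + (u - t) *\<^sub>R v \<in> W" using d(2) by blast
      from W(3)[rule_format, OF this] show ?thesis unfolding Mu using e(2)[of u] u by simp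
    qed
    then show ?thesis using e(1) d(1) by (intro exI[of _ k'] exI[of _ "M x + \<tau>"] exI[of _ "min e d"]) auto
  qed
  moreover have "pathin (surface c) (\<Phi> \<circ> \<gamma>)" unfolding pathin_def by (rule continuous_map_compose[OF path cont])
  ultimately show ?thesis
    using \<gamma> M(2) sing top unfolding saddle_connection_along_def by (auto simp: less_imp_le)
qed

end

section \<open>Cylinders and the discreteness of holonomy\<close>

text \<open>
  The total widths of finite sequences of cylinders, where cylinder \<open>n\<close> has width
  \<open>a (n + 1) - a n\<close>.
\<close>

inductive_set level_sums :: "(nat \<Rightarrow> real) \<Rightarrow> real set" for a where
  zero: "0 \<in> level_sums a"
| add: "x \<in> level_sums a \<Longrightarrow> x + (a (Suc n) - a n) \<in> level_sums a"

lemma level_sums_nonneg: assumes "grid a" "x \<in> level_sums a" shows "0 \<le> x"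
  using assms(2)
proof induction
  case (add x n)
  have "a n + 1 \<le> a (Suc n)" by (rule gridD[OF assms(1)])
  then show ?case using add.IH by linarith
qed (rule order_refl)

text \<open>
  The common situation of the horizontal and the slope one direction: a linear coordinate
  \<open>L\<close>, the values \<open>lev\<close> that it takes at the vertices, and a function
  \<open>\<sigma>\<close> on the surface that vanishes exactly on these levels. The complement of
  the levels is a union of cylinders, bounded by consecutive levels, whose widths grow at least
  linearly.
\<close>

locale level_structure =
  fixes c :: real and L :: "real^2 \<Rightarrow> real" and lev :: "nat \<Rightarrow> real" and \<sigma> :: "surface_point \<Rightarrow> real"
  assumes c: "c \<ge> 1" and lin: "linear L" and grid: "grid lev"
    and cont_\<sigma>: "continuous_map (surface c) euclideanreal \<sigma>"
    and \<sigma>_sp: "sheet s \<Longrightarrow> \<sigma> (sp c s z) = sin (pi * interpolate lev real (L z))"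
    and L_nonneg: "z \<in> Qplus c \<Longrightarrow> 0 \<le> L z"
    and edge_level: "z \<in> edge c k \<Longrightarrow>
      (\<exists>n. lev n \<le> L z \<and> L z \<le> lev (Suc n) \<and> L (fold_edge c k z) = lev n + lev (Suc n) - L z) \<or>
      (L z = 0 \<and> L (fold_edge c k z) = 0)"
    and vertex_level: "\<exists>n. L (P c k) = lev n"
    and L_gap: "lev (Suc n) - lev n \<ge> real n + 1"
begin

lemma L_cont [continuous_intros]:
  assumes "continuous_on S f" shows "continuous_on S (\<lambda>x. L (f x))"
  by (rule bounded_linear.continuous_on[OF lin[unfolded linear_conv_bounded_linear] assms])

lemma L_line: "L (x + r *\<^sub>R v) = L x + r * L v" "L (x - y) = L x - L y" "L (x + y) = L x + L y" "L (- x) = - L x"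
  "L (r *\<^sub>R v) = r * L v"
  using lin by (simp_all add: linear_add linear_scale linear_diff linear_neg)

lemma L_fold: "L (fold_edge c k x) = L (P c k) + L (P c (k + 1)) - L x"
  by (simp add: fold_edge_def L_line)

lemma gap_unique: assumes "lev n < r" "r < lev (Suc n)" "lev m < r" "r < lev (Suc m)" shows "m = n"
proof -
  have "lev n < lev (Suc m)" "lev m < lev (Suc n)" using assms by linarith+
  then show ?thesis using grid_less[OF grid] by simp
qed

text \<open>
  The number of the cylinder and the distance from the boundary that a path with increasing
  \<open>L\<close> crosses first. The second polygon is rotated, so on sheet \<open>-1\<close>
  this is the boundary with the larger folded coordinate. Points on the levels get
  \<open>None\<close>.
\<close>

definition sheet_cylinder :: "real \<Rightarrow> real^2 \<Rightarrow> (nat \<times> real) option" where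
  "sheet_cylinder s z = (if \<exists>n. lev n < L z \<and> L z < lev (Suc n)
     then (let n = SOME n. lev n < L z \<and> L z < lev (Suc n)
           in Some (n, if s = 1 then L z - lev n else lev (Suc n) - L z))
     else None)"

lemma sheet_cylinder_Some: assumes "lev n < L z" "L z < lev (Suc n)"
  shows "sheet_cylinder s z = Some (n, if s = 1 then L z - lev n else lev (Suc n) - L z)"
proof -
  have "(SOME n. lev n < L z \<and> L z < lev (Suc n)) = n"
    by (rule some_equality) (use assms gap_unique in blast)+
  then show ?thesis using assms unfolding sheet_cylinder_def by auto
qed

lemma sheet_cylinder_level: "sheet_cylinder s (z :: real^2) = None" if "L z = lev n" for z
proof -
  have "\<not> (lev m < L z \<and> L z < lev (Suc m))" for m
    using that grid_less[OF grid, of m n] grid_less[OF grid, of n "Suc m"] by auto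
  then have no: "\<not> (\<exists>m. lev m < L z \<and> L z < lev (Suc m))" by blast
  show ?thesis unfolding sheet_cylinder_def by (rule if_not_P[OF no])
qed

lemma sheet_cylinder_SomeD: assumes "sheet_cylinder s z = Some (n, r)"
  shows "lev n < L z" "L z < lev (Suc n)" "r = (if s = 1 then L z - lev n else lev (Suc n) - L z)"
proof -
  have "\<exists>m. lev m < L z \<and> L z < lev (Suc m)"
  proof (rule ccontr)
    assume no: "\<not> (\<exists>m. lev m < L z \<and> L z < lev (Suc m))"
    have "sheet_cylinder s z = None" unfolding sheet_cylinder_def by (rule if_not_P[OF no])
    then show False using assms by simp
  qed
  then obtain m where m: "lev m < L z" "L z < lev (Suc m)" by blast
  then have "m = n \<and> r = (if s = 1 then L z - lev n else lev (Suc n) - L z)"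
    using sheet_cylinder_Some[OF m, of s] assms by auto
  then show "lev n < L z" "L z < lev (Suc n)" "r = (if s = 1 then L z - lev n else lev (Suc n) - L z)" using m by auto
qed

lemma sheet_cylinder_None: assumes "z \<in> Qplus c" "sheet_cylinder s z = None" obtains n where "L z = lev n"
proof -
  obtain n where n: "lev n \<le> L z" "L z < lev (Suc n)" using grid_cell[OF grid L_nonneg[OF assms(1)]] .
  then have "L z = lev n" using sheet_cylinder_Some[of n z s] assms(2) by (cases "lev n < L z") auto
  then show ?thesis by (rule that)
qed

lemma glue_invariant_sheet_cylinder: "glue_invariant c sheet_cylinder"
  unfolding glue_invariant_def
proof (intro allI ballI)
  fix k z assume z: "z \<in> edge c k"
  from edge_level[OF z] show "sheet_cylinder 1 z = sheet_cylinder (-1) (fold_edge c k z)"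
  proof
    assume "\<exists>n. lev n \<le> L z \<and> L z \<le> lev (Suc n) \<and> L (fold_edge c k z) = lev n + lev (Suc n) - L z"
    then obtain n where n: "lev n \<le> L z" "L z \<le> lev (Suc n)" "L (fold_edge c k z) = lev n + lev (Suc n) - L z" by blast
    consider "L z = lev n" | "L z = lev (Suc n)" | "lev n < L z" "L z < lev (Suc n)" using n by linarith
    then show ?thesis
    proof cases
      case 1
      then show ?thesis using sheet_cylinder_level[of z n 1] sheet_cylinder_level[of "fold_edge c k z" "Suc n" "-1"] n by simp
    next
      case 2
      then show ?thesis using sheet_cylinder_level[of z "Suc n" 1] sheet_cylinder_level[of "fold_edge c k z" n "-1"] n by simp
    next
      case 3
      then show ?thesis using sheet_cylinder_Some[of n z 1] sheet_cylinder_Some[of n "fold_edge c k z" "-1"] n by simp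
    qed
  next
    assume "L z = 0 \<and> L (fold_edge c k z) = 0"
    then show ?thesis using sheet_cylinder_level[of z 0 1] sheet_cylinder_level[of "fold_edge c k z" 0 "-1"] grid_0[OF grid] by simp
  qed
qed

definition cylinder :: "surface_point \<Rightarrow> (nat \<times> real) option" where "cylinder = lift sheet_cylinder"

lemma cylinder_sp: "sheet s \<Longrightarrow> cylinder (sp c s z) = sheet_cylinder s z"
  unfolding cylinder_def by (rule lift_sp[OF glue_invariant_sheet_cylinder])

text \<open>
  The value of \<open>\<sigma>\<close> at distance \<open>r\<close> from the boundary of cylinder
  \<open>n\<close>; by symmetry it is the same from both sides.
\<close>

definition wave :: "nat \<Rightarrow> real \<Rightarrow> real" where "wave n r = sin (pi * interpolate lev real (lev n + r))"

lemma wave_nonzero: assumes "0 < r" "r < lev (Suc n) - lev n" shows "wave n r \<noteq> 0"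
proof
  assume "wave n r = 0"
  then obtain i where i: "interpolate lev real (lev n + r) = of_int i" by (auto simp: wave_def sin_pi_eq_0 Ints_def)
  have "interpolate lev real (lev n) < interpolate lev real (lev n + r)" "interpolate lev real (lev n + r) < interpolate lev real (lev (Suc n))"
    using assms by (simp_all add: interpolate_less_iff[OF grid grid_real])
  then have "real_of_int (int n) < of_int i" "real_of_int i < of_int (int n + 1)" using i by (simp_all add: grid)
  then have "int n < i" "i < int n + 1" by (simp_all only: of_int_less_iff)
  then show False by simp
qed

lemma wave_ends: "wave n 0 = 0" "wave n (lev (Suc n) - lev n) = 0"
proof -
  have "interpolate lev real (lev n) = real n" "interpolate lev real (lev (Suc n)) = real (Suc n)" by (simp_all only: interpolate_at[OF grid])
  then show "wave n 0 = 0" "wave n (lev (Suc n) - lev n) = 0" by (simp_all only: wave_def) (simp_all add: sin_pi_eq_0)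
qed

lemma continuous_wave [continuous_intros]:
  fixes f :: "'a :: t2_space \<Rightarrow> real"
  assumes "continuous_on S f" shows "continuous_on S (\<lambda>x. wave n (f x))"
  unfolding wave_def
  by (rule continuous_on_sin, rule continuous_on_mult_left, rule continuous_on_interpolate[OF grid grid_real],
      rule continuous_on_add[OF continuous_on_const assms])

lemma cylinder_bounds: assumes "C \<in> topspace (surface c)" "cylinder C = Some (n, r)"
  shows "0 < r" "r < lev (Suc n) - lev n" "\<sigma> C = wave n r"
proof -
  obtain s z where s: "sheet s" "z \<in> Qplus c" "C = sp c s z" using assms(1) by (rule surface_cases)
  have "sheet_cylinder s z = Some (n, r)" using assms(2) cylinder_sp[OF s(1)] s(3) by simp
  note m = sheet_cylinder_SomeD(1,2)[OF this] and e = sheet_cylinder_SomeD(3)[OF this]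
  show "0 < r" "r < lev (Suc n) - lev n" using m e by auto
  show "\<sigma> C = wave n r"
  proof (cases "s = 1")
    case True
    then show ?thesis using \<sigma>_sp[OF s(1)] s(3) e by (simp add: wave_def)
  next
    case False
    have eq: "lev n + r = lev n + lev (Suc n) - L z" using e False by simp
    have "interpolate lev real (lev n + r) = interpolate lev real (lev n + lev (Suc n) - L z)" unfolding eq ..
    also have "\<dots> = real n + real (Suc n) - interpolate lev real (L z)" using m e by (intro interpolate_reflect[OF grid]) auto
    also have "\<dots> = 2 * real n + 1 - interpolate lev real (L z)" by simp
    finally show ?thesis unfolding wave_def using \<sigma>_sp[OF s(1)] s(3) sin_odd_minus by simp
  qed
qed

lemma cylinder_None: assumes "C \<in> topspace (surface c)" "cylinder C = None" shows "\<sigma> C = 0"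
proof -
  obtain s z where s: "sheet s" "z \<in> Qplus c" "C = sp c s z" using assms(1) by (rule surface_cases)
  have "sheet_cylinder s z = None" using assms(2) cylinder_sp[OF s(1)] s(3) by simp
  then obtain n where "L z = lev n" by (rule sheet_cylinder_None[OF s(2)])
  then show ?thesis using \<sigma>_sp[OF s(1), of z] s(3) interpolate_at[OF grid, of real n] by (simp add: sin_pi_eq_0)
qed

lemma \<sigma>_zero_iff: "C \<in> topspace (surface c) \<Longrightarrow> \<sigma> C = 0 \<longleftrightarrow> cylinder C = None"
  using cylinder_None cylinder_bounds wave_nonzero by (cases "cylinder C") fastforce+

lemma cylinder_chart_Some:
  assumes x: "x \<in> chart_domain c k" and C: "cylinder (chart_param c k x) = Some (n, r)"
  shows "\<exists>W. open W \<and> x \<in> W \<and> (\<forall>y\<in>W. cylinder (chart_param c k y) = Some (n, r + (L y - L x)))"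
proof -
  let ?I = "interior (Qplus c)"
  let ?B = "\<lambda>f. {y. lev n < L (f y)} \<inter> {y. L (f y) < lev (Suc n)}"
  have oB: "open (?B f)" if "continuous_on UNIV f" for f :: "real^2 \<Rightarrow> real^2"
    by (intro open_Int open_Collect_less continuous_intros that)
  have cf: "continuous_on UNIV (fold_edge c k)" unfolding fold_edge_def by (intro continuous_intros)
  consider (int) "x \<in> ?I" | (edge) "x \<in> open_edge c k" | (fold) "fold_edge c k x \<in> ?I"
    using x by (auto simp: mem_chart_domain)
  then show ?thesis
  proof cases
    case int
    have "sheet_cylinder 1 x = Some (n, r)" using C chart_interior(1)[OF c int] cylinder_sp by simp
    from sheet_cylinder_SomeD[OF this] have g: "lev n < L x" "L x < lev (Suc n)" "r = L x - lev n" by simp_all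
    have "cylinder (chart_param c k y) = Some (n, r + (L y - L x))" if "y \<in> ?I \<inter> ?B (\<lambda>y. y)" for y
      using that chart_interior(1)[OF c, of y k] cylinder_sp sheet_cylinder_Some[of n y 1] g by simp
    moreover have "open (?I \<inter> ?B (\<lambda>y. y))" by (intro open_Int[OF open_interior oB] continuous_intros)
    ultimately show ?thesis using int g by (intro exI[of _ "?I \<inter> ?B (\<lambda>y. y)"]) auto
  next
    case fold
    have "cylinder (sp c (-1) (fold_edge c k x)) = Some (n, r)"
      using C chart_fold_interior(1)[OF c fold, of k] by simp
    then have "sheet_cylinder (-1) (fold_edge c k x) = Some (n, r)" by (simp add: cylinder_sp)
    from sheet_cylinder_SomeD[OF this] have g: "lev n < L (fold_edge c k x)" "L (fold_edge c k x) < lev (Suc n)" "r = lev (Suc n) - L (fold_edge c k x)" by simp_all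
    let ?W = "fold_edge c k -` ?I \<inter> ?B (fold_edge c k)"
    have "cylinder (chart_param c k y) = Some (n, r + (L y - L x))" if y: "y \<in> ?W" for y
    proof -
      have "chart_param c k y = sp c (-1) (fold_edge c k y)" using chart_fold_interior(1)[OF c, of "fold_edge c k y" k] y by simp
      then show ?thesis using y cylinder_sp[of "-1"] sheet_cylinder_Some[of n "fold_edge c k y" "-1"] g by (simp add: L_fold)
    qed
    moreover have "open ?W" by (intro open_Int oB cf open_vimage[OF open_interior])
    ultimately show ?thesis using fold g by (intro exI[of _ ?W]) auto
  next
    case edge
    have xe: "x \<in> edge c k" using edge mem_open_edge_iff by blast
    have "chart_param c k x = sp c 1 x" using open_edge_in_Qplus[OF edge] by (simp add: chart_param_sp)
    then have "sheet_cylinder 1 x = Some (n, r)" using C cylinder_sp by simp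
    from sheet_cylinder_SomeD[OF this] have g: "lev n < L x" "L x < lev (Suc n)" "r = L x - lev n" by simp_all
    have s: "L (P c k) + L (P c (k + 1)) = lev n + lev (Suc n)"
      using edge_level[OF xe]
    proof
      assume "\<exists>m. lev m \<le> L x \<and> L x \<le> lev (Suc m) \<and> L (fold_edge c k x) = lev m + lev (Suc m) - L x"
      then obtain m where m: "lev m \<le> L x" "L x \<le> lev (Suc m)" "L (fold_edge c k x) = lev m + lev (Suc m) - L x" by blast
      have "lev m < lev (Suc n)" "lev n < lev (Suc m)" using m g by linarith+
      then have "m = n" using grid_less[OF grid] by simp
      then show ?thesis using m(3) by (simp add: L_fold)
    next
      assume "L x = 0 \<and> L (fold_edge c k x) = 0"
      then show ?thesis using g(1) grid_ge[OF grid, of n] by simp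
    qed
    let ?W = "chart_domain c k \<inter> ?B (\<lambda>y. y)"
    have "cylinder (chart_param c k y) = Some (n, r + (L y - L x))" if y: "y \<in> ?W" for y
    proof (cases "y \<in> Qplus c")
      case True
      then show ?thesis using y g sheet_cylinder_Some[of n y 1] by (simp add: chart_param_sp cylinder_sp)
    next
      case False
      then show ?thesis using y g s sheet_cylinder_Some[of n "fold_edge c k y" "-1"] by (simp add: chart_param_sp cylinder_sp L_fold)
    qed
    moreover have "open ?W" by (intro open_Int open_chart_domain[OF c] open_Collect_less continuous_intros)
    ultimately show ?thesis using x g by (intro exI[of _ ?W]) auto
  qed
qed

lemma near_level:
  assumes "\<bar>r - lev m\<bar> < 1" "r \<noteq> lev m" "0 \<le> r"
  shows "\<exists>n. lev n < r \<and> r < lev (Suc n)"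
proof (cases "r > lev m")
  case True
  then show ?thesis using assms gridD[OF grid, of m] by (intro exI[of _ m]) auto
next
  case False
  then have "m \<noteq> 0" using assms grid_0[OF grid] by (intro notI) simp
  then obtain i where "m = Suc i" using not0_implies_Suc by blast
  then show ?thesis using assms gridD[OF grid, of i] False by (intro exI[of _ i]) auto
qed

lemma cylinder_chart_None:
  assumes x: "x \<in> chart_domain c k" and C: "cylinder (chart_param c k x) = None"
  shows "\<exists>W. open W \<and> x \<in> W \<and> (\<forall>y\<in>W. L y \<noteq> L x \<longrightarrow> cylinder (chart_param c k y) \<noteq> None)"
proof -
  let ?I = "interior (Qplus c)"
  let ?N = "{y. L y < L x + 1} \<inter> {y. L x - 1 < L y}"
  have oN: "open ?N" by (intro open_Int open_Collect_less continuous_intros)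
  have ok: "sheet_cylinder s y \<noteq> None" if "y \<in> Qplus c" "L z = lev m" "\<bar>L y - L z\<bar> < 1" "L y \<noteq> L z" for s y z m
    using near_level[of "L y" m] that L_nonneg sheet_cylinder_Some[of _ y s] by fastforce
  consider (int) "x \<in> ?I" | (edge) "x \<in> open_edge c k" | (fold) "fold_edge c k x \<in> ?I"
    using x by (auto simp: mem_chart_domain)
  then show ?thesis
  proof cases
    case int
    have "sheet_cylinder 1 x = None" using C chart_interior(1)[OF c int] cylinder_sp by simp
    then obtain m where m: "L x = lev m" using sheet_cylinder_None interior_in_Q[OF c int] by metis
    have "cylinder (chart_param c k y) \<noteq> None" if y: "y \<in> ?I \<inter> ?N" "L y \<noteq> L x" for y
      using ok[of y x m 1] y m interior_in_Q[OF c] chart_interior(1)[OF c, of y k] cylinder_sp[of 1 y] by auto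
    moreover have "open (?I \<inter> ?N)" by (intro open_Int[OF open_interior oN])
    ultimately show ?thesis using int by (intro exI[of _ "?I \<inter> ?N"]) auto
  next
    case fold
    have "cylinder (sp c (-1) (fold_edge c k x)) = None"
      using C chart_fold_interior(1)[OF c fold, of k] by simp
    then have "sheet_cylinder (-1) (fold_edge c k x) = None" by (simp add: cylinder_sp)
    then obtain m where m: "L (fold_edge c k x) = lev m" using sheet_cylinder_None interior_in_Q[OF c fold] by metis
    let ?W = "fold_edge c k -` ?I \<inter> ?N"
    have "cylinder (chart_param c k y) \<noteq> None" if y: "y \<in> ?W" "L y \<noteq> L x" for y
    proof -
      have "chart_param c k y = sp c (-1) (fold_edge c k y)" using chart_fold_interior(1)[OF c, of "fold_edge c k y" k] y by simp
      then show ?thesis using ok[of "fold_edge c k y" "fold_edge c k x" m "-1"] y m interior_in_Q[OF c] cylinder_sp[of "-1"] by (auto simp: L_fold)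
    qed
    moreover have "open ?W" unfolding fold_edge_def
      by (intro open_Int oN open_vimage[OF open_interior] continuous_intros)
    ultimately show ?thesis using fold by (intro exI[of _ ?W]) auto
  next
    case edge
    have xe: "x \<in> edge c k" "fold_edge c k x \<in> edge c k" using edge mem_open_edge_iff fold_in_edge by blast+
    have "chart_param c k x = sp c 1 x" using open_edge_in_Qplus[OF edge] by (simp add: chart_param_sp)
    then have 1: "cylinder (sp c 1 x) = None" using C by simp
    then have 2: "cylinder (sp c (-1) (fold_edge c k x)) = None" using sp_fold[OF xe(1), of 1] by simp
    have "x \<in> Qplus c" "sheet_cylinder 1 x = None" using 1 open_edge_in_Qplus[OF edge] cylinder_sp[of 1 x] by auto
    then obtain m where m: "L x = lev m" by (rule sheet_cylinder_None)
    have "fold_edge c k x \<in> Qplus c" "sheet_cylinder (-1) (fold_edge c k x) = None"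
      using 2 xe edge_subset_Qplus cylinder_sp[of "-1" "fold_edge c k x"] by auto
    then obtain m' where m': "L (fold_edge c k x) = lev m'" by (rule sheet_cylinder_None)
    let ?W = "chart_domain c k \<inter> ?N"
    have "cylinder (chart_param c k y) \<noteq> None" if y: "y \<in> ?W" "L y \<noteq> L x" for y
    proof (cases "y \<in> Qplus c")
      case True
      then show ?thesis using ok[of y x m 1] y m by (auto simp: chart_param_sp cylinder_sp)
    next
      case False
      then have "fold_edge c k y \<in> Qplus c" using y interior_in_Q[OF c] open_edge_in_Qplus by (auto simp: mem_chart_domain)
      then show ?thesis using False ok[of "fold_edge c k y" "fold_edge c k x" m' "-1"] y m' by (auto simp: chart_param_sp cylinder_sp L_fold)
    qed
    moreover have "open ?W" by (intro open_Int open_chart_domain[OF c] oN)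
    ultimately show ?thesis using x by (intro exI[of _ ?W]) auto
  qed
qed

text \<open>
  The widths are at least 1 and tend to infinity, so a bounded sum has few terms, all taken from
  finitely many cylinders.
\<close>

lemma finite_level_sums: "finite {x \<in> level_sums lev. x \<le> real N}"
proof (induction N)
  case 0
  have "{x \<in> level_sums lev. x \<le> real 0} \<subseteq> {0}" using level_sums_nonneg[OF grid] by force
  then show ?case by (rule finite_subset) simp
next
  case (Suc N)
  let ?S = "{x \<in> level_sums lev. x \<le> real N}"
  have "{x \<in> level_sums lev. x \<le> real (Suc N)} \<subseteq> insert 0 ((\<lambda>(x, n). x + (lev (Suc n) - lev n)) ` (?S \<times> {..Suc N}))"
  proof
    fix y assume "y \<in> {x \<in> level_sums lev. x \<le> real (Suc N)}"
    then have y: "y \<in> level_sums lev" "y \<le> real (Suc N)" by auto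
    from y(1) show "y \<in> insert 0 ((\<lambda>(x, n). x + (lev (Suc n) - lev n)) ` (?S \<times> {..Suc N}))"
    proof cases
      case (add x n)
      have "0 \<le> x" using level_sums_nonneg[OF grid] add by simp
      then have "real n + 1 \<le> real (Suc N)" "x \<le> real N" using L_gap[of n] add y(2) by simp_all
      then have "(x, n) \<in> ?S \<times> {..Suc N}" using add by simp
      then show ?thesis unfolding add(1) by (intro insertI2 image_eqI[of _ _ "(x, n)"]) simp_all
    qed simp
  qed
  then show ?case by (rule finite_subset) (use Suc in simp)
qed

context
  fixes v \<gamma> assumes \<gamma>: "saddle_connection_along c v \<gamma>"
begin

lemma \<gamma>_path: "continuous_map (top_of_set {0..1}) (surface c) \<gamma>"
  and \<gamma>_top: "t \<in> {0..1} \<Longrightarrow> \<gamma> t \<in> topspace (surface c)"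
proof -
  show *: "continuous_map (top_of_set {0..1}) (surface c) \<gamma>" using \<gamma> by (simp add: saddle_connection_along_def pathin_def)
  show "t \<in> {0..1} \<Longrightarrow> \<gamma> t \<in> topspace (surface c)" using * by (auto simp: continuous_map_def)
qed

lemma continuous_\<sigma>\<gamma>: "continuous_on {0..1} (\<lambda>t. \<sigma> (\<gamma> t))"
  using continuous_map_compose[OF \<gamma>_path cont_\<sigma>] by (simp add: o_def)

lemma \<sigma>_singular: "C \<in> singularities c \<Longrightarrow> \<sigma> C = 0"
proof -
  assume "C \<in> singularities c"
  then obtain s k where s: "sheet s" "C = sp c s (P c k)" by (auto simp: singularities_sp)
  obtain n where "L (P c k) = lev n" using vertex_level by blast
  then have "sheet_cylinder s (P c k) = None" by (rule sheet_cylinder_level)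
  then show ?thesis using cylinder_None[of C] s cylinder_sp by simp
qed

lemma \<gamma>_ends: "\<gamma> 0 \<in> singularities c" "\<gamma> 1 \<in> singularities c"
  using \<gamma> by (simp_all add: saddle_connection_along_def)

lemma \<gamma>_chart: assumes "t \<in> {0<..<1}"
  obtains k x e where "e > 0" "x \<in> chart_domain c k" "\<And>u. \<bar>u - t\<bar> < e \<Longrightarrow> \<gamma> u = chart_param c k (x + (u - t) *\<^sub>R v)"
proof -
  obtain k x e where e: "e > 0" "\<forall>u. \<bar>u - t\<bar> < e \<longrightarrow> x + (u - t) *\<^sub>R v \<in> chart_domain c k \<and> \<gamma> u = chart_param c k (x + (u - t) *\<^sub>R v)"
    using \<gamma> assms unfolding saddle_connection_along_def by blast
  have "x \<in> chart_domain c k" using e(1) e(2)[rule_format, of t] by simp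
  then show ?thesis using that[OF e(1), of x k] e(2) by simp
qed

lemma pull_open:
  assumes "open W" "x \<in> W" obtains d where "d > 0" "\<And>u. \<bar>u - t\<bar> < d \<Longrightarrow> x + (u - t) *\<^sub>R v \<in> W"
proof -
  have "open ((\<lambda>u. x + (u - t) *\<^sub>R v) -` W)" by (intro open_vimage assms(1) continuous_intros)
  moreover have "t \<in> (\<lambda>u. x + (u - t) *\<^sub>R v) -` W" using assms(2) by simp
  ultimately obtain d where d: "d > 0" "ball t d \<subseteq> (\<lambda>u. x + (u - t) *\<^sub>R v) -` W" by (meson openE)
  have "x + (u - t) *\<^sub>R v \<in> W" if "\<bar>u - t\<bar> < d" for u
  proof -
    have "u \<in> ball t d" using that by (simp add: dist_real_def abs_minus_commute)
    then show ?thesis using d(2) by blast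
  qed
  then show ?thesis using that d(1) by blast
qed

lemma near_Some:
  assumes t: "t \<in> {0<..<1}" and C: "cylinder (\<gamma> t) = Some (n, r)"
  obtains d where "d > 0" "\<And>u. \<bar>u - t\<bar> < d \<Longrightarrow> cylinder (\<gamma> u) = Some (n, r + (u - t) * L v)"
proof -
  obtain k x e where e: "e > 0" "x \<in> chart_domain c k" "\<And>u. \<bar>u - t\<bar> < e \<Longrightarrow> \<gamma> u = chart_param c k (x + (u - t) *\<^sub>R v)"
    using \<gamma>_chart[OF t] by metis
  have "cylinder (chart_param c k x) = Some (n, r)" using e(3)[of t] e(1) C by simp
  from cylinder_chart_Some[OF e(2) this] obtain W where W: "open W" "x \<in> W"
    "\<forall>y\<in>W. cylinder (chart_param c k y) = Some (n, r + (L y - L x))" by (elim exE conjE)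
  obtain d where d: "d > 0" "\<And>u. \<bar>u - t\<bar> < d \<Longrightarrow> x + (u - t) *\<^sub>R v \<in> W" using pull_open[OF W(1,2)] by metis
  have "cylinder (\<gamma> u) = Some (n, r + (u - t) * L v)" if "\<bar>u - t\<bar> < min d e" for u
    using W(3)[rule_format, OF d(2), of u] e(3)[of u] that by (simp add: L_line)
  then show ?thesis using that[of "min d e"] d(1) e(1) by simp
qed

lemma near_None:
  assumes t: "t \<in> {0<..<1}" and C: "cylinder (\<gamma> t) = None" and Lv: "L v \<noteq> 0"
  obtains d where "d > 0" "\<And>u. \<bar>u - t\<bar> < d \<Longrightarrow> u \<noteq> t \<Longrightarrow> cylinder (\<gamma> u) \<noteq> None"
proof -
  obtain k x e where e: "e > 0" "x \<in> chart_domain c k" "\<And>u. \<bar>u - t\<bar> < e \<Longrightarrow> \<gamma> u = chart_param c k (x + (u - t) *\<^sub>R v)"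
    using \<gamma>_chart[OF t] by metis
  have "cylinder (chart_param c k x) = None" using e(3)[of t] e(1) C by simp
  from cylinder_chart_None[OF e(2) this] obtain W where W: "open W" "x \<in> W"
    "\<forall>y\<in>W. L y \<noteq> L x \<longrightarrow> cylinder (chart_param c k y) \<noteq> None" by (elim exE conjE)
  obtain d where d: "d > 0" "\<And>u. \<bar>u - t\<bar> < d \<Longrightarrow> x + (u - t) *\<^sub>R v \<in> W" using pull_open[OF W(1,2)] by metis
  have "cylinder (\<gamma> u) \<noteq> None" if "\<bar>u - t\<bar> < min d e" "u \<noteq> t" for u
    using W(3)[rule_format, OF d(2), of u] e(3)[of u] that Lv by (simp add: L_line)
  then show ?thesis using that[of "min d e"] d(1) e(1) by simp
qed

lemma follow_cylinder:
  assumes t: "a < t" "t < b" "0 \<le> a" "b \<le> 1" and C: "cylinder (\<gamma> t) = Some (n, r)"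
    and range: "\<And>u. a < u \<Longrightarrow> u < b \<Longrightarrow> 0 < r + (u - t) * L v \<and> r + (u - t) * L v < lev (Suc n) - lev n"
    and u: "a < u" "u < b"
  shows "cylinder (\<gamma> u) = Some (n, r + (u - t) * L v)"
proof -
  define p where "p u \<longleftrightarrow> cylinder (\<gamma> u) = Some (n, r + (u - t) * L v)" for u
  have "p t = p u"
  proof (rule connected_local_const[where f = p])
    show "connected {a<..<b}" by simp
    show "\<forall>w\<in>{a<..<b}. \<forall>\<^sub>F u in at w within {a<..<b}. p w = p u"
    proof
      fix w assume w: "w \<in> {a<..<b}"
      then have w01: "w \<in> {0<..<1}" using t by auto
      have "\<exists>d>0. \<forall>u\<in>{a<..<b}. \<bar>u - w\<bar> < d \<longrightarrow> p w = p u"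
      proof (cases "cylinder (\<gamma> w)")
        case (Some q)
        obtain n' r' where q: "q = (n', r')" by (cases q)
        obtain d where d: "d > 0" "\<And>u. \<bar>u - w\<bar> < d \<Longrightarrow> cylinder (\<gamma> u) = Some (n', r' + (u - w) * L v)"
          using near_Some[OF w01] Some q by metis
        have "p w = p u" if "\<bar>u - w\<bar> < d" for u
          unfolding p_def d(2)[OF that] Some q by (auto simp: algebra_simps)
        then show ?thesis using d(1) by blast
      next
        case None
        have "continuous_on {a<..<b} (\<lambda>u. wave n (r + (u - t) * L v) - \<sigma> (\<gamma> u))"
          by (intro continuous_intros continuous_on_subset[OF continuous_\<sigma>\<gamma>]) (use t in auto)
        moreover have "wave n (r + (w - t) * L v) - \<sigma> (\<gamma> w) \<noteq> 0"
          using wave_nonzero range[of w] w cylinder_None[OF \<gamma>_top None] w01 by simp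
        ultimately have "\<forall>\<^sub>F u in at w within {a<..<b}. wave n (r + (u - t) * L v) - \<sigma> (\<gamma> u) \<noteq> 0"
          using w unfolding continuous_on_def by (intro tendsto_imp_eventually_ne) auto
        then obtain d where d: "d > 0" "\<forall>u\<in>{a<..<b}. u \<noteq> w \<and> dist u w < d \<longrightarrow> wave n (r + (u - t) * L v) - \<sigma> (\<gamma> u) \<noteq> 0"
          unfolding eventually_at by auto
        have "\<not> p u" if "u \<in> {a<..<b}" "\<bar>u - w\<bar> < d" for u
        proof
          assume pu: "p u"
          then have "u \<noteq> w" using None by (auto simp: p_def)
          then have "wave n (r + (u - t) * L v) - \<sigma> (\<gamma> u) \<noteq> 0" using d(2) that by (simp add: dist_real_def)
          moreover have "u \<in> {0..1}" using that t by auto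
          ultimately show False using cylinder_bounds(3)[OF \<gamma>_top, of u] pu by (simp add: p_def)
        qed
        moreover have "\<not> p w" using None by (simp add: p_def)
        ultimately show ?thesis using d(1) by blast
      qed
      then show "\<forall>\<^sub>F u in at w within {a<..<b}. p w = p u"
        unfolding eventually_at by (auto simp: dist_real_def)
    qed
  qed (use t u in auto)
  moreover have "p t" using C by (simp add: p_def)
  ultimately show ?thesis by (simp add: p_def)
qed

lemma \<sigma>_limit_end:
  assumes ab: "0 \<le> a" "a < b" "b \<le> 1"
    and f: "\<And>u. a < u \<Longrightarrow> u < b \<Longrightarrow> \<sigma> (\<gamma> u) = f u" and cf: "continuous_on {a..b} f"
  shows "\<sigma> (\<gamma> a) = f a" "\<sigma> (\<gamma> b) = f b"
proof -
  have c\<sigma>: "continuous_on {a..b} (\<lambda>u. \<sigma> (\<gamma> u) - f u)"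
    by (intro continuous_intros continuous_on_subset[OF continuous_\<sigma>\<gamma>] cf) (use ab in auto)
  have "\<sigma> (\<gamma> u) - f u = 0" if "u \<in> closure {a<..<b}" for u
    by (rule continuous_constant_on_closure[OF _ _ that])
      (use c\<sigma> ab f in \<open>auto simp: closure_greaterThanLessThan\<close>)
  then show "\<sigma> (\<gamma> a) = f a" "\<sigma> (\<gamma> b) = f b" using ab by (auto simp: closure_greaterThanLessThan)
qed

lemma level_path_None:
  assumes Lv: "L v = 0" and t: "t \<in> {0<..<1}" shows "cylinder (\<gamma> t) = None"
proof (rule ccontr)
  assume "cylinder (\<gamma> t) \<noteq> None"
  then obtain n r where C: "cylinder (\<gamma> t) = Some (n, r)" by auto
  have b: "0 < r" "r < lev (Suc n) - lev n" using cylinder_bounds[OF \<gamma>_top C] t by auto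
  have "cylinder (\<gamma> u) = Some (n, r)" if "0 < u" "u < 1" for u
    using follow_cylinder[of 0 t 1 n r u] t C b that Lv by simp
  then have "\<sigma> (\<gamma> u) = wave n r" if "0 < u" "u < 1" for u
    using cylinder_bounds(3)[OF \<gamma>_top, of u] that by simp
  then have "\<sigma> (\<gamma> 0) = wave n r" by (intro \<sigma>_limit_end(1)[of 0 1 "\<lambda>_. wave n r"]) auto
  then show False using \<sigma>_singular[OF \<gamma>_ends(1)] wave_nonzero[OF b] by simp
qed

text \<open>
  Singularities lie on the levels, so a saddle connection neither starts nor ends inside a
  cylinder: it crosses every cylinder that it meets from one boundary to the other.
\<close>

lemma cylinder_crossing:
  assumes Lv: "L v > 0" and t: "t \<in> {0<..<1}" and C: "cylinder (\<gamma> t) \<noteq> None"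
  obtains a b n where "0 \<le> a" "a < t" "t < b" "b \<le> 1" "b * L v = a * L v + (lev (Suc n) - lev n)"
    "\<sigma> (\<gamma> a) = 0" "\<sigma> (\<gamma> b) = 0" "\<And>u. a < u \<Longrightarrow> u < b \<Longrightarrow> \<sigma> (\<gamma> u) \<noteq> 0"
proof -
  obtain n r where C: "cylinder (\<gamma> t) = Some (n, r)" using C by auto
  define h where "h = lev (Suc n) - lev n"
  have r: "0 < r" "r < h" using cylinder_bounds[OF \<gamma>_top C] t by (auto simp: h_def)
  define a where "a = t - r / L v"
  define b where "b = t + (h - r) / L v"
  have ab: "a < t" "t < b" using r Lv by (auto simp: a_def b_def)
  have ra: "r + (a - t) * L v = 0" "r + (b - t) * L v = h" using Lv by (auto simp: a_def b_def)
  have range: "0 < r + (u - t) * L v \<and> r + (u - t) * L v < h" if "a < u" "u < b" for u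
  proof -
    have "(a - t) * L v < (u - t) * L v" "(u - t) * L v < (b - t) * L v" using that Lv by auto
    then show ?thesis using ra by linarith
  qed
  \<comment> \<open>The line is inside the cylinder between the times \<open>a\<close> and \<open>b\<close>, but the path exists only on \<open>[0, 1]\<close>.\<close>
  let ?a = "max a 0" and ?b = "min b 1"
  have \<sigma>w: "\<sigma> (\<gamma> u) = wave n (r + (u - t) * L v)" if u: "?a < u" "u < ?b" for u
  proof -
    have "cylinder (\<gamma> u) = Some (n, r + (u - t) * L v)"
      by (rule follow_cylinder[of ?a t ?b]) (use ab t u C range in \<open>auto simp: h_def\<close>)
    then show ?thesis using cylinder_bounds(3)[OF \<gamma>_top, of u] u by auto
  qed
  have lim: "\<sigma> (\<gamma> ?a) = wave n (r + (?a - t) * L v)" "\<sigma> (\<gamma> ?b) = wave n (r + (?b - t) * L v)"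
    by (rule \<sigma>_limit_end[of ?a ?b "\<lambda>u. wave n (r + (u - t) * L v)"];
        use \<sigma>w ab t in \<open>auto intro!: continuous_wave continuous_intros\<close>)+
  have a0: "0 \<le> a"
  proof (rule ccontr)
    assume "\<not> 0 \<le> a"
    then have "\<sigma> (\<gamma> 0) = wave n (r + (0 - t) * L v)" using lim(1) by (simp add: max_def)
    moreover have "wave n (r + (0 - t) * L v) \<noteq> 0"
      using wave_nonzero range[of 0] \<open>\<not> 0 \<le> a\<close> ab t unfolding h_def by auto
    ultimately show False using \<sigma>_singular[OF \<gamma>_ends(1)] by simp
  qed
  have b1: "b \<le> 1"
  proof (rule ccontr)
    assume "\<not> b \<le> 1"
    then have "\<sigma> (\<gamma> 1) = wave n (r + (1 - t) * L v)" using lim(2) by (simp add: min_def)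
    moreover have "wave n (r + (1 - t) * L v) \<noteq> 0"
      using wave_nonzero range[of 1] \<open>\<not> b \<le> 1\<close> ab t unfolding h_def by auto
    ultimately show False using \<sigma>_singular[OF \<gamma>_ends(2)] by simp
  qed
  have m: "?a = a" "?b = b" using a0 b1 by auto
  show ?thesis
  proof (rule that[of a b n])
    show "b * L v = a * L v + (lev (Suc n) - lev n)" using Lv by (simp add: a_def b_def h_def field_simps)
    show "\<sigma> (\<gamma> a) = 0" using lim(1) m ra wave_ends(1) by simp
    show "\<sigma> (\<gamma> b) = 0" using lim(2) m ra wave_ends(2) by (simp add: h_def)
    show "\<sigma> (\<gamma> u) \<noteq> 0" if "a < u" "u < b" for u
      using \<sigma>w[of u] range[OF that] wave_nonzero that m by (simp add: h_def)
  qed (use ab a0 b1 in auto)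
qed

text \<open>
  Go back from one level to the preceding one. Cylinders have width at least 1, so
  \<open>N\<close> bounds the number of such steps.
\<close>

lemma boundary_time_level_sum:
  assumes Lv: "L v > 0" and "0 \<le> a" "a < 1" "\<sigma> (\<gamma> a) = 0" "a * L v \<le> real N"
  shows "a * L v \<in> level_sums lev"
  using assms(2-)
proof (induction N arbitrary: a)
  case 0
  have "0 \<le> a * L v" using 0 Lv by simp
  then have "a * L v = 0" using 0 by simp
  then show ?case by (metis level_sums.zero)
next
  case (Suc N)
  show ?case
  proof (cases "a = 0")
    case True
    then show ?thesis by (simp add: level_sums.zero)
  next
    case False
    then have a: "a \<in> {0<..<1}" using Suc by auto
    have "cylinder (\<gamma> a) = None" using \<sigma>_zero_iff[OF \<gamma>_top, of a] a Suc.prems by simp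
    then obtain d where d: "d > 0" "\<And>u. \<bar>u - a\<bar> < d \<Longrightarrow> u \<noteq> a \<Longrightarrow> cylinder (\<gamma> u) \<noteq> None"
      using near_None[OF a] Lv by (metis less_irrefl)
    define t where "t = a - min d a / 2"
    have "0 < min d a" "min d a \<le> d" "min d a \<le> a" using d(1) a by simp_all
    then have t: "0 < t" "t < a" "\<bar>t - a\<bar> < d" unfolding t_def by linarith+
    have tt: "t \<in> {0<..<1}" using t a by simp
    have Ct: "cylinder (\<gamma> t) \<noteq> None" using d(2)[OF t(3)] t(2) by simp
    obtain a' b' n where ab: "0 \<le> a'" "a' < t" "t < b'" "b' \<le> 1" "b' * L v = a' * L v + (lev (Suc n) - lev n)"
      "\<sigma> (\<gamma> a') = 0" "\<sigma> (\<gamma> b') = 0" "\<And>u. a' < u \<Longrightarrow> u < b' \<Longrightarrow> \<sigma> (\<gamma> u) \<noteq> 0"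
      by (rule cylinder_crossing[OF Lv tt Ct]) (rule that)
    have "b' = a"
    proof (rule antisym)
      show "b' \<le> a" using ab(8)[of a] Suc.prems ab(2) t by force
      show "a \<le> b'"
      proof (rule ccontr)
        assume "\<not> a \<le> b'"
        then have "cylinder (\<gamma> b') \<noteq> None" using d(2)[of b'] ab(3) t by simp
        then show False using \<sigma>_zero_iff[OF \<gamma>_top, of b'] ab t by simp
      qed
    qed
    have g: "lev (Suc n) - lev n \<ge> 1" using gridD[OF grid, of n] by simp
    have "a' * L v \<in> level_sums lev"
      by (rule Suc.IH) (use ab \<open>b' = a\<close> g Suc.prems t in auto)
    then show ?thesis using level_sums.add ab(5) \<open>b' = a\<close> by metis
  qed
qed

text \<open>
  Only finitely many times before the end lie on a level, and the cylinder entered at the last of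
  them is left at the end of the saddle connection.
\<close>

lemma positive_holonomy_level_sum:
  assumes Lv: "L v > 0" shows "L v \<in> level_sums lev"
proof -
  define Z where "Z = {a. 0 \<le> a \<and> a < 1 \<and> \<sigma> (\<gamma> a) = 0}"
  obtain N where N: "L v \<le> real N" using real_arch_simple by blast
  have aN: "a * L v \<le> real N" if "a \<in> Z" for a
  proof -
    have "a * L v \<le> 1 * L v" using that Lv by (intro mult_right_mono) (auto simp: Z_def)
    then show ?thesis using N by simp
  qed
  have "(\<lambda>a. a * L v) ` Z \<subseteq> {x \<in> level_sums lev. x \<le> real N}"
    using boundary_time_level_sum[OF Lv] aN by (auto simp: Z_def)
  then have "finite ((\<lambda>a. a * L v) ` Z)" using finite_level_sums finite_subset by blast
  then have Zf: "finite Z" using Lv by (subst (asm) finite_image_iff) (auto simp: inj_on_def)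
  have Z0: "0 \<in> Z" using \<sigma>_singular[OF \<gamma>_ends(1)] by (simp add: Z_def)
  have "Max Z \<in> Z" using Zf Z0 by (intro Max_in) auto
  then have m: "0 \<le> Max Z" "Max Z < 1" by (auto simp: Z_def)
  define t where "t = (Max Z + 1) / 2"
  have t: "Max Z < t" "t < 1" using m by (auto simp: t_def)
  then have "t \<notin> Z" using Max_ge[OF Zf, of t] by auto
  then have Ct: "cylinder (\<gamma> t) \<noteq> None" using t m \<sigma>_zero_iff[OF \<gamma>_top, of t] by (auto simp: Z_def)
  have tt: "t \<in> {0<..<1}" using t m by auto
  obtain a b n where ab: "0 \<le> a" "a < t" "t < b" "b \<le> 1" "b * L v = a * L v + (lev (Suc n) - lev n)"
      "\<sigma> (\<gamma> a) = 0" "\<sigma> (\<gamma> b) = 0"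
    by (rule cylinder_crossing[OF Lv tt Ct]) (rule that)
  have "b \<notin> Z" using Max_ge[OF Zf, of b] t ab by auto
  then have "b = 1" using ab t m by (auto simp: Z_def)
  have "a \<in> Z" using ab t by (auto simp: Z_def)
  then have "a * L v \<in> level_sums lev" using boundary_time_level_sum[OF Lv, of a N] aN by (simp add: Z_def)
  then have "a * L v + (lev (Suc n) - lev n) \<in> level_sums lev" by (rule level_sums.add)
  then show ?thesis using ab(5) \<open>b = 1\<close> by simp
qed

end

lemma rotation_singular: "C \<in> topspace (surface c) \<Longrightarrow> rotation c C \<in> singularities c \<longleftrightarrow> C \<in> singularities c"
  by (elim surface_cases) (auto simp: sp_singular_iff[OF c])

lemma saddle_rotation: assumes "saddle_connection_along c v \<gamma>" shows "saddle_connection_along c (- v) (rotation c \<circ> \<gamma>)"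
proof (rule saddle_transfer[OF c assms])
  show "linear (uminus :: real^2 \<Rightarrow> real^2)" by (intro linearI) auto
  show "- v \<noteq> 0" using assms by (simp add: saddle_connection_along_def)
qed (use local_affine_rotation[OF c] continuous_rotation rotation_singular in auto)

lemma holonomy_level_sum:
  assumes \<gamma>: "saddle_connection_along c v \<gamma>" shows "\<bar>L v\<bar> \<in> level_sums lev"
proof -
  consider "L v > 0" | "L v = 0" | "L (- v) > 0" using L_line(4)[of v] by linarith
  then show ?thesis
  proof cases
    case 3
    then have "L (- v) \<in> level_sums lev" by (rule positive_holonomy_level_sum[OF saddle_rotation[OF \<gamma>]])
    then show ?thesis using 3 L_line(4)[of v] by simp
  qed (use positive_holonomy_level_sum[OF \<gamma>] level_sums.zero in auto)
qed

end

lemma half_gap_ge: assumes c: "c \<ge> 1" shows "row_at c (Suc i) - col_at c i \<ge> real (Suc i)"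
proof (induction i)
  case (Suc i)
  have 1: "1 * (row_at c (Suc i) - col_at c i) \<le> c * (row_at c (Suc i) - col_at c i)"
    using gaps[OF c, of i] c by (intro mult_right_mono) auto
  have 2: "0 \<le> (c - 1) * row_at c (Suc i)" using gaps[OF c, of i] c by simp
  have "row_at c (Suc (Suc i)) - col_at c (Suc i) \<ge> (row_at c (Suc i) - col_at c i) + 1"
    unfolding gap_step using add_mono[OF 1 2] by simp
  then show ?case using Suc by simp
qed simp

lemma level_structure_height: assumes c: "c \<ge> 1" shows "level_structure c height (row_at c) (siny c)"
proof (rule level_structure.intro)
  show "linear height" by (rule linear_height)
  show "grid (row_at c)" by (rule grid_row[OF c])
  show "continuous_map (surface c) euclideanreal (siny c)" by (rule continuous_siny[OF c])
  show "siny c (sp c s z) = sin (pi * interpolate (row_at c) real (height z))" if "sheet s" for s z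
    using siny_sp[OF c that] by (simp add: gy_def)
  show "0 \<le> height z" if "z \<in> Qplus c" for z
  proof -
    have "0 \<le> gx c z" "gx c z \<le> gy c z" using that gx_nonneg[OF c] by (auto simp: Qplus_iff[OF c])
    then show ?thesis using gy_nonneg[OF c, of z] by simp
  qed
  show "(\<exists>n. row_at c n \<le> height z \<and> height z \<le> row_at c (Suc n) \<and> height (fold_edge c k z) = row_at c n + row_at c (Suc n) - height z) \<or>
      (height z = 0 \<and> height (fold_edge c k z) = 0)" if z: "z \<in> edge c k" for z k
  proof -
    obtain m where "row_at c m \<le> height z" "height z \<le> row_at c (Suc m)"
      "height (P c k) + height (P c (k + 1)) = row_at c m + row_at c (Suc m)" using edge_row[OF c z] .
    then show ?thesis by (auto simp: fold_edge_def)
  qed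
  show "\<exists>n. height (P c k) = row_at c n" for k
    by (cases k rule: int_cases_vertex) (auto simp: P_neg P_pos)
  show "real n + 1 \<le> row_at c (Suc n) - row_at c n" for n
  proof (cases n)
    case (Suc m)
    note w = half_gap_ge[OF c]
    show ?thesis using row_step[of c m] w[of m] w[of n] Suc by simp
  qed simp
qed (rule c)

lemma level_structure_skew: assumes c: "c \<ge> 1" shows "level_structure c skew (col_at c) (sinx c)"
proof (rule level_structure.intro)
  show "linear skew" by (rule linear_skew)
  show "grid (col_at c)" by (rule grid_col[OF c])
  show "continuous_map (surface c) euclideanreal (sinx c)" by (rule continuous_sinx[OF c])
  show "sinx c (sp c s z) = sin (pi * interpolate (col_at c) real (skew z))" if "sheet s" for s z
    using sinx_sp[OF c that] by (simp add: gx_def)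
  show "0 \<le> skew z" if "z \<in> Qplus c" for z using that by (auto simp: Qplus_iff[OF c])
  show "(\<exists>n. col_at c n \<le> skew z \<and> skew z \<le> col_at c (Suc n) \<and> skew (fold_edge c k z) = col_at c n + col_at c (Suc n) - skew z) \<or>
      (skew z = 0 \<and> skew (fold_edge c k z) = 0)" if z: "z \<in> edge c k" for z k
  proof (cases "k = 0")
    case True
    then show ?thesis using z fold_in_edge[OF z] by (simp add: edge_0_iff)
  next
    case False
    obtain m where "col_at c m \<le> skew z" "skew z \<le> col_at c (Suc m)"
      "skew (P c k) + skew (P c (k + 1)) = col_at c m + col_at c (Suc m)" using edge_col[OF c z False] .
    then show ?thesis by (auto simp: fold_edge_def)
  qed
  show "\<exists>n. skew (P c k) = col_at c n" for k
    by (cases k rule: int_cases_vertex) (auto simp: P_neg P_pos)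
  show "real n + 1 \<le> col_at c (Suc n) - col_at c n" for n
  proof -
    note w = half_gap_ge[OF c]
    show ?thesis using col_step[of c n] w[of n] by simp
  qed
qed (rule c)

section \<open>Saddle connections inside a polygon\<close>

lemma saddle_connection_alongD:
  assumes "saddle_connection_along c v \<gamma>"
  shows "singular_arc c \<gamma>" "v \<noteq> 0" "continuous_map (top_of_set {0..1}) (surface c) \<gamma>"
  using assms by (auto simp: saddle_connection_along_def singular_arc_def pathin_def)

lemma saddle_top: "saddle_connection_along c v \<gamma> \<Longrightarrow> t \<in> {0..1} \<Longrightarrow> \<gamma> t \<in> topspace (surface c)"
  using saddle_connection_alongD(3) by (fastforce simp: continuous_map_def)

text \<open>
  Whether the path is on the predicted line is locally constant in time, and the set of times
  considered is connected.
\<close>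

lemma follow_line_upper:
  assumes c: "c \<ge> 1" and \<gamma>: "saddle_connection_along c v \<gamma>"
    and A: "connected A" "A \<subseteq> {0<..<1}" "t0 \<in> A" and start: "\<gamma> t0 = sp c 1 z"
    and Q: "\<And>u. u \<in> A \<Longrightarrow> z + (u - t0) *\<^sub>R v \<in> Qplus c - range (P c)"
    and u: "u \<in> A"
  shows "\<gamma> u = sp c 1 (z + (u - t0) *\<^sub>R v)"
proof -
  define p where "p u \<longleftrightarrow> \<gamma> u = sp c 1 (z + (u - t0) *\<^sub>R v)" for u
  have "p t0 = p u"
  proof (rule connected_local_const[where f = p, OF A(1) A(3) u], intro ballI)
    fix w assume w: "w \<in> A"
    obtain k x e where e: "e > 0" "\<forall>u. \<bar>u - w\<bar> < e \<longrightarrow> x + (u - w) *\<^sub>R v \<in> chart_domain c k \<and> \<gamma> u = chart_param c k (x + (u - w) *\<^sub>R v)"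
      using \<gamma> w A(2) unfolding saddle_connection_along_def by blast
    have all: "p u'" if pu: "p u" and u: "u \<in> A" "\<bar>u - w\<bar> < e" and u': "u' \<in> A" "\<bar>u' - w\<bar> < e" for u u'
    proof -
      let ?y = "x + (u - w) *\<^sub>R v" and ?z = "z + (u - t0) *\<^sub>R v"
      have y: "?y \<in> chart_domain c k" "\<gamma> u = chart_param c k ?y" using e(2) u by blast+
      have zQ: "?z \<notin> range (P c)" using Q[OF u(1)] by blast
      have "?y \<in> Qplus c"
      proof (rule ccontr)
        assume n: "?y \<notin> Qplus c"
        then have i: "fold_edge c k ?y \<in> interior (Qplus c)" using y(1) interior_in_Q[OF c] open_edge_in_Qplus by (auto simp: mem_chart_domain)
        have "sp c (-1) (fold_edge c k ?y) = sp c 1 ?z" using pu y(2) n by (simp add: p_def chart_param_sp)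
        then show False using sp_interior_eq[OF c i, of "-1" 1 ?z] by simp
      qed
      then have "sp c 1 ?z = sp c 1 ?y" using pu y(2) by (simp add: p_def chart_param_sp)
      then have "?y = ?z" using sp_eq_imp[OF c zQ, of 1 1 ?y] by simp
      then have x: "x = z + (w - t0) *\<^sub>R v" by (simp add: algebra_simps)
      have "x + (u' - w) *\<^sub>R v = z + (u' - t0) *\<^sub>R v" unfolding x by (simp add: algebra_simps)
      then show ?thesis using e(2) u' Q[OF u'(1)] by (simp add: p_def chart_param_sp)
    qed
    have "p w = p u" if "u \<in> A" "\<bar>u - w\<bar> < e" for u
      using all[of w u] all[of u w] that w e(1) by auto
    then show "\<forall>\<^sub>F u in at w within A. p w = p u"
      unfolding eventually_at using e(1) by (auto simp: dist_real_def)
  qed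
  then show ?thesis using start by (simp add: p_def)
qed

lemma follow_line:
  assumes c: "c \<ge> 1" and \<gamma>: "saddle_connection_along c v \<gamma>" and s: "sheet s"
    and A: "connected A" "A \<subseteq> {0<..<1}" "t0 \<in> A" and start: "\<gamma> t0 = sp c s z"
    and Q: "\<And>u. u \<in> A \<Longrightarrow> z + (u - t0) *\<^sub>R (s *\<^sub>R v) \<in> Qplus c - range (P c)"
    and u: "u \<in> A"
  shows "\<gamma> u = sp c s (z + (u - t0) *\<^sub>R (s *\<^sub>R v))"
proof (cases "s = 1")
  case True
  then show ?thesis using follow_line_upper[OF c \<gamma> A, of z u] start Q u by simp
next
  case False
  then have s: "s = -1" using s by simp
  have i: "saddle_connection_along c (- v) (rotation c \<circ> \<gamma>)"
    using level_structure.saddle_rotation[OF level_structure_height[OF c] \<gamma>] .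
  have "(rotation c \<circ> \<gamma>) u = sp c 1 (z + (u - t0) *\<^sub>R (- v))"
    using follow_line_upper[OF c i A, of z u] start Q u s by simp
  moreover have "\<gamma> u = rotation c (rotation c (\<gamma> u))"
  proof -
    have "u \<in> {0..1}" using subsetD[OF A(2) u] by simp
    then have "\<gamma> u \<in> topspace (surface c)" by (rule saddle_top[OF \<gamma>])
    then obtain s' z' where s': "sheet s'" "\<gamma> u = sp c s' z'" by (rule surface_cases)
    have "sheet (- s')" using s'(1) by auto
    then show ?thesis using s' by simp
  qed
  ultimately show ?thesis using s by simp
qed

lemma agree_at_ends:
  fixes f g :: "real \<Rightarrow> real"
  assumes "continuous_on {a..b} f" "continuous_on {a..b} g" "a < b" "\<And>u. a < u \<Longrightarrow> u < b \<Longrightarrow> f u = g u"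
  shows "f a = g a" "f b = g b"
proof -
  have cfg: "continuous_on {a..b} (\<lambda>u. f u - g u)" by (intro continuous_intros assms)
  have "f u - g u = 0" if "u \<in> closure {a<..<b}" for u
    by (rule continuous_constant_on_closure[OF _ _ that])
      (use cfg assms(3,4) in \<open>auto simp: closure_greaterThanLessThan\<close>)
  then show "f a = g a" "f b = g b" using assms(3) by (auto simp: closure_greaterThanLessThan)
qed

text \<open>
  The charts do not cover the ends of a saddle connection. There continuity of \<open>sinx\<close>
  and \<open>siny\<close> decides whether the limit point is singular, and \<open>cosy\<close>
  which singularity it is.
\<close>

lemma line_end:
  assumes c: "c \<ge> 1" and \<gamma>: "saddle_connection_along c v \<gamma>" and s: "sheet s"
    and ab: "0 \<le> a" "a < b" "b \<le> 1" and eq: "\<And>u. a < u \<Longrightarrow> u < b \<Longrightarrow> \<gamma> u = sp c s (q + u *\<^sub>R w)"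
    and e: "e = a \<or> e = b" and Q: "q + e *\<^sub>R w \<in> Qplus c"
  shows "\<gamma> e \<in> singularities c \<longleftrightarrow> q + e *\<^sub>R w \<in> range (P c)"
    "cosy c (\<gamma> e) = cosy c (sp c s (q + e *\<^sub>R w))"
proof -
  have cont: "continuous_on {a..b} (\<lambda>u. F (\<gamma> u))" if "continuous_map (surface c) euclideanreal F" for F
  proof -
    have "continuous_on {0..1} (\<lambda>u. F (\<gamma> u))"
      using continuous_map_compose[OF saddle_connection_alongD(3)[OF \<gamma>] that] by (simp add: o_def)
    then show ?thesis by (rule continuous_on_subset) (use ab in auto)
  qed
  have l: "continuous_on {a..b} (\<lambda>u. q + u *\<^sub>R w)" by (intro continuous_intros)
  have gx: "continuous_on {a..b} (\<lambda>u. sin (pi * gx c (q + u *\<^sub>R w)))"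
    "continuous_on {a..b} (\<lambda>u. sin (pi * gy c (q + u *\<^sub>R w)))"
    "continuous_on {a..b} (\<lambda>u. s * cos (pi * gy c (q + u *\<^sub>R w)))"
    by (intro continuous_intros c)+
  have 1: "sinx c (\<gamma> e) = sin (pi * gx c (q + e *\<^sub>R w))"
    using agree_at_ends[OF cont[OF continuous_sinx[OF c]] gx(1) ab(2)] eq e sinx_sp[OF c s] by auto
  have 2: "siny c (\<gamma> e) = sin (pi * gy c (q + e *\<^sub>R w))"
    using agree_at_ends[OF cont[OF continuous_siny[OF c]] gx(2) ab(2)] eq e siny_sp[OF c s] by auto
  have 3: "cosy c (\<gamma> e) = s * cos (pi * gy c (q + e *\<^sub>R w))"
    using agree_at_ends[OF cont[OF continuous_cosy[OF c]] gx(3) ab(2)] eq e cosy_sp[OF c s] by auto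
  have "e \<in> {0..1}" using e ab by (elim disjE) simp_all
  then have "\<gamma> e \<in> topspace (surface c)" by (rule saddle_top[OF \<gamma>])
  then show "\<gamma> e \<in> singularities c \<longleftrightarrow> q + e *\<^sub>R w \<in> range (P c)"
    using 1 2 singular_iff_sin[OF c] vertex_iff_lattice[OF c Q] by simp
  show "cosy c (\<gamma> e) = cosy c (sp c s (q + e *\<^sub>R w))" using 3 cosy_sp[OF c s] by simp
qed

lemma saddle_midpoint:
  assumes c: "c \<ge> 1" and \<gamma>: "saddle_connection_along c v \<gamma>"
  obtains s z where "sheet s" "z \<in> Qplus c" "z \<notin> range (P c)" "\<gamma> (1/2) = sp c s z"
proof -
  have "\<gamma> (1/2) \<in> topspace (surface c)" using saddle_top[OF \<gamma>, of "1/2"] by simp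
  then obtain s z where s: "sheet s" "z \<in> Qplus c" "\<gamma> (1/2) = sp c s z" by (rule surface_cases)
  moreover have "\<gamma> (1/2) \<notin> singularities c" using \<gamma> by (simp add: saddle_connection_along_def)
  ultimately show ?thesis using that sp_singular_iff[OF c s(1)] by metis
qed

section \<open>Directions without saddle connections\<close>

text \<open>
  By \<open>edge_slope\<close>, these directions point into the polygon from every edge.
\<close>

definition steep :: "real \<Rightarrow> real^2 \<Rightarrow> bool" where
  "steep c v \<longleftrightarrow> 0 < skew v \<and> skew v \<le> height v \<and> 2 * height v \<le> (c + 1) * skew v"

lemma steep_side:
  assumes c: "c \<ge> 1" and v: "steep c v"
  shows "(height (P c (k + 1)) - height (P c k)) * skew v - (skew (P c (k + 1)) - skew (P c k)) * height v > 0"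
proof -
  have v: "0 < skew v" "skew v \<le> height v" "2 * height v \<le> (c + 1) * skew v" using v by (auto simp: steep_def)
  consider "k = 0" | n where "k = int n + 1" | n where "k = - int n - 1"
    using that(1) that(2)[of "nat (k - 1)"] that(3)[of "nat (- k - 1)"] by linarith
  then show ?thesis
  proof cases
    case 1
    have "P c 1 = pt 0 1" using P_pos[of c 0] by simp
    then show ?thesis using 1 v by simp
  next
    case (2 n)
    let ?r = "row_at c (Suc (Suc n)) - row_at c (Suc n)" and ?s = "col_at c (Suc n) - col_at c n"
    have s: "0 < ?s" using grid_less[OF grid_col[OF c], of n "Suc n"] by simp
    have "?s * (2 * height v) \<le> ?s * ((c + 1) * skew v)" using v s by (intro mult_left_mono) auto
    also have "\<dots> = ((c + 1) * ?s) * skew v" by (simp add: algebra_simps)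
    also have "\<dots> < (2 * ?r) * skew v" using edge_slope(1)[OF c, of n] v by (intro mult_strict_right_mono) auto
    finally have "0 < ?r * skew v - ?s * height v" by (simp add: algebra_simps)
    then show ?thesis unfolding 2 P_upper by simp
  next
    case (3 n)
    let ?r = "row_at c (Suc n) - row_at c n" and ?s = "col_at c (Suc n) - col_at c n"
    have s: "0 < ?s" using grid_less[OF grid_col[OF c], of n "Suc n"] by simp
    have "?r * skew v < ?s * skew v" using edge_slope(2)[OF c, of n] v by (intro mult_strict_right_mono) auto
    also have "\<dots> \<le> ?s * height v" using v s by (intro mult_left_mono) auto
    finally show ?thesis unfolding 3 P_lower by (simp add: algebra_simps)
  qed
qed

lemma steep_into_interior:
  assumes c: "c \<ge> 1" and v: "steep c v" and z: "z \<in> Qplus c" and r: "r > 0"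
  shows "z + r *\<^sub>R v \<in> interior (Qplus c)"
  unfolding interior_Qplus_iff_side[OF c]
proof
  fix k
  have "side c k (z + r *\<^sub>R v) = side c k z + r * ((height (P c (k + 1)) - height (P c k)) * skew v - (skew (P c (k + 1)) - skew (P c k)) * height v)"
    by (simp add: side_def algebra_simps)
  moreover have "r * ((height (P c (k + 1)) - height (P c k)) * skew v - (skew (P c (k + 1)) - skew (P c k)) * height v) > 0"
    using r steep_side[OF c v, of k] by (rule mult_pos_pos)
  ultimately show "0 < side c k (z + r *\<^sub>R v)" using Qplus_side[OF c z, of k] by linarith
qed

text \<open>
  Once such a line is in a polygon it stays in the interior for all later times. Hence the path
  from its midpoint to the end (to the start, on the other sheet or for the opposite direction)
  avoids all singularities, even at the end.
\<close>

lemma no_steep_saddle: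
  assumes c: "c \<ge> 1" and \<gamma>: "saddle_connection_along c v \<gamma>"
  shows "\<not> steep c v" "\<not> steep c (- v)"
proof -
  have False if st: "steep c v \<or> steep c (- v)"
  proof -
    obtain s z where s: "sheet s" "z \<in> Qplus c" "z \<notin> range (P c)" "\<gamma> (1/2) = sp c s z" using saddle_midpoint[OF c \<gamma>] .
    let ?w = "s *\<^sub>R v"
    have ew: "z + (u - 1/2) *\<^sub>R ?w = (z - (1/2) *\<^sub>R ?w) + u *\<^sub>R ?w" for u by (simp add: algebra_simps)
    have nv: "y \<in> Qplus c - range (P c)" if "y \<in> interior (Qplus c)" for y
      using that interior_in_Q[OF c] interior_not_vertex[OF c] by blast
    consider "steep c ?w" | "steep c (- ?w)" using st s(1) by auto
    then show False
    proof cases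
      case 1
      have int: "z + (u - 1/2) *\<^sub>R ?w \<in> interior (Qplus c)" if "1/2 < u" for u
        using steep_into_interior[OF c 1 s(2)] that by simp
      have Q: "z + (u - 1/2) *\<^sub>R ?w \<in> Qplus c - range (P c)" if u: "u \<in> {1/2..<1}" for u
      proof (cases "u = 1/2")
        case True
        have e: "z + (u - 1/2) *\<^sub>R ?w = z" unfolding True by simp
        show ?thesis unfolding e using s by blast
      next
        case False
        then show ?thesis using nv[OF int[of u]] u by auto
      qed
      have fol: "\<gamma> u = sp c s (z + (u - 1/2) *\<^sub>R ?w)" if "u \<in> {1/2..<1}" for u
        by (rule follow_line[OF c \<gamma> s(1), where A = "{1/2..<1}"]) (use Q s that in auto)
      have "\<gamma> u = sp c s ((z - (1/2) *\<^sub>R ?w) + u *\<^sub>R ?w)" if "1/2 < u" "u < 1" for u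
        unfolding ew[symmetric] using fol[of u] that by simp
      note fol2 = this
      have end_pt: "(z - (1/2) *\<^sub>R ?w) + 1 *\<^sub>R ?w \<in> Qplus c - range (P c)"
        unfolding ew[symmetric] by (rule nv[OF int]) simp
      have "\<gamma> 1 \<in> singularities c \<longleftrightarrow> (z - (1/2) *\<^sub>R ?w) + 1 *\<^sub>R ?w \<in> range (P c)"
        by (rule line_end(1)[OF c \<gamma> s(1), where a = "1/2" and b = 1, OF _ _ _ fol2]) (use end_pt in \<open>simp_all only: Diff_iff\<close>, simp_all)
      then show False using end_pt \<gamma> by (simp add: saddle_connection_along_def)
    next
      case 2
      have int: "z + (u - 1/2) *\<^sub>R ?w \<in> interior (Qplus c)" if "u < 1/2" for u
      proof -
        have e: "z + (1/2 - u) *\<^sub>R (- ?w) = z + (u - 1/2) *\<^sub>R ?w" by (simp add: algebra_simps)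
        have "0 < 1/2 - u" using that by simp
        from steep_into_interior[OF c 2 s(2) this] show ?thesis unfolding e .
      qed
      have Q: "z + (u - 1/2) *\<^sub>R ?w \<in> Qplus c - range (P c)" if u: "u \<in> {0<..1/2}" for u
      proof (cases "u = 1/2")
        case True
        have e: "z + (u - 1/2) *\<^sub>R ?w = z" unfolding True by simp
        show ?thesis unfolding e using s by blast
      next
        case False
        then show ?thesis using nv[OF int[of u]] u by auto
      qed
      have fol: "\<gamma> u = sp c s (z + (u - 1/2) *\<^sub>R ?w)" if "u \<in> {0<..1/2}" for u
        by (rule follow_line[OF c \<gamma> s(1), where A = "{0<..1/2}"]) (use Q s that in auto)
      have "\<gamma> u = sp c s ((z - (1/2) *\<^sub>R ?w) + u *\<^sub>R ?w)" if "0 < u" "u < 1/2" for u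
        unfolding ew[symmetric] using fol[of u] that by simp
      note fol2 = this
      have end_pt: "(z - (1/2) *\<^sub>R ?w) + 0 *\<^sub>R ?w \<in> Qplus c - range (P c)"
        unfolding ew[symmetric] by (rule nv[OF int]) simp
      have "\<gamma> 0 \<in> singularities c \<longleftrightarrow> (z - (1/2) *\<^sub>R ?w) + 0 *\<^sub>R ?w \<in> range (P c)"
        by (rule line_end(1)[OF c \<gamma> s(1), where a = 0 and b = "1/2", OF _ _ _ fol2]) (use end_pt in \<open>simp_all only: Diff_iff\<close>, simp_all)
      then show False using end_pt \<gamma> by (simp add: saddle_connection_along_def)
    qed
  qed
  then show "\<not> steep c v" "\<not> steep c (- v)" by blast+
qed

section \<open>Diagonals of the polygon\<close>

lemma diagonal_nonvertex:
  assumes c: "c \<ge> 1" and ab: "a \<noteq> b" and t: "0 < t" "t < 1"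
  shows "(1 - t) *\<^sub>R P c a + t *\<^sub>R P c b \<in> Qplus c - range (P c)"
proof -
  let ?z = "(1 - t) *\<^sub>R P c a + t *\<^sub>R P c b"
  have "?z \<in> Qplus c" using convexD_alt[OF convex_Qplus P_in_Qplus P_in_Qplus] t by simp
  moreover have "?z \<noteq> P c k" for k
  proof
    assume k: "?z = P c k"
    then have "P c a = P c k" by (rule convex_combination_vertex[OF c P_in_Qplus P_in_Qplus t])
    moreover have "P c b = P c k"
      by (rule convex_combination_vertex[OF c P_in_Qplus P_in_Qplus, of "1 - t" _ a]) (use t k in \<open>simp_all add: add.commute\<close>)
    ultimately show False using inj_P[OF c] ab by metis
  qed
  ultimately show ?thesis by auto
qed

text \<open>
  Near an interior time the diagonal lies in the interior of the polygon, or it is an edge; in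
  either case a single chart suffices.
\<close>

lemma diagonal_saddle:
  assumes c: "c \<ge> 1" and ab: "a \<noteq> b" and s: "sheet s"
  shows "saddle_connection_along c (s *\<^sub>R (P c b - P c a)) (\<lambda>t. sp c s ((1 - t) *\<^sub>R P c a + t *\<^sub>R P c b))"
proof -
  define z where "z t = (1 - t) *\<^sub>R P c a + t *\<^sub>R P c b" for t
  let ?v = "P c b - P c a"
  have zu: "z u = z t + (u - t) *\<^sub>R ?v" for u t by (simp add: z_def algebra_simps)
  have zQ: "z t \<in> Qplus c" if "0 \<le> t" "t \<le> 1" for t
    using convexD_alt[OF convex_Qplus P_in_Qplus P_in_Qplus] that by (simp add: z_def)
  have nv: "z t \<in> Qplus c - range (P c)" if "0 < t" "t < 1" for t
    using diagonal_nonvertex[OF c ab that] by (simp add: z_def)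
  have cz: "continuous_on A z" for A unfolding z_def by (intro continuous_intros)
  have "continuous_map (top_of_set {0..1}) (top_of_set (Qplus c)) z"
    using cz zQ by (auto simp: continuous_map_in_subtopology)
  from continuous_map_compose[OF this continuous_map_sp[OF s]]
  have path: "pathin (surface c) (\<lambda>t. sp c s (z t))" by (simp add: pathin_def o_def)
  have fz: "fold_edge c k (z u) = fold_edge c k (z t) + (u - t) *\<^sub>R (- ?v)" for k u t
    by (simp add: zu[of u t] fold_edge_def algebra_simps)
  have local: "\<exists>k x e. e > 0 \<and> (\<forall>u. \<bar>u - t\<bar> < e \<longrightarrow> x + (u - t) *\<^sub>R (s *\<^sub>R ?v) \<in> chart_domain c k \<and>
      sp c s (z u) = chart_param c k (x + (u - t) *\<^sub>R (s *\<^sub>R ?v)))" if t: "t \<in> {0<..<1}" for t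
  proof -
    have t': "0 < t" "t < 1" using t by auto
    have key: ?thesis if e: "e > 0" and *: "\<And>u. \<bar>u - t\<bar> < e \<Longrightarrow> z u \<in> chart_domain c k \<and> z u \<in> Qplus c" for e k
    proof (cases "s = 1")
      case True
      have "z t + (u - t) *\<^sub>R (s *\<^sub>R ?v) \<in> chart_domain c k \<and> sp c s (z u) = chart_param c k (z t + (u - t) *\<^sub>R (s *\<^sub>R ?v))"
        if "\<bar>u - t\<bar> < e" for u
        using *[OF that] True zu[of u t] by (simp add: chart_param_sp)
      then show ?thesis using e by blast
    next
      case False
      then have s: "s = -1" using s by simp
      have "fold_edge c k (z t) + (u - t) *\<^sub>R (s *\<^sub>R ?v) \<in> chart_domain c k \<and>
          sp c s (z u) = chart_param c k (fold_edge c k (z t) + (u - t) *\<^sub>R (s *\<^sub>R ?v))"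
        if "\<bar>u - t\<bar> < e" for u
      proof -
        have f: "fold_edge c k (z t) + (u - t) *\<^sub>R (s *\<^sub>R ?v) = fold_edge c k (z u)" using fz[of k u t] s by simp
        have "chart_param c k (fold_edge c k (z u)) = rotation c (sp c 1 (z u))"
          using rotation_chart_param[OF c, of "z u" k] *[OF that] by (simp add: chart_param_sp)
        then show ?thesis unfolding f using fold_chart_domain *[OF that] s by simp
      qed
      then show ?thesis using e by blast
    qed
    show ?thesis
    proof (cases rule: nonvertex_cases[OF c, of "z t"])
      case 3
      have "open (z -` interior (Qplus c))" by (intro open_vimage open_interior cz)
      moreover have "t \<in> z -` interior (Qplus c)" using 3 by simp
      ultimately obtain e where e: "e > 0" "ball t e \<subseteq> z -` interior (Qplus c)" by (meson openE)
      show ?thesis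
      proof (rule key[OF e(1), of 0])
        fix u assume "\<bar>u - t\<bar> < e"
        then have "u \<in> ball t e" by (simp add: dist_real_def abs_minus_commute)
        then have "z u \<in> interior (Qplus c)" using e(2) by blast
        then show "z u \<in> chart_domain c 0 \<and> z u \<in> Qplus c" using interior_in_Q[OF c] by (simp add: mem_chart_domain)
      qed
    next
      case (4 k)
      have s0: "side c k (z u) = (1 - u) * side c k (P c a) + u * side c k (P c b)" for u by (simp add: z_def side_affine)
      have "(1 - t) * side c k (P c a) + t * side c k (P c b) = 0"
        using s0[of t] side_edge[OF c, of "z t" k] 4 mem_open_edge_iff by metis
      moreover have "0 \<le> (1 - t) * side c k (P c a)" "0 \<le> t * side c k (P c b)" using t' side_P_nonneg[OF c] by auto
      ultimately have "side c k (P c a) = 0 \<and> side c k (P c b) = 0"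
        using t' by (metis add_nonneg_eq_0_iff diff_gt_0_iff_gt less_irrefl mult_eq_0_iff)
      then have sz: "side c k (z u) = 0" for u using s0[of u] by simp
      show ?thesis
      proof (rule key[of "min t (1 - t)" k])
        show "min t (1 - t) > 0" using t' by simp
        fix u assume "\<bar>u - t\<bar> < min t (1 - t)"
        then have "0 < u" "u < 1" by auto
        then have n: "z u \<in> Qplus c - range (P c)" by (rule nv)
        then have "z u \<in> edge c k" using sz edge_iff_side[OF c] by blast
        then have "z u \<in> open_edge c k" using n edge_cases by blast
        then show "z u \<in> chart_domain c k \<and> z u \<in> Qplus c" using n by (simp add: mem_chart_domain)
      qed
    qed (use nv[OF t'] in auto)
  qed
  have "s *\<^sub>R ?v \<noteq> 0" using ab s inj_P[OF c] by auto
  moreover have "sp c s (z 0) \<in> singularities c" "sp c s (z 1) \<in> singularities c"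
    using sp_singular_iff[OF c s] by (simp_all add: z_def)
  moreover have "sp c s (z t) \<notin> singularities c" if "t \<in> {0<..<1}" for t
    using sp_singular_iff[OF c s] nv[of t] that by auto
  ultimately have "saddle_connection_along c (s *\<^sub>R ?v) (\<lambda>t. sp c s (z t))"
    unfolding saddle_connection_along_def using path local by blast
  then show ?thesis by (simp add: z_def)
qed

text \<open>
  From its midpoint the path follows the diagonal in both directions until it meets a vertex or
  its own end. Singularities occur exactly at the times 0 and 1, so both happen simultaneously.
\<close>

lemma saddle_through_diagonal:
  assumes c: "c \<ge> 1" and \<gamma>: "saddle_connection_along c v \<gamma>" and s: "sheet s" and ab: "a \<noteq> b"
    and h: "\<gamma> (1/2) = sp c s ((1 - \<tau>) *\<^sub>R P c a + \<tau> *\<^sub>R P c b)" "0 < \<tau>" "\<tau> < 1"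
    and w: "s *\<^sub>R v = r *\<^sub>R (P c b - P c a)" "r > 0"
  shows "v = s *\<^sub>R (P c b - P c a)" "t \<in> {0..1} \<Longrightarrow> \<gamma> t = sp c s ((1 - t) *\<^sub>R P c a + t *\<^sub>R P c b)"
proof -
  define y where "y \<theta> = (1 - \<theta>) *\<^sub>R P c a + \<theta> *\<^sub>R P c b" for \<theta>
  define m where "m u = \<tau> + (u - 1/2) * r" for u
  define q where "q = y (\<tau> - r / 2)"
  have line: "y \<tau> + (u - 1/2) *\<^sub>R (s *\<^sub>R v) = y (m u)" for u
    unfolding w y_def m_def by (simp add: algebra_simps)
  have qline: "q + u *\<^sub>R (s *\<^sub>R v) = y (m u)" for u
    unfolding w y_def m_def q_def by (simp add: algebra_simps)
  have nv: "y \<theta> \<in> Qplus c - range (P c)" if "0 < \<theta>" "\<theta> < 1" for \<theta>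
    using diagonal_nonvertex[OF c ab that] by (simp add: y_def)
  \<comment> \<open>The times at which the line through the midpoint reaches the two vertices.\<close>
  define u0 where "u0 = 1/2 - \<tau> / r"
  define u1 where "u1 = 1/2 + (1 - \<tau>) / r"
  have u01: "u0 < 1/2" "1/2 < u1" using h w by (auto simp: u0_def u1_def)
  have m01: "m u0 = 0" "m u1 = 1" using w(2) by (simp_all add: m_def u0_def u1_def)
  have mm: "m u < m u'" if "u < u'" for u u' using that w(2) by (simp add: m_def)
  let ?a = "max u0 0" and ?b = "min u1 1"
  let ?A = "{?a<..<?b}"
  have Q: "y (m u) \<in> Qplus c - range (P c)" if "u0 < u" "u < u1" for u
    using nv mm[OF that(1)] mm[OF that(2)] m01 by simp
  have \<gamma>u: "\<gamma> u = sp c s (y (m u))" if "u \<in> ?A" for u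
  proof -
    have "\<gamma> u = sp c s (y \<tau> + (u - 1/2) *\<^sub>R (s *\<^sub>R v))"
    proof (rule follow_line[OF c \<gamma> s, where A = ?A])
      show "1/2 \<in> ?A" using u01 by simp
      show "\<gamma> (1/2) = sp c s (y \<tau>)" using h(1) by (simp add: y_def)
      show "y \<tau> + (u - 1/2) *\<^sub>R (s *\<^sub>R v) \<in> Qplus c - range (P c)" if "u \<in> ?A" for u
        unfolding line using Q that by simp
    qed (use that in auto)
    then show ?thesis by (simp only: line)
  qed
  have ab': "0 \<le> ?a" "?a < ?b" "?b \<le> 1" using u01 by auto
  have eq: "\<gamma> u = sp c s (q + u *\<^sub>R (s *\<^sub>R v))" if "?a < u" "u < ?b" for u
    unfolding qline using \<gamma>u that by simp
  have mr: "0 \<le> m ?a" "m ?a < 1" "0 < m ?b" "m ?b \<le> 1"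
  proof -
    have mono: "m u \<le> m u'" if "u \<le> u'" for u u' using that w(2) by (simp add: m_def)
    show "0 \<le> m ?a" "m ?b \<le> 1" using mono[of u0 ?a] mono[of ?b u1] m01 by auto
    show "m ?a < 1" "0 < m ?b" using mm[of ?a u1] mm[of u0 ?b] m01 u01 by auto
  qed
  have yQ: "y \<theta> \<in> Qplus c" if "0 \<le> \<theta>" "\<theta> \<le> 1" for \<theta>
    using convexD_alt[OF convex_Qplus P_in_Qplus P_in_Qplus] that by (simp add: y_def)
  have enda: "\<gamma> ?a \<in> singularities c \<longleftrightarrow> y (m ?a) \<in> range (P c)" "cosy c (\<gamma> ?a) = cosy c (sp c s (y (m ?a)))"
    using line_end[OF c \<gamma> s ab' eq, of ?a] yQ[of "m ?a"] mr unfolding qline by auto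
  have endb: "\<gamma> ?b \<in> singularities c \<longleftrightarrow> y (m ?b) \<in> range (P c)" "cosy c (\<gamma> ?b) = cosy c (sp c s (y (m ?b)))"
    using line_end[OF c \<gamma> s ab' eq, of ?b] yQ[of "m ?b"] mr unfolding qline by auto
  have sing: "\<gamma> 0 \<in> singularities c" "\<gamma> 1 \<in> singularities c" "\<And>t. 0 < t \<Longrightarrow> t < 1 \<Longrightarrow> \<gamma> t \<notin> singularities c"
    using \<gamma> by (auto simp: saddle_connection_along_def)
  have y01: "y 0 = P c a" "y 1 = P c b" by (simp_all add: y_def)
  have "u0 = 0"
  proof (rule ccontr)
    assume "u0 \<noteq> 0"
    then consider "u0 < 0" | "0 < u0" by linarith
    then show False
    proof cases
      case 1
      then have "?a = 0" by simp
      then have "0 < m ?a" using mm[OF 1] m01 by simp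
      then show False using nv[of "m ?a"] mr(2) enda(1) sing(1) \<open>?a = 0\<close> by simp
    next
      case 2
      then have "?a = u0" by simp
      then show False using enda(1) m01 y01 sing(3)[of u0] 2 u01 by auto
    qed
  qed
  moreover have "u1 = 1"
  proof (rule ccontr)
    assume "u1 \<noteq> 1"
    then consider "1 < u1" | "u1 < 1" by linarith
    then show False
    proof cases
      case 1
      then have "?b = 1" by simp
      then have "m ?b < 1" using mm[OF 1] m01 by simp
      then show False using nv[of "m ?b"] mr(3) endb(1) sing(2) \<open>?b = 1\<close> by simp
    next
      case 2
      then have "?b = u1" by simp
      then show False using endb(1) m01 y01 sing(3)[of u1] 2 u01 by auto
    qed
  qed
  ultimately have u: "?a = 0" "?b = 1" "\<tau> = r / 2" "1 - \<tau> = r / 2" using w(2) by (auto simp: u0_def u1_def field_simps)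
  then have r: "r = 1" "\<tau> = 1/2" by linarith+
  have m: "m u = u" for u by (simp add: m_def r)
  have "v = s *\<^sub>R (s *\<^sub>R v)" using s by simp
  then show "v = s *\<^sub>R (P c b - P c a)" unfolding w(1) by (simp add: r)
  show "\<gamma> t = sp c s ((1 - t) *\<^sub>R P c a + t *\<^sub>R P c b)" if t: "t \<in> {0..1}"
  proof -
    consider "t = 0" | "t = 1" | "0 < t" "t < 1" using t by fastforce
    then have "\<gamma> t = sp c s (y t)"
    proof cases
      case 1
      have "\<gamma> 0 = sp c s (y 0)"
        by (rule singularity_eqI[OF c sing(1)]) (use enda(2) u m y01 sp_singular_iff[OF c s] in auto)
      then show ?thesis using 1 by simp
    next
      case 2
      have "\<gamma> 1 = sp c s (y 1)"
        by (rule singularity_eqI[OF c sing(2)]) (use endb(2) u m y01 sp_singular_iff[OF c s] in auto)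
      then show ?thesis using 2 by simp
    next
      case 3
      then show ?thesis using \<gamma>u[of t] u m by simp
    qed
    then show ?thesis by (simp add: y_def)
  qed
qed

lemma saddle_through_level:
  assumes c: "c \<ge> 1" and \<gamma>: "saddle_connection_along c v \<gamma>" and s: "sheet s" and ab: "a \<noteq> b"
    and h: "\<gamma> (1/2) = sp c s ((1 - \<tau>) *\<^sub>R P c a + \<tau> *\<^sub>R P c b)" "0 < \<tau>" "\<tau> < 1"
    and w: "s *\<^sub>R v = r *\<^sub>R (P c b - P c a)"
  shows "\<exists>a b. a \<noteq> b \<and> v = s *\<^sub>R (P c b - P c a) \<and> (\<forall>t\<in>{0..1}. \<gamma> t = sp c s ((1 - t) *\<^sub>R P c a + t *\<^sub>R P c b))"
proof -
  have "v \<noteq> 0" using saddle_connection_alongD(2)[OF \<gamma>] .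
  then have "s *\<^sub>R v \<noteq> 0" using s by auto
  then consider "r > 0" | "r < 0" using w by force
  then show ?thesis
  proof cases
    case 1
    then show ?thesis using saddle_through_diagonal[OF c \<gamma> s ab h w] ab
      by (intro exI[of _ a] exI[of _ b] conjI ballI)
  next
    case 2
    have h': "\<gamma> (1/2) = sp c s ((1 - (1 - \<tau>)) *\<^sub>R P c b + (1 - \<tau>) *\<^sub>R P c a)" "0 < 1 - \<tau>" "1 - \<tau> < 1"
      using h by (simp_all add: add.commute)
    have w': "s *\<^sub>R v = (- r) *\<^sub>R (P c a - P c b)" "- r > 0" using w 2 by (simp_all add: algebra_simps)
    show ?thesis
      using saddle_through_diagonal[OF c \<gamma> s ab[symmetric] h' w'] ab
      by (intro exI[of _ b] exI[of _ a]) blast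
  qed
qed

text \<open>
  The path stays on one horizontal level, and that level meets the polygon in the diagonal between
  its two vertices. Level 0 is excluded, as it meets the polygon in a single vertex.
\<close>

lemma horizontal_saddle:
  assumes c: "c \<ge> 1" and \<gamma>: "saddle_connection_along c v \<gamma>" and v: "height v = 0"
  shows "\<exists>s a b. sheet s \<and> a \<noteq> b \<and> v = s *\<^sub>R (P c b - P c a) \<and> (\<forall>t\<in>{0..1}. \<gamma> t = sp c s ((1 - t) *\<^sub>R P c a + t *\<^sub>R P c b))"
proof -
  interpret level_structure c height "row_at c" "siny c" by (rule level_structure_height[OF c])
  obtain s z where s: "sheet s" "z \<in> Qplus c" "z \<notin> range (P c)" "\<gamma> (1/2) = sp c s z" using saddle_midpoint[OF c \<gamma>] .
  have "cylinder (\<gamma> (1/2)) = None" using level_path_None[OF \<gamma> v, of "1/2"] by simp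
  then have "sheet_cylinder s z = None" using cylinder_sp s by simp
  then obtain n where n: "height z = row_at c n" using sheet_cylinder_None[OF s(2)] by metis
  then have gy: "gy c z = real n" using interpolate_at[OF grid_row[OF c], of real n] by (simp add: gy_def)
  have g: "0 \<le> gx c z" "gx c z \<le> real n" "real n \<le> gx c z + 1" using s(2) gy gx_nonneg[OF c, of z] by (auto simp: Qplus_iff[OF c])
  have "n \<noteq> 0"
  proof
    assume "n = 0"
    then have "gx c z = 0" using g by simp
    then show False using vertex_iff_lattice[OF c s(2)] s(3) gy by (simp add: sin_pi_eq_0)
  qed
  then obtain m where m: "n = Suc m" using not0_implies_Suc by blast
  have "sin (pi * gx c z) \<noteq> 0" using vertex_iff_lattice[OF c s(2)] s(3) gy by (simp add: sin_pi_eq_0)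
  then have gn: "gx c z \<noteq> real i" for i by (auto simp: sin_pi_eq_0)
  have gm: "real m < gx c z" "gx c z < real (Suc m)" using g m gn[of m] gn[of "Suc m"] by auto
  then have b: "col_at c m < skew z" "skew z < col_at c (Suc m)" by (simp_all only: gx_cell[OF c])
  let ?a = "int m + 1" and ?b = "- int (Suc m)"
  have P: "P c ?a = pt (col_at c m) (row_at c (Suc m))" "P c ?b = pt (col_at c (Suc m)) (row_at c (Suc m))"
    by (rule P_pos, rule P_neg)
  define \<tau> where "\<tau> = (skew z - col_at c m) / (col_at c (Suc m) - col_at c m)"
  have \<tau>: "0 < \<tau>" "\<tau> < 1" using b by (auto simp: \<tau>_def)
  have "\<tau> * (col_at c (Suc m) - col_at c m) = skew z - col_at c m" using b by (simp add: \<tau>_def)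
  then have z: "z = (1 - \<tau>) *\<^sub>R P c ?a + \<tau> *\<^sub>R P c ?b"
    unfolding P vec2_eq_iff using n m by (simp add: algebra_simps)
  have w: "s *\<^sub>R v = (s * skew v / (col_at c (Suc m) - col_at c m)) *\<^sub>R (P c ?b - P c ?a)"
    unfolding P vec2_eq_iff using v b by simp
  have "?a \<noteq> ?b" by simp
  have h: "\<gamma> (1/2) = sp c s ((1 - \<tau>) *\<^sub>R P c ?a + \<tau> *\<^sub>R P c ?b)" unfolding s(4) z[symmetric] ..
  from saddle_through_level[OF c \<gamma> s(1) \<open>?a \<noteq> ?b\<close> h \<tau> w] show ?thesis
    by (elim exE) (intro exI, rule conjI[OF s(1)], assumption)
qed

lemma slope_one_saddle:
  assumes c: "c \<ge> 1" and \<gamma>: "saddle_connection_along c v \<gamma>" and v: "skew v = 0"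
  shows "\<exists>s a b. sheet s \<and> a \<noteq> b \<and> v = s *\<^sub>R (P c b - P c a) \<and> (\<forall>t\<in>{0..1}. \<gamma> t = sp c s ((1 - t) *\<^sub>R P c a + t *\<^sub>R P c b))"
proof -
  interpret level_structure c skew "col_at c" "sinx c" by (rule level_structure_skew[OF c])
  obtain s z where s: "sheet s" "z \<in> Qplus c" "z \<notin> range (P c)" "\<gamma> (1/2) = sp c s z" using saddle_midpoint[OF c \<gamma>] .
  have "cylinder (\<gamma> (1/2)) = None" using level_path_None[OF \<gamma> v, of "1/2"] by simp
  then have "sheet_cylinder s z = None" using cylinder_sp s by simp
  then obtain n where n: "skew z = col_at c n" using sheet_cylinder_None[OF s(2)] by metis
  then have gx: "gx c z = real n" using interpolate_at[OF grid_col[OF c], of real n] by (simp add: gx_def)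
  have g: "real n \<le> gy c z" "gy c z \<le> real n + 1" using s(2) gx by (auto simp: Qplus_iff[OF c])
  have "sin (pi * gy c z) \<noteq> 0" using vertex_iff_lattice[OF c s(2)] s(3) gx by (simp add: sin_pi_eq_0)
  then have gn: "gy c z \<noteq> real i" for i by (auto simp: sin_pi_eq_0)
  have gm: "real n < gy c z" "gy c z < real (Suc n)" using g gn[of n] gn[of "Suc n"] by auto
  then have b: "row_at c n < height z" "height z < row_at c (Suc n)" by (simp_all only: gy_cell[OF c])
  let ?a = "- int n" and ?b = "int n + 1"
  have P: "P c ?a = pt (col_at c n) (row_at c n)" "P c ?b = pt (col_at c n) (row_at c (Suc n))"
    by (rule P_neg, rule P_pos)
  define \<tau> where "\<tau> = (height z - row_at c n) / (row_at c (Suc n) - row_at c n)"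
  have \<tau>: "0 < \<tau>" "\<tau> < 1" using b by (auto simp: \<tau>_def)
  have "\<tau> * (row_at c (Suc n) - row_at c n) = height z - row_at c n" using b by (simp add: \<tau>_def)
  then have z: "z = (1 - \<tau>) *\<^sub>R P c ?a + \<tau> *\<^sub>R P c ?b"
    unfolding P vec2_eq_iff using n by (simp add: algebra_simps)
  have w: "s *\<^sub>R v = (s * height v / (row_at c (Suc n) - row_at c n)) *\<^sub>R (P c ?b - P c ?a)"
    unfolding P vec2_eq_iff using v b by simp
  have "?a \<noteq> ?b" by simp
  have h: "\<gamma> (1/2) = sp c s ((1 - \<tau>) *\<^sub>R P c ?a + \<tau> *\<^sub>R P c ?b)" unfolding s(4) z[symmetric] ..
  from saddle_through_level[OF c \<gamma> s(1) \<open>?a \<noteq> ?b\<close> h \<tau> w] show ?thesis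
    by (elim exE) (intro exI, rule conjI[OF s(1)], assumption)
qed

section \<open>Reduction of a saddle connection to a diagonal\<close>

definition move_C :: "real \<Rightarrow> real^2 \<Rightarrow> real^2" where "move_C c v = pt (skew v) ((c + 1) * skew v - height v)"

lemma affine_C_eq: "affine_C c z = pt (skew z) ((c + 1) * skew z + 1 - height z)"
  by (simp add: affine_C_def move_A_def vec2_eq_iff skew_T height_T)

lemma move_A_simps [simp]: "skew (move_A v) = 2 * height v - skew v" "height (move_A v) = height v"
  by (simp_all add: move_A_def)
lemma move_B_simps [simp]: "skew (move_B v) = - skew v" "height (move_B v) = height v"
  by (simp_all add: move_B_def)
lemma move_C_simps [simp]: "skew (move_C c v) = skew v" "height (move_C c v) = (c + 1) * skew v - height v"
  by (simp_all add: move_C_def)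

lemma vec2_zero_iff: "v = 0 \<longleftrightarrow> skew v = 0 \<and> height v = 0"
  by (simp add: vec2_eq_iff)

lemma linear_moves: "linear move_A" "linear move_B" "linear (move_C c)"
  by (auto intro!: linearI simp: vec2_eq_iff algebra_simps)

lemma moves_nonzero: assumes "v \<noteq> 0" shows "move_A v \<noteq> 0" "move_B v \<noteq> 0" "move_C c v \<noteq> 0"
  using assms by (auto simp: vec2_zero_iff)

lemma abs_reflect_less:
  fixes x y z :: real assumes "0 < x * y" "\<bar>z\<bar> < 2 * \<bar>x\<bar>" "0 < z * x" shows "\<bar>z - x\<bar> < \<bar>x\<bar>"
  using assms by (cases "x > 0") (auto simp: zero_less_mult_iff)

lemma level_count_less:
  assumes fin: "\<And>N. finite {x \<in> S. x \<le> real N}" and "x' \<in> S" "x' < x"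
  shows "card {y \<in> S. y < x'} < card {y \<in> S. y < (x::real)}"
proof -
  obtain N where "x \<le> real N" using real_arch_simple by blast
  then have "finite {y \<in> S. y < x}" by (intro finite_subset[OF _ fin[of N]]) auto
  moreover have "{y \<in> S. y < x'} \<subset> {y \<in> S. y < x}" using assms by force
  ultimately show ?thesis by (rule psubset_card_mono)
qed

context fixes c :: real assumes c: "c \<ge> 1" begin

lemma saddle_A: assumes \<gamma>: "saddle_connection_along c v \<gamma>"
  shows "saddle_connection_along c (move_A v) (surface_map c c move_A \<circ> \<gamma>)"
proof (rule saddle_transfer[OF c \<gamma> linear_moves(1)])
  have "(\<lambda>y. move_A y - move_A 0) = move_A" by (simp add: fun_eq_iff vec2_eq_iff)
  then show "local_affine c move_A (surface_map c c move_A)" using local_affine_symmetry[OF c symmetry_move_A] by simp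
  show "move_A v \<noteq> 0" by (rule moves_nonzero[OF saddle_connection_alongD(2)[OF \<gamma>]])
qed (use continuous_surface_map surface_map_singular[OF c c] symmetry_polygon_map[OF c symmetry_move_A] in blast)+

lemma saddle_C: assumes \<gamma>: "saddle_connection_along c v \<gamma>"
  shows "saddle_connection_along c (move_C c v) (surface_map c c (affine_C c) \<circ> \<gamma>)"
proof (rule saddle_transfer[OF c \<gamma> linear_moves(3)])
  have "(\<lambda>y. affine_C c y - affine_C c 0) = move_C c" by (simp add: fun_eq_iff vec2_eq_iff affine_C_eq)
  then show "local_affine c (move_C c) (surface_map c c (affine_C c))" using local_affine_symmetry[OF c symmetry_affine_C] by simp
  show "move_C c v \<noteq> 0" by (rule moves_nonzero[OF saddle_connection_alongD(2)[OF \<gamma>]])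
qed (use continuous_surface_map surface_map_singular[OF c c] symmetry_polygon_map[OF c symmetry_affine_C] in blast)+

lemma saddle_B: assumes \<gamma>: "saddle_connection_along c v \<gamma>"
  shows "saddle_connection_along c (move_B v) (cell_flip c \<circ> \<gamma>)"
proof (rule saddle_transfer[OF c \<gamma> linear_moves(2)])
  show "move_B v \<noteq> 0" by (rule moves_nonzero[OF saddle_connection_alongD(2)[OF \<gamma>]])
qed (use local_affine_cell_flip[OF c] continuous_cell_flip[OF c] cell_flip_singular[OF c] in auto)

text \<open>
  The reduction of saddle connections. Let the holonomy have skew \<open>X\<close> and height
  \<open>Y\<close>. If \<open>X Y < 0\<close>, then \<open>B\<close> makes the product positive
  without changing absolute values. If \<open>X Y > 0\<close> and
  \<open>\<bar>Y\<bar> < \<bar>X\<bar>\<close>, then \<open>A\<close> decreases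
  \<open>\<bar>X\<bar>\<close>; if \<open>(c + 1) \<bar>X\<bar> < 2 \<bar>Y\<bar>\<close>,
  then \<open>C\<close> decreases \<open>\<bar>Y\<bar>\<close>; the remaining directions are steep
  and contain no saddle connection. Both absolute values range over discrete sets of sums of
  cylinder widths, so the process ends, and it can only end at a holonomy with
  \<open>X = 0\<close> or \<open>Y = 0\<close>, which belongs to a diagonal.
\<close>

lemma saddle_connection_induct:
  assumes \<gamma>: "saddle_connection_along c v \<gamma>"
    and diagonal: "\<And>v \<gamma> s a b. saddle_connection_along c v \<gamma> \<Longrightarrow> sheet s \<Longrightarrow> a \<noteq> b \<Longrightarrow> skew v = 0 \<or> height v = 0 \<Longrightarrow>
        (\<forall>t\<in>{0..1}. \<gamma> t = sp c s ((1 - t) *\<^sub>R P c a + t *\<^sub>R P c b)) \<Longrightarrow> Pr v \<gamma>"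
    and A: "\<And>v \<gamma>. saddle_connection_along c v \<gamma> \<Longrightarrow> Pr (move_A v) (surface_map c c move_A \<circ> \<gamma>) \<Longrightarrow> Pr v \<gamma>"
    and B: "\<And>v \<gamma>. saddle_connection_along c v \<gamma> \<Longrightarrow> Pr (move_B v) (cell_flip c \<circ> \<gamma>) \<Longrightarrow> Pr v \<gamma>"
    and C: "\<And>v \<gamma>. saddle_connection_along c v \<gamma> \<Longrightarrow> Pr (move_C c v) (surface_map c c (affine_C c) \<circ> \<gamma>) \<Longrightarrow> Pr v \<gamma>"
  shows "Pr v \<gamma>"
proof -
  \<comment> \<open>Counts the admissible values below the two coordinates; \<open>move_A\<close> and \<open>move_C\<close> lower it in their cases, \<open>move_B\<close> keeps it.\<close>
  define \<mu> where "\<mu> v = card {x \<in> level_sums (col_at c). x < \<bar>skew v\<bar>} + card {x \<in> level_sums (row_at c). x < \<bar>height v\<bar>}" for v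
  have finx: "finite {x \<in> level_sums (col_at c). x \<le> real N}" and finy: "finite {x \<in> level_sums (row_at c). x \<le> real N}" for N
    using level_structure.finite_level_sums[OF level_structure_skew[OF c]] level_structure.finite_level_sums[OF level_structure_height[OF c]] by blast+
  have lx: "\<bar>skew v\<bar> \<in> level_sums (col_at c)" and ly: "\<bar>height v\<bar> \<in> level_sums (row_at c)"
    if "saddle_connection_along c v \<gamma>" for v \<gamma>
    using level_structure.holonomy_level_sum[OF level_structure_skew[OF c] that] level_structure.holonomy_level_sum[OF level_structure_height[OF c] that] by blast+
  have step: "\<forall>v \<gamma>. saddle_connection_along c v \<gamma> \<longrightarrow> \<mu> v = N \<longrightarrow> Pr v \<gamma>" for N
  proof (induction N rule: less_induct)
    case (less N)
    have IH: "Pr v \<gamma>" if "saddle_connection_along c v \<gamma>" "\<mu> v < N" for v \<gamma> using less that by blast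
    have pos: "Pr v \<gamma>" if \<gamma>: "saddle_connection_along c v \<gamma>" and N: "\<mu> v = N" and xy: "0 < skew v * height v" for v \<gamma>
    proof -
      have yx: "0 < height v * skew v" using xy by (simp add: mult.commute)
      consider (A) "\<bar>height v\<bar> < \<bar>skew v\<bar>" | (C) "(c + 1) * \<bar>skew v\<bar> < 2 * \<bar>height v\<bar>"
        | (steep) "\<bar>skew v\<bar> \<le> \<bar>height v\<bar>" "2 * \<bar>height v\<bar> \<le> (c + 1) * \<bar>skew v\<bar>" by linarith
      then show ?thesis
      proof cases
        case A
        have "\<bar>2 * height v - skew v\<bar> < \<bar>skew v\<bar>"
          by (rule abs_reflect_less[OF xy]) (use A yx in \<open>auto simp: abs_mult mult_pos_pos\<close>)
        then have l: "\<bar>skew (move_A v)\<bar> < \<bar>skew v\<bar>" by simp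
        note sA = saddle_A[OF \<gamma>]
        have "\<mu> (move_A v) < N" using level_count_less[OF finx lx[OF sA] l] N unfolding \<mu>_def by simp
        then show ?thesis using assms(3)[OF \<gamma>] IH[OF sA] by blast
      next
        case C
        have "0 < ((c + 1) * skew v) * height v" using xy c by (simp add: mult.assoc)
        then have "\<bar>(c + 1) * skew v - height v\<bar> < \<bar>height v\<bar>"
          by (intro abs_reflect_less[OF yx]) (use C c in \<open>auto simp: abs_mult\<close>)
        then have l: "\<bar>height (move_C c v)\<bar> < \<bar>height v\<bar>" by simp
        note sC = saddle_C[OF \<gamma>]
        have "\<mu> (move_C c v) < N" using level_count_less[OF finy ly[OF sC] l] N unfolding \<mu>_def by simp
        then show ?thesis using assms(5)[OF \<gamma>] IH[OF sC] by blast
      next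
        case steep
        have "steep c v \<or> steep c (- v)"
        proof (cases "0 < skew v")
          case True
          then have "0 < height v" using xy by (simp add: zero_less_mult_iff)
          then show ?thesis using steep True by (simp add: steep_def)
        next
          case False
          then have "skew v < 0" "height v < 0" using xy by (auto simp: zero_less_mult_iff)
          then show ?thesis using steep by (simp add: steep_def)
        qed
        then show ?thesis using no_steep_saddle[OF c \<gamma>] by blast
      qed
    qed
    show ?case
    proof (intro allI impI)
      fix v \<gamma> assume \<gamma>: "saddle_connection_along c v \<gamma>" and N: "\<mu> v = N"
      consider "skew v = 0" | "height v = 0" | "0 < skew v * height v" | "0 < skew (move_B v) * height (move_B v)"
        by (cases "skew v = 0"; cases "height v = 0"; simp add: zero_less_mult_iff mult_less_0_iff) linarith
      then show "Pr v \<gamma>"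
      proof cases
        case 1
        from slope_one_saddle[OF c \<gamma> 1] obtain s a b where "sheet s" "a \<noteq> b"
          "\<forall>t\<in>{0..1}. \<gamma> t = sp c s ((1 - t) *\<^sub>R P c a + t *\<^sub>R P c b)" by (elim exE conjE)
        then show ?thesis by (intro diagonal[OF \<gamma>]) (use 1 in auto)
      next
        case 2
        from horizontal_saddle[OF c \<gamma> 2] obtain s a b where "sheet s" "a \<noteq> b"
          "\<forall>t\<in>{0..1}. \<gamma> t = sp c s ((1 - t) *\<^sub>R P c a + t *\<^sub>R P c b)" by (elim exE conjE)
        then show ?thesis by (intro diagonal[OF \<gamma>]) (use 2 in auto)
      next
        case 3
        then show ?thesis by (rule pos[OF \<gamma> N])
      next
        case 4
        have "\<mu> (move_B v) = N" using N by (simp add: \<mu>_def)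
        then show ?thesis by (intro B[OF \<gamma>] pos[OF saddle_B[OF \<gamma>]] 4)
      qed
    qed
  qed
  show ?thesis using step \<gamma> by blast
qed

end

section \<open>Corresponding saddle connections on two surfaces\<close>

definition corresponds :: "real \<Rightarrow> real \<Rightarrow> (real \<Rightarrow> surface_point) \<Rightarrow> bool" where
  "corresponds c d \<gamma> \<longleftrightarrow> (\<exists>w \<gamma>'. saddle_connection_along d w \<gamma>' \<and> \<gamma>' \<in> homotopy_class d (surface_map c d (grid_map c d) \<circ> \<gamma>))"

context fixes c d :: real assumes c: "c \<ge> 1" and d: "d \<ge> 1" begin

text \<open>
  The image of a diagonal and the diagonal with the same end points are joined by the straight
  line homotopy in the convex polygon.
\<close>

lemma corresponds_diagonal:
  assumes \<gamma>: "saddle_connection_along c v \<gamma>" and s: "sheet s" and ab: "a \<noteq> b"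
    and line: "\<forall>t\<in>{0..1}. \<gamma> t = sp c s ((1 - t) *\<^sub>R P c a + t *\<^sub>R P c b)"
  shows "corresponds c d \<gamma>"
proof -
  let ?y = "\<lambda>t. (1 - t) *\<^sub>R P c a + t *\<^sub>R P c b" and ?y' = "\<lambda>t. (1 - t) *\<^sub>R P d a + t *\<^sub>R P d b"
  let ?I = "top_of_set {0..1::real}"
  note F = polygon_map_grid_map[OF c d]
  define f where "f t = grid_map c d (?y t)" for t
  define h where "h r t = (1 - r) *\<^sub>R f t + r *\<^sub>R ?y' t" for r t
  have yQ: "?y t \<in> Qplus c" if "t \<in> {0..1}" for t using convexD_alt[OF convex_Qplus P_in_Qplus P_in_Qplus] that by simp
  have yQ': "?y' t \<in> Qplus d" if "t \<in> {0..1}" for t using convexD_alt[OF convex_Qplus P_in_Qplus P_in_Qplus] that by simp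
  have fQ: "f t \<in> Qplus d" if "t \<in> {0..1}" for t using polygon_map_Q[OF F yQ[OF that]] by (simp add: f_def)
  have hQ: "h r t \<in> Qplus d" if "r \<in> {0..1}" "t \<in> {0..1}" for r t
    unfolding h_def using convexD_alt[OF convex_Qplus fQ[OF that(2)] yQ'[OF that(2)]] that by simp
  have f01: "f 0 = P d a" "f 1 = P d b" using polygon_map_P[OF F] by (simp_all add: f_def)
  have \<gamma>f: "(surface_map c d (grid_map c d) \<circ> \<gamma>) t = sp d s (f t)" if "t \<in> {0..1}" for t
    using line that surface_map_sp[OF F s] by (simp add: f_def)
  have hv: "h r t \<notin> range (P d)" if r: "r \<in> {0..1}" and t: "t \<in> {0<..<1}" for r t
  proof -
    have ff: "f t \<notin> range (P d)"
      using polygon_map_vertex[OF F, of "?y t"] diagonal_nonvertex[OF c ab, of t] t by (auto simp: f_def)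
    have yy: "?y' t \<notin> range (P d)" using diagonal_nonvertex[OF d ab, of t] t by auto
    have t': "t \<in> {0..1}" using t by auto
    consider "r = 0" | "r = 1" | "0 < r" "r < 1" using r by fastforce
    then show ?thesis
    proof cases
      case 3
      then show ?thesis using convex_combination_vertex[OF d fQ[OF t'] yQ'[OF t'] 3] ff unfolding h_def by fastforce
    qed (use ff yy in \<open>simp_all add: h_def\<close>)
  qed
  have "(\<lambda>t. sp d s (?y' t)) \<in> homotopy_class d (surface_map c d (grid_map c d) \<circ> \<gamma>)"
  proof (rule homotopy_classI)
    have cf: "continuous_on {0..1} f"
      unfolding f_def by (rule continuous_on_compose2[of "Qplus c" "grid_map c d"])
        (use F yQ in \<open>auto simp: polygon_map_def intro!: continuous_intros\<close>)
    have "continuous_on ({0..1} \<times> {0..1}) (\<lambda>x. f (snd x))"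
      by (rule continuous_on_compose2[OF cf]) (auto intro: continuous_on_snd continuous_on_id)
    then have "continuous_on ({0..1} \<times> {0..1}) (\<lambda>x. h (fst x) (snd x))"
      unfolding h_def by (intro continuous_on_add continuous_on_scaleR continuous_on_diff continuous_on_const
          continuous_on_fst continuous_on_snd continuous_on_id)
    then have "continuous_map (top_of_set ({0..1} \<times> {0..1})) (top_of_set (Qplus d)) (\<lambda>x. h (fst x) (snd x))"
      using hQ by (auto simp: continuous_map_in_subtopology)
    from continuous_map_compose[OF this continuous_map_sp[OF s]]
    show "continuous_map (prod_topology ?I ?I) (surface d) (\<lambda>(r, t). sp d s (h r t))"
      by (simp add: o_def case_prod_unfold)
    show "(case (0, t) of (r, t) \<Rightarrow> sp d s (h r t)) = (surface_map c d (grid_map c d) \<circ> \<gamma>) t" if "t \<in> {0..1}" for t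
      using \<gamma>f[OF that] by (simp add: h_def)
    show "(case (1, t) of (r, t) \<Rightarrow> sp d s (h r t)) = sp d s (?y' t)" if "t \<in> {0..1}" for t
      by (simp add: h_def)
    have h01: "h r 0 = P d a" "h r 1 = P d b" for r unfolding h_def using f01 by (simp_all flip: scaleR_add_left)
    show "(case (r, 0) of (r, t) \<Rightarrow> sp d s (h r t)) = (surface_map c d (grid_map c d) \<circ> \<gamma>) 0" if "r \<in> {0..1}" for r
      using \<gamma>f[of 0] h01 f01 by simp
    show "(case (r, 1) of (r, t) \<Rightarrow> sp d s (h r t)) = (surface_map c d (grid_map c d) \<circ> \<gamma>) 1" if "r \<in> {0..1}" for r
      using \<gamma>f[of 1] h01 f01 by simp
    show "(case (r, t) of (r, t) \<Rightarrow> sp d s (h r t)) \<notin> singularities d" if "r \<in> {0..1}" "t \<in> {0<..<1}" for r t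
      using hv[OF that] sp_singular_iff[OF d s] by simp
  qed
  then show ?thesis unfolding corresponds_def using diagonal_saddle[OF d ab s] by blast
qed

text \<open>
  Conjugating the grid map by the symmetries of the two polygons gives a polygon map that fixes
  every vertex index, which is therefore homotopic to the grid map.
\<close>

lemma corresponds_symmetry:
  assumes \<gamma>: "saddle_connection_along c v \<gamma>"
    and f: "symmetry c (-1) m f" and g: "symmetry d (-1) m g"
    and move: "\<And>w \<gamma>'. saddle_connection_along d w \<gamma>' \<Longrightarrow> \<exists>w'. saddle_connection_along d w' (surface_map d d g \<circ> \<gamma>')"
    and good: "corresponds c d (surface_map c c f \<circ> \<gamma>)"
  shows "corresponds c d \<gamma>"
proof -
  note F = polygon_map_grid_map[OF c d] and pf = symmetry_polygon_map[OF c f] and pg = symmetry_polygon_map[OF d g]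
  obtain w \<gamma>' where \<gamma>': "saddle_connection_along d w \<gamma>'" "\<gamma>' \<in> homotopy_class d (surface_map c d (grid_map c d) \<circ> (surface_map c c f \<circ> \<gamma>))"
    using good unfolding corresponds_def by blast
  obtain w' where w': "saddle_connection_along d w' (surface_map d d g \<circ> \<gamma>')" using move[OF \<gamma>'(1)] by blast
  have 1: "surface_map d d g \<circ> \<gamma>' \<in> homotopy_class d (surface_map d d g \<circ> (surface_map c d (grid_map c d) \<circ> (surface_map c c f \<circ> \<gamma>)))"
    by (rule homotopy_class_map[OF \<gamma>'(2) continuous_surface_map[OF pg]]) (use surface_map_singular[OF d d pg] in blast)
  have "polygon_map c d (-1) m (grid_map c d \<circ> f)" using polygon_map_compose[OF pf F] by simp
  from polygon_map_compose[OF this pg] have k: "polygon_map c d 1 0 (g \<circ> (grid_map c d \<circ> f))" by simp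
  have pFf: "polygon_map c d (-1) m (grid_map c d \<circ> f)" using polygon_map_compose[OF pf F] by simp
  have singular_arc: "singular_arc c \<gamma>" by (rule saddle_connection_alongD(1)[OF \<gamma>])
  have 2: "surface_map c d (g \<circ> (grid_map c d \<circ> f)) \<circ> \<gamma> \<in> homotopy_class d (surface_map c d (grid_map c d) \<circ> \<gamma>)"
    by (rule surface_map_homotopic[OF c d F k singular_arc])
  have "(surface_map d d g \<circ> (surface_map c d (grid_map c d) \<circ> (surface_map c c f \<circ> \<gamma>))) t = (surface_map c d (g \<circ> (grid_map c d \<circ> f)) \<circ> \<gamma>) t" if "t \<in> {0..1}" for t
    using surface_map_compose[OF pf F saddle_top[OF \<gamma> that]] surface_map_compose[OF pFf pg saddle_top[OF \<gamma> that]] by simp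
  then have 3: "surface_map d d g \<circ> (surface_map c d (grid_map c d) \<circ> (surface_map c c f \<circ> \<gamma>)) \<in> homotopy_class d (surface_map c d (g \<circ> (grid_map c d \<circ> f)) \<circ> \<gamma>)"
    by (intro homotopy_class_eq_on singular_arc_map[OF singular_arc] continuous_surface_map[OF k] surface_map_singular[OF c d k])
  show ?thesis unfolding corresponds_def
    using w' homotopy_class_trans[OF homotopy_class_trans[OF 2 3] 1] by blast
qed

lemma grid_map_cell: "grid_map c d z \<in> cell d j \<longleftrightarrow> z \<in> cell c j"
  unfolding cell_iff[OF c] cell_iff[OF d] by (simp add: c d)

lemma grid_map_flip_skew: assumes "z \<in> cell c j" shows "grid_map c d (flip_skew c j z) = flip_skew d j (grid_map c d z)"
  using assms interpolate_reflect[OF grid_col[OF c], of "cell_col j" "skew z" "col_at d"] by (simp add: grid_map_def flip_skew_def cell_def)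

lemma grid_map_flip_height: assumes "z \<in> cell c j" shows "grid_map c d (flip_height c j z) = flip_height d j (grid_map c d z)"
  using assms interpolate_reflect[OF grid_row[OF c], of "cell_row j" "height z" "row_at d"] by (simp add: grid_map_def flip_height_def cell_def)

text \<open>
  Both maps are affine on cells, and an affine map of rectangles commutes with reflecting them.
  The two sides agree exactly, so in contrast to \<open>A\<close> and \<open>C\<close> no homotopy
  is involved; this matters because \<open>cell_flip\<close> is not induced by a map of polygons.
\<close>

lemma grid_map_cell_flip: assumes C: "C \<in> topspace (surface c)"
  shows "surface_map c d (grid_map c d) (cell_flip c C) = cell_flip d (surface_map c d (grid_map c d) C)"
proof -
  note F = polygon_map_grid_map[OF c d]
  obtain s z where s: "sheet s" "z \<in> Qplus c" "C = sp c s z" using C by (rule surface_cases)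
  obtain j where j: "z \<in> cell c j" using Q_in_some_cell[OF c s(2)] by blast
  have Fz: "grid_map c d z \<in> Qplus d" "grid_map c d z \<in> cell d j" using grid_map_Q[OF c d] grid_map_cell s j by simp_all
  have "sheet (- s)" using s(1) by auto
  then have "surface_map c d (grid_map c d) (flip_in_cell c j s z) = flip_in_cell d j s (grid_map c d z)"
    using surface_map_sp[OF F] s(1) grid_map_flip_skew[OF j] grid_map_flip_height[OF j] grid_map_Q[OF c d, of "flip_skew c j z"] by (simp add: flip_in_cell_def)
  then show ?thesis using cell_flip_sp[OF c s(2) j s(1)] cell_flip_sp[OF d Fz s(1)] surface_map_sp[OF F s(1)] s(3) by simp
qed

lemma corresponds_cell_flip:
  assumes \<gamma>: "saddle_connection_along c v \<gamma>" and good: "corresponds c d (cell_flip c \<circ> \<gamma>)"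
  shows "corresponds c d \<gamma>"
proof -
  note F = polygon_map_grid_map[OF c d]
  obtain w \<gamma>' where \<gamma>': "saddle_connection_along d w \<gamma>'" "\<gamma>' \<in> homotopy_class d (surface_map c d (grid_map c d) \<circ> (cell_flip c \<circ> \<gamma>))"
    using good unfolding corresponds_def by blast
  have 1: "cell_flip d \<circ> \<gamma>' \<in> homotopy_class d (cell_flip d \<circ> (surface_map c d (grid_map c d) \<circ> (cell_flip c \<circ> \<gamma>)))"
    by (rule homotopy_class_map[OF \<gamma>'(2) continuous_cell_flip[OF d]]) (use cell_flip_singular[OF d] in blast)
  have singular_arc: "singular_arc c \<gamma>" by (rule saddle_connection_alongD(1)[OF \<gamma>])
  have "(cell_flip d \<circ> (surface_map c d (grid_map c d) \<circ> (cell_flip c \<circ> \<gamma>))) t = (surface_map c d (grid_map c d) \<circ> \<gamma>) t" if "t \<in> {0..1}" for t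
    using grid_map_cell_flip[OF cell_flip_in_surface[OF c saddle_top[OF \<gamma> that]]] cell_flip_cell_flip[OF c saddle_top[OF \<gamma> that]] by simp
  then have 2: "cell_flip d \<circ> (surface_map c d (grid_map c d) \<circ> (cell_flip c \<circ> \<gamma>)) \<in> homotopy_class d (surface_map c d (grid_map c d) \<circ> \<gamma>)"
    by (intro homotopy_class_eq_on singular_arc_map[OF singular_arc] continuous_surface_map[OF F] surface_map_singular[OF c d F])
  show ?thesis unfolding corresponds_def using saddle_B[OF d \<gamma>'(1)] homotopy_class_trans[OF 2 1] by blast
qed

theorem corresponding_saddle_connection:
  assumes "saddle_connection_along c v \<gamma>" shows "corresponds c d \<gamma>"
  using assms
proof (induction rule: saddle_connection_induct[OF c, consumes 1, case_names diagonal A B C])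
  case (diagonal v \<gamma> s a b)
  then show ?case by (intro corresponds_diagonal[OF diagonal(1-3)])
next
  case (A v \<gamma>)
  show ?case
  proof (rule corresponds_symmetry[OF A(1) symmetry_move_A symmetry_move_A _ A(2)])
    fix w \<gamma>' assume "saddle_connection_along d w \<gamma>'"
    from saddle_A[OF d this] show "\<exists>w'. saddle_connection_along d w' (surface_map d d move_A \<circ> \<gamma>')" by (rule exI)
  qed
next
  case (B v \<gamma>)
  show ?case by (rule corresponds_cell_flip[OF B])
next
  case (C v \<gamma>)
  show ?case
  proof (rule corresponds_symmetry[OF C(1) symmetry_affine_C symmetry_affine_C _ C(2)])
    fix w \<gamma>' assume "saddle_connection_along d w \<gamma>'"
    from saddle_C[OF d this] show "\<exists>w'. saddle_connection_along d w' (surface_map d d (affine_C d) \<circ> \<gamma>')" by (rule exI)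
  qed
qed

end

section \<open>The canonical homeomorphism\<close>

text \<open>
  The charts constrain the path near interior times only, so its values outside the unit interval
  are irrelevant.
\<close>

lemma saddle_connection_along_cong:
  assumes \<gamma>: "saddle_connection_along c v \<gamma>" and eq: "\<And>t. t \<in> {0..1} \<Longrightarrow> \<delta> t = \<gamma> t"
  shows "saddle_connection_along c v \<delta>"
  unfolding saddle_connection_along_def
proof (intro conjI ballI)
  note a = \<gamma>[unfolded saddle_connection_along_def]
  show "pathin (surface c) \<delta>" using a eq unfolding pathin_def by (auto intro: continuous_map_eq)
  show "v \<noteq> 0" "\<delta> 0 \<in> singularities c" "\<delta> 1 \<in> singularities c" using a eq by simp_all
  show "\<delta> t \<notin> singularities c" if "t \<in> {0<..<1}" for t using a eq[of t] that by simp
  fix t :: real assume t: "t \<in> {0<..<1}"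
  then obtain k x e where e: "e > 0"
    "\<forall>u. \<bar>u - t\<bar> < e \<longrightarrow> x + (u - t) *\<^sub>R v \<in> chart_domain c k \<and> \<gamma> u = chart_param c k (x + (u - t) *\<^sub>R v)"
    using a by blast
  show "\<exists>k x. \<exists>e>0. \<forall>u. \<bar>u - t\<bar> < e \<longrightarrow> x + (u - t) *\<^sub>R v \<in> chart_domain c k \<and> \<delta> u = chart_param c k (x + (u - t) *\<^sub>R v)"
  proof (intro exI[of _ k] exI[of _ x] exI[of _ "min e (min t (1 - t))"] conjI allI impI)
    show "0 < min e (min t (1 - t))" using e t by simp
    fix u assume u: "\<bar>u - t\<bar> < min e (min t (1 - t))"
    then have "u \<in> {0..1}" by auto
    then show "x + (u - t) *\<^sub>R v \<in> chart_domain c k" "\<delta> u = chart_param c k (x + (u - t) *\<^sub>R v)"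
      using e(2) u eq[of u] by simp_all
  qed
qed

lemma similarity_on_segment:
  fixes f :: "'a::real_normed_vector \<Rightarrow> 'b::real_normed_vector"
  assumes r: "\<And>x y. x \<in> closed_segment a b \<Longrightarrow> y \<in> closed_segment a b \<Longrightarrow> dist (f x) (f y) = r * dist x y"
    and seg: "f ` closed_segment a b \<subseteq> closed_segment (f a) (f b)" and ne: "f a \<noteq> f b" and t: "0 \<le> t" "t \<le> 1"
  shows "f ((1 - t) *\<^sub>R a + t *\<^sub>R b) = (1 - t) *\<^sub>R f a + t *\<^sub>R f b"
proof -
  let ?x = "(1 - t) *\<^sub>R a + t *\<^sub>R b"
  have x: "?x \<in> closed_segment a b" using t by (auto simp: closed_segment_def)
  have dist_at: "dist ((1 - s) *\<^sub>R p + s *\<^sub>R q) p = s * dist q p" if "0 \<le> s" for s :: real and p q :: "'c::real_normed_vector"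
  proof -
    have "(1 - s) *\<^sub>R p + s *\<^sub>R q - p = s *\<^sub>R (q - p)" by (simp add: algebra_simps)
    then show ?thesis using that by (simp add: dist_norm)
  qed
  obtain u where u: "0 \<le> u" "u \<le> 1" "f ?x = (1 - u) *\<^sub>R f a + u *\<^sub>R f b"
    using seg x unfolding closed_segment_def by blast
  have "u * dist (f b) (f a) = dist (f ?x) (f a)" unfolding u(3) by (simp add: dist_at u)
  also have "\<dots> = r * dist ?x a" by (rule r[OF x]) simp
  also have "\<dots> = t * (r * dist b a)" by (simp add: dist_at t)
  also have "r * dist b a = dist (f b) (f a)" by (rule r[symmetric]) simp_all
  finally have "u = t" using ne by simp
  then show ?thesis using u(3) by simp
qed

lemma edge_Int_edge_pred: assumes c: "c \<ge> 1" and z: "z \<in> edge c k" "z \<in> edge c (k - 1)" shows "z = P c k"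
  using edge_cases[OF z(1)] edge_unique[OF c _ z(2), of k] edge_cases[OF z(2)] edge_unique[OF c _ z(1), of "k - 1"] inj_P[OF c]
  by auto

text \<open>
  A vertex is the only common point of its two edges, hence its index is preserved, and on each
  edge the constant ratio of distances makes the map affine.
\<close>

lemma polygon_map_canonical:
  assumes c: "c \<ge> 1" and d: "d \<ge> 1" and fg: "homeomorphism (Qplus c) (Qplus d) f g"
    and edges: "\<And>k. f ` edge c k = edge d k"
    and ratio: "\<And>k. \<exists>r. \<forall>x\<in>edge c k. \<forall>y\<in>edge c k. dist (f x) (f y) = r * dist x y"
  shows "polygon_map c d 1 0 f" "polygon_map d c 1 0 g"
proof -
  have vertex: "f (P c k) = P d k" for k
  proof -
    have "P c k \<in> edge c k" "P c k \<in> edge c (k - 1)" by (simp_all add: edge_def)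
    then have "f (P c k) \<in> edge d k" "f (P c k) \<in> edge d (k - 1)" using edges by blast+
    then show ?thesis by (rule edge_Int_edge_pred[OF d])
  qed
  have gf: "g (f x) = x" if "x \<in> Qplus c" for x using fg that by (simp add: homeomorphism_def)
  have fgx: "f (g x) = x" if "x \<in> Qplus d" for x using fg that by (simp add: homeomorphism_def)
  have gvertex: "g (P d k) = P c k" for k using gf[OF P_in_Qplus[of c k]] vertex by simp
  have on_edge: "f ((1 - t) *\<^sub>R P c k + t *\<^sub>R P c (k + 1)) = (1 - t) *\<^sub>R P d k + t *\<^sub>R P d (k + 1)" if t: "t \<in> {0..1}" for k t
  proof -
    obtain r where r: "\<forall>x\<in>edge c k. \<forall>y\<in>edge c k. dist (f x) (f y) = r * dist x y" using ratio[of k] ..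
    have "f ` closed_segment (P c k) (P c (k + 1)) \<subseteq> closed_segment (f (P c k)) (f (P c (k + 1)))"
      unfolding vertex using edges[of k] by (simp add: edge_def)
    from similarity_on_segment[OF _ this, of r t] show ?thesis
      using r t inj_P[OF d] unfolding vertex edge_def by simp
  qed
  have inQ: "(1 - t) *\<^sub>R P c k + t *\<^sub>R P c (k + 1) \<in> Qplus c" if t: "t \<in> {0..1}" for k t
    using convexD_alt[OF convex_Qplus P_in_Qplus P_in_Qplus] t by simp
  have g_on_edge: "g ((1 - t) *\<^sub>R P d k + t *\<^sub>R P d (k + 1)) = (1 - t) *\<^sub>R P c k + t *\<^sub>R P c (k + 1)" if t: "t \<in> {0..1}" for k t
    using gf[OF inQ[OF t, of k]] on_edge[OF t, of k] by simp
  show "polygon_map c d 1 0 f" unfolding polygon_map_def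
  proof (intro conjI allI ballI impI)
    fix z assume z: "z \<in> Qplus c" "f z \<in> range (P d)"
    then obtain k where "f z = P d k" by blast
    then have "z = P c k" using gf[OF z(1)] gvertex by simp
    then show "z \<in> range (P c)" by simp
  qed (use fg on_edge in \<open>simp_all add: homeomorphism_def\<close>)
  show "polygon_map d c 1 0 g" unfolding polygon_map_def
  proof (intro conjI allI ballI impI)
    fix z assume z: "z \<in> Qplus d" "g z \<in> range (P c)"
    then obtain k where "g z = P c k" by blast
    then have "z = P d k" using fgx[OF z(1)] vertex by simp
    then show "z \<in> range (P d)" by simp
  qed (use fg g_on_edge in \<open>simp_all add: homeomorphism_def\<close>)
qed

lemma canonical_homeomorphism_cases:
  assumes c: "c \<ge> 1" and h: "canonical_homeomorphism c h"
  obtains f g where "polygon_map c 1 1 0 f" "polygon_map 1 c 1 0 g" "\<forall>x\<in>Qplus 1. f (g x) = x"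
    "\<forall>C\<in>topspace (surface c). h C = surface_map c 1 f C"
proof -
  obtain f g where fg: "homeomorphism (Qplus c) (Qplus 1) f g"
    and edges: "\<And>k. f ` edge c k = edge 1 k"
    and ratio: "\<And>k. \<exists>r. \<forall>x\<in>edge c k. \<forall>y\<in>edge c k. dist (f x) (f y) = r * dist x y"
    and h: "\<And>x. x \<in> Qplus c \<Longrightarrow> h (to_surface c (1, x)) = to_surface 1 (1, f x)"
      "\<And>x. x \<in> Qplus c \<Longrightarrow> h (to_surface c (-1, - x)) = to_surface 1 (-1, - f x)"
    using h unfolding canonical_homeomorphism_def by (elim exE conjE) (rule that; simp)
  note p = polygon_map_canonical[OF c order_refl fg edges ratio]
  have "h C = surface_map c 1 f C" if C: "C \<in> topspace (surface c)" for C
  proof -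
    obtain s z where s: "sheet s" "z \<in> Qplus c" "C = sp c s z" using C by (rule surface_cases)
    then show ?thesis using surface_map_sp[OF p(1) s(1)] h[OF s(2)] by (auto simp: sp_def)
  qed
  moreover have "f (g x) = x" if "x \<in> Qplus 1" for x using fg that by (simp add: homeomorphism_def)
  ultimately show thesis using that p by blast
qed

text \<open>
  The saddle connection \<open>\<tau>\<close> homotopic to the image of \<open>\<sigma>\<close>
  under the grid map is pulled back to the path
  \<open>surface_map 1 c g \<circ> \<tau>\<close> by the inverse of the canonical
  homeomorphism. That path is homotopic to \<open>\<sigma>\<close>, because \<open>g\<close>
  composed with the grid map fixes all vertices and is thus homotopic to the identity.
\<close>

lemma saddle_connection_pushed:
  assumes c: "c \<ge> 1" and h: "canonical_homeomorphism c h" and \<sigma>: "saddle_connection c \<sigma>"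
  shows "\<exists>\<sigma>'. saddle_connection 1 \<sigma>' \<and> \<sigma>' \<in> (\<lambda>\<gamma>. h \<circ> \<gamma>) ` homotopy_class c \<sigma>"
proof -
  obtain f g where p: "polygon_map c 1 1 0 f" "polygon_map 1 c 1 0 g" "\<forall>x\<in>Qplus 1. f (g x) = x"
    "\<forall>C\<in>topspace (surface c). h C = surface_map c 1 f C" using canonical_homeomorphism_cases[OF c h] .
  note one = order_refl[of "1::real"]
  note F = polygon_map_grid_map[OF c one]
  obtain v where \<sigma>: "saddle_connection_along c v \<sigma>" using \<sigma> unfolding saddle_connection_def ..
  note \<sigma>s = saddle_connection_alongD(1)[OF \<sigma>]
  obtain w \<tau> where \<tau>: "saddle_connection_along 1 w \<tau>" "\<tau> \<in> homotopy_class 1 (surface_map c 1 (grid_map c 1) \<circ> \<sigma>)"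
    using corresponding_saddle_connection[OF c one \<sigma>] unfolding corresponds_def by blast
  let ?\<gamma> = "surface_map 1 c g \<circ> \<tau>"
  have k: "polygon_map c c 1 0 (g \<circ> grid_map c 1)" using polygon_map_compose[OF F p(2)] by simp
  have 1: "?\<gamma> \<in> homotopy_class c (surface_map 1 c g \<circ> (surface_map c 1 (grid_map c 1) \<circ> \<sigma>))"
    by (rule homotopy_class_map[OF \<tau>(2) continuous_surface_map[OF p(2)]]) (use surface_map_singular[OF one c p(2)] in blast)
  have "surface_map c c (\<lambda>z. z) C = C" if "C \<in> topspace (surface c)" for C
    using that by (rule surface_cases) (simp add: surface_map_sp[OF polygon_map_id])
  then have 3: "surface_map c c (\<lambda>z. z) \<circ> \<sigma> \<in> homotopy_class c \<sigma>"
    by (intro homotopy_class_eq_on[OF \<sigma>s]) (simp add: saddle_top[OF \<sigma>])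
  have 2: "surface_map c c (g \<circ> grid_map c 1) \<circ> \<sigma> \<in> homotopy_class c (surface_map c c (\<lambda>z. z) \<circ> \<sigma>)"
    by (rule surface_map_homotopic[OF c c polygon_map_id k \<sigma>s])
  have "(surface_map 1 c g \<circ> (surface_map c 1 (grid_map c 1) \<circ> \<sigma>)) t = (surface_map c c (g \<circ> grid_map c 1) \<circ> \<sigma>) t" if "t \<in> {0..1}" for t
    using surface_map_compose[OF F p(2) saddle_top[OF \<sigma> that]] by simp
  then have "surface_map 1 c g \<circ> (surface_map c 1 (grid_map c 1) \<circ> \<sigma>) \<in> homotopy_class c (surface_map c c (g \<circ> grid_map c 1) \<circ> \<sigma>)"
    by (intro homotopy_class_eq_on singular_arc_map[OF \<sigma>s] continuous_surface_map[OF k] surface_map_singular[OF c c k])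
  then have in_class: "?\<gamma> \<in> homotopy_class c \<sigma>"
    using 1 2 3 homotopy_class_trans by blast
  have id: "surface_map 1 1 (f \<circ> g) C = C" if "C \<in> topspace (surface 1)" for C
  proof -
    have "polygon_map 1 1 1 0 (f \<circ> g)" using polygon_map_compose[OF p(2,1)] by simp
    from surface_map_sp[OF this] that show ?thesis by (elim surface_cases) (simp add: p(3))
  qed
  have "(h \<circ> ?\<gamma>) t = \<tau> t" if t: "t \<in> {0..1}" for t
  proof -
    note top = saddle_top[OF \<tau>(1) t]
    have "surface_map 1 c g (\<tau> t) \<in> topspace (surface c)"
      using continuous_map_image_subset_topspace[OF continuous_surface_map[OF p(2)]] top by blast
    then show ?thesis using p(4) surface_map_compose[OF p(2,1) top] id[OF top] by simp
  qed
  from saddle_connection_along_cong[OF \<tau>(1) this] have "saddle_connection 1 (h \<circ> ?\<gamma>)"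
    unfolding saddle_connection_def by (rule exI)
  then show ?thesis using in_class by blast
qed

lemma saddle_connection_pulled_back:
  assumes c: "c \<ge> 1" and h: "canonical_homeomorphism c h" and \<sigma>': "saddle_connection 1 \<sigma>'"
  shows "\<exists>\<sigma>. saddle_connection c \<sigma> \<and> \<sigma> \<in> (\<lambda>\<gamma>. h \<circ> \<gamma>) -` homotopy_class 1 \<sigma>'"
proof -
  obtain f g where p: "polygon_map c 1 1 0 f" "polygon_map 1 c 1 0 g" "\<forall>x\<in>Qplus 1. f (g x) = x"
    "\<forall>C\<in>topspace (surface c). h C = surface_map c 1 f C" using canonical_homeomorphism_cases[OF c h] .
  note one = order_refl[of "1::real"]
  note F = polygon_map_grid_map[OF one c]
  obtain v where \<sigma>': "saddle_connection_along 1 v \<sigma>'" using \<sigma>' unfolding saddle_connection_def ..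
  note \<sigma>s = saddle_connection_alongD(1)[OF \<sigma>']
  obtain w \<sigma> where \<sigma>: "saddle_connection_along c w \<sigma>" "\<sigma> \<in> homotopy_class c (surface_map 1 c (grid_map 1 c) \<circ> \<sigma>')"
    using corresponding_saddle_connection[OF one c \<sigma>'] unfolding corresponds_def by blast
  have k: "polygon_map 1 1 1 0 (f \<circ> grid_map 1 c)" using polygon_map_compose[OF F p(1)] by simp
  have 1: "surface_map c 1 f \<circ> \<sigma> \<in> homotopy_class 1 (surface_map c 1 f \<circ> (surface_map 1 c (grid_map 1 c) \<circ> \<sigma>'))"
    by (rule homotopy_class_map[OF \<sigma>(2) continuous_surface_map[OF p(1)]]) (use surface_map_singular[OF c one p(1)] in blast)
  have "surface_map 1 1 (\<lambda>z. z) C = C" if "C \<in> topspace (surface 1)" for C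
    using that by (rule surface_cases) (simp add: surface_map_sp[OF polygon_map_id])
  then have 3: "surface_map 1 1 (\<lambda>z. z) \<circ> \<sigma>' \<in> homotopy_class 1 \<sigma>'"
    by (intro homotopy_class_eq_on[OF \<sigma>s]) (simp add: saddle_top[OF \<sigma>'])
  have 2: "surface_map 1 1 (f \<circ> grid_map 1 c) \<circ> \<sigma>' \<in> homotopy_class 1 (surface_map 1 1 (\<lambda>z. z) \<circ> \<sigma>')"
    by (rule surface_map_homotopic[OF one one polygon_map_id k \<sigma>s])
  have "(surface_map c 1 f \<circ> (surface_map 1 c (grid_map 1 c) \<circ> \<sigma>')) t = (surface_map 1 1 (f \<circ> grid_map 1 c) \<circ> \<sigma>') t" if "t \<in> {0..1}" for t
    using surface_map_compose[OF F p(1) saddle_top[OF \<sigma>' that]] by simp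
  then have 4: "surface_map c 1 f \<circ> (surface_map 1 c (grid_map 1 c) \<circ> \<sigma>') \<in> homotopy_class 1 (surface_map 1 1 (f \<circ> grid_map 1 c) \<circ> \<sigma>')"
    by (intro homotopy_class_eq_on singular_arc_map[OF \<sigma>s] continuous_surface_map[OF k] surface_map_singular[OF one one k])
  have "(h \<circ> \<sigma>) t = (surface_map c 1 f \<circ> \<sigma>) t" if "t \<in> {0..1}" for t
    using bspec[OF p(4) saddle_top[OF \<sigma>(1) that]] by simp
  then have "h \<circ> \<sigma> \<in> homotopy_class 1 (surface_map c 1 f \<circ> \<sigma>)"
    by (intro homotopy_class_eq_on singular_arc_map[OF saddle_connection_alongD(1)[OF \<sigma>(1)]] continuous_surface_map[OF p(1)] surface_map_singular[OF c one p(1)])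
  then have "h \<circ> \<sigma> \<in> homotopy_class 1 \<sigma>'" using 1 2 3 4 homotopy_class_trans by blast
  then show ?thesis using \<sigma>(1) unfolding saddle_connection_def by blast
qed

section \<open>Directions of saddle connections\<close>

lemma direction_eq: "direction v = {t *\<^sub>R v | t. t \<noteq> 0}"
  by (auto simp: direction_def collinear_rel_def)

lemma direction_scale: assumes "t \<noteq> 0" shows "direction (t *\<^sub>R v) = direction v"
proof -
  have "s *\<^sub>R v = (s / t) *\<^sub>R (t *\<^sub>R v)" for s using assms by simp
  then have "s *\<^sub>R v \<in> direction (t *\<^sub>R v)" if "s \<noteq> 0" for s
    unfolding direction_eq mem_Collect_eq using that assms by (intro exI[of _ "s / t"]) simp
  then show ?thesis
    unfolding direction_eq[of v] unfolding direction_eq[of "t *\<^sub>R v"] using assms by auto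
qed

lemma mem_direction: "v \<in> direction v"
  by (auto simp: direction_eq intro!: exI[of _ 1])

lemma direction_eqD: "direction v = direction w \<Longrightarrow> \<exists>t. t \<noteq> 0 \<and> v = t *\<^sub>R w"
  using mem_direction[of v] by (auto simp: direction_eq)

lemma topspace_RP1: "topspace RP1 = {direction v | v. v \<noteq> 0}"
  by (auto simp: RP1_def quotient_def direction_def)

lemma mem_topspace_RP1: assumes "\<theta> \<in> topspace RP1" "v \<in> \<theta>" shows "\<theta> = direction v" "v \<noteq> 0"
proof -
  obtain w where w: "w \<noteq> 0" "\<theta> = direction w" using assms(1) by (auto simp: topspace_RP1)
  then obtain t where "t \<noteq> 0" "v = t *\<^sub>R w" using assms(2) by (auto simp: direction_eq)
  then show "\<theta> = direction v" "v \<noteq> 0" using w direction_scale by auto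
qed

lemma act_direction: "act M (direction v) = direction (M *v v)"
  by (simp add: act_def direction_eq setcompr_eq_image image_image matrix_vector_mult_scaleR)

lemma act_mult: "act (M ** N) \<theta> = act M (act N \<theta>)"
  by (simp add: act_def image_image matrix_vector_mul_assoc)

lemma act_one: "act (mat 1) \<theta> = \<theta>"
  by (simp add: act_def)

lemma direction_horizontal: assumes "v \<noteq> 0" "height v = 0" shows "direction v = horizontal"
proof -
  have "v = (v $ 1) *\<^sub>R vector [1, 0]" using assms(2) by (simp add: vec_eq_iff forall_2 height_def)
  moreover have "v $ 1 \<noteq> 0" using assms by (auto simp: vec_eq_iff forall_2 height_def)
  ultimately show ?thesis using direction_scale by metis
qed

lemma direction_slope_one: assumes "v \<noteq> 0" "skew v = 0" shows "direction v = slope_one"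
proof -
  have "v = (v $ 2) *\<^sub>R vector [1, 1]" using assms(2) by (simp add: vec_eq_iff forall_2 skew_def)
  moreover have "v $ 2 \<noteq> 0" using assms by (auto simp: vec_eq_iff forall_2 skew_def)
  ultimately show ?thesis using direction_scale by metis
qed

lemma reflection_matrix_move:
  "reflection_matrix c ReflA *v v = move_A v" "reflection_matrix c ReflB *v v = move_B v" "reflection_matrix c ReflC *v v = move_C c v"
  unfolding vec2_eq_iff move_A_simps move_B_simps move_C_simps
  by (simp_all add: skew_def height_def matrix_vector_mult_def sum_2 algebra_simps)

lemma Gpm_image_mult:
  assumes "M \<in> Gpm_image c" shows "reflection_matrix c g ** M \<in> Gpm_image c"
proof -
  have "reflection_matrix c g \<in> Gpm_image c" unfolding Gpm_image_def by (rule generate.incl) simp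
  from generate.eng[OF this[unfolded Gpm_image_def] assms[unfolded Gpm_image_def]] show ?thesis
    by (simp add: Gpm_image_def GL2_def)
qed

lemma mat_1_Gpm_image: "mat 1 \<in> Gpm_image c"
  using generate.one[of GL2] by (simp add: Gpm_image_def GL2_def)

text \<open>
  The horizontal and the slope one direction are the fixed points of the parabolic elements
  \<open>B A\<close> and \<open>- B C\<close>, so their orbits are the cusps of the group.
\<close>

definition cusp_direction :: "real \<Rightarrow> (real^2) set \<Rightarrow> bool" where
  "cusp_direction c \<theta> \<longleftrightarrow> (\<exists>M \<in> Gpm_image c. \<theta> = act M horizontal \<or> \<theta> = act M slope_one)"

lemma cusp_direction_reflection:
  assumes "cusp_direction c (direction (reflection_matrix c g *v v))" shows "cusp_direction c (direction v)"
proof -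
  have "direction v = act (reflection_matrix c g) (direction (reflection_matrix c g *v v))"
    by (simp add: act_direction matrix_vector_mul_assoc reflection_matrix_square)
  then have act: "direction v = act (reflection_matrix c g ** M) p"
    if "direction (reflection_matrix c g *v v) = act M p" for M p
    using that by (simp add: act_mult)
  obtain M where M: "M \<in> Gpm_image c"
    "direction (reflection_matrix c g *v v) = act M horizontal \<or> direction (reflection_matrix c g *v v) = act M slope_one"
    using assms unfolding cusp_direction_def by (elim bexE)
  show ?thesis
    unfolding cusp_direction_def
    by (rule bexI[OF _ Gpm_image_mult[OF M(1), of g]], rule disj_forward[OF M(2)]) (erule act)+
qed

lemma saddle_cusp_direction:
  assumes c: "c \<ge> 1" and \<gamma>: "saddle_connection_along c v \<gamma>" shows "cusp_direction c (direction v)"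
  using \<gamma>
proof (induction rule: saddle_connection_induct[OF c, consumes 1, case_names diagonal A B C])
  case (diagonal v \<gamma> s a b)
  from diagonal(4) have "direction v = horizontal \<or> direction v = slope_one"
    using direction_horizontal[of v] direction_slope_one[of v] saddle_connection_alongD(2)[OF diagonal(1)] by blast
  then show ?case unfolding cusp_direction_def by (intro bexI[OF _ mat_1_Gpm_image]) (simp only: act_one)
next
  case (A v \<gamma>)
  show ?case by (rule cusp_direction_reflection[of c ReflA, unfolded reflection_matrix_move]) (rule A(2))
next
  case (B v \<gamma>)
  show ?case by (rule cusp_direction_reflection[of c ReflB, unfolded reflection_matrix_move]) (rule B(2))
next
  case (C v \<gamma>)
  show ?case by (rule cusp_direction_reflection[of c ReflC, unfolded reflection_matrix_move]) (rule C(2))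
qed

lemma has_saddle_connection_reflection:
  assumes c: "c \<ge> 1" and \<theta>: "has_saddle_connection c \<theta>" shows "has_saddle_connection c (act (reflection_matrix c g) \<theta>)"
proof -
  obtain v \<sigma> where v: "v \<in> \<theta>" "saddle_connection_along c v \<sigma>" using \<theta> unfolding has_saddle_connection_def by blast
  have "\<exists>\<sigma>. saddle_connection_along c (reflection_matrix c g *v v) \<sigma>"
    using saddle_A[OF c v(2)] saddle_B[OF c v(2)] saddle_C[OF c v(2)] by (cases g) (auto simp only: reflection_matrix_move)
  then show ?thesis using v(1) unfolding has_saddle_connection_def act_def by blast
qed

lemma has_saddle_connection_act:
  assumes c: "c \<ge> 1" and v: "has_saddle_connection c (direction v)" and M: "M \<in> Gpm_image c"
  shows "has_saddle_connection c (act M (direction v))"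
proof -
  obtain w e where M: "M = rep c (w, e)" using M unfolding Gpm_image_eq by auto
  let ?N = "foldr (\<lambda>g M. reflection_matrix c g ** M) w (mat 1)"
  have "has_saddle_connection c (act ?N (direction v))"
  proof (induction w)
    case (Cons g w)
    then show ?case using has_saddle_connection_reflection[OF c] by (simp add: act_mult)
  qed (simp add: act_one v)
  moreover have "act M (direction v) = act ?N (direction v)"
    using direction_scale[of "(-1) ^ nat e" "?N *v v"] by (simp add: M rep_def act_direction scaleR_matrix_vector_assoc[symmetric])
  ultimately show ?thesis by simp
qed

lemma has_saddle_connection_base:
  assumes c: "c \<ge> 1" shows "has_saddle_connection c horizontal" "has_saddle_connection c slope_one"
proof -
  have d: "has_saddle_connection c (direction v)" if "saddle_connection_along c v \<gamma>" for v \<gamma>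
    using that mem_direction unfolding has_saddle_connection_def by blast
  note h = diagonal_saddle[OF c, of 1 "-1" 1, simplified] and s = diagonal_saddle[OF c, of 0 1 1, simplified]
  have P: "P c 1 = pt (col_at c 0) (row_at c 1)" "P c (-1) = pt (col_at c 1) (row_at c 1)" "P c 0 = pt (col_at c 0) (row_at c 0)"
    using P_pos[of c 0] P_neg[of c 1] P_neg[of c 0] by simp_all
  have "direction (P c (- 1) - P c 1) = horizontal"
    by (rule direction_horizontal[OF saddle_connection_alongD(2)[OF h]]) (simp add: P)
  then show "has_saddle_connection c horizontal" using d[OF h] by simp
  have "direction (P c 1) = slope_one"
    using s by (intro direction_slope_one) (auto simp: P dest: saddle_connection_alongD(2))
  then show "has_saddle_connection c slope_one" using d[OF s] by (simp add: P)
qed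

theorem has_saddle_connection_iff_cusp:
  assumes c: "c \<ge> 1" and \<theta>: "\<theta> \<in> topspace RP1" shows "has_saddle_connection c \<theta> \<longleftrightarrow> cusp_direction c \<theta>"
proof
  assume "has_saddle_connection c \<theta>"
  then obtain v \<sigma> where v: "v \<in> \<theta>" "saddle_connection_along c v \<sigma>" unfolding has_saddle_connection_def by blast
  then show "cusp_direction c \<theta>" using saddle_cusp_direction[OF c v(2)] mem_topspace_RP1(1)[OF \<theta> v(1)] by simp
next
  assume "cusp_direction c \<theta>"
  then show "has_saddle_connection c \<theta>" unfolding cusp_direction_def
    using has_saddle_connection_act[OF c] has_saddle_connection_base[OF c] by blast
qed

section \<open>Monotone lifts of the semiconjugacy\<close>

lemma angle_direction_eq_iff: "angle_direction a = angle_direction b \<longleftrightarrow> (\<exists>n::int. a = b + of_int n * pi)"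
proof
  assume "angle_direction a = angle_direction b"
  then obtain t where t: "(vector [cos a, sin a] :: real^2) = t *\<^sub>R vector [cos b, sin b]"
    unfolding angle_direction_def using direction_eqD by blast
  then have "cos a = t * cos b" "sin a = t * sin b" by (auto simp: vec_eq_iff forall_2)
  then have "sin (a - b) = 0" by (simp add: sin_diff)
  then obtain n :: int where "a - b = of_int n * pi" unfolding sin_zero_iff_int2 by blast
  then show "\<exists>n::int. a = b + of_int n * pi" by (intro exI[of _ n]) simp
next
  assume "\<exists>n::int. a = b + of_int n * pi"
  then obtain n :: int where a: "a = b + of_int n * pi" by blast
  have s: "sin (of_int n * pi) = 0" using sin_zero_iff_int2 by blast
  have c: "cos (of_int n * pi) \<noteq> 0" using s sin_zero_abs_cos_one by force
  have "vector [cos a, sin a] = cos (of_int n * pi) *\<^sub>R (vector [cos b, sin b] :: real^2)"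
    unfolding a by (simp add: vec_eq_iff forall_2 cos_add sin_add s mult.commute)
  then show "angle_direction a = angle_direction b" unfolding angle_direction_def by (simp add: direction_scale[OF c])
qed

lemma vector_cos_sin_nonzero: "vector [cos a, sin a] \<noteq> (0::real^2)"
  using sin_zero_abs_cos_one[of a] by (auto simp: vec_eq_iff forall_2)

lemma angle_direction_RP1 [simp]: "angle_direction a \<in> topspace RP1"
  unfolding topspace_RP1 angle_direction_def using vector_cos_sin_nonzero by blast

lemma lift_add_pi:
  fixes F :: "real \<Rightarrow> real" assumes "\<And>a. F (a + pi) = F a + pi" shows "F (a + real n * pi) = F a + real n * pi"
proof (induction n)
  case (Suc n)
  have "a + real (Suc n) * pi = a + real n * pi + pi" by (simp add: algebra_simps)
  then show ?case using assms[of "a + real n * pi"] Suc by (simp add: algebra_simps)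
qed simp

text \<open>
  If \<open>F\<close> decreases from \<open>a\<close> to some later point \<open>x\<close>, there
  is a third point whose value lies between \<open>F a\<close> and \<open>F x + pi\<close>;
  the three points are positively oriented while their images are negatively oriented.
\<close>

lemma lift_mono:
  assumes F: "continuous_on UNIV F" "\<And>a. \<phi> (angle_direction a) = angle_direction (F a)" "\<And>a. F (a + pi) = F a + pi"
    and ori: "\<And>\<theta>\<^sub>1 \<theta>\<^sub>2 \<theta>\<^sub>3. \<theta>\<^sub>1 \<in> topspace RP1 \<Longrightarrow> \<theta>\<^sub>2 \<in> topspace RP1 \<Longrightarrow> \<theta>\<^sub>3 \<in> topspace RP1 \<Longrightarrow>
      positively_oriented \<theta>\<^sub>1 \<theta>\<^sub>2 \<theta>\<^sub>3 \<Longrightarrow> \<not> positively_oriented (\<phi> \<theta>\<^sub>1) (\<phi> \<theta>\<^sub>3) (\<phi> \<theta>\<^sub>2)"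
  shows "mono F"
proof (rule ccontr)
  assume "\<not> mono F"
  then obtain a b where ab: "a \<le> b" "F b < F a" by (force simp: mono_def)
  \<comment> \<open>Moving \<open>b\<close> back by whole periods brings it within one period of \<open>a\<close> and only lowers \<open>F b\<close>.\<close>
  define n where "n = nat \<lfloor>(b - a) / pi\<rfloor>"
  have nf: "real n = of_int \<lfloor>(b - a) / pi\<rfloor>" using ab by (simp add: n_def)
  have "real n \<le> (b - a) / pi" "(b - a) / pi < real n + 1" unfolding nf by linarith+
  then have n: "real n * pi \<le> b - a" "b - a < real n * pi + pi" by (simp_all add: field_simps)
  define b' where "b' = b - real n * pi"
  have "F b' \<le> F b" using lift_add_pi[of F b' n, OF F(3)] by (simp add: b'_def)
  then have b': "F b' < F a" "a \<le> b'" "b' < a + pi" using ab n by (simp_all add: b'_def)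
  have cont: "continuous_on S F" for S using F(1) continuous_on_subset by blast
  \<comment> \<open>The value is kept within half a period below \<open>F a\<close>, so that the images stay in one period.\<close>
  obtain x where x: "a \<le> x" "x \<le> b'" "F x = max (F b') (F a - pi / 2)"
    using IVT2'[of F b' "max (F b') (F a - pi / 2)" a] b' cont by force
  have "F a - pi / 2 \<le> F x" unfolding x(3) by simp
  then have Fx: "F a - pi < F x" "F x < F a" using pi_gt_zero x(3) b'(1) by (linarith, simp)
  obtain y where y: "x \<le> y" "y \<le> a + pi" "F y = (F a + F x + pi) / 2"
    using IVT'[of F x "(F a + F x + pi) / 2" "a + pi"] Fx F(3)[of a] cont x b' by force
  have "x \<noteq> a" "y \<noteq> x" "y \<noteq> a + pi" using Fx y(3) F(3)[of a] by auto
  then have "a < x" "x < y" "y < a + pi" using x y by auto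
  then have "positively_oriented (angle_direction a) (angle_direction x) (angle_direction y)"
    unfolding positively_oriented_def by blast
  moreover have "positively_oriented (\<phi> (angle_direction a)) (\<phi> (angle_direction y)) (\<phi> (angle_direction x))"
    unfolding positively_oriented_def
  proof (intro exI conjI)
    show "F a < F y" "F y < F x + pi" "F x + pi < F a + pi" using Fx y(3) by auto
    show "\<phi> (angle_direction x) = angle_direction (F x + pi)"
      unfolding F(2) angle_direction_eq_iff by (rule exI[of _ "-1"]) simp
  qed (rule F(2))+
  ultimately show False using ori by simp
qed

section \<open>Fibres of the semiconjugacy over the cusps\<close>

lemma int_multiple_of_pi_in_0_pi:
  fixes k :: int assumes "0 \<le> of_int k * pi" "of_int k * pi \<le> pi" shows "k = 0 \<or> k = 1"
  using assms pi_gt_zero by (simp add: zero_le_mult_iff) linarith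

text \<open>
  The directions other than that of \<open>u\<close> are parametrized by a slope \<open>r\<close>, on which a parabolic element
  fixing \<open>u\<close> acts as a translation.
\<close>

context
  fixes \<alpha> :: real and u w :: "real^2" and D :: "real \<Rightarrow> (real^2) set"
  assumes u: "u = vector [cos \<alpha>, sin \<alpha>]" and w: "w = vector [- sin \<alpha>, cos \<alpha>]"
    and D: "D = (\<lambda>r. direction (r *\<^sub>R u + w))"
begin

lemma direction_slope_cases:
  assumes "\<theta> \<in> topspace RP1" shows "\<theta> = angle_direction \<alpha> \<or> (\<exists>r. \<theta> = D r)"
proof -
  obtain v where v: "v \<noteq> 0" "\<theta> = direction v" using assms by (auto simp: topspace_RP1)
  define x y where "x = cos \<alpha> * v$1 + sin \<alpha> * v$2" and "y = cos \<alpha> * v$2 - sin \<alpha> * v$1"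
  have cs: "cos \<alpha> * (cos \<alpha> * a) + sin \<alpha> * (sin \<alpha> * a) = a" for a
    using sin_cos_squared_add2[of \<alpha>] by (simp flip: mult.assoc distrib_right)
  have vxy: "v = x *\<^sub>R u + y *\<^sub>R w"
    using cs[of "v$1"] cs[of "v$2"] by (simp add: x_def y_def u w vec_eq_iff forall_2 algebra_simps)
  show ?thesis
  proof (cases "y = 0")
    case True
    then have "v = x *\<^sub>R u" "x \<noteq> 0" using vxy v by auto
    then show ?thesis using v(2) direction_scale by (simp add: angle_direction_def u)
  next
    case False
    then have "v = y *\<^sub>R ((x / y) *\<^sub>R u + w)" using vxy by (simp add: scaleR_add_right)
    then show ?thesis using v(2) direction_scale[OF False] unfolding D by metis
  qed
qed

lemma slope_coords:
  assumes "a *\<^sub>R u + b *\<^sub>R w = a' *\<^sub>R u + b' *\<^sub>R w" shows "a = a'" "b = b'"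
proof -
  have 1: "a * cos \<alpha> - b * sin \<alpha> = a' * cos \<alpha> - b' * sin \<alpha>" and 2: "a * sin \<alpha> + b * cos \<alpha> = a' * sin \<alpha> + b' * cos \<alpha>"
    using assms by (auto simp: u w vec_eq_iff forall_2)
  have "a = (a * cos \<alpha> - b * sin \<alpha>) * cos \<alpha> + (a * sin \<alpha> + b * cos \<alpha>) * sin \<alpha>" for a b
    using sin_cos_squared_add[of \<alpha>] by (simp add: power2_eq_square) algebra
  note A = this
  have B: "b = (a * sin \<alpha> + b * cos \<alpha>) * cos \<alpha> - (a * cos \<alpha> - b * sin \<alpha>) * sin \<alpha>" for a b
    using sin_cos_squared_add[of \<alpha>] by (simp add: power2_eq_square) algebra
  show "a = a'" using A[of a b] A[of a' b'] unfolding 1 2 by simp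
  show "b = b'" using B[of b a] B[of b' a'] unfolding 1 2 by simp
qed

lemma slope_direction_neq: "D r \<noteq> angle_direction \<alpha>"
proof
  assume "D r = angle_direction \<alpha>"
  then obtain t where "r *\<^sub>R u + w = t *\<^sub>R u" unfolding D angle_direction_def u[symmetric] using direction_eqD by blast
  then show False using slope_coords[of r 1 t 0] by simp
qed

lemma slope_direction_inj: assumes "D r = D r'" shows "r = r'"
proof -
  obtain t where "r *\<^sub>R u + w = t *\<^sub>R (r' *\<^sub>R u + w)" using assms unfolding D using direction_eqD by blast
  then have "r *\<^sub>R u + 1 *\<^sub>R w = (t * r') *\<^sub>R u + t *\<^sub>R w" by (simp add: scaleR_add_right)
  from slope_coords[OF this] show ?thesis by simp
qed

lemma slope_direction_RP1: "D r \<in> topspace RP1"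
proof -
  have "r *\<^sub>R u + w \<noteq> 0" using slope_coords[of r 1 0 0] by auto
  then show ?thesis unfolding topspace_RP1 D by blast
qed

lemma slope_direction_angle: "angle_direction (\<alpha> + (pi / 2 - arctan r)) = D r"
proof -
  have c: "cos (arctan r) \<noteq> 0" by simp
  have s: "sin (arctan r) = r * cos (arctan r)" using tan_arctan[of r] by (simp add: tan_def field_simps)
  have "vector [cos (\<alpha> + (pi / 2 - arctan r)), sin (\<alpha> + (pi / 2 - arctan r))] = cos (arctan r) *\<^sub>R (r *\<^sub>R u + w)"
    by (simp add: vec_eq_iff forall_2 u w cos_add sin_add cos_diff sin_diff s algebra_simps)
  then show ?thesis unfolding angle_direction_def D by (simp only: direction_scale[OF c])
qed

lemma parabolic_act:
  assumes "N *v u = u" "N *v w = w + \<kappa> *\<^sub>R u"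
  shows "act N (angle_direction \<alpha>) = angle_direction \<alpha>" "act N (D r) = D (r + \<kappa>)"
  using assms unfolding angle_direction_def u[symmetric] D act_direction
  by (simp_all add: matrix_vector_right_distrib matrix_vector_mult_scaleR scaleR_add_left add.commute add.left_commute)

text \<open>
  Let \<open>p\<close> be the fixed direction of the parabolic element. Equivariance makes
  \<open>\<phi> p\<close> a fixed direction of the corresponding parabolic element for
  \<open>c = 1\<close>, so \<open>\<phi> p = p\<close>. If \<open>\<phi>\<close> collapsed
  another direction to \<open>p\<close>, then by monotonicity it would collapse all directions on
  one side of it, up to \<open>p\<close>. Every orbit of the translation by
  \<open>\<kappa>\<close> enters that side, and the fibre over \<open>p\<close> is invariant, so
  \<open>\<phi>\<close> would be constant, whereas its lift advances by a full period.
\<close>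

lemma cusp_preimage:
  assumes \<phi>: "natural_semiconjugacy c \<phi>" and G: "G \<in> carrier Gpm"
    and N: "rep c G *v u = u" "rep c G *v w = w + \<kappa> *\<^sub>R u" "\<kappa> \<noteq> 0"
    and N1: "rep 1 G *v u = u" "rep 1 G *v w = w + \<kappa>' *\<^sub>R u" "\<kappa>' \<noteq> 0"
    and \<theta>: "\<theta> \<in> topspace RP1"
  shows "\<phi> \<theta> = angle_direction \<alpha> \<longleftrightarrow> \<theta> = angle_direction \<alpha>"
proof -
  let ?p = "angle_direction \<alpha>"
  note act = parabolic_act[OF N(1,2)] and act1 = parabolic_act[OF N1(1,2)]
  have equi: "\<phi> (act (rep c G) \<theta>) = act (rep 1 G) (\<phi> \<theta>)" if "\<theta> \<in> topspace RP1" for \<theta>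
    using \<phi> G that unfolding natural_semiconjugacy_def by blast
  have RP1: "\<phi> \<theta> \<in> topspace RP1" if "\<theta> \<in> topspace RP1" for \<theta>
    using \<phi> that unfolding natural_semiconjugacy_def by blast
  have fix_p: "\<phi> ?p = ?p"
  proof (rule ccontr)
    assume "\<phi> ?p \<noteq> ?p"
    then obtain r where r: "\<phi> ?p = D r" using direction_slope_cases[OF RP1[OF angle_direction_RP1]] by blast
    have "D r = D (r + \<kappa>')" using equi[of ?p] unfolding act r act1 by simp
    from slope_direction_inj[OF this] show False using N1(3) by simp
  qed
  have step: "\<phi> (D (r + \<kappa>)) = ?p \<longleftrightarrow> \<phi> (D r) = ?p" for r
  proof -
    have e: "\<phi> (D (r + \<kappa>)) = act (rep 1 G) (\<phi> (D r))" using equi[OF slope_direction_RP1] unfolding act .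
    consider "\<phi> (D r) = ?p" | r' where "\<phi> (D r) = D r'" using direction_slope_cases[OF RP1[OF slope_direction_RP1]] by blast
    then show ?thesis by cases (simp_all add: e act1 slope_direction_neq)
  qed
  have steps: "\<phi> (D (r + real n * \<kappa>)) = ?p \<longleftrightarrow> \<phi> (D r) = ?p" for r n
  proof (induction n)
    case (Suc n)
    have e: "r + real (Suc n) * \<kappa> = r + real n * \<kappa> + \<kappa>" by (simp add: algebra_simps)
    show ?case unfolding e step by (rule Suc)
  qed simp
  have far: "\<exists>r'. (s * (r' - r0) \<ge> 0) \<and> (\<phi> (D r') = ?p \<longleftrightarrow> \<phi> (D r) = ?p)" if s: "sheet s" for r0 r s
  proof -
    obtain n where n: "\<bar>r - r0\<bar> < real n * \<bar>\<kappa>\<bar>" using reals_Archimedean3[of "\<bar>\<kappa>\<bar>"] N(3) by auto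
    have "0 \<le> s * (r + real n * \<kappa> - r0) \<or> 0 \<le> s * (r - real n * \<kappa> - r0)"
      using s n by (auto simp: abs_if split: if_splits)
    then show ?thesis using steps[of r n] steps[of "r - real n * \<kappa>" n] by auto
  qed
  obtain F where F: "continuous_on UNIV F" "\<And>a. \<phi> (angle_direction a) = angle_direction (F a)" "\<And>a. F (a + pi) = F a + pi"
    using \<phi> unfolding natural_semiconjugacy_def degree_one_def by blast
  have mono: "mono F"
    by (rule lift_mono[OF F]) (use \<phi> in \<open>unfold natural_semiconjugacy_def, blast\<close>)
  have \<phi>D: "\<phi> (D r) = angle_direction (F (\<alpha> + (pi / 2 - arctan r)))" for r
    unfolding slope_direction_angle[symmetric] by (rule F(2))
  have bounds: "F \<alpha> \<le> F (\<alpha> + (pi / 2 - arctan r))" "F (\<alpha> + (pi / 2 - arctan r)) \<le> F \<alpha> + pi" for r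
    using arctan_bounded[of r] unfolding F(3)[symmetric] by (auto intro!: monoD[OF mono])
  have p: "angle_direction (F \<alpha>) = ?p" "angle_direction (F \<alpha> + pi) = ?p"
    using fix_p F(2)[of \<alpha>] F(2)[of "\<alpha> + pi"] F(3)[of \<alpha>] angle_direction_eq_iff[of "\<alpha> + pi" \<alpha>] by (auto intro: exI[of _ 1])
  have "\<phi> (D r0) \<noteq> ?p" for r0
  proof
    assume r0: "\<phi> (D r0) = ?p"
    obtain k :: int where "F (\<alpha> + (pi / 2 - arctan r0)) = F \<alpha> + of_int k * pi"
      using r0 unfolding \<phi>D p(1)[symmetric] angle_direction_eq_iff by blast
    then have ends: "F (\<alpha> + (pi / 2 - arctan r0)) = F \<alpha> \<or> F (\<alpha> + (pi / 2 - arctan r0)) = F \<alpha> + pi"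
      using bounds[of r0] int_multiple_of_pi_in_0_pi[of k] by auto
    obtain s where s: "sheet s" "\<And>r. 0 \<le> s * (r - r0) \<Longrightarrow> \<phi> (D r) = ?p"
    proof (rule disjE[OF ends])
      assume e: "F (\<alpha> + (pi / 2 - arctan r0)) = F \<alpha>"
      have "\<phi> (D r) = ?p" if "0 \<le> 1 * (r - r0)" for r
      proof -
        have "F (\<alpha> + (pi / 2 - arctan r)) \<le> F (\<alpha> + (pi / 2 - arctan r0))"
          using that by (intro monoD[OF mono]) (simp add: arctan_le_iff)
        then have "F (\<alpha> + (pi / 2 - arctan r)) = F \<alpha>" using e bounds(1)[of r] by simp
        then show ?thesis unfolding \<phi>D by (simp only: p)
      qed
      then show thesis using that[of 1] by blast
    next
      assume e: "F (\<alpha> + (pi / 2 - arctan r0)) = F \<alpha> + pi"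
      have "\<phi> (D r) = ?p" if "0 \<le> (-1) * (r - r0)" for r
      proof -
        have "F (\<alpha> + (pi / 2 - arctan r0)) \<le> F (\<alpha> + (pi / 2 - arctan r))"
          using that by (intro monoD[OF mono]) (simp add: arctan_le_iff)
        then have "F (\<alpha> + (pi / 2 - arctan r)) = F \<alpha> + pi" using e bounds(2)[of r] by simp
        then show ?thesis unfolding \<phi>D by (simp only: p)
      qed
      then show thesis using that[of "-1"] by blast
    qed
    have all: "\<phi> (D r) = ?p" for r using far[OF s(1), of r0 r] s(2) by blast
    have "continuous_on {\<alpha>..\<alpha> + pi} F" using F(1) continuous_on_subset by blast
    then obtain x where x: "F x = F \<alpha> + pi / 2"
      using IVT'[of F \<alpha> "F \<alpha> + pi / 2" "\<alpha> + pi"] F(3)[of \<alpha>] by force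
    have "\<phi> (angle_direction x) = ?p" using direction_slope_cases[OF angle_direction_RP1] all fix_p by metis
    then obtain k :: int where "F x = F \<alpha> + of_int k * pi" unfolding F(2) p(1)[symmetric] angle_direction_eq_iff by blast
    then have "of_int k * pi = (1/2) * pi" using x by simp
    then have "real_of_int (2 * k) = 1" by simp
    then have "2 * k = 1" by linarith
    then show False by presburger
  qed
  then show ?thesis using direction_slope_cases[OF \<theta>] fix_p slope_direction_neq by metis
qed

end

lemma rep_word2: "rep c ([g, g'], e) *v v = (-1) ^ nat e *\<^sub>R (reflection_matrix c g *v (reflection_matrix c g' *v v))"
  by (simp add: rep_def scaleR_matrix_vector_assoc[symmetric] matrix_vector_mul_assoc)

lemma word2_in_Gpm: "g \<noteq> g' \<Longrightarrow> e \<in> {0, 1} \<Longrightarrow> ([g, g'], e) \<in> carrier Gpm"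
  by (auto simp: Gpm_def free_product_Z2_def carrier_integer_mod_group)

lemma horizontal_preimage:
  assumes "natural_semiconjugacy c \<phi>" "\<theta> \<in> topspace RP1" shows "\<phi> \<theta> = horizontal \<longleftrightarrow> \<theta> = horizontal"
proof -
  have e: "rep b ([ReflB, ReflA], 0) *v vector [1, 0] = (vector [1, 0] :: real^2)"
    "rep b ([ReflB, ReflA], 0) *v vector [0, 1] = (vector [0, 1] :: real^2) + 2 *\<^sub>R vector [1, 0]" for b
    unfolding rep_word2 by (simp_all add: vec_eq_iff forall_2 matrix_vector_mult_def sum_2)
  have u: "vector [1, 0] = (vector [cos 0, sin 0] :: real^2)" "vector [0, 1] = (vector [- sin 0, cos 0] :: real^2)" by simp_all
  show ?thesis
    using cusp_preimage[OF u refl assms(1) word2_in_Gpm e _ e _ assms(2)] by (simp add: angle_direction_def)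
qed

text \<open>
  The word \<open>B C\<close> negates the slope one vector, and the factor \<open>-I\<close>
  restores it; the translation length depends on \<open>c\<close> but is not 0 for
  \<open>c \<ge> 1\<close>.
\<close>

lemma slope_one_preimage:
  assumes c: "c \<ge> 1" and "natural_semiconjugacy c \<phi>" "\<theta> \<in> topspace RP1" shows "\<phi> \<theta> = slope_one \<longleftrightarrow> \<theta> = slope_one"
proof -
  let ?s = "sqrt 2 / 2"
  have e: "rep b ([ReflB, ReflC], 1) *v vector [?s, ?s] = (vector [?s, ?s] :: real^2)"
    "rep b ([ReflB, ReflC], 1) *v vector [- ?s, ?s] = (vector [- ?s, ?s] :: real^2) + (- 2 * (b + 1)) *\<^sub>R vector [?s, ?s]" for b
    unfolding rep_word2 by (simp_all add: vec_eq_iff forall_2 matrix_vector_mult_def sum_2 field_simps)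
  have u: "vector [?s, ?s] = (vector [cos (pi / 4), sin (pi / 4)] :: real^2)"
    "vector [- ?s, ?s] = (vector [- sin (pi / 4), cos (pi / 4)] :: real^2)" by (simp_all add: cos_45 sin_45)
  have "angle_direction (pi / 4) = slope_one"
    unfolding angle_direction_def by (rule direction_slope_one[OF vector_cos_sin_nonzero]) (simp add: skew_def cos_45 sin_45)
  then show ?thesis
    using cusp_preimage[OF u refl assms(2) word2_in_Gpm e _ e _ assms(3)] c by simp
qed

lemma rep_inverse:
  assumes "G \<in> carrier Gpm" obtains H where "H \<in> carrier Gpm" "\<forall>c. rep c H ** rep c G = mat 1" "\<forall>c. rep c G ** rep c H = mat 1"
proof -
  interpret group Gpm by (rule group_Gpm)
  let ?H = "inv\<^bsub>Gpm\<^esub> G"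
  have H: "?H \<in> carrier Gpm" using assms by simp
  have mult: "rep c (x \<otimes>\<^bsub>Gpm\<^esub> y) = rep c x ** rep c y" if "x \<in> carrier Gpm" "y \<in> carrier Gpm" for c x y
    using hom_mult[OF rep_hom that] by (simp add: GL2_def)
  have one: "rep c \<one>\<^bsub>Gpm\<^esub> = mat 1" for c
    by (simp add: Gpm_def free_product_Z2_def rep_def)
  show thesis
    using mult[OF H assms] mult[OF assms H] assms one by (intro that[OF H] allI) simp_all
qed

lemma act_RP1: assumes "invertible M" "\<theta> \<in> topspace RP1" shows "act M \<theta> \<in> topspace RP1"
proof -
  obtain v where v: "v \<noteq> 0" "\<theta> = direction v" using assms(2) by (auto simp: topspace_RP1)
  obtain N where "N ** M = mat 1" using assms(1) unfolding invertible_def by blast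
  then have "N *v (M *v v) = v" by (simp add: matrix_vector_mul_assoc)
  then have "M *v v \<noteq> 0" using v(1) by auto
  then show ?thesis unfolding v(2) act_direction topspace_RP1 by blast
qed

theorem semiconjugacy_cusp_direction:
  assumes c: "c \<ge> 1" and \<phi>: "natural_semiconjugacy c \<phi>" and \<theta>: "\<theta> \<in> topspace RP1"
  shows "cusp_direction 1 (\<phi> \<theta>) \<longleftrightarrow> cusp_direction c \<theta>"
proof -
  have equi: "\<phi> (act (rep c G) \<theta>) = act (rep 1 G) (\<phi> \<theta>)" if "G \<in> carrier Gpm" "\<theta> \<in> topspace RP1" for G \<theta>
    using \<phi> that unfolding natural_semiconjugacy_def by blast
  have orbit: "\<phi> \<theta> = act (rep 1 G) p \<longleftrightarrow> \<theta> = act (rep c G) p"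
    if G: "G \<in> carrier Gpm" and p: "p \<in> topspace RP1" "\<And>\<theta>. \<theta> \<in> topspace RP1 \<Longrightarrow> \<phi> \<theta> = p \<longleftrightarrow> \<theta> = p" for G p
  proof
    obtain H where H: "H \<in> carrier Gpm" "\<forall>c. rep c H ** rep c G = mat 1" "\<forall>c. rep c G ** rep c H = mat 1"
      using rep_inverse[OF G] .
    have inv: "invertible (rep c H)" using H unfolding invertible_def by blast
    assume "\<phi> \<theta> = act (rep 1 G) p"
    then have "\<phi> (act (rep c H) \<theta>) = p" using equi[OF H(1) \<theta>] by (simp add: act_mult[symmetric] H(2) act_one)
    then have "act (rep c H) \<theta> = p" using p(2)[OF act_RP1[OF inv \<theta>]] by simp
    then have "act (rep c G) p = act (rep c G) (act (rep c H) \<theta>)" by simp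
    then show "\<theta> = act (rep c G) p" by (simp add: act_mult[symmetric] H(3) act_one)
  next
    assume "\<theta> = act (rep c G) p"
    then show "\<phi> \<theta> = act (rep 1 G) p" using equi[OF G p(1)] p(2)[OF p(1)] by simp
  qed
  have RP1: "horizontal \<in> topspace RP1" "slope_one \<in> topspace RP1"
    unfolding topspace_RP1 by (auto simp: vec_eq_iff forall_2 intro!: exI)
  have eq: "(\<phi> \<theta> = act (rep 1 G) horizontal \<or> \<phi> \<theta> = act (rep 1 G) slope_one) \<longleftrightarrow>
      (\<theta> = act (rep c G) horizontal \<or> \<theta> = act (rep c G) slope_one)" if "G \<in> carrier Gpm" for G
    using orbit[OF that RP1(1) horizontal_preimage[OF \<phi>]] orbit[OF that RP1(2) slope_one_preimage[OF c \<phi>]] by simp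
  show ?thesis
    unfolding cusp_direction_def Gpm_image_eq bex_simps(7) using eq by (rule bex_cong[OF refl])
qed

section \<open>Comparison of \<open>S\<^sub>c\<close> with \<open>S\<^sub>1\<close>\<close>

theorem theorem7:
  fixes c :: real
  assumes "c > 1"
  shows
    "(\<forall>\<theta> \<in> topspace RP1.
        (\<forall>\<phi>. natural_semiconjugacy c \<phi> \<longrightarrow>
           (has_saddle_connection c \<theta> \<longleftrightarrow> has_saddle_connection 1 (\<phi> \<theta>))) \<and>
        (has_saddle_connection c \<theta> \<longleftrightarrow>
           (\<exists>M \<in> Gpm_image c. \<theta> = act M horizontal \<or> \<theta> = act M slope_one))) \<and>
     (\<forall>h. canonical_homeomorphism c h \<longrightarrow>
        (\<forall>\<sigma>. saddle_connection c \<sigma> \<longrightarrow>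
           (\<exists>\<sigma>'. saddle_connection 1 \<sigma>' \<and> \<sigma>' \<in> (\<lambda>\<gamma>. h \<circ> \<gamma>) ` homotopy_class c \<sigma>)) \<and>
        (\<forall>\<sigma>'. saddle_connection 1 \<sigma>' \<longrightarrow>
           (\<exists>\<sigma>. saddle_connection c \<sigma> \<and> \<sigma> \<in> (\<lambda>\<gamma>. h \<circ> \<gamma>) -` homotopy_class 1 \<sigma>')))"
proof (intro conjI ballI allI impI)
  have c: "c \<ge> 1" using assms by simp
  fix \<theta> assume \<theta>: "\<theta> \<in> topspace RP1"
  show "has_saddle_connection c \<theta> \<longleftrightarrow> (\<exists>M \<in> Gpm_image c. \<theta> = act M horizontal \<or> \<theta> = act M slope_one)"
    using has_saddle_connection_iff_cusp[OF c \<theta>] unfolding cusp_direction_def .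
  fix \<phi> assume \<phi>: "natural_semiconjugacy c \<phi>"
  then have "\<phi> \<theta> \<in> topspace RP1" using \<theta> unfolding natural_semiconjugacy_def by blast
  then show "has_saddle_connection c \<theta> \<longleftrightarrow> has_saddle_connection 1 (\<phi> \<theta>)"
    using semiconjugacy_cusp_direction[OF c \<phi> \<theta>] by (simp only: has_saddle_connection_iff_cusp[OF c \<theta>] has_saddle_connection_iff_cusp[OF order_refl])
next
  have c: "c \<ge> 1" using assms by simp
  fix h assume h: "canonical_homeomorphism c h"
  show "\<exists>\<sigma>'. saddle_connection 1 \<sigma>' \<and> \<sigma>' \<in> (\<lambda>\<gamma>. h \<circ> \<gamma>) ` homotopy_class c \<sigma>" if "saddle_connection c \<sigma>" for \<sigma>
    by (rule saddle_connection_pushed[OF c h that])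
  show "\<exists>\<sigma>. saddle_connection c \<sigma> \<and> \<sigma> \<in> (\<lambda>\<gamma>. h \<circ> \<gamma>) -` homotopy_class 1 \<sigma>'" if "saddle_connection 1 \<sigma>'" for \<sigma>'
    by (rule saddle_connection_pulled_back[OF c h that])
qed

end
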